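(* Let $\mathbb P\curvearrowleft\mathbb G\to\mathbb X$ be a principal 2-bundle equipped with a 2-connection. Let $h:\mathbb L(T\mathbb X)\to\mathbb L(\mathrm{At}(\mathbb P))$ be the induced splitting of the Atiyah extension of Lie 2-algebras $$0\to\mathbb L(\mathrm{Ad}(\mathbb P))\to\mathbb L(\mathrm{At}(\mathbb P))\to\mathbb L(T\mathbb X)\to0.$$ For every $k\ge0$ there exists a natural map $$cw:\underline{\mathrm{Hom}}^{\bullet}(\wedge^k\mathbb L(\mathrm{Ad}(\mathbb P))[1],\mathbb F(\mathbb X))^{\mathbb L(\mathrm{At}(\mathbb P))}\to H^{\bullet+k}(\mathbb L(T\mathbb X),\mathbb F(\mathbb X)),\qquad f\mapsto[f\circ K_h^k],$$ where $K_h^k=K_h\wedge_{\mathrm{Id}}\cdots\wedge_{\mathrm{Id}}K_h$ ($k$ factors) and $K_h\in C^1(\mathbb L(T\mathbb X),\mathbb L(\mathrm{Ad}(\mathbb P))[1])$ is the curvature of $h$. The map $cw$ does not depend on the 2-connection.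
   Context: **Principal 2-bundles.** A Lie groupoid is written $\mathbb X=(X_1\rightrightarrows X_0)$ with source $s$, target $t$, and $x*y$ (also $x\cdot y$) defined when $s(x)=t(y)$. A Lie 2-group $\mathbb G=(G_1\rightrightarrows G_0)$ is a (strict) group object in Lie groupoids, with Lie 2-algebra $\mathbb g=(\mathfrak g_1\rightrightarrows\mathfrak g_0)$; $\mathfrak h=\ker(s_*:\mathfrak g_1\to\mathfrak g_0)$, $\partial=t_*|_{\mathfrak h}$, $\mathfrak g_1=\mathfrak h\oplus\mathfrak g_0$ via the unit map. A right action of $\mathbb G$ on $\mathbb P$ is a Lie groupoid morphism $\mathbb P\times\mathbb G\to\mathbb P$ that is a right Lie group action on arrows and on objects. A Lie groupoid morphism $\pi:\mathbb P\to\mathbb X$ is a fibration if $\pi_0$ and $P_1\to X_1\times_{s,X_0,\pi_0}P_0$, $p\mapsto(\pi_1(p),s(p))$, are surjective submersions. A principal 2-bundle $\mathbb P\curvearrowleft\mathbb G\to\mathbb X$ is a fibration with a right $\mathbb G$-action such that $(p,g)\mapsto(p,pg)$ is a Lie groupoid isomorphism $\mathbb P\times\mathbb G\to\mathbb P\times_{\mathbb X}\mathbb P$. A 2-connection is a pair of principal connection forms $\theta_i\in\Omega^1(P_i,\mathfrak g_i)$, $i=0,1$, such that $\theta_1:TP_1\to\mathfrak g_1\times P_1$ is a Lie groupoid morphism covering $\theta_0:TP_0\to\mathfrak g_0\times P_0$. **Lie 2-algebras.** $\mathfrak X_{mult}(\mathbb X)$ is the Lie algebra of pairs $(\xi,u)$,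 $\xi\in\mathfrak X(X_1)$, $u\in\mathfrak X(X_0)$, with $\xi:\mathbb X\to T\mathbb X$ a groupoid morphism over $u$. $A_{\mathbb X}=\ker(ds)|_{X_0}$; for $a\in\Gamma(A_{\mathbb X})$, $a^r(x)=a_{t(x)}\cdot0_x$, $a^l(x)=-0_x\cdot(a_{s(x)})^{-1}$. $\mathbb L(T\mathbb X)$ is the crossed module $\delta:\Gamma(A_{\mathbb X})\to\mathfrak X_{mult}(\mathbb X)$, $\delta a=a^r-a^l$, $D_\xi a=[\xi,a^r]|_{X_0}$. $\mathbb L(\mathrm{At}(\mathbb P))$ is the crossed module $\Gamma(A_{\mathbb P})^{G_0}\to\mathfrak X_{mult}(\mathbb P)^{\mathbb G}$ of invariant objects, with the same formulas. $\mathbb L(\mathrm{Ad}(\mathbb P))$ is the kernel of the projection $\mathbb L(\mathrm{At}(\mathbb P))\to\mathbb L(T\mathbb X)$, identified via fundamental vector fields with $C^\infty(P_0,\mathfrak h)^{G_0}\to\mathrm{Hom}_{gpd}(\mathbb P,\mathbb g)^{\mathbb G}$ (equivariant functions, respectively equivariant groupoid morphisms), $f\mapsto(t^*f-s^*f)+s^*(\partial\circ f)$. A crossed module $\delta:\mathfrak g_{-1}\to\mathfrak g_0$ is viewed as an $L_\infty$-algebra in degrees $-1,0$ with shifted brackets on $\mathfrak g[1]$ given by $\lambda_1(a)=-\delta a$, $\lambda_2(\xi_1\vee\xi_2)=[\xi_1,\xi_2]$, $\lambda_2(\xi\vee a)=D_\xi a$, all other brackets zero. The splitting induced by the 2-connection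 is $h=(h_c,h_m)$: $h_m(\xi,u)=(\xi^h,u^h)$ (horizontal lifts for $\theta_1,\theta_0$), and $h_c(a)$ is the $\theta_1$-horizontal lift of $a$ along the units of $\mathbb P$. **Coefficients.** $\mathbb F(\mathbb X)$ is the complex $\delta:C^\infty(X_0)\to C^\infty_{mult}(\mathbb X)$, $f\mapsto t^*f-s^*f$, in degrees $-1,0$, where $C^\infty_{mult}(\mathbb X)=\{F\in C^\infty(X_1):F(x*y)=F(x)+F(y)\}$. The Lie 2-algebra $\mathbb L(T\mathbb X)$ acts on it by $(a,(\xi,u))\otimes(f,F)\mapsto(\mathcal L_uf+(\mathcal L_{a^r}F)|_{X_0},\mathcal L_\xi F)$. As a representation up to homotopy $\rho$ of $\mathbb L(T\mathbb X)$ this means: $\rho(1\otimes-)=\delta$; $\rho((\xi,u)\otimes(f,F))=(\mathcal L_uf,\mathcal L_\xi F)$; $\rho(a\otimes(f,F))=((\mathcal L_{a^r}F)|_{X_0},0)$; $\rho=0$ on elements of weight $\ge2$. **$L_\infty$ conventions.** Vector spaces are over $\mathbb R$; $\underline{\mathrm{Hom}}^p(V,W)$ is the space of linear maps homogeneous of degree $p$; $(f\otimes g)(v\otimes w)=(-1)^{|g||v|}f(v)\otimes g(w)$; $V[1]_n=V_{n+1}$. $S(V)$ is the graded symmetric algebra, product $\vee$ or $\mu$, with coproduct $\Delta(v_1\vee\cdots\vee v_n)=\sum_k\sum_{\sigma\in Sh(k,n-k)}\epsilon(\sigma)(v_{\sigma(1)}\vee\cdots\vee v_{\sigma(k)})\otimes(v_{\sigma(k+1)}\vee\cdots\vee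 v_{\sigma(n)})$ ($Sh$: permutations increasing on the first $k$ and last $n-k$ indices; $\epsilon$: Koszul sign). $\wedge^kV$ is $V^{\otimes k}$ modulo all $v_1\otimes\cdots\otimes v_k-\mathrm{sgn}(\sigma)\epsilon(\sigma)v_{\sigma(1)}\otimes\cdots\otimes v_{\sigma(k)}$. For an $L_\infty$-algebra with total bracket $\lambda=\sum_k\lambda_k$, $d_\lambda=\mu\circ(\lambda\otimes\mathrm{Id})\circ\Delta$, $d_\lambda^2=0$. A representation up to homotopy of $(\mathfrak g,\lambda)$ on a graded vector space $\mathbb V$ is a degree 1 map $\rho:S(\mathfrak g[1])\otimes\mathbb V\to\mathbb V$ with $\rho\circ(d_\lambda\otimes\mathrm{Id})+\rho\circ(\mathrm{Id}\otimes\rho)\circ(\Delta\otimes\mathrm{Id})=0$. $H(\mathfrak g,\mathbb V)$ is the cohomology of $C^p(\mathfrak g,\mathbb V)=\underline{\mathrm{Hom}}^p(S(\mathfrak g[1]),\mathbb V)$ with $D_\rho\alpha=\rho\circ(\mathrm{Id}\otimes\alpha)\circ\Delta-(-1)^p\alpha\circ d_\lambda$ for $\alpha$ of degree $p$. For an extension $0\to\mathfrak n\to\hat{\mathfrak g}\xrightarrow{\pi}\mathfrak g\to0$ with brackets $\hat\lambda,\lambda$ on $\hat{\mathfrak g},\mathfrak g$ and a degree 0 linear section $h$, with $S(h)(v_1\vee\cdots\vee v_n)=h(v_1)\vee\cdots\vee h(v_n)$, the curvature is $K_h=\hat\lambda\circ S(h)-h\circ\lambda:S(\mathfrak g[1])\to\mathfrak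 n[1]$. The product $\wedge_{\mathrm{Id}}$ is $\alpha\wedge_{\mathrm{Id}}\beta=(\alpha\otimes\beta)\circ\Delta$, so $K_h^k=(K_h\otimes\cdots\otimes K_h)\circ\Delta^{k-1}$, with $\Delta^{k-1}$ the iterated coproduct into $k$ factors; in $f\circ K_h^k$ it is followed by the projection $\mathfrak n[1]^{\otimes k}\to\wedge^k\mathfrak n[1]$. $\hat{\mathfrak g}$ acts on $\mathfrak n[1]$ by $\mathrm{ad}(x\otimes y)=\hat\lambda(x\vee y)$, on $\wedge^k\mathfrak n[1]$ by the induced representation up to homotopy $\wedge^k\mathrm{ad}$: $x\otimes v_1\wedge\cdots\wedge v_k\mapsto\sum_i(-1)^{(|x|+1)(|v_1|+\cdots+|v_{i-1}|)}v_1\wedge\cdots\wedge\mathrm{ad}(x\otimes v_i)\wedge\cdots\wedge v_k$, and on $\mathbb V$ by the pullback $\pi^*\rho=\rho\circ(S(\pi)\otimes\mathrm{Id})$. $\underline{\mathrm{Hom}}^p(\wedge^k\mathfrak n[1],\mathbb V)^{\hat{\mathfrak g}}$ is the space of all $f\in\underline{\mathrm{Hom}}^p(\wedge^k\mathfrak n[1],\mathbb V)$ that are maps of representations up to homotopy of $\hat{\mathfrak g}$, i.e. $f\circ\wedge^k\mathrm{ad}=\pi^*\rho\circ(\mathrm{Id}_{S(\hat{\mathfrak g}[1])}\otimes f)$. Here $\mathfrak n=\mathbb L(\mathrm{Ad}(\mathbb P))$, $\hat{\mathfrak g}=\mathbb L(\mathrm{At}(\mathbb P))$, $\mathfrak g=\mathbb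 L(T\mathbb X)$, $\mathbb V=\mathbb F(\mathbb X)$.
   Formalization: For maps f of odd degree p, invariance is taken with an extra sign, f∘∧^k ad = (-1)^p π*ρ∘(Id⊗f); without it f∘K_h^k need not be a cocycle. For even p the condition is unchanged. *)

theory Defs
  imports
    "HOL-Analysis.Analysis"
    "HOL-Algebra.Group"
    "HOL-Combinatorics.Permutations"
    "HOL-Library.Function_Algebras"
begin

section \<open>Functions with values in a vector space\<close>

instantiation "fun" :: (type, real_vector) real_vector
begin

definition scaleR_fun :: "real \<Rightarrow> ('a \<Rightarrow> 'b) \<Rightarrow> 'a \<Rightarrow> 'b"
  where "scaleR_fun c f = (\<lambda>x. c *\<^sub>R f x)"

instance
  by standard (simp_all add: scaleR_fun_def fun_eq_iff scaleR_add_right scaleR_add_left)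

end


section \<open>Smooth manifolds\<close>

text \<open>\<open>Ck k W g\<close>: the map \<open>g\<close> is \<open>k\<close> times continuously differentiable on the open set \<open>W\<close>
  (for a finite-dimensional domain).\<close>

primrec Ck :: "nat \<Rightarrow> 'e::euclidean_space set \<Rightarrow> ('e \<Rightarrow> 'f::euclidean_space) \<Rightarrow> bool" where
  "Ck 0 W g \<longleftrightarrow> continuous_on W g"
| "Ck (Suc k) W g \<longleftrightarrow>
     (\<forall>x\<in>W. g differentiable (at x)) \<and> (\<forall>v. Ck k W (\<lambda>x. frechet_derivative g (at x) v))"

text \<open>Smoothness on an arbitrary subset is local extendability to smooth maps on open sets. For a
  relatively open subset of a linear subspace this is ordinary smoothness.\<close>

definition smooth_on :: "'e::euclidean_space set \<Rightarrow> ('e \<Rightarrow> 'f::euclidean_space) \<Rightarrow> bool" where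
  "smooth_on A f \<longleftrightarrow> (\<forall>x\<in>A. \<exists>W g. open W \<and> x \<in> W \<and> (\<forall>k. Ck k W g) \<and> (\<forall>y\<in>W \<inter> A. g y = f y))"

text \<open>A manifold is given by its set of points and an atlas of pairs (domain, coordinate map).
  Charts take values in linear subspaces of a Euclidean space \<open>'e\<close>, not in \<open>'e\<close> itself: thus
  one type \<open>'e\<close> serves manifolds of different dimensions, including dimension zero.\<close>

record ('a, 'e) mfd =
  points :: "'a set"
  atlas :: "('a set \<times> ('a \<Rightarrow> 'e)) set"

definition is_chart :: "nat \<Rightarrow> 'a set \<times> ('a \<Rightarrow> 'e::euclidean_space) \<Rightarrow> bool" where
  "is_chart n = (\<lambda>(U, \<phi>). inj_on \<phi> U \<and>
     (\<exists>E. subspace E \<and> dim E = n \<and> openin (top_of_set E) (\<phi> ` U)))"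

definition compatible_charts ::
  "'a set \<times> ('a \<Rightarrow> 'e::euclidean_space) \<Rightarrow> 'a set \<times> ('a \<Rightarrow> 'e) \<Rightarrow> bool" where
  "compatible_charts = (\<lambda>(U, \<phi>) (V, \<psi>).
     openin (top_of_set (\<phi> ` U)) (\<phi> ` (U \<inter> V)) \<and>
     openin (top_of_set (\<psi> ` V)) (\<psi> ` (U \<inter> V)) \<and>
     smooth_on (\<phi> ` (U \<inter> V)) (\<psi> \<circ> inv_into U \<phi>) \<and>
     smooth_on (\<psi> ` (U \<inter> V)) (\<phi> \<circ> inv_into V \<psi>))"

definition mtop :: "('a, 'e::euclidean_space) mfd \<Rightarrow> 'a topology" where
  "mtop M = topology (\<lambda>W. W \<subseteq> points M \<and>
     (\<forall>(U, \<phi>)\<in>atlas M. openin (top_of_set (\<phi> ` U)) (\<phi> ` (U \<inter> W))))"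

definition smooth_manifold :: "('a, 'e::euclidean_space) mfd \<Rightarrow> bool" where
  "smooth_manifold M \<longleftrightarrow>
     points M = \<Union> (fst ` atlas M) \<and>
     (\<exists>n. \<forall>c\<in>atlas M. is_chart n c) \<and>
     (\<forall>c\<in>atlas M. \<forall>d\<in>atlas M. compatible_charts c d) \<and>
     Hausdorff_space (mtop M) \<and> second_countable (mtop M)"

definition max_atlas :: "('a, 'e::euclidean_space) mfd \<Rightarrow> ('a set \<times> ('a \<Rightarrow> 'e)) set" where
  "max_atlas M = {c. fst c \<subseteq> points M \<and> (\<exists>n. is_chart n c) \<and>
     (\<forall>d\<in>atlas M. compatible_charts c d)}"

definition prod_mfd ::
  "('a, 'e::euclidean_space) mfd \<Rightarrow> ('b, 'f::euclidean_space) mfd \<Rightarrow> ('a \<times> 'b, 'e \<times> 'f) mfd" where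
  "prod_mfd M N = \<lparr>points = points M \<times> points N,
     atlas = {(U \<times> V, map_prod \<phi> \<psi>) |U \<phi> V \<psi>. (U, \<phi>) \<in> atlas M \<and> (V, \<psi>) \<in> atlas N}\<rparr>"

text \<open>An embedded submanifold \<open>S\<close> with the atlas of all slice charts.\<close>

definition sub_mfd :: "('a, 'e::euclidean_space) mfd \<Rightarrow> 'a set \<Rightarrow> ('a, 'e) mfd" where
  "sub_mfd M S = \<lparr>points = S,
     atlas = {(U \<inter> S, \<phi>) |U \<phi>. (U, \<phi>) \<in> max_atlas M \<and>
       (\<exists>F. subspace F \<and> \<phi> ` (U \<inter> S) = \<phi> ` U \<inter> F)}\<rparr>"

definition smooth_map ::
  "('a, 'e::euclidean_space) mfd \<Rightarrow> ('b, 'f::euclidean_space) mfd \<Rightarrow> ('a \<Rightarrow> 'b) \<Rightarrow> bool" where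
  "smooth_map M N f \<longleftrightarrow> f ` points M \<subseteq> points N \<and>
     (\<forall>(U, \<phi>)\<in>atlas M. \<forall>(V, \<psi>)\<in>atlas N.
        openin (top_of_set (\<phi> ` U)) (\<phi> ` (U \<inter> f -` V)) \<and>
        smooth_on (\<phi> ` (U \<inter> f -` V)) (\<psi> \<circ> f \<circ> inv_into U \<phi>))"

definition diffeomorphism ::
  "('a, 'e::euclidean_space) mfd \<Rightarrow> ('b, 'f::euclidean_space) mfd \<Rightarrow> ('a \<Rightarrow> 'b) \<Rightarrow> bool" where
  "diffeomorphism M N f \<longleftrightarrow> bij_betw f (points M) (points N) \<and>
     smooth_map M N f \<and> smooth_map N M (inv_into (points M) f)"

text \<open>Functions, vector fields and sections are extended by zero off the manifold, so that
  each of them is represented by exactly one function on the type.\<close>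

definition C_inf :: "('a, 'e::euclidean_space) mfd \<Rightarrow> ('a \<Rightarrow> real) set" where
  "C_inf M = {f. (\<forall>x. x \<notin> points M \<longrightarrow> f x = 0) \<and>
     (\<forall>(U, \<phi>)\<in>atlas M. smooth_on (\<phi> ` U) (f \<circ> inv_into U \<phi>))}"

text \<open>Tangent vectors at \<open>p\<close> are the derivations of the algebra of smooth functions at \<open>p\<close>. The
  base point is not part of the value (the zero vectors at all points are the same function),
  so it is carried along as a separate argument.\<close>

type_synonym 'a tvec = "('a \<Rightarrow> real) \<Rightarrow> real"

definition tangent_space :: "('a, 'e::euclidean_space) mfd \<Rightarrow> 'a \<Rightarrow> 'a tvec set" where
  "tangent_space M p = {v.
     (\<forall>f\<in>C_inf M. \<forall>g\<in>C_inf M. v (f + g) = v f + v g \<and> v (f * g) = f p * v g + g p * v f) \<and>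
     (\<forall>f\<in>C_inf M. \<forall>c. v (c *\<^sub>R f) = c * v f) \<and>
     (\<forall>f. f \<notin> C_inf M \<longrightarrow> v f = 0)}"

definition tmap :: "('a, 'e::euclidean_space) mfd \<Rightarrow> ('b, 'f::euclidean_space) mfd \<Rightarrow>
    ('a \<Rightarrow> 'b) \<Rightarrow> 'a tvec \<Rightarrow> 'b tvec" where
  "tmap M N \<phi> v = (\<lambda>f. if f \<in> C_inf N then v (\<lambda>x. if x \<in> points M then f (\<phi> x) else 0) else 0)"

definition submersion ::
  "('a, 'e::euclidean_space) mfd \<Rightarrow> ('b, 'f::euclidean_space) mfd \<Rightarrow> ('a \<Rightarrow> 'b) \<Rightarrow> bool" where
  "submersion M N f \<longleftrightarrow> smooth_map M N f \<and>
     (\<forall>p\<in>points M. tmap M N f ` tangent_space M p = tangent_space N (f p))"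

definition surjective_submersion ::
  "('a, 'e::euclidean_space) mfd \<Rightarrow> ('b, 'f::euclidean_space) mfd \<Rightarrow> ('a \<Rightarrow> 'b) \<Rightarrow> bool" where
  "surjective_submersion M N f \<longleftrightarrow> submersion M N f \<and> f ` points M = points N"

definition vector_fields :: "('a, 'e::euclidean_space) mfd \<Rightarrow> ('a \<Rightarrow> 'a tvec) set" where
  "vector_fields M = {\<xi>. (\<forall>p\<in>points M. \<xi> p \<in> tangent_space M p) \<and>
     (\<forall>p. p \<notin> points M \<longrightarrow> \<xi> p = 0) \<and> (\<forall>f\<in>C_inf M. (\<lambda>p. \<xi> p f) \<in> C_inf M)}"

definition lie_der :: "('a \<Rightarrow> 'a tvec) \<Rightarrow> ('a \<Rightarrow> real) \<Rightarrow> 'a \<Rightarrow> real" where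
  "lie_der \<xi> f = (\<lambda>p. \<xi> p f)"

definition lie_bracket :: "('a, 'e::euclidean_space) mfd \<Rightarrow>
    ('a \<Rightarrow> 'a tvec) \<Rightarrow> ('a \<Rightarrow> 'a tvec) \<Rightarrow> 'a \<Rightarrow> 'a tvec" where
  "lie_bracket M \<xi> \<eta> =
     (\<lambda>p f. if f \<in> C_inf M then \<xi> p (lie_der \<eta> f) - \<eta> p (lie_der \<xi> f) else 0)"


section \<open>Lie groupoids\<close>

record ('o, 'a, 'e) lgpd =
  Obj :: "('o, 'e) mfd"
  Arr :: "('a, 'e) mfd"
  src :: "'a \<Rightarrow> 'o"
  tgt :: "'a \<Rightarrow> 'o"
  cmp :: "'a \<Rightarrow> 'a \<Rightarrow> 'a"
  unt :: "'o \<Rightarrow> 'a"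
  ginv :: "'a \<Rightarrow> 'a"

text \<open>The product \<open>cmp X x y\<close> is meaningful when \<open>src X x = tgt X y\<close>.\<close>

definition composables :: "('o, 'a, 'e::euclidean_space) lgpd \<Rightarrow> ('a \<times> 'a, 'e \<times> 'e) mfd" where
  "composables X = sub_mfd (prod_mfd (Arr X) (Arr X))
     {(x, y). x \<in> points (Arr X) \<and> y \<in> points (Arr X) \<and> src X x = tgt X y}"

definition lie_groupoid :: "('o, 'a, 'e::euclidean_space) lgpd \<Rightarrow> bool" where
  "lie_groupoid X \<longleftrightarrow>
     smooth_manifold (Obj X) \<and> smooth_manifold (Arr X) \<and>
     submersion (Arr X) (Obj X) (src X) \<and> submersion (Arr X) (Obj X) (tgt X) \<and>
     smooth_map (Obj X) (Arr X) (unt X) \<and>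
     smooth_map (Arr X) (Arr X) (ginv X) \<and>
     smooth_map (composables X) (Arr X) (\<lambda>(x, y). cmp X x y) \<and>
     (\<forall>x\<in>points (Obj X). src X (unt X x) = x \<and> tgt X (unt X x) = x) \<and>
     (\<forall>(x, y)\<in>points (composables X).
        src X (cmp X x y) = src X y \<and> tgt X (cmp X x y) = tgt X x) \<and>
     (\<forall>x\<in>points (Arr X). \<forall>y\<in>points (Arr X). \<forall>z\<in>points (Arr X).
        src X x = tgt X y \<longrightarrow> src X y = tgt X z \<longrightarrow> cmp X (cmp X x y) z = cmp X x (cmp X y z)) \<and>
     (\<forall>x\<in>points (Arr X).
        cmp X x (unt X (src X x)) = x \<and> cmp X (unt X (tgt X x)) x = x \<and>
        src X (ginv X x) = tgt X x \<and> tgt X (ginv X x) = src X x \<and>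
        cmp X x (ginv X x) = unt X (tgt X x) \<and> cmp X (ginv X x) x = unt X (src X x))"

definition lgpd_morphism :: "('o, 'a, 'e::euclidean_space) lgpd \<Rightarrow>
    ('p, 'b, 'f::euclidean_space) lgpd \<Rightarrow> ('a \<Rightarrow> 'b) \<Rightarrow> ('o \<Rightarrow> 'p) \<Rightarrow> bool" where
  "lgpd_morphism X Y F1 F0 \<longleftrightarrow>
     smooth_map (Arr X) (Arr Y) F1 \<and> smooth_map (Obj X) (Obj Y) F0 \<and>
     (\<forall>x\<in>points (Arr X). src Y (F1 x) = F0 (src X x) \<and> tgt Y (F1 x) = F0 (tgt X x)) \<and>
     (\<forall>(x, y)\<in>points (composables X). F1 (cmp X x y) = cmp Y (F1 x) (F1 y))"

definition lgpd_isomorphism :: "('o, 'a, 'e::euclidean_space) lgpd \<Rightarrow>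
    ('p, 'b, 'f::euclidean_space) lgpd \<Rightarrow> ('a \<Rightarrow> 'b) \<Rightarrow> ('o \<Rightarrow> 'p) \<Rightarrow> bool" where
  "lgpd_isomorphism X Y F1 F0 \<longleftrightarrow> lgpd_morphism X Y F1 F0 \<and>
     diffeomorphism (Arr X) (Arr Y) F1 \<and> diffeomorphism (Obj X) (Obj Y) F0"

definition prod_lgpd :: "('o, 'a, 'e::euclidean_space) lgpd \<Rightarrow> ('p, 'b, 'f::euclidean_space) lgpd \<Rightarrow>
    ('o \<times> 'p, 'a \<times> 'b, 'e \<times> 'f) lgpd" where
  "prod_lgpd X Y = \<lparr>Obj = prod_mfd (Obj X) (Obj Y), Arr = prod_mfd (Arr X) (Arr Y),
     src = map_prod (src X) (src Y), tgt = map_prod (tgt X) (tgt Y),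
     cmp = (\<lambda>(x, y) (x', y'). (cmp X x x', cmp Y y y')),
     unt = map_prod (unt X) (unt Y), ginv = map_prod (ginv X) (ginv Y)\<rparr>"

text \<open>The fibre product of \<open>P\<close> with itself along \<open>(q1, q0)\<close>.\<close>

definition kernel_pair :: "('o, 'a, 'e::euclidean_space) lgpd \<Rightarrow> ('a \<Rightarrow> 'b) \<Rightarrow> ('o \<Rightarrow> 'p) \<Rightarrow>
    ('o \<times> 'o, 'a \<times> 'a, 'e \<times> 'e) lgpd" where
  "kernel_pair P q1 q0 = (prod_lgpd P P)\<lparr>
     Obj := sub_mfd (prod_mfd (Obj P) (Obj P))
       {(p, p'). p \<in> points (Obj P) \<and> p' \<in> points (Obj P) \<and> q0 p = q0 p'},
     Arr := sub_mfd (prod_mfd (Arr P) (Arr P))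
       {(p, p'). p \<in> points (Arr P) \<and> p' \<in> points (Arr P) \<and> q1 p = q1 p'}\<rparr>"

definition fibration :: "('o, 'a, 'e::euclidean_space) lgpd \<Rightarrow> ('p, 'b, 'f::euclidean_space) lgpd \<Rightarrow>
    ('a \<Rightarrow> 'b) \<Rightarrow> ('o \<Rightarrow> 'p) \<Rightarrow> bool" where
  "fibration P X q1 q0 \<longleftrightarrow> lgpd_morphism P X q1 q0 \<and>
     surjective_submersion (Obj P) (Obj X) q0 \<and>
     surjective_submersion (Arr P)
       (sub_mfd (prod_mfd (Arr X) (Obj P))
          {(x, p). x \<in> points (Arr X) \<and> p \<in> points (Obj P) \<and> src X x = q0 p})
       (\<lambda>p. (q1 p, src P p))"

text \<open>Multiplication in the tangent groupoid: the tangent map of the multiplication, applied to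
  the tangent vector \<open>(v, w)\<close> at \<open>(x, y)\<close> of the manifold of composable arrows.\<close>

definition tcmp :: "('o, 'a, 'e::euclidean_space) lgpd \<Rightarrow>
    'a \<Rightarrow> 'a tvec \<Rightarrow> 'a \<Rightarrow> 'a tvec \<Rightarrow> 'a tvec" where
  "tcmp X x v y w = tmap (composables X) (Arr X) (\<lambda>(x, y). cmp X x y)
     (THE z. z \<in> tangent_space (composables X) (x, y) \<and>
        tmap (composables X) (Arr X) fst z = v \<and> tmap (composables X) (Arr X) snd z = w)"

definition mult_fields :: "('o, 'a, 'e::euclidean_space) lgpd \<Rightarrow>
    (('a \<Rightarrow> 'a tvec) \<times> ('o \<Rightarrow> 'o tvec)) set" where
  "mult_fields X = {(\<xi>, u). \<xi> \<in> vector_fields (Arr X) \<and> u \<in> vector_fields (Obj X) \<and>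
     (\<forall>x\<in>points (Arr X). tmap (Arr X) (Obj X) (src X) (\<xi> x) = u (src X x) \<and>
        tmap (Arr X) (Obj X) (tgt X) (\<xi> x) = u (tgt X x)) \<and>
     (\<forall>(x, y)\<in>points (composables X). \<xi> (cmp X x y) = tcmp X x (\<xi> x) y (\<xi> y))}"

definition algebroid_sections :: "('o, 'a, 'e::euclidean_space) lgpd \<Rightarrow> ('o \<Rightarrow> 'a tvec) set" where
  "algebroid_sections X = {a.
     (\<forall>x\<in>points (Obj X). a x \<in> tangent_space (Arr X) (unt X x) \<and>
        tmap (Arr X) (Obj X) (src X) (a x) = 0) \<and>
     (\<forall>x. x \<notin> points (Obj X) \<longrightarrow> a x = 0) \<and>
     (\<forall>F\<in>C_inf (Arr X). (\<lambda>x. a x F) \<in> C_inf (Obj X))}"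

definition right_inv :: "('o, 'a, 'e::euclidean_space) lgpd \<Rightarrow> ('o \<Rightarrow> 'a tvec) \<Rightarrow> 'a \<Rightarrow> 'a tvec" where
  "right_inv X a = (\<lambda>x. if x \<in> points (Arr X)
     then tcmp X (unt X (tgt X x)) (a (tgt X x)) x 0 else 0)"

definition left_inv :: "('o, 'a, 'e::euclidean_space) lgpd \<Rightarrow> ('o \<Rightarrow> 'a tvec) \<Rightarrow> 'a \<Rightarrow> 'a tvec" where
  "left_inv X a = (\<lambda>x. if x \<in> points (Arr X)
     then - tcmp X x 0 (unt X (src X x)) (tmap (Arr X) (Arr X) (ginv X) (a (src X x))) else 0)"


section \<open>The Lie 2-algebra of multiplicative vector fields\<close>

text \<open>The data of a crossed module \<open>\<delta> : low \<rightarrow> up\<close> of Lie algebras. The bracket of \<open>low\<close> is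
  determined by the Peiffer identity and does not enter the associated \<open>L_\<infinity>\<close>-structure.\<close>

record ('c, 'm) crossed_module =
  low :: "'c set"
  up :: "'m set"
  bdry :: "'c \<Rightarrow> 'm"
  brk :: "'m \<Rightarrow> 'm \<Rightarrow> 'm"
  action :: "'m \<Rightarrow> 'c \<Rightarrow> 'c"

type_synonym ('o, 'a) mfield = "('a \<Rightarrow> 'a tvec) \<times> ('o \<Rightarrow> 'o tvec)"

text \<open>The field on objects underlying \<open>\<delta> a\<close> is the anchor of \<open>a\<close>.\<close>

definition LTX :: "('o, 'a, 'e::euclidean_space) lgpd \<Rightarrow>
    ('o \<Rightarrow> 'a tvec, ('o, 'a) mfield) crossed_module" where
  "LTX X = \<lparr>low = algebroid_sections X, up = mult_fields X,
     bdry = (\<lambda>a. (right_inv X a - left_inv X a, \<lambda>x. tmap (Arr X) (Obj X) (tgt X) (a x))),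
     brk = (\<lambda>(\<xi>, u) (\<eta>, w). (lie_bracket (Arr X) \<xi> \<eta>, lie_bracket (Obj X) u w)),
     action = (\<lambda>(\<xi>, u) a x. if x \<in> points (Obj X)
       then lie_bracket (Arr X) \<xi> (right_inv X a) (unt X x) else 0)\<rparr>"


section \<open>Principal 2-bundles and 2-connections\<close>

record ('o, 'a, 'e) lie2 =
  gpd :: "('o, 'a, 'e) lgpd"
  AGrp :: "'a monoid"
  OGrp :: "'o monoid"

definition lie_2_group :: "('o, 'a, 'e::euclidean_space) lie2 \<Rightarrow> bool" where
  "lie_2_group G \<longleftrightarrow> lie_groupoid (gpd G) \<and>
     group (AGrp G) \<and> carrier (AGrp G) = points (Arr (gpd G)) \<and>
     group (OGrp G) \<and> carrier (OGrp G) = points (Obj (gpd G)) \<and>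
     lgpd_morphism (prod_lgpd (gpd G) (gpd G)) (gpd G)
       (\<lambda>(g, h). g \<otimes>\<^bsub>AGrp G\<^esub> h) (\<lambda>(g, h). g \<otimes>\<^bsub>OGrp G\<^esub> h) \<and>
     lgpd_morphism (gpd G) (gpd G) (\<lambda>g. inv\<^bsub>AGrp G\<^esub> g) (\<lambda>g. inv\<^bsub>OGrp G\<^esub> g) \<and>
     unt (gpd G) \<one>\<^bsub>OGrp G\<^esub> = \<one>\<^bsub>AGrp G\<^esub>"

definition right_group_action :: "'p set \<Rightarrow> 'g monoid \<Rightarrow> ('p \<Rightarrow> 'g \<Rightarrow> 'p) \<Rightarrow> bool" where
  "right_group_action S H act \<longleftrightarrow>
     (\<forall>p\<in>S. act p \<one>\<^bsub>H\<^esub> = p \<and>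
        (\<forall>g\<in>carrier H. \<forall>h\<in>carrier H. act (act p g) h = act p (g \<otimes>\<^bsub>H\<^esub> h)))"

record ('p0, 'p1, 'e, 'g0, 'g1, 'f, 'x0, 'x1, 'd) two_bundle =
  Tot :: "('p0, 'p1, 'e) lgpd"
  Grp :: "('g0, 'g1, 'f) lie2"
  Base :: "('x0, 'x1, 'd) lgpd"
  proj1 :: "'p1 \<Rightarrow> 'x1"
  proj0 :: "'p0 \<Rightarrow> 'x0"
  act1 :: "'p1 \<Rightarrow> 'g1 \<Rightarrow> 'p1"
  act0 :: "'p0 \<Rightarrow> 'g0 \<Rightarrow> 'p0"

definition principal_2_bundle :: "('p0, 'p1, 'e::euclidean_space, 'g0, 'g1, 'f::euclidean_space,
    'x0, 'x1, 'd::euclidean_space) two_bundle \<Rightarrow> bool" where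
  "principal_2_bundle B \<longleftrightarrow>
     lie_groupoid (Tot B) \<and> lie_2_group (Grp B) \<and> lie_groupoid (Base B) \<and>
     fibration (Tot B) (Base B) (proj1 B) (proj0 B) \<and>
     lgpd_morphism (prod_lgpd (Tot B) (gpd (Grp B))) (Tot B)
       (\<lambda>(p, g). act1 B p g) (\<lambda>(p, g). act0 B p g) \<and>
     right_group_action (points (Arr (Tot B))) (AGrp (Grp B)) (act1 B) \<and>
     right_group_action (points (Obj (Tot B))) (OGrp (Grp B)) (act0 B) \<and>
     lgpd_isomorphism (prod_lgpd (Tot B) (gpd (Grp B)))
       (kernel_pair (Tot B) (proj1 B) (proj0 B))
       (\<lambda>(p, g). (p, act1 B p g)) (\<lambda>(p, g). (p, act0 B p g))"

text \<open>A connection form on the manifold \<open>M\<close> with a right action of the Lie group given by the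
  manifold \<open>N\<close> and the group \<open>H\<close>. The Lie algebra is the tangent space at the identity. A form
  \<open>\<theta>\<close> is smooth iff \<open>\<theta>(\<xi>)\<close> is smooth for all vector fields \<open>\<xi>\<close>; the functionals \<open>v \<mapsto> v f\<close>
  span the dual of the Lie algebra.\<close>

definition principal_connection :: "('p, 'e::euclidean_space) mfd \<Rightarrow>
    ('g, 'f::euclidean_space) mfd \<Rightarrow> 'g monoid \<Rightarrow> ('p \<Rightarrow> 'g \<Rightarrow> 'p) \<Rightarrow>
    ('p \<Rightarrow> 'p tvec \<Rightarrow> 'g tvec) \<Rightarrow> bool" where
  "principal_connection M N H act \<theta> \<longleftrightarrow>
     (\<forall>p\<in>points M. \<forall>v\<in>tangent_space M p. \<theta> p v \<in> tangent_space N \<one>\<^bsub>H\<^esub> \<and>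
        (\<forall>w\<in>tangent_space M p. \<theta> p (v + w) = \<theta> p v + \<theta> p w) \<and>
        (\<forall>c. \<theta> p (c *\<^sub>R v) = c *\<^sub>R \<theta> p v)) \<and>
     (\<forall>\<xi>\<in>vector_fields M. \<forall>f\<in>C_inf N.
        (\<lambda>p. if p \<in> points M then \<theta> p (\<xi> p) f else 0) \<in> C_inf M) \<and>
     (\<forall>p\<in>points M. \<forall>A\<in>tangent_space N \<one>\<^bsub>H\<^esub>. \<theta> p (tmap N M (act p) A) = A) \<and>
     (\<forall>p\<in>points M. \<forall>g\<in>carrier H. \<forall>v\<in>tangent_space M p.
        \<theta> (act p g) (tmap M M (\<lambda>q. act q g) v) =
        tmap N N (\<lambda>k. inv\<^bsub>H\<^esub> g \<otimes>\<^bsub>H\<^esub> k \<otimes>\<^bsub>H\<^esub> g) (\<theta> p v))"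

type_synonym ('p0, 'p1, 'g0, 'g1) forms =
  "('p1 \<Rightarrow> 'p1 tvec \<Rightarrow> 'g1 tvec) \<times> ('p0 \<Rightarrow> 'p0 tvec \<Rightarrow> 'g0 tvec)"

text \<open>The Lie 2-algebra of the structure 2-group is the restriction of its tangent groupoid to
  the tangent spaces at the identities.\<close>

definition two_connection :: "('p0, 'p1, 'e::euclidean_space, 'g0, 'g1, 'f::euclidean_space,
    'x0, 'x1, 'd::euclidean_space) two_bundle \<Rightarrow> ('p0, 'p1, 'g0, 'g1) forms \<Rightarrow> bool" where
  "two_connection B = (\<lambda>(\<theta>1, \<theta>0). let P = Tot B; G = gpd (Grp B); e = \<one>\<^bsub>AGrp (Grp B)\<^esub> in
     principal_connection (Arr P) (Arr G) (AGrp (Grp B)) (act1 B) \<theta>1 \<and>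
     principal_connection (Obj P) (Obj G) (OGrp (Grp B)) (act0 B) \<theta>0 \<and>
     (\<forall>p\<in>points (Arr P). \<forall>v\<in>tangent_space (Arr P) p.
        tmap (Arr G) (Obj G) (src G) (\<theta>1 p v) = \<theta>0 (src P p) (tmap (Arr P) (Obj P) (src P) v) \<and>
        tmap (Arr G) (Obj G) (tgt G) (\<theta>1 p v) = \<theta>0 (tgt P p) (tmap (Arr P) (Obj P) (tgt P) v)) \<and>
     (\<forall>(p, q)\<in>points (composables P). \<forall>v\<in>tangent_space (Arr P) p. \<forall>w\<in>tangent_space (Arr P) q.
        tmap (Arr P) (Obj P) (src P) v = tmap (Arr P) (Obj P) (tgt P) w \<longrightarrow>
        \<theta>1 (cmp P p q) (tcmp P p v q w) = tcmp G e (\<theta>1 p v) e (\<theta>1 q w)))"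


section \<open>The Atiyah extension\<close>

text \<open>The group of objects acts on the algebroid of \<open>P\<close> through right translations by units.\<close>

definition LAt :: "('p0, 'p1, 'e::euclidean_space, 'g0, 'g1, 'f::euclidean_space,
    'x0, 'x1, 'd::euclidean_space) two_bundle \<Rightarrow> ('p0 \<Rightarrow> 'p1 tvec, ('p0, 'p1) mfield) crossed_module" where
  "LAt B = (let P = Tot B; G = Grp B in (LTX P)\<lparr>
     low := {a \<in> algebroid_sections P. \<forall>p\<in>points (Obj P). \<forall>g\<in>carrier (OGrp G).
       a (act0 B p g) = tmap (Arr P) (Arr P) (\<lambda>q. act1 B q (unt (gpd G) g)) (a p)},
     up := {(\<xi>, u) \<in> mult_fields P.
       (\<forall>p\<in>points (Arr P). \<forall>g\<in>carrier (AGrp G).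
          \<xi> (act1 B p g) = tmap (Arr P) (Arr P) (\<lambda>q. act1 B q g) (\<xi> p)) \<and>
       (\<forall>p\<in>points (Obj P). \<forall>g\<in>carrier (OGrp G).
          u (act0 B p g) = tmap (Obj P) (Obj P) (\<lambda>q. act0 B q g) (u p))}\<rparr>)"

definition push_field :: "('a, 'e::euclidean_space) mfd \<Rightarrow> ('b, 'f::euclidean_space) mfd \<Rightarrow>
    ('a \<Rightarrow> 'b) \<Rightarrow> ('a \<Rightarrow> 'a tvec) \<Rightarrow> 'b \<Rightarrow> 'b tvec" where
  "push_field M N q \<xi> = (THE \<eta>. \<eta> \<in> vector_fields N \<and>
     (\<forall>p\<in>points M. tmap M N q (\<xi> p) = \<eta> (q p)))"

definition push_low :: "('p0, 'p1, 'e::euclidean_space, 'g0, 'g1, 'f::euclidean_space,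
    'x0, 'x1, 'd::euclidean_space) two_bundle \<Rightarrow> ('p0 \<Rightarrow> 'p1 tvec) \<Rightarrow> 'x0 \<Rightarrow> 'x1 tvec" where
  "push_low B a = (THE b. b \<in> algebroid_sections (Base B) \<and>
     (\<forall>p\<in>points (Obj (Tot B)). tmap (Arr (Tot B)) (Arr (Base B)) (proj1 B) (a p) = b (proj0 B p)))"

definition push_up :: "('p0, 'p1, 'e::euclidean_space, 'g0, 'g1, 'f::euclidean_space,
    'x0, 'x1, 'd::euclidean_space) two_bundle \<Rightarrow> ('p0, 'p1) mfield \<Rightarrow> ('x0, 'x1) mfield" where
  "push_up B = map_prod (push_field (Arr (Tot B)) (Arr (Base B)) (proj1 B))
     (push_field (Obj (Tot B)) (Obj (Base B)) (proj0 B))"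

definition LAd :: "('p0, 'p1, 'e::euclidean_space, 'g0, 'g1, 'f::euclidean_space,
    'x0, 'x1, 'd::euclidean_space) two_bundle \<Rightarrow> ('p0 \<Rightarrow> 'p1 tvec, ('p0, 'p1) mfield) crossed_module" where
  "LAd B = (LAt B)\<lparr>low := {a \<in> low (LAt B). push_low B a = 0},
     up := {\<xi> \<in> up (LAt B). push_up B \<xi> = 0}\<rparr>"

definition hor_lift :: "('p, 'e::euclidean_space) mfd \<Rightarrow> ('x, 'd::euclidean_space) mfd \<Rightarrow>
    ('p \<Rightarrow> 'x) \<Rightarrow> ('p \<Rightarrow> 'p tvec \<Rightarrow> 'g tvec) \<Rightarrow> 'p \<Rightarrow> 'x tvec \<Rightarrow> 'p tvec" where
  "hor_lift M N q \<theta> p w = (THE v. v \<in> tangent_space M p \<and> tmap M N q v = w \<and> \<theta> p v = 0)"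

definition split_low :: "('p0, 'p1, 'e::euclidean_space, 'g0, 'g1, 'f::euclidean_space,
    'x0, 'x1, 'd::euclidean_space) two_bundle \<Rightarrow> ('p0, 'p1, 'g0, 'g1) forms \<Rightarrow>
    ('x0 \<Rightarrow> 'x1 tvec) \<Rightarrow> 'p0 \<Rightarrow> 'p1 tvec" where
  "split_low B \<theta> a = (\<lambda>p. if p \<in> points (Obj (Tot B))
     then hor_lift (Arr (Tot B)) (Arr (Base B)) (proj1 B) (fst \<theta>) (unt (Tot B) p) (a (proj0 B p))
     else 0)"

definition split_up :: "('p0, 'p1, 'e::euclidean_space, 'g0, 'g1, 'f::euclidean_space,
    'x0, 'x1, 'd::euclidean_space) two_bundle \<Rightarrow> ('p0, 'p1, 'g0, 'g1) forms \<Rightarrow>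
    ('x0, 'x1) mfield \<Rightarrow> ('p0, 'p1) mfield" where
  "split_up B \<theta> = (\<lambda>(\<xi>, u).
     (\<lambda>p. if p \<in> points (Arr (Tot B))
        then hor_lift (Arr (Tot B)) (Arr (Base B)) (proj1 B) (fst \<theta>) p (\<xi> (proj1 B p)) else 0,
      \<lambda>p. if p \<in> points (Obj (Tot B))
        then hor_lift (Obj (Tot B)) (Obj (Base B)) (proj0 B) (snd \<theta>) p (u (proj0 B p)) else 0))"


section \<open>Graded multilinear algebra\<close>

text \<open>A graded vector space is a family of subspaces of one vector space, indexed by the degree.
  A word \<open>[(i1, v1), \<dots>, (in, vn)]\<close>, with each \<open>vj\<close> of degree \<open>ij\<close>, stands for the monomial
  \<open>v1 \<or> \<dots> \<or> vn\<close> of the symmetric algebra, or for \<open>v1 \<and> \<dots> \<and> vn\<close> in the exterior power, or for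
  \<open>v1 \<otimes> \<dots> \<otimes> vn\<close>. Linear maps out of these quotients of the tensor algebra are represented by
  their values on words: the functions of words that are multilinear and respect the defining
  relations. They are extended by zero to lists that are not words.\<close>

type_synonym 'v grading = "int \<Rightarrow> 'v set"
type_synonym 'v word = "(int \<times> 'v) list"

definition shift :: "'v grading \<Rightarrow> 'v grading" where
  "shift V i = V (i + 1)"

definition words :: "'v grading \<Rightarrow> 'v word set" where
  "words V = {w. \<forall>(i, v)\<in>set w. v \<in> V i}"

definition deg :: "'v word \<Rightarrow> int" where
  "deg w = sum_list (map fst w)"

abbreviation psign :: "int \<Rightarrow> real" where
  "psign n \<equiv> (-1) powi n"

text \<open>The sign \<open>\<epsilon>(\<sigma>)\<close> with
  \<open>v_1 \<or> \<dots> \<or> v_n = \<epsilon>(\<sigma>) v_\<sigma>(1) \<or> \<dots> \<or> v_\<sigma>(n)\<close>.\<close>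

definition koszul :: "(nat \<Rightarrow> nat) \<Rightarrow> 'v word \<Rightarrow> real" where
  "koszul \<sigma> w = (\<Prod>(i, j)\<in>{(i, j). i < j \<and> j < length w \<and> \<sigma> j < \<sigma> i}.
     psign (fst (w ! \<sigma> i) * fst (w ! \<sigma> j)))"

definition multilinear_on :: "'v::real_vector grading \<Rightarrow> ('v word \<Rightarrow> 'w::real_vector) \<Rightarrow> bool" where
  "multilinear_on V \<alpha> \<longleftrightarrow> (\<forall>w1\<in>words V. \<forall>w2\<in>words V. \<forall>i. \<forall>u\<in>V i. \<forall>v\<in>V i. \<forall>b c.
     \<alpha> (w1 @ (i, b *\<^sub>R u + c *\<^sub>R v) # w2) =
       b *\<^sub>R \<alpha> (w1 @ (i, u) # w2) + c *\<^sub>R \<alpha> (w1 @ (i, v) # w2))"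

text \<open>\<open>sym_hom V W p\<close> are the linear maps of degree \<open>p\<close> from the symmetric algebra of \<open>V\<close> to \<open>W\<close>,
  and \<open>ext_hom k V W p\<close> those from the \<open>k\<close>-th exterior power of \<open>V\<close> to \<open>W\<close>.\<close>

definition sym_hom :: "'v::real_vector grading \<Rightarrow> 'w::real_vector grading \<Rightarrow> int \<Rightarrow>
    ('v word \<Rightarrow> 'w) set" where
  "sym_hom V W p = {\<alpha>. multilinear_on V \<alpha> \<and>
     (\<forall>w\<in>words V. \<alpha> w \<in> W (p + deg w)) \<and>
     (\<forall>w\<in>words V. \<forall>\<sigma>. \<sigma> permutes {..<length w} \<longrightarrow>
        \<alpha> w = koszul \<sigma> w *\<^sub>R \<alpha> (permute_list \<sigma> w)) \<and>
     (\<forall>w. w \<notin> words V \<longrightarrow> \<alpha> w = 0)}"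

definition ext_hom :: "nat \<Rightarrow> 'v::real_vector grading \<Rightarrow> 'w::real_vector grading \<Rightarrow> int \<Rightarrow>
    ('v word \<Rightarrow> 'w) set" where
  "ext_hom k V W p = {f. multilinear_on V f \<and>
     (\<forall>w\<in>words V. f w \<in> W (p + deg w)) \<and>
     (\<forall>w\<in>words V. \<forall>\<sigma>. \<sigma> permutes {..<length w} \<longrightarrow>
        f w = (of_int (sign \<sigma>) * koszul \<sigma> w) *\<^sub>R f (permute_list \<sigma> w)) \<and>
     (\<forall>w. w \<notin> words V \<or> length w \<noteq> k \<longrightarrow> f w = 0)}"

definition Sh :: "nat \<Rightarrow> nat \<Rightarrow> (nat \<Rightarrow> nat) set" where
  "Sh k l = {\<sigma>. \<sigma> permutes {..<k + l} \<and>
     strict_mono_on {..<k} \<sigma> \<and> strict_mono_on {k..<k + l} \<sigma>}"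

text \<open>\<open>coprod w b\<close> is the value on \<open>\<Delta> w\<close> of the linear map \<open>w1 \<otimes> w2 \<mapsto> b w1 w2\<close>.\<close>

definition coprod :: "'v word \<Rightarrow> ('v word \<Rightarrow> 'v word \<Rightarrow> 'w::real_vector) \<Rightarrow> 'w" where
  "coprod w b = (\<Sum>k\<le>length w. \<Sum>\<sigma>\<in>Sh k (length w - k).
     koszul \<sigma> w *\<^sub>R b (take k (permute_list \<sigma> w)) (drop k (permute_list \<sigma> w)))"

text \<open>\<open>\<alpha> \<circ> d_\<lambda>\<close>, where \<open>d_\<lambda> = \<mu> \<circ> (\<lambda> \<otimes> Id) \<circ> \<Delta>\<close> and \<open>\<lambda>\<close> has degree 1.\<close>

definition comp_dlam :: "('v word \<Rightarrow> 'v) \<Rightarrow> ('v word \<Rightarrow> 'w::real_vector) \<Rightarrow> 'v word \<Rightarrow> 'w" where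
  "comp_dlam lam \<alpha> w = coprod w (\<lambda>w1 w2. \<alpha> ((deg w1 + 1, lam w1) # w2))"

definition rep_diff :: "'v::real_vector grading \<Rightarrow> ('v word \<Rightarrow> 'v) \<Rightarrow>
    ('v word \<Rightarrow> 'w \<Rightarrow> 'w::real_vector) \<Rightarrow> int \<Rightarrow> ('v word \<Rightarrow> 'w) \<Rightarrow> 'v word \<Rightarrow> 'w" where
  "rep_diff V lam rho p \<alpha> = (\<lambda>w. if w \<in> words V
     then coprod w (\<lambda>w1 w2. psign (p * deg w1) *\<^sub>R rho w1 (\<alpha> w2)) - psign p *\<^sub>R comp_dlam lam \<alpha> w
     else 0)"

definition cocycles :: "'v::real_vector grading \<Rightarrow> ('v word \<Rightarrow> 'v) \<Rightarrow>
    ('v word \<Rightarrow> 'w \<Rightarrow> 'w) \<Rightarrow> 'w::real_vector grading \<Rightarrow> int \<Rightarrow> ('v word \<Rightarrow> 'w) set" where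
  "cocycles V lam rho W p = {\<alpha> \<in> sym_hom V W p. rep_diff V lam rho p \<alpha> = 0}"

definition cohomology_class :: "'v::real_vector grading \<Rightarrow> ('v word \<Rightarrow> 'v) \<Rightarrow>
    ('v word \<Rightarrow> 'w \<Rightarrow> 'w) \<Rightarrow> 'w::real_vector grading \<Rightarrow> int \<Rightarrow> ('v word \<Rightarrow> 'w) \<Rightarrow>
    ('v word \<Rightarrow> 'w) set" where
  "cohomology_class V lam rho W p \<alpha> = {\<beta> \<in> cocycles V lam rho W p.
     \<beta> - \<alpha> \<in> rep_diff V lam rho (p - 1) ` sym_hom V W (p - 1)}"

text \<open>\<open>comp_wedge_pow f K k acc w\<close> is the value of \<open>f(acc \<otimes> -) \<circ> K^k\<close> on \<open>w\<close> for \<open>K\<close> of degree 1,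
  through \<open>K^(k+1) = K \<and>_Id K^k = (K \<otimes> K^k) \<circ> \<Delta>\<close>; the sign is the Koszul sign of moving \<open>K^k\<close>,
  of degree \<open>k\<close>, past \<open>w1\<close>. \<open>K^0\<close> is the counit.\<close>

primrec comp_wedge_pow :: "('n word \<Rightarrow> 'w::real_vector) \<Rightarrow> ('v word \<Rightarrow> 'n) \<Rightarrow> nat \<Rightarrow>
    'n word \<Rightarrow> 'v word \<Rightarrow> 'w" where
  "comp_wedge_pow f K 0 acc w = (if w = [] then f acc else 0)"
| "comp_wedge_pow f K (Suc k) acc w = coprod w (\<lambda>w1 w2.
     psign (int k * deg w1) *\<^sub>R comp_wedge_pow f K k (acc @ [(deg w1 + 1, K w1)]) w2)"


section \<open>The Chern--Weil construction\<close>

text \<open>The pair \<open>(a, x)\<close> stands for \<open>a\<close> of degree -1 plus \<open>x\<close> of degree 0.\<close>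

definition grading :: "'c::real_vector set \<Rightarrow> 'm::real_vector set \<Rightarrow> ('c \<times> 'm) grading" where
  "grading A M i = (if i = -1 then A \<times> {0} else if i = 0 then {0} \<times> M else {0})"

abbreviation cm_grading :: "('c::real_vector, 'm::real_vector) crossed_module \<Rightarrow> ('c \<times> 'm) grading" where
  "cm_grading C \<equiv> grading (low C) (up C)"

text \<open>On words, \<open>cm_lam\<close> gives \<open>a \<mapsto> -\<delta> a\<close>, \<open>\<xi> \<or> \<eta> \<mapsto> [\<xi>, \<eta>]\<close>, \<open>\<xi> \<or> a \<mapsto> D_\<xi> a\<close>,
  \<open>a \<or> \<xi> \<mapsto> D_\<xi> a\<close>, \<open>a \<or> b \<mapsto> 0\<close>, the other components of letters being zero.\<close>

fun cm_lam :: "('c::real_vector, 'm::real_vector) crossed_module \<Rightarrow> ('c \<times> 'm) word \<Rightarrow> 'c \<times> 'm" where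
  "cm_lam C [(i, (a, x))] = (0, - bdry C a)"
| "cm_lam C [(i, (a, x)), (j, (b, y))] = (action C x b + action C y a, brk C x y)"
| "cm_lam C w = 0"

definition mult_funs :: "('o, 'a, 'e::euclidean_space) lgpd \<Rightarrow> ('a \<Rightarrow> real) set" where
  "mult_funs X = {F \<in> C_inf (Arr X). \<forall>(x, y)\<in>points (composables X). F (cmp X x y) = F x + F y}"

definition FX :: "('o, 'a, 'e::euclidean_space) lgpd \<Rightarrow>
    (('o \<Rightarrow> real) \<times> ('a \<Rightarrow> real)) grading" where
  "FX X = grading (C_inf (Obj X)) (mult_funs X)"

fun FX_rep :: "('o, 'a, 'e::euclidean_space) lgpd \<Rightarrow>
    (('o \<Rightarrow> 'a tvec) \<times> ('o, 'a) mfield) word \<Rightarrow>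
    ('o \<Rightarrow> real) \<times> ('a \<Rightarrow> real) \<Rightarrow> ('o \<Rightarrow> real) \<times> ('a \<Rightarrow> real)" where
  "FX_rep X [] (f, F) = (0, \<lambda>x. if x \<in> points (Arr X) then f (tgt X x) - f (src X x) else 0)"
| "FX_rep X [(i, (a, (\<xi>, u)))] (f, F) =
     (lie_der u f + (\<lambda>x. if x \<in> points (Obj X) then lie_der (right_inv X a) F (unt X x) else 0),
      lie_der \<xi> F)"
| "FX_rep X (l # l' # w) (f, F) = 0"

context
  fixes B :: "('p0, 'p1, 'e::euclidean_space, 'g0, 'g1, 'f::euclidean_space,
    'x0, 'x1, 'd::euclidean_space) two_bundle"
begin

definition S_proj :: "(('p0 \<Rightarrow> 'p1 tvec) \<times> ('p0, 'p1) mfield) word \<Rightarrow>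
    (('x0 \<Rightarrow> 'x1 tvec) \<times> ('x0, 'x1) mfield) word" where
  "S_proj = map (map_prod id (map_prod (push_low B) (push_up B)))"

definition S_split :: "('p0, 'p1, 'g0, 'g1) forms \<Rightarrow>
    (('x0 \<Rightarrow> 'x1 tvec) \<times> ('x0, 'x1) mfield) word \<Rightarrow>
    (('p0 \<Rightarrow> 'p1 tvec) \<times> ('p0, 'p1) mfield) word" where
  "S_split \<theta> = map (map_prod id (map_prod (split_low B \<theta>) (split_up B \<theta>)))"

definition curvature :: "('p0, 'p1, 'g0, 'g1) forms \<Rightarrow>
    (('x0 \<Rightarrow> 'x1 tvec) \<times> ('x0, 'x1) mfield) word \<Rightarrow> ('p0 \<Rightarrow> 'p1 tvec) \<times> ('p0, 'p1) mfield" where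
  "curvature \<theta> w = (if w \<in> words (shift (cm_grading (LTX (Base B))))
     then cm_lam (LAt B) (S_split \<theta> w) -
       map_prod (split_low B \<theta>) (split_up B \<theta>) (cm_lam (LTX (Base B)) w)
     else 0)"

text \<open>The maps \<open>f\<close> of degree \<open>p\<close> with \<open>f \<circ> \<and>^k ad = (-1)^p \<pi>^*\<rho> \<circ> (Id \<otimes> f)\<close>. The sign
  \<open>(-1)^p\<close> is that of a morphism to the representation shifted by \<open>p\<close>, whose structure map is
  \<open>(-1)^p \<rho>\<close>; this is the condition for \<open>\<alpha> \<mapsto> f \<circ> \<alpha>\<close> to commute with the differentials up to
  \<open>(-1)^p\<close>. The second sign comes from \<open>Id \<otimes> f\<close>.\<close>

definition invariant_hom :: "nat \<Rightarrow> int \<Rightarrow>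
    ((('p0 \<Rightarrow> 'p1 tvec) \<times> ('p0, 'p1) mfield) word \<Rightarrow> ('x0 \<Rightarrow> real) \<times> ('x1 \<Rightarrow> real)) set" where
  "invariant_hom k p = {f \<in> ext_hom k (shift (cm_grading (LAd B))) (FX (Base B)) p.
     \<forall>x\<in>words (shift (cm_grading (LAt B))).
     \<forall>w\<in>words (shift (cm_grading (LAd B))). length w = k \<longrightarrow>
       (\<Sum>i<k. psign ((deg x + 1) * deg (take i w)) *\<^sub>R
          f (take i w @ (deg x + fst (w ! i) + 1, cm_lam (LAt B) (x @ [w ! i])) # drop (Suc i) w)) =
       psign p *\<^sub>R psign (p * deg x) *\<^sub>R FX_rep (Base B) (S_proj x) (f w)}"

definition cw_cochain :: "('p0, 'p1, 'g0, 'g1) forms \<Rightarrow> nat \<Rightarrow>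
    ((('p0 \<Rightarrow> 'p1 tvec) \<times> ('p0, 'p1) mfield) word \<Rightarrow> ('x0 \<Rightarrow> real) \<times> ('x1 \<Rightarrow> real)) \<Rightarrow>
    (('x0 \<Rightarrow> 'x1 tvec) \<times> ('x0, 'x1) mfield) word \<Rightarrow> ('x0 \<Rightarrow> real) \<times> ('x1 \<Rightarrow> real)" where
  "cw_cochain \<theta> k f w = (if w \<in> words (shift (cm_grading (LTX (Base B))))
     then comp_wedge_pow f (curvature \<theta>) k [] w else 0)"

definition base_cocycles :: "int \<Rightarrow>
    ((('x0 \<Rightarrow> 'x1 tvec) \<times> ('x0, 'x1) mfield) word \<Rightarrow> ('x0 \<Rightarrow> real) \<times> ('x1 \<Rightarrow> real)) set" where
  "base_cocycles = cocycles (shift (cm_grading (LTX (Base B)))) (cm_lam (LTX (Base B)))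
     (FX_rep (Base B)) (FX (Base B))"

definition base_class :: "int \<Rightarrow>
    ((('x0 \<Rightarrow> 'x1 tvec) \<times> ('x0, 'x1) mfield) word \<Rightarrow> ('x0 \<Rightarrow> real) \<times> ('x1 \<Rightarrow> real)) \<Rightarrow>
    ((('x0 \<Rightarrow> 'x1 tvec) \<times> ('x0, 'x1) mfield) word \<Rightarrow> ('x0 \<Rightarrow> real) \<times> ('x1 \<Rightarrow> real)) set" where
  "base_class = cohomology_class (shift (cm_grading (LTX (Base B)))) (cm_lam (LTX (Base B)))
     (FX_rep (Base B)) (FX (Base B))"

end

end

theory Submission
  imports Defs "HOL-Computational_Algebra.Polynomial"
begin

text \<open>Horizontal lifts for a 2-connection are unique, and the tangent multiplication is natural; hence
  the lift of a multiplicative field is multiplicative and invariant. Push-forwards are avoided: brackets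
  and actions upstairs are compared with those downstairs through the relation of being projectable.
  On the algebraic side the Bianchi identity and the invariance of \<open>f\<close> make \<open>f \<circ> K_h^k\<close> a cocycle.
  Two splittings are joined by the path \<open>h + t (h' - h)\<close>; the derivative of its curvature is the
  covariant differential of \<open>h' - h\<close>, so the derivative of \<open>f \<circ> K_t^k\<close> is a coboundary of a cochain
  that is polynomial in \<open>t\<close>. The coefficients carry no topology, so the integral over \<open>t\<close> is replaced
  by a quadrature formula that is exact for polynomials of the relevant degree.\<close>

text \<open>Tangent vectors are derivations of global smooth functions and carry no base point, and
  both the tangent multiplication and the horizontal lifts are definite descriptions. Two facts make
  them usable. Every such derivation is the velocity of a curve; this rests on Hadamard's lemma and
  on having enough global functions. A tangent vector of a fibre product over a submersion is
  determined by its two components; this takes slice charts, hence the inverse function theorem.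
  Identities between tangent vectors then follow from identities between curves. In the algebra, the
  brackets have one or two arguments, so the curvature along a path of splittings is quadratic in
  \<open>t\<close>. Its derivative is therefore the difference of the curvatures at
  \<open>t + 1/2\<close> and \<open>t - 1/2\<close>, again a cochain, and the \<open>k\<close>-th
  power has degree at most \<open>2 * k\<close>. A coboundary is the image of a single cochain, so
  the quadrature nodes and weights must not depend on the word; they depend on that degree bound
  only.\<close>

notation scaleR (infixr "*r" 75) and inner (infix "*i" 70)

abbreviation "pts == points"
abbreviation "TS == tangent_space"
abbreviation "VF == vector_fields"
abbreviation "AS == algebroid_sections"
abbreviation "MF == mult_fields"
abbreviation "FD == frechet_derivative"
abbreviation "lbr == lie_bracket"
abbreviation "ev == eventually"
abbreviation "multilin == multilinear_on"
abbreviation (input) Iff (infixr "<->" 25) where "A <-> B == A = B"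

section \<open>Calculus of smooth maps\<close>

lemma Ck_cong: assumes "open W" "!!x. x : W ==> f x = g x" shows "Ck k W f <-> Ck k W g"
 using assms(2)
proof (induction k arbitrary: f g)
 case 0
 then show ?case by (auto cong: continuous_on_cong)
next
 case (Suc k)
 have 1: "(f has_derivative D) (at x) <-> (g has_derivative D) (at x)" if "x : W" for x D
  using has_derivative_transform_within_open[OF _ `open W` that, of f D UNIV g]
   has_derivative_transform_within_open[OF _ `open W` that, of g D UNIV f] Suc.prems by auto
 then have "FD f (at x) = FD g (at x)" if "x : W" for x
  using that by (simp add: frechet_derivative_def)
 then have "Ck k W (%x. FD f (at x) v) <-> Ck k W (%x. FD g (at x) v)" for v by (intro Suc.IH) auto
 then show ?case using 1 by (auto simp: differentiable_def)
qed

text \<open>\<open>FD\<close> is a derivative obtained by choice. This rule accepts any explicit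
  family \<open>D\<close> of derivatives instead, and the closure properties below go through
  it.\<close>

lemma Ck_SucI:
 assumes "open W" "!!x. x : W ==> (f has_derivative D x) (at x)" "!!v. Ck k W (%x. D x v)"
 shows "Ck (Suc k) W f"
proof -
 have "Ck k W (%x. FD f (at x) v)" for v
  using Ck_cong[OF assms(1), of "%x. FD f (at x) v" "%x. D x v" k] assms(2,3)
   frechet_derivative_at by fastforce
 then show ?thesis using assms(2) by (auto simp: differentiable_def)
qed

lemma Ck_has_derivative: "Ck (Suc k) W f ==> x : W ==> (f has_derivative FD f (at x)) (at x)"
 by (simp add: frechet_derivative_works)

lemma Ck_SucD: "open W ==> Ck (Suc k) W f ==> Ck k W f"
proof (induction k arbitrary: f)
 case 0
 then show ?case
  by (auto intro!: continuous_at_imp_continuous_on differentiable_imp_continuous_within)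
next
 case (Suc k)
 show ?case unfolding Ck.simps(2)[of k]
 proof (intro conjI allI ballI)
  show "f differentiable at x" if "x : W" for x using Suc.prems that by simp
  show "Ck k W (%x. FD f (at x) v)" for v by (rule Suc.IH) (use Suc.prems in auto)
 qed
qed

lemma Ck_subset: "Ck k W f ==> V <= W ==> Ck k V f"
 by (induction k arbitrary: f) (auto intro: continuous_on_subset)

lemma Ck_local: assumes "!!x. x : W ==> EX V. open V & x : V & Ck k V f" shows "Ck k W f"
 using assms
proof (induction k arbitrary: f)
 case 0
 then show ?case
  by (auto intro!: continuous_at_imp_continuous_on simp: continuous_on_eq_continuous_at)
    (metis continuous_on_eq_continuous_at)
next
 case (Suc k)
 have "f differentiable at x" if "x : W" for x using Suc.prems[OF that] by auto
 moreover have "Ck k W (%x. FD f (at x) v)" for v by (rule Suc.IH) (use Suc.prems in "auto, blast")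
 ultimately show ?case by simp
qed

lemma Ck_const: "Ck k W (%x. c)" by (induction k arbitrary: c) auto

lemma Ck_compose_bounded_linear: assumes "bounded_linear h" "open W" "Ck k W f"
 shows "Ck k W (%x. h (f x))" using assms(3)
proof (induction k arbitrary: f)
 case 0
 then show ?case using bounded_linear.continuous_on[OF assms(1)] by auto
next
 case (Suc k)
 show ?case by (rule Ck_SucI[OF assms(2), where D="%x v. h (FD f (at x) v)"])
    (use Suc in "auto intro!: bounded_linear.has_derivative[OF assms(1)] Ck_has_derivative")
qed

lemma Ck_ident: "open W ==> Ck k W (%x. x)"
proof (cases k)
 case (Suc m)
 assume "open W"
 then show ?thesis unfolding Suc by (rule Ck_SucI[where D="%x v. v"]) (auto intro: Ck_const)
qed auto

lemma Ck_bounded_linear: "bounded_linear h ==> open W ==> Ck k W h"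
 using Ck_compose_bounded_linear Ck_ident by blast

lemma Ck_add: assumes "open W" "Ck k W f" "Ck k W g" shows "Ck k W (%x. f x + g x)" using assms(2,3)
proof (induction k arbitrary: f g)
 case 0
 then show ?case by (auto intro: continuous_on_add)
next
 case (Suc k)
 show ?case by (rule Ck_SucI[OF assms(1), where
     D="%x v. FD f (at x) v + FD g (at x) v"])
    (use Suc in "auto intro!: has_derivative_add Ck_has_derivative")
qed

lemma Ck_sum: assumes "open W" "!!i. i : I ==> Ck k W (f i)" shows "Ck k W (%x. SUM i:I. f i x)"
 using assms(2)
 by (induction I rule: infinite_finite_induct) (auto intro: Ck_const Ck_add[OF assms(1)])

lemma Ck_scaleR:
 fixes f :: "'e::euclidean_space => real" assumes "open W" "Ck k W f" "Ck k W g"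
 shows "Ck k W (%x. f x *r g x)" using assms(2,3)
proof (induction k arbitrary: f g)
 case 0
 then show ?case by (auto intro: continuous_on_scaleR)
next
 case (Suc k)
 have "Ck k W f" "Ck k W g" using Suc.prems Ck_SucD[OF assms(1)] by blast+
 then show ?case by (intro Ck_SucI[OF assms(1), where
     D="%x v. f x *r FD g (at x) v + FD f (at x) v *r g x"])
    (use Suc in "auto intro!: has_derivative_scaleR Ck_has_derivative Ck_add[OF assms(1)]")
qed

lemma Ck_mult:
 fixes f g :: "'e::euclidean_space => real" assumes "open W" "Ck k W f" "Ck k W g"
 shows "Ck k W (%x. f x * g x)" using Ck_scaleR[OF assms] by simp

lemma linear_euclidean_expand:
 fixes L :: "'e::euclidean_space => 'f::real_vector" assumes "linear L"
 shows "L x = (SUM b:Basis. (x *i b) *r L b)"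
proof -
 have "L x = L (SUM b:Basis. (x *i b) *r b)" by (simp add: euclidean_representation)
 then show ?thesis using assms by (simp add: linear_sum linear_scale)
qed

text \<open>The chain rule composes two linear maps, but \<open>Ck\<close> speaks about one fixed
  direction at a time. Expanding the outer derivative in a basis turns the composite into a sum of
  products, to which the induction hypothesis applies with \<open>g\<close> replaced by its partial
  derivatives; hence \<open>g\<close> is arbitrary in the induction.\<close>

lemma Ck_compose:
 fixes f :: "'e::euclidean_space => 'f::euclidean_space" and g :: "'f => 'g::euclidean_space"
 assumes "open W" "open V" "f ` W <= V" "Ck k V g" "Ck k W f" shows "Ck k W (%x. g (f x))"
 using assms(4,5)
proof (induction k arbitrary: g)
 case 0
 then show ?case using assms(3) by (auto intro: continuous_on_compose2)
next
 case (Suc k)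
 let ?D = "%x v. SUM b:Basis. (FD f (at x) v *i b) *r FD g (at (f x)) b"
 show ?case
 proof (rule Ck_SucI[OF assms(1), where D="?D"])
  fix x assume x: "x : W"
  then have fx: "f x : V" using assms(3) by auto
  have dg: "(g has_derivative FD g (at (f x))) (at (f x))"
   using Suc.prems(1) fx by (rule Ck_has_derivative)
  have "((%x. g (f x)) has_derivative (%v. FD g (at (f x)) (FD f (at x) v))) (at x)"
   by (rule has_derivative_compose[OF Ck_has_derivative[OF Suc.prems(2) x] dg])
  moreover have "(%v. FD g (at (f x)) (FD f (at x) v)) = ?D x"
   by (intro ext) (rule linear_euclidean_expand[OF has_derivative_linear[OF dg]])
  ultimately show "((%x. g (f x)) has_derivative ?D x) (at x)" by simp
 next
  fix v
  have f: "Ck k W f" using Suc.prems Ck_SucD[OF assms(1)] by blast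
  show "Ck k W (%x. ?D x v)"
  proof (intro Ck_sum Ck_scaleR assms(1))
   fix b :: 'f
   show "Ck k W (%x. FD f (at x) v *i b)"
    by (rule Ck_compose_bounded_linear[OF bounded_linear_inner_left assms(1)])
     (use Suc.prems in auto)
   show "Ck k W (%x. FD g (at (f x)) b)" by (rule Suc.IH) (use Suc.prems f in auto)
  qed
 qed
qed

definition Cinf :: "'e::euclidean_space set => ('e => 'f::euclidean_space) => bool" where
 "Cinf W g <-> (ALL k. Ck k W g)"

lemma Cinf_cong: "open W ==> (!!x. x : W ==> f x = g x) ==> Cinf W f <-> Cinf W g"
 unfolding Cinf_def using Ck_cong by blast

lemma Cinf_subset: "Cinf W f ==> V <= W ==> Cinf V f" unfolding Cinf_def using Ck_subset by blast

lemma Cinf_has_derivative: "Cinf W f ==> x : W ==> (f has_derivative FD f (at x)) (at x)"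
 unfolding Cinf_def using Ck_has_derivative by blast

lemma Cinf_derivative: "Cinf W f ==> Cinf W (%x. FD f (at x) v)"
 unfolding Cinf_def using Ck.simps(2) by blast

lemma Cinf_continuous_on: "Cinf W f ==> continuous_on W f"
 unfolding Cinf_def using Ck.simps(1) by blast

lemma Cinf_local: "(!!x. x : W ==> EX V. open V & x : V & Cinf V f) ==> Cinf W f"
 unfolding Cinf_def using Ck_local by metis

lemma Cinf_const: "Cinf W (%x. c)" by (simp add: Cinf_def Ck_const)

lemma Cinf_compose_bounded_linear:
 "bounded_linear h ==> open W ==> Cinf W f ==> Cinf W (%x. h (f x))"
 by (simp add: Cinf_def Ck_compose_bounded_linear)

lemma Cinf_bounded_linear: "bounded_linear h ==> open W ==> Cinf W h"
 by (simp add: Cinf_def Ck_bounded_linear)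

lemma Cinf_ident: "open W ==> Cinf W (%x. x)" by (simp add: Cinf_def Ck_ident)

lemma Cinf_add: "open W ==> Cinf W f ==> Cinf W g ==> Cinf W (%x. f x + g x)"
 by (simp add: Cinf_def Ck_add)

lemma Cinf_sum: "open W ==> (!!i. i : I ==> Cinf W (f i)) ==> Cinf W (%x. SUM i:I. f i x)"
 by (simp add: Cinf_def Ck_sum)

lemma Cinf_scaleR: "open W ==> Cinf W f ==> Cinf W g ==> Cinf W (%x. f x *r g x)"
 by (simp add: Cinf_def Ck_scaleR)

lemma Cinf_mult: "open W ==> Cinf W f ==> Cinf W g ==> Cinf W (%x. f x * g x :: real)"
 by (simp add: Cinf_def Ck_mult)

lemma Cinf_diff: assumes "open W" "Cinf W f" "Cinf W g" shows "Cinf W (%x. f x - g x)"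
proof -
 have "Cinf W (%x. f x + (-1) *r g x)" by (intro Cinf_add Cinf_scaleR Cinf_const assms)
 then show ?thesis by simp
qed

lemma Cinf_compose:
 "open W ==> open V ==> f ` W <= V ==> Cinf V g ==> Cinf W f ==> Cinf W (%x. g (f x))"
 unfolding Cinf_def by (intro allI, rule Ck_compose[of W V]) auto

lemma Cinf_Pair: assumes "open W" "Cinf W f" "Cinf W g" shows "Cinf W (%x. (f x, g x))"
proof -
 have "Cinf W (%x. (f x, 0) + (0, g x))"
  by (intro Cinf_add assms Cinf_compose_bounded_linear[OF _ assms(1,2), of "%x. (x, 0)"]
    Cinf_compose_bounded_linear[OF _ assms(1,3), of "%x. (0, x)"])
   (auto intro!: bounded_linear_intros)
 then show ?thesis by simp
qed

lemma Cinf_inner: "open W ==> Cinf W f ==> Cinf W (%x. f x *i b)"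
 by (rule Cinf_compose_bounded_linear[OF bounded_linear_inner_left])

lemma smooth_on_iff:
 "smooth_on A f <-> (ALL x:A. EX W g. open W & x : W & Cinf W g & (ALL y:W Int A. g y = f y))"
 unfolding smooth_on_def Cinf_def by blast

lemma smooth_on_Cinf: assumes "open W" shows "smooth_on W f <-> Cinf W f"
proof
 assume f: "smooth_on W f"
 show "Cinf W f"
 proof (rule Cinf_local)
  fix x assume "x : W"
  then obtain V g where V: "open V" "x : V" "Cinf V g" "ALL y:V Int W. g y = f y"
   using f unfolding smooth_on_iff by blast
  then have "Cinf (V Int W) f" using Cinf_cong[of "V Int W" f g] Cinf_subset[of V g "V Int W"] assms
   by auto
  then show "EX V. open V & x : V & Cinf V f"
   using V assms `x : W` by (intro exI[of _ "V Int W"]) auto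
 qed
qed (use assms in "auto simp: smooth_on_iff")

subsection \<open>Cutoff functions\<close>

text \<open>The functions \<open>p(1/t) exp(-1/t)\<close>, extended by zero, form a class closed
  under differentiation, so smoothness is one induction for all polynomials \<open>p\<close>
  together. The case \<open>p = 1\<close> is the usual flat function.\<close>

definition flat :: "real poly => real => real" where
 "flat p t = (if t <= 0 then 0 else poly p (1 / t) * exp (- (1 / t)))"

lemma poly_exp_tendsto: "((%s. poly p s * exp (- s)) \<longlongrightarrow> 0) at_top" for p :: "real poly"
proof -
 have "((%s. SUM i<=degree p. coeff p i * (s ^ i / exp s)) \<longlongrightarrow> (SUM i<=degree p. coeff p i * 0)) at_top"
  by (intro tendsto_sum tendsto_mult tendsto_const tendsto_power_div_exp_0)
 then show ?thesis
  by (simp add: poly_altdef exp_minus field_simps sum_divide_distrib sum_distrib_right)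
qed

lemma flat_tendsto: "((%t. flat p t) \<longlongrightarrow> 0) (at_right 0)"
proof -
 have "((%t. poly p (1/t) * exp (- (1 / t))) \<longlongrightarrow> 0) (at_right 0)"
  using filterlim_compose[OF poly_exp_tendsto filterlim_inverse_at_top_right, of p]
  by (simp add: inverse_eq_divide)
 moreover have "ev (%t::real. poly p (1/t) * exp (- (1 / t)) = flat p t) (at_right 0)"
  by (auto simp: eventually_at_right_field flat_def intro: exI[of _ 1])
 ultimately show ?thesis by (rule Lim_transform_eventually)
qed

text \<open>With \<open>s = 1/t\<close> the derivative of \<open>p(s) exp(-s)\<close> in
  \<open>t\<close> is \<open>s^2 (p - p')(s) exp(-s)\<close>, whence the polynomial on the
  right.\<close>

lemma flat_deriv: "(flat p has_real_derivative flat (monom 1 2 * (p - pderiv p)) t) (at t)"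
proof -
 consider "t < 0" | "t = 0" | "t > 0" by linarith
 then show ?thesis
 proof cases
  case 1
  have "((%x. 0) has_real_derivative 0) (at t)" by simp
  then have "(flat p has_real_derivative 0) (at t)"
   by (rule has_field_derivative_transform_within_open[where S="{..<0}"]) (use 1 in "auto simp: flat_def")
  then show ?thesis using 1 by (simp add: flat_def)
 next
  case 3
  have d: "((%t. 1 / t) has_real_derivative - (1 / t^2)) (at t)"
   using 3 by (auto intro!: derivative_eq_intros simp: power2_eq_square)
  have "((%t. poly p (1 / t) * exp (- (1 / t))) has_real_derivative
    poly (pderiv p) (1 / t) * - (1 / t^2) * exp (- (1 / t)) +
    exp (- (1 / t)) * - (- (1 / t^2)) * poly p (1 / t)) (at t)"
   by (intro DERIV_mult DERIV_chain2[OF poly_DERIV d] DERIV_chain2[OF DERIV_exp DERIV_minus[OF d]])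
  also have "poly (pderiv p) (1 / t) * - (1 / t^2) * exp (- (1 / t)) +
    exp (- (1 / t)) * - (- (1 / t^2)) * poly p (1 / t) = flat (monom 1 2 * (p - pderiv p)) t"
   using 3 by (simp add: flat_def poly_monom algebra_simps power_one_over)
  finally show ?thesis
   by (rule has_field_derivative_transform_within_open[where S="{0<..}"]) (use 3 in "auto simp: flat_def")
 next
  case 2
  \<comment> \<open>Dividing by \<open>t\<close> multiplies the polynomial by its variable, so the
    difference quotient at 0 is again of the form \<open>flat\<close> and tends to 0.\<close>
  have r: "((%y. (flat p y - flat p 0) / (y - 0)) \<longlongrightarrow> 0) (at_right 0)"
  proof (rule Lim_transform_eventually[OF flat_tendsto[of "monom 1 1 * p"]])
   show "\<forall>\<^sub>F x in at_right 0. flat (monom 1 1 * p) x = (flat p x - flat p 0) / (x - 0)"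
    by (auto simp: eventually_at_right_field flat_def poly_monom intro: exI[of _ 1])
  qed
  have l: "((%y. (flat p y - flat p 0) / (y - 0)) \<longlongrightarrow> 0) (at_left 0)"
   by (rule Lim_transform_eventually[OF tendsto_const])
    (auto simp: eventually_at_left_field flat_def intro: exI[of _ "-1"])
  show ?thesis using r l unfolding 2 has_field_derivative_iff
   by (simp add: flat_def filterlim_split_at)
 qed
qed

lemma Ck_flat: "Ck k UNIV (flat p)"
proof (induction k arbitrary: p)
 case 0
 have "isCont (flat p) t" for t using flat_deriv DERIV_isCont by blast
 then show ?case by (simp add: continuous_on_eq_continuous_at)
next
 case (Suc k)
 show ?case
 proof (rule Ck_SucI[where D="%t v. flat (monom 1 2 * (p - pderiv p)) t * v"])
  show "Ck k UNIV (%t. flat (monom 1 2 * (p - pderiv p)) t * v)" for v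
   by (intro Ck_mult Suc.IH Ck_const) auto
 qed (simp_all add: flat_deriv[unfolded has_field_derivative_def])
qed

lemma Cinf_flat: "Cinf UNIV (flat p)" unfolding Cinf_def using Ck_flat by blast

text \<open>\<open>q\<close> is positive exactly inside radius \<open>2 * r\<close>, and since
  \<open>(2 * r)^2 - r^2 = 3 * r^2\<close> it is at least \<open>F (3 * r^2)\<close> within radius
  \<open>r\<close>. Feeding the deficit \<open>F (3 * r^2) - q\<close> into \<open>F\<close> once
  more flattens the inner part to the constant 1; the denominator is the value of this at
  \<open>q = 0\<close>.\<close>

lemma cutoff_exists:
 fixes a :: "'e::euclidean_space" assumes "r > 0"
 obtains ka :: "'e => real" where "Cinf UNIV ka" "!!x. dist a x <= r ==> ka x = 1"
  "!!x. dist a x >= 2 * r ==> ka x = 0"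
proof -
 define F where "F = flat 1"
 have Fpos: "F t > 0" if "t > 0" for t using that by (simp add: F_def flat_def)
 have F0: "F t = 0" if "t <= 0" for t using that by (simp add: F_def flat_def)
 have Fmono: "F s <= F t" if "0 < s" "s <= t" for s t
  using that by (simp add: F_def flat_def frac_le)
 define q where "q x = F (4 * r^2 - (x - a) *i (x - a))" for x
 define ka where "ka x = 1 - F (F (3 * r^2) - q x) / F (F (3 * r^2))" for x
 have in2: "Cinf UNIV (%x::'e. (x - a) *i (x - a))"
 proof -
  have "Cinf UNIV (%x::'e. SUM b:Basis. ((x - a) *i b) * ((x - a) *i b))"
   by (intro Cinf_sum Cinf_mult Cinf_inner Cinf_diff Cinf_ident Cinf_const) auto
  then show ?thesis by (subst euclidean_inner) simp
 qed
 have FF: "Cinf UNIV (%x. F (g x))" if "Cinf UNIV g" for g :: "'e => real"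
  unfolding F_def by (rule Cinf_compose[OF _ _ _ Cinf_flat that]) auto
 have q: "Cinf UNIV q" unfolding q_def by (intro FF Cinf_diff in2 Cinf_const) auto
 have "Cinf UNIV (%x. 1 - (1 / F (F (3 * r^2))) * F (F (3 * r^2) - q x))"
  by (intro Cinf_diff Cinf_mult FF q Cinf_const) auto
 then have 1: "Cinf UNIV ka" unfolding ka_def by simp
 have pos: "F (3 * r^2) > 0" using assms by (intro Fpos) auto
 have d: "(x - a) *i (x - a) = (dist a x)^2" for x
  by (simp add: dist_norm power2_norm_eq_inner[symmetric] norm_minus_commute)
 have 2: "ka x = 1" if "dist a x <= r" for x
 proof -
  have "(dist a x)^2 <= r^2" using that by (simp add: power_mono)
  then have "F (3 * r^2) <= q x" unfolding q_def d using assms by (intro Fmono) auto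
  then show ?thesis unfolding ka_def by (subst F0) auto
 qed
 have 3: "ka x = 0" if "dist a x >= 2 * r" for x
 proof -
  have "(2 * r)^2 <= (dist a x)^2" using that assms by (intro power_mono) auto
  then have "q x = 0" unfolding q_def d by (intro F0) auto
  then show ?thesis unfolding ka_def using Fpos[OF pos] by simp
 qed
 show ?thesis by (rule that[OF 1 2 3])
qed

subsection \<open>Hadamard's lemma\<close>

text \<open>Means over the segment from \<open>a\<close> to \<open>x\<close>. The weight
  \<open>t ^ j\<close> is there because each differentiation in \<open>x\<close> brings out a factor
  \<open>t\<close>: the family is closed under differentiation, with \<open>j\<close> raised by
  one.\<close>

definition ray_mean :: "'e::euclidean_space => nat => ('e => real) => 'e => real" where
 "ray_mean a j F x = integral {0..1} (%t. t ^ j * F (a + t *r (x - a)))"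

lemma ray_in_ball: "x : ball a r ==> t : {0..1} ==> a + t *r (x - a) : ball a r"
 for x a :: "'e::euclidean_space"
proof -
 assume x: "x : ball a r" and t: "t : {0..1::real}"
 have "norm (t *r (x - a)) <= norm (x - a)" using t by (auto simp: mult_left_le_one_le)
 then show ?thesis using x by (simp add: dist_norm norm_minus_commute)
qed

lemma ray_mean_has_derivative: assumes F: "Cinf (ball a r) F" and x: "x : ball a r"
 shows "(ray_mean a j F has_derivative (%v. ray_mean a (Suc j) (%x. FD F (at x) v) x)) (at x)"
proof -
 let ?B = "ball a r" and ?g = "%x t. a + t *r (x - a)"
 let ?f = "%x t. t ^ j * F (?g x t)"
 \<comment> \<open>The Leibniz rule wants the derivative as a bounded linear map that is continuous
   in both variables jointly; written in a basis, this reduces to continuity of the partial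
   derivatives.\<close>
 define fx where "fx x t = (SUM b:Basis. (t ^ Suc j * FD F (at (?g x t)) b) *r
  blinfun_inner_right b)" for x t
 have D: "(F has_derivative FD F (at y)) (at y)" if "y : ?B" for y
  using Cinf_has_derivative[OF F that] .
 have fx: "blinfun_apply (fx x t) v = t ^ Suc j * FD F (at (?g x t)) v"
  if "x : ?B" "t : {0..1}" for x t v
 proof -
  have "FD F (at (?g x t)) v = (SUM b:Basis. (v *i b) *r FD F (at (?g x t)) b)"
   by (rule linear_euclidean_expand[OF has_derivative_linear[OF D[OF ray_in_ball[OF that]]]])
  then show ?thesis
   by (simp add: fx_def blinfun.sum_left blinfun.scaleR_left sum_distrib_left inner_commute mult_ac)
 qed
 have cg: "continuous_on (?B \<times> {0..1}) (%(x,t). ?g x t)"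
  by (auto intro!: continuous_intros simp: split_beta)
 have c: "continuous_on (?B \<times> {0..1}) (%(x,t). G (?g x t))" if "continuous_on ?B G"
  for G :: "'a => real"
  using continuous_on_compose2[OF that cg] ray_in_ball by (force simp: split_beta)
 have cfx: "continuous_on (?B \<times> cbox 0 1) (%(x,t). fx x t)"
  unfolding fx_def split_beta using c[OF Cinf_continuous_on[OF Cinf_derivative[OF F]]]
  by (auto intro!: continuous_intros simp: split_beta)
 have "((%x. integral (cbox 0 1) (?f x)) has_derivative integral (cbox 0 1) (fx x)) (at x within ?B)"
 proof (rule leibniz_rule)
  fix y and t :: real assume y: "y : ?B" "t : cbox 0 1"
  then have t: "t : {0..1}" by simp
  have g: "((%x. ?g x t) has_derivative (%v. t *r v)) (at y)" by (auto intro!: derivative_eq_intros)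
  have "((%x. ?f x t) has_derivative (%v. t ^ j * FD F (at (?g y t)) (t *r v))) (at y)"
   by (rule has_derivative_mult_right[OF has_derivative_compose[OF g D[OF ray_in_ball[OF y(1) t]]]])
  also have "(%v. t ^ j * FD F (at (?g y t)) (t *r v)) = blinfun_apply (fx y t)"
   using fx[OF y(1) t] linear_scale[OF has_derivative_linear[OF D[OF ray_in_ball[OF y(1) t]]]]
   by auto
  finally show "((%x. ?f x t) has_derivative blinfun_apply (fx y t)) (at y within ?B)"
   by (rule has_derivative_at_withinI)
 next
  fix y assume y: "y : ?B"
  have "continuous_on {0..1} (%t. F (?g y t))"
   by (rule continuous_on_compose2[OF Cinf_continuous_on[OF F]])
    (use ray_in_ball[OF y] in "auto intro!: continuous_intros")
  then show "?f y integrable_on cbox 0 1"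
   by (intro integrable_continuous) (auto intro!: continuous_intros)
 qed (use cfx x in auto)
 moreover have "blinfun_apply (integral (cbox 0 1) (fx x)) v =
   ray_mean a (Suc j) (%x. FD F (at x) v) x" for v
 proof -
  have "continuous_on (cbox 0 1) (%t. (%(x,t). fx x t) (x,t))"
   by (rule continuous_on_compose2[OF cfx]) (use x in "auto intro!: continuous_intros")
  then have cx: "continuous_on (cbox 0 1) (%t. fx x t)" by simp
  have "integral (cbox 0 1) ((%L. blinfun_apply L v) o fx x) = blinfun_apply (integral (cbox 0 1) (fx x)) v"
   by (rule integral_linear[OF integrable_continuous[OF cx] blinfun.bounded_linear_left])
  also have "integral (cbox 0 1) ((%L. blinfun_apply L v) o fx x) =
    ray_mean a (Suc j) (%x. FD F (at x) v) x" unfolding ray_mean_def box_real(2)[symmetric]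
   by (intro integral_cong) (use fx[OF x] in auto)
  finally show ?thesis ..
 qed
 then have "blinfun_apply (integral (cbox 0 1) (fx x)) =
   (%v. ray_mean a (Suc j) (%x. FD F (at x) v) x)" by (rule ext)
 ultimately have "((%x. integral (cbox 0 1) (?f x)) has_derivative
   (%v. ray_mean a (Suc j) (%x. FD F (at x) v) x)) (at x)"
  by (simp only: at_within_open[OF x open_ball])
 then show ?thesis by (simp add: ray_mean_def[abs_def] box_real)
qed

lemma Cinf_ray_mean: "Cinf (ball a r) F ==> Cinf (ball a r) (ray_mean a j F)"
proof -
 have "Cinf (ball a r) F ==> Ck k (ball a r) (ray_mean a j F)" for k
 proof (induction k arbitrary: F j)
  case 0
  then show ?case using ray_mean_has_derivative has_derivative_continuous
   by (fastforce intro!: continuous_at_imp_continuous_on)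
 next
  case (Suc k)
  then show ?case
   by (intro Ck_SucI[OF open_ball ray_mean_has_derivative]) (auto intro: Cinf_derivative)
 qed
 then show "Cinf (ball a r) F ==> Cinf (ball a r) (ray_mean a j F)" by (simp add: Cinf_def)
qed

text \<open>The fundamental theorem of calculus along the segment from \<open>a\<close> to
  \<open>x\<close>. What matters is that the coefficients are again smooth in \<open>x\<close>, by
  \<open>Cinf_ray_mean\<close>.\<close>

lemma Hadamard:
 fixes F :: "'e::euclidean_space => real" assumes F: "Cinf (ball a r) F" and x: "x : ball a r"
 shows "F x = F a + (SUM b:Basis. ((x - a) *i b) * ray_mean a 0 (%x. FD F (at x) b) x)"
proof -
 let ?g = "%t. a + t *r (x - a)"
 have D: "(F has_derivative FD F (at (?g t))) (at (?g t))" if "t : {0..1}" for t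
  using Cinf_has_derivative[OF F ray_in_ball[OF x that]] .
 have "((%t. FD F (at (?g t)) (x - a)) has_integral F (?g 1) - F (?g 0)) {0..1}"
 proof (rule fundamental_theorem_of_calculus)
  fix t :: real assume t: "t : {0..1}"
  have "(?g has_derivative (%s. s *r (x - a))) (at t)" by (auto intro!: derivative_eq_intros)
  then have "((%t. F (?g t)) has_derivative (%s. FD F (at (?g t)) (s *r (x - a)))) (at t)"
   using D[OF t] by (rule has_derivative_compose[where g=F])
  then show "((%t. F (?g t)) has_vector_derivative FD F (at (?g t)) (x - a)) (at t within {0..1})"
   unfolding has_vector_derivative_def linear_scale[OF has_derivative_linear[OF D[OF t]]]
   by (rule has_derivative_at_withinI)
 qed simp
 moreover have "FD F (at (?g t)) (x - a) =
   (SUM b:Basis. ((x - a) *i b) * FD F (at (?g t)) b)" if "t : {0..1}" for t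
  using linear_euclidean_expand[OF has_derivative_linear[OF D[OF that]], of "x - a"] by (simp only: real_scaleR_def)
 ultimately have "((%t. SUM b:Basis. ((x - a) *i b) * FD F (at (?g t)) b)
   has_integral F x - F a) {0..1}"
  by (subst has_integral_cong[where g="%t. FD F (at (?g t)) (x - a)"]) auto
 then have "F x - F a = integral {0..1} (%t. SUM b:Basis. ((x - a) *i b) * FD F (at (?g t)) b)"
  by (simp add: integral_unique)
 also have "... = (SUM b:Basis. integral {0..1} (%t. ((x - a) *i b) * FD F (at (?g t)) b))"
 proof (rule Henstock_Kurzweil_Integration.integral_sum)
  fix b :: 'e
  have "continuous_on {0..1} (%t. FD F (at (?g t)) b)"
   by (rule continuous_on_compose2[OF Cinf_continuous_on[OF Cinf_derivative[OF F]]])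
    (use ray_in_ball[OF x] in "auto intro!: continuous_intros")
  then show "(%t. ((x - a) *i b) * FD F (at (?g t)) b) integrable_on {0..1}"
   by (intro integrable_continuous_real continuous_intros)
 qed simp
 also have "... = (SUM b:Basis. ((x - a) *i b) * ray_mean a 0 (%x. FD F (at x) b) x)"
  by (simp add: ray_mean_def)
 finally show ?thesis by simp
qed

subsection \<open>The inverse function theorem\<close>

text \<open>A product rule in which the scalar factor is merely continuous: the other factor
  vanishes at the point, so no derivative of \<open>c\<close> enters. It is made for
  \<open>local_inverse\<close>, where \<open>c\<close> is a component of the derivative of the
  inverse and only its continuity is known at that stage.\<close>

lemma has_derivative_scaleR_null:
 assumes c: "isCont c y" and H: "(H has_derivative H') (at y)" and 0: "H y = 0"
 shows "((%x. c x *r H x) has_derivative (%z. c y *r H' z)) (at y)"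
proof -
 have b: "bounded_linear H'" using H by (rule has_derivative_bounded_linear)
 let ?q = "%x. c x *r ((H x - H' (x - y)) /\<^sub>R norm (x - y)) + (c x - c y) *r (H' (x - y) /\<^sub>R norm (x - y))"
 have "((%x. (H x - H' (x - y)) /\<^sub>R norm (x - y)) \<longlongrightarrow> 0) (at y)"
  using H by (simp add: has_derivative_at_within 0 algebra_simps)
 then have 1: "((%x. c x *r ((H x - H' (x - y)) /\<^sub>R norm (x - y))) \<longlongrightarrow> c y *r 0) (at y)"
  using c by (intro tendsto_scaleR) (auto simp: isCont_def)
 have n: "norm (H' v /\<^sub>R norm v) <= onorm H'" for v
  using onorm[OF b, of v] onorm_pos_le[OF b] by (cases "v = 0") (simp_all add: field_simps)
 have "((%x. \<bar>c x - c y\<bar> * onorm H') \<longlongrightarrow> 0) (at y)"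
  using c by (intro tendsto_mult_left_zero tendsto_rabs_zero) (simp add: isCont_def LIM_zero)
 then have "((%x. (c x - c y) *r (H' (x - y) /\<^sub>R norm (x - y))) \<longlongrightarrow> 0) (at y)"
  by (rule Lim_null_comparison[rotated])
   (use n in \<open>simp only: norm_scaleR[of "c x - c y" for x] eventuallyI mult_left_mono abs_ge_zero\<close>)
 from tendsto_add[OF 1 this] have "(?q \<longlongrightarrow> 0) (at y)" by simp
 moreover have "?q = (%x. ((c x *r H x - c y *r H y) - c y *r H' (x - y)) /\<^sub>R norm (x - y))"
  by (simp add: 0 algebra_simps)
 ultimately show ?thesis
  using has_derivative_bounded_linear[OF has_derivative_scaleR_right[OF H, of "c y"]]
  by (simp only: has_derivative_at_within)
qed

text \<open>A differentiable local inverse \<open>k\<close> is available; the work is its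
  smoothness. The fixed point equation for the derivative \<open>k'\<close> gives first the
  continuity of \<open>k'\<close>, then its derivative, as a polynomial expression in
  \<open>k'\<close> and in the second derivatives of \<open>g\<close> at \<open>k y\<close>.\<close>

lemma local_inverse:
 fixes g :: "'e::euclidean_space => 'e" assumes W: "open W" and g: "Cinf W g" and a: "a : W"
  and id: "FD g (at a) = (%v. v)"
 obtains U where "open U" "a : U" "U <= W" "inj_on g U" "open (g ` U)" "Cinf (g ` U) (inv_into U g)"
proof -
 define A where "A x = FD g (at x)" for x
 define B where "B x = Blinfun (A x)" for x
 define A2 where "A2 b x c = FD (%x. A x b) (at x) c" for b x c
 have gA: "(g has_derivative A x) (at x)" if "x : W" for x
  unfolding A_def by (rule Cinf_has_derivative[OF g that])
 have Ab: "Cinf W (%x. A x b)" for b unfolding A_def by (rule Cinf_derivative[OF g])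
 have B: "blinfun_apply (B x) = A x" if "x : W" for x
  unfolding B_def by (rule bounded_linear_Blinfun_apply[OF has_derivative_bounded_linear[OF gA[OF that]]])
 have cB: "continuous_on W B" by (intro continuous_on_blinfun_componentwise)
   (use Cinf_continuous_on[OF Ab] in "simp add: B cong: continuous_on_cong")
 \<comment> \<open>On this set the derivative is within 1/2 of the identity, which yields the
   uniform bound 2 on the inverse derivatives in \<open>bd\<close>.\<close>
 let ?W = "W Int B -` ball id_blinfun (1/2)"
 have Ba: "B a = id_blinfun" using B[OF a] id by (auto intro!: blinfun_eqI simp: A_def)
 obtain U V k k' where U: "open U" "U <= ?W" "a : U" "open V" "homeomorphism U V g k"
  and k: "!!y. y : V ==> (k has_derivative k' y) (at y)"
   "!!y. y : V ==> k' y = inv_into UNIV (blinfun_apply (B (k y)))" "!!y. y : V ==> bij (blinfun_apply (B (k y)))"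
 proof (rule inverse_function_theorem[of ?W g B a id_blinfun])
  show "open ?W" by (rule continuous_open_preimage[OF cB W open_ball])
  show "continuous_on ?W B" by (rule continuous_on_subset[OF cB]) auto
  show "id_blinfun o\<^sub>L B a = id_blinfun" by (rule blinfun_eqI) (simp add: Ba)
 qed (use gA B a Ba in auto)
 have kU: "k y : U" "g (k y) = y" "k y : W" if "y : V" for y
  using U that by (auto simp: homeomorphism_def)
 have lA: "linear (A x)" if "x : W" for x by (rule has_derivative_linear[OF gA[OF that]])
 have lk: "linear (k' y)" if "y : V" for y by (rule has_derivative_linear[OF k(1)[OF that]])
 have Ak: "A (k y) (k' y w) = w" "k' y (A (k y) w) = w" if "y : V" for y w
  using k(2,3)[OF that] B[OF kU(3)[OF that]] by (auto simp: bij_def surj_f_inv_f)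
 have bd: "norm (k' y w) <= 2 * norm w" if "y : V" for y w
 proof -
  have "norm (id_blinfun - B (k y)) <= 1/2" using kU(1)[OF that] U(2) by (auto simp: dist_norm)
  from order_trans[OF norm_blinfun mult_right_mono[OF this norm_ge_zero], of "k' y w"]
  have "norm (k' y w - A (k y) (k' y w)) <= 1/2 * norm (k' y w)"
   by (simp add: blinfun.diff_left B kU that)
  then show ?thesis using norm_triangle_ineq2[of "k' y w" w] Ak(1)[OF that] by simp
 qed
 \<comment> \<open>The inverse \<open>k' y\<close> of \<open>A (k y)\<close> satisfies the fixed point equation
    \<open>k' z w = k' y w - \<Sum>b (k' z w \<bullet> b) (k' y (A (k z) b) - b)\<close>, whose last factor vanishes at \<open>y\<close>.\<close>
 have eq: "k' z w = k' y w - (SUM b:Basis. (k' z w *i b) *r (k' y (A (k z) b) - b))" if "y : V" "z : V" for y z w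
 proof -
  have "(SUM b:Basis. (k' z w *i b) *r k' y (A (k z) b)) = k' y (A (k z) (k' z w))"
   by (subst (3) euclidean_representation[symmetric])
    (simp add: linear_sum lk linear_scale lA kU that)
  then show ?thesis using that by (simp add: Ak scaleR_diff_right sum_subtractf euclidean_representation)
 qed
 define D where "D y w z = - (SUM b:Basis. SUM c:Basis. ((k' y w *i b) * (A2 b (k y) z *i c)) *r k' y c)" for y w z
 have D: "((%z. k' z w) has_derivative (%z. D y w (k' y z))) (at y)" if y: "y : V" for y w
 proof -
  have H: "((%z. k' y (A (k z) b) - b) has_derivative (%z. k' y (A2 b (k y) (k' y z)))) (at y)" for b
  proof -
   have "((%z. A (k z) b) has_derivative (%z. A2 b (k y) (k' y z))) (at y)" unfolding A2_def
    by (rule has_derivative_compose[OF k(1)[OF y] Cinf_has_derivative[OF Ab kU(3)[OF y]]])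
   from has_derivative_diff[OF bounded_linear.has_derivative[OF
     has_derivative_bounded_linear[OF k(1)[OF y]] this] has_derivative_const[of b]]
   show ?thesis by simp
  qed
  have tr: "\<forall>\<^sub>F z in at y. z : V" using U(4) y by (auto simp: eventually_at_topological)
  have "((%z. SUM b:Basis. (k' z w *i b) *r (k' y (A (k z) b) - b)) \<longlongrightarrow> 0) (at y)"
  proof (rule tendsto_null_sum)
   fix b :: 'e assume b: "b : Basis"
   have "((%z. 2 * norm w * norm (k' y (A (k z) b) - b)) \<longlongrightarrow> 0) (at y)"
    using has_derivative_continuous[OF H[of b]] unfolding continuous_within Ak(2)[OF y]
    by (intro tendsto_mult_right_zero tendsto_norm_zero) simp
   moreover have "\<forall>\<^sub>F z in at y. norm ((k' z w *i b) *r (k' y (A (k z) b) - b)) <=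
     2 * norm w * norm (k' y (A (k z) b) - b)" using tr by (rule eventually_mono)
     (unfold norm_scaleR, rule mult_right_mono[OF order_trans[OF Basis_le_norm[OF b] bd] norm_ge_zero])
   ultimately show "((%z. (k' z w *i b) *r (k' y (A (k z) b) - b)) \<longlongrightarrow> 0) (at y)"
    by (rule Lim_null_comparison[rotated])
  qed
  from tendsto_diff[OF tendsto_const[of "k' y w"] this] have "isCont (%z. k' z w) y"
   unfolding isCont_def diff_zero
   by (rule Lim_transform_eventually) (use tr in eventually_elim, rule eq[OF y, symmetric])
  then have "((%z. SUM b:Basis. (k' z w *i b) *r (k' y (A (k z) b) - b)) has_derivative
    (%z. SUM b:Basis. (k' y w *i b) *r k' y (A2 b (k y) (k' y z)))) (at y)"
   by (intro has_derivative_sum has_derivative_scaleR_null[OF _ H]) (auto simp: Ak y intro!: continuous_intros)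
  from has_derivative_diff[OF has_derivative_const[of "k' y w"] this]
  have "((%z. k' z w) has_derivative (%z. 0 - (SUM b:Basis. (k' y w *i b) *r k' y (A2 b (k y) (k' y z))))) (at y)"
   by (rule has_derivative_transform_within_open[OF _ U(4) y]) (rule eq[OF y, symmetric])
  moreover have "k' y (A2 b (k y) (k' y z)) = (SUM c:Basis. (A2 b (k y) (k' y z) *i c) *r k' y c)" for b z
   by (rule linear_euclidean_expand[OF lk[OF y]])
  ultimately show ?thesis by (simp add: D_def scaleR_sum_right)
 qed
 have A2l: "A2 b (k y) z = (SUM c:Basis. (z *i c) *r A2 b (k y) c)" if "y : V" for b y z
  unfolding A2_def by (rule linear_euclidean_expand[OF has_derivative_linear[OF Cinf_has_derivative[OF Ab kU(3)[OF that]]]])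
 \<comment> \<open>The induction carries \<open>k\<close> and its derivative together: the
   derivative of \<open>k\<close> is \<open>k'\<close>, and that of \<open>k'\<close> is built from
   \<open>k'\<close> and from \<open>A2\<close> at \<open>k y\<close>.\<close>
 have "Ck n V k & (ALL w. Ck n V (%y. k' y w))" for n
 proof (induction n)
  case 0
  show ?case using k(1) D U(4) has_derivative_continuous
   by (auto intro!: continuous_at_imp_continuous_on) blast+
 next
  case (Suc n)
  have A2k: "Ck n V (%y. A2 b (k y) c)" for b c unfolding A2_def
   by (rule Ck_compose[OF U(4) W _ Cinf_derivative[OF Ab, unfolded Cinf_def, rule_format]]) (use kU Suc in auto)
  have "Ck n V (%y. D y w (k' y z))" for w z
  proof (subst Ck_cong[OF U(4)])
   show "Ck n V (%y. (- 1) *r (SUM b:Basis. SUM c:Basis. ((k' y w *i b) * ((SUM d:Basis. (k' y z *i d) *r A2 b (k y) d) *i c)) *r k' y c))"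
    using Suc A2k by (intro Ck_scaleR Ck_const Ck_sum Ck_mult U(4)
      Ck_compose_bounded_linear[OF bounded_linear_inner_left U(4)]) auto
  qed (simp add: D_def A2l[symmetric])
  then show ?case using Suc by (intro conjI allI Ck_SucI[OF U(4) D] Ck_SucI[OF U(4) k(1)]) auto
 qed
 then have "Cinf V k" by (simp add: Cinf_def)
 moreover have i: "inj_on g U" "g ` U = V" using U(5) by (auto simp: homeomorphism_def intro: inj_on_inverseI[of U k])
 moreover have "inv_into U g y = k y" if "y : V" for y using kU[OF that] i by (auto intro: inv_into_f_eq)
 ultimately show ?thesis using U(1-4) Cinf_cong[OF U(4), of "inv_into U g" k] by (intro that[of U]) auto
qed

section \<open>Manifolds through their smooth functions\<close>

lemma smooth_on_cong: "(!!x. x : A ==> f x = g x) ==> smooth_on A f <-> smooth_on A g"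
 unfolding smooth_on_def by (metis IntD2)

lemma smooth_on_compose: assumes "smooth_on A f" "smooth_on B h" "h ` B <= A"
 shows "smooth_on B (%x. f (h x))" unfolding smooth_on_iff
proof
 fix x assume x: "x : B"
 then obtain W k where W: "open W" "x : W" "Cinf W k" "ALL y:W Int B. k y = h y"
  using assms(2) unfolding smooth_on_iff by meson
 have "h x : A" using x assms(3) by auto
 then obtain V g where V: "open V" "h x : V" "Cinf V g" "ALL y:V Int A. g y = f y"
  using assms(1) unfolding smooth_on_iff by meson
 let ?O = "W Int k -` V"
 have o: "open ?O" using continuous_open_preimage[OF Cinf_continuous_on[OF W(3)] W(1) V(1)] .
 have "Cinf ?O (%x. g (k x))" by (rule Cinf_compose[OF o V(1) _ V(3) Cinf_subset[OF W(3)]]) auto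
 moreover have "ALL y:?O Int B. g (k y) = f (h y)"
 proof
  fix y assume y: "y : ?O Int B"
  then have "k y = h y" using W(4) by simp
  moreover have "h y : A" using y assms(3) by auto
  ultimately show "g (k y) = f (h y)" using V(4) y by auto
 qed
 moreover have "x : ?O" using W(2,4) x V(2) by auto
 ultimately show "EX W g. open W & x : W & Cinf W g & (ALL y:W Int B. g y = f (h y))"
  using o by (intro exI[of _ ?O] exI[of _ "%x. g (k x)"] conjI)
qed

lemma smooth_on_compose_Cinf: assumes "smooth_on A f" "open W" "Cinf W h" "h ` W <= A"
 shows "Cinf W (%x. f (h x))"
 using smooth_on_compose[OF assms(1) _ assms(4)] assms(2,3) by (simp add: smooth_on_Cinf)

lemma smooth_onE: assumes "smooth_on A f" "x : A"
 obtains W g where "open W" "x : W" "Cinf W g" "ALL y:W Int A. g y = f y"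
 using assms unfolding smooth_on_iff by meson

lemma smooth_on_subset: assumes "smooth_on A f" "B <= A" shows "smooth_on B f"
 unfolding smooth_on_iff
proof
 fix x assume "x : B"
 then obtain W g where "open W" "x : W" "Cinf W g" "ALL y:W Int A. g y = f y"
  using smooth_onE[OF assms(1)] assms(2) by (metis subsetD)
 then show "EX W g. open W & x : W & Cinf W g & (ALL y:W Int B. g y = f y)"
  using assms(2) by (intro exI[of _ W] exI[of _ g]) auto
qed

lemma smooth_on_continuous: assumes "smooth_on A f" shows "continuous_on A f"
 unfolding continuous_on_def
proof
 fix x assume x: "x : A"
 obtain W g where W: "open W" "x : W" "Cinf W g" "ALL y:W Int A. g y = f y"
  using smooth_onE[OF assms x] .
 have "(g \<longlongrightarrow> g x) (at x within A)" using Cinf_continuous_on[OF W(3)] W(1,2)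
  by (metis continuous_on_eq_continuous_at continuous_at_imp_continuous_at_within continuous_within)
 moreover have "ev (%y. g y = f y) (at x within A)"
  using W by (auto simp: eventually_at_topological)
 moreover have "g x = f x" using W x by auto
 ultimately show "(f \<longlongrightarrow> f x) (at x within A)" using Lim_transform_eventually by fastforce
qed

lemma Cinf_imp_smooth_on: "open W ==> Cinf W f ==> A <= W ==> smooth_on A f"
 by (rule smooth_on_subset[OF smooth_on_Cinf[THEN iffD2]])

lemma smooth_on_locally:
 assumes "!!x. x : A ==> EX V. openin (top_of_set A) V & x : V & smooth_on V f"
 shows "smooth_on A f" unfolding smooth_on_iff
proof
 fix x assume "x : A"
 then obtain O' where O: "open O'" "x : A Int O'" "smooth_on (A Int O') f"
  using assms by (metis openin_open)
 then obtain W g where W: "open W" "x : W" "Cinf W g" "ALL y:W Int (A Int O'). g y = f y"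
  unfolding smooth_on_iff by meson
 then show "EX W g. open W & x : W & Cinf W g & (ALL y:W Int A. g y = f y)"
  using O Cinf_subset[OF W(3), of "W Int O'"] by (intro exI[of _ "W Int O'"] exI[of _ g]) auto
qed

lemma smooth_on_const: "smooth_on A (%x. c)" unfolding smooth_on_iff using Cinf_const by blast

lemma smooth_on_bilinear:
 fixes h :: "'f::euclidean_space => 'g::euclidean_space => 'h::euclidean_space"
 assumes "!!W f g. open W ==> Cinf W f ==> Cinf W g ==> Cinf W (%x::'e. h (f x) (g x))"
  "smooth_on A f" "smooth_on A g" shows "smooth_on (A::'e::euclidean_space set) (%x. h (f x) (g x))"
 unfolding smooth_on_iff
proof
 fix x assume x: "x : A"
 obtain W f' where W: "open W" "x : W" "Cinf W f'" "ALL y:W Int A. f' y = f y"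
  using assms(2) x unfolding smooth_on_iff by meson
 obtain V g' where V: "open V" "x : V" "Cinf V g'" "ALL y:V Int A. g' y = g y"
  using assms(3) x unfolding smooth_on_iff by meson
 have "Cinf (W Int V) (%x. h (f' x) (g' x))" using W V by (intro assms(1)) (auto intro: Cinf_subset)
 then show "EX W k. open W & x : W & Cinf W k & (ALL y:W Int A. k y = h (f y) (g y))"
  using W V by (intro exI[of _ "W Int V"] exI[of _ "%x. h (f' x) (g' x)"]) auto
qed

lemma smooth_on_Pair: "smooth_on A f ==> smooth_on A g ==> smooth_on A (%x. (f x, g x))"
 by (rule smooth_on_bilinear[where h=Pair]) (auto intro: Cinf_Pair)

lemma smooth_on_add: "smooth_on A f ==> smooth_on A g ==> smooth_on A (%x. f x + g x)"
 by (rule smooth_on_bilinear[where h="(+)"]) (auto intro: Cinf_add)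

lemma smooth_on_mult: "smooth_on A f ==> smooth_on A g ==> smooth_on A (%x. f x * g x :: real)"
 by (rule smooth_on_bilinear[where h="(*)"]) (auto intro: Cinf_mult)

subsection \<open>The algebra of smooth functions\<close>

text \<open>The part of the notion of manifold that fibre products with their slice charts are shown
  to satisfy: a cover by charts onto open subsets of linear spaces. The local theory of smooth
  functions is developed over this; the existence of enough smooth functions is added separately in
  \<open>mf\<close>.\<close>

definition hatl :: "('a, 'e::euclidean_space) mfd => bool" where
 "hatl M <-> pts M = \<Union> (fst ` atlas M) & (ALL c:atlas M. EX n. is_chart n c)"

lemma hatlD: assumes "hatl M"
 shows "(U, ph) : atlas M ==> U <= pts M" "(U, ph) : atlas M ==> inj_on ph U"
  "p : pts M ==> EX U ph. (U, ph) : atlas M & p : U"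
 using assms unfolding hatl_def is_chart_def by fastforce+

lemma C_inf_0: "f : C_inf M ==> x ~: pts M ==> f x = 0" by (simp add: C_inf_def)

lemma C_inf_chart: "f : C_inf M ==> (U, ph) : atlas M ==> smooth_on (ph ` U) (f o inv_into U ph)"
 by (auto simp: C_inf_def)

lemma C_inf_zero [simp]: "0 : C_inf M" using smooth_on_const[of _ 0] by (auto simp: C_inf_def o_def)

lemma C_inf_add [intro]: "f : C_inf M ==> g : C_inf M ==> f + g : C_inf M"
 by (auto simp: C_inf_def o_def intro!: smooth_on_add)

lemma C_inf_mult [intro]: "f : C_inf M ==> g : C_inf M ==> f * g : C_inf M"
 by (auto simp: C_inf_def o_def intro!: smooth_on_mult)

lemma C_inf_scaleR [intro]: "f : C_inf M ==> c *r f : C_inf M"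
 by (auto simp: C_inf_def o_def scaleR_fun_def intro!: smooth_on_mult smooth_on_const)

lemma C_inf_minus [intro]: "f : C_inf M ==> - f : C_inf M" using C_inf_scaleR[of f M "-1"] by simp

lemma C_inf_diff [intro]: "f : C_inf M ==> g : C_inf M ==> f - g : C_inf M"
 using C_inf_add[of f M "- g"] by auto

lemma C_inf_sum [intro]: "(!!i. i : I ==> f i : C_inf M) ==> sum f I : C_inf M"
 by (induction I rule: infinite_finite_induct) auto

lemma C_inf_subspace: "subspace (C_inf M)" by (rule subspaceI) auto

definition const_on :: "('a, 'e) mfd => real => 'a => real" where
 "const_on M c x = (if x : pts M then c else 0)"

lemma C_inf_const [simp]: "hatl M ==> const_on M c : C_inf M"
proof -
 assume M: "hatl M"
 have "smooth_on (ph ` U) (const_on M c o inv_into U ph)" if "(U, ph) : atlas M" for U ph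
  using hatlD(1)[OF M that] by (intro smooth_on_cong[THEN iffD1, OF _ smooth_on_const[of _ c]])
   (metis comp_apply const_on_def inv_into_into subsetD)
 then show ?thesis by (auto simp: C_inf_def const_on_def)
qed

text \<open>Neighbourhoods are given by the sets where a smooth function does not vanish; this makes
  the topology of \<open>M\<close> accessible through pullbacks of functions.\<close>

definition nhm :: "('a, 'e::euclidean_space) mfd => 'a => 'a filter" where
 "nhm M p = (INF h\<in>{h : C_inf M. h p ~= 0}. principal {x. h x ~= 0})"

lemma ev_nhm: assumes "hatl M" "p : pts M"
 shows "ev Q (nhm M p) <-> (EX h:C_inf M. h p ~= 0 & (ALL x. h x ~= 0 --> Q x))"
proof -
 have "const_on M 1 : {h : C_inf M. h p ~= 0}" using assms by (simp add: const_on_def)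
 then have "{h : C_inf M. h p ~= 0} ~= {}" by blast
 then show ?thesis unfolding nhm_def
 proof (subst eventually_INF_base)
  fix a b assume "a : {h : C_inf M. h p ~= 0}" "b : {h : C_inf M. h p ~= 0}"
  then show "EX x:{h : C_inf M. h p ~= 0}. principal {y. x y ~= 0} <=
    inf (principal {y. a y ~= 0}) (principal {y. b y ~= 0})" by (intro bexI[of _ "a * b"]) auto
 qed (auto simp: eventually_principal)
qed

lemma ev_nhmE: assumes "hatl M" "p : pts M" "ev Q (nhm M p)"
 obtains h where "h : C_inf M" "h p ~= 0" "ALL x. h x ~= 0 --> Q x"
 using assms(3) unfolding ev_nhm[OF assms(1,2)] by auto

lemma ev_nhmI: assumes "hatl M" "p : pts M" "h : C_inf M" "h p ~= 0" "!!x. h x ~= 0 ==> Q x"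
 shows "ev Q (nhm M p)" unfolding ev_nhm[OF assms(1,2)] using assms by auto

lemma ev_nhmD: "hatl M ==> p : pts M ==> ev Q (nhm M p) ==> Q p" by (auto simp: ev_nhm)

lemma ev_ev_nhm: assumes "hatl M" "p : pts M" "ev Q (nhm M p)"
 shows "ev (%x. x : pts M & ev Q (nhm M x)) (nhm M p)"
proof -
 obtain h where h: "h : C_inf M" "h p ~= 0" "ALL x. h x ~= 0 --> Q x" by (rule ev_nhmE[OF assms])
 show ?thesis
 proof (rule ev_nhmI[OF assms(1,2) h(1,2)])
  fix x assume x: "h x ~= 0"
  then have xM: "x : pts M" using C_inf_0[OF h(1)] by blast
  show "x : pts M & ev Q (nhm M x)" using xM ev_nhmI[OF assms(1) xM h(1) x] h(3) by blast
 qed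
qed

lemma ev_pts: "hatl M ==> p : pts M ==> ev (%x. x : pts M) (nhm M p)"
 using ev_ev_nhm[of M p "%x. True"] by simp

text \<open>Smoothness is local also when neighbourhoods are measured by \<open>nhm\<close>, because
  the non-vanishing set of a smooth function is open in every chart.\<close>

lemma C_infI: assumes M: "hatl M" and "!!x. x ~: pts M ==> f x = 0"
  and loc: "!!p. p : pts M ==> EX g:C_inf M. ev (%x. f x = g x) (nhm M p)" shows "f : C_inf M"
proof -
 have "smooth_on (ph ` U) (f o inv_into U ph)" if c: "(U, ph) : atlas M" for U ph
 proof (rule smooth_on_locally)
  fix y assume y: "y : ph ` U"
  let ?c = "inv_into U ph"
  have p: "?c y : pts M" using inv_into_into[OF y] hatlD(1)[OF M c] by auto
  obtain g where g: "g : C_inf M" and ev: "ev (%x. f x = g x) (nhm M (?c y))"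
   using loc[OF p] by blast
  obtain h where h: "h : C_inf M" "h (?c y) ~= 0" "ALL x. h x ~= 0 --> f x = g x"
   using ev_nhmE[OF M p ev] by blast
  have ch: "continuous_on (ph ` U) (h o ?c)" by (rule smooth_on_continuous[OF C_inf_chart[OF h(1) c]])
  let ?V = "ph ` U Int (h o ?c) -` {t. t ~= 0}"
  have "openin (top_of_set (ph ` U)) ?V"
   by (rule continuous_openin_preimage_gen[OF ch]) (simp add: open_Collect_neq)
  moreover have "y : ?V" using y h(2) by simp
  moreover have "smooth_on ?V (f o ?c)"
   using h(3) smooth_on_cong[of ?V "f o ?c" "g o ?c"] smooth_on_subset[OF C_inf_chart[OF g c], of ?V]
   by auto
  ultimately show "EX V. openin (top_of_set (ph ` U)) V & y : V & smooth_on V (f o ?c)" by blast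
 qed
 then show ?thesis using assms(2) by (auto simp: C_inf_def)
qed

text \<open>One cutoff serves every \<open>g\<close>. This order of choices matters in
  \<open>submersion_section\<close>, where the neighbourhood, given by \<open>h\<close>, has to be
  fixed before the function \<open>F\<close> to be transported.\<close>

lemma cutoff_uniform:
 fixes a :: "'z::euclidean_space" assumes "open W" "a : W"
 obtains ka :: "'z => real" and r where "r > 0" "!!x. dist a x < r ==> x : W & ka x = 1"
  "!!g::'z => real. Cinf W g ==> Cinf UNIV (%x. if x : W then ka x * g x else 0)"
proof -
 obtain e where e: "e > 0" "cball a e <= W" using assms(1,2) open_contains_cball by blast
 obtain ka :: "'z => real" where ka: "Cinf UNIV ka" "!!x. dist a x <= e/2 ==> ka x = 1"
  "!!x. dist a x >= 2 * (e/2) ==> ka x = 0" using cutoff_exists[of "e/2" a] e by auto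
 have "Cinf UNIV (%x. if x : W then ka x * g x else 0)" (is "Cinf _ ?G") if g: "Cinf W g" for g :: "'z => real"
 proof (rule Cinf_local)
  fix x :: 'z
  show "EX V. open V & x : V & Cinf V ?G"
  proof (cases "x : W")
   case True
   have "Cinf W (%x. ka x * g x)" by (intro Cinf_mult assms g Cinf_subset[OF ka(1)]) auto
   then have "Cinf W ?G" by (rule Cinf_cong[OF assms(1), THEN iffD1, rotated]) simp
   then show ?thesis using True assms(1) by auto
  next
   case False
   have "Cinf (- cball a e) ?G"
    by (subst Cinf_cong[of _ _ "%x. 0"]) (auto intro: Cinf_const simp: ka(3))
   then show ?thesis using False e by (intro exI[of _ "- cball a e"]) auto
  qed
 qed
 then show ?thesis by (intro that[of "e/2" ka]) (use e ka(2) in auto)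
qed

lemma C_inf_compose:
 fixes k :: "'a => 'z::euclidean_space" and g :: "'z => real"
 assumes M: "hatl M" and g: "Cinf UNIV g" and k: "!!b. b : Basis ==> (%x. k x *i b) : C_inf M"
 shows "(%x. if x : pts M then g (k x) else 0) : C_inf M" (is "?f : _")
proof -
 have "smooth_on (ph ` U) (?f o inv_into U ph)" if c: "(U, ph) : atlas M" for U ph
 proof -
  have "EX W h. open W & y : W & Cinf W h & (ALL z:W Int ph ` U. h z = k (inv_into U ph z))" if y: "y : ph ` U" for y
  proof -
   have "EX W h. open W & y : W & Cinf W h & (ALL z:W Int ph ` U. h z = k (inv_into U ph z) *i b)" if "b : Basis" for b
    using C_inf_chart[OF k[OF that] c] y unfolding smooth_on_iff o_def by meson
   then obtain W h where W: "!!b. b : Basis ==> open (W b) & y : W b & Cinf (W b) (h b) &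
     (ALL z:W b Int ph ` U. h b z = k (inv_into U ph z) *i b)" by metis
   let ?W = "INT b:Basis. W b"
   have o: "open ?W" using W by (intro open_INT) auto
   have "Cinf ?W (%z. SUM b:Basis. h b z *r b)"
    using W by (intro Cinf_sum Cinf_scaleR o Cinf_const Cinf_subset[of "W b" _ ?W for b]) auto
   moreover have "(SUM b:Basis. h b z *r b) = k (inv_into U ph z)" if "z : ?W Int ph ` U" for z
   proof -
    have "(SUM b:Basis. h b z *r b) = (SUM b:Basis. (k (inv_into U ph z) *i b) *r b)"
     using W that by (intro sum.cong) auto
    then show ?thesis by (simp add: euclidean_representation)
   qed
   ultimately show ?thesis using o W
    by (intro exI[of _ ?W] exI[of _ "%z. SUM b:Basis. h b z *r b"]) auto
  qed
  then have k': "smooth_on (ph ` U) (%z. k (inv_into U ph z))" by (simp add: smooth_on_iff)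
  have g': "smooth_on UNIV g" using g by (simp add: smooth_on_Cinf)
  have "smooth_on (ph ` U) (%z. g (k (inv_into U ph z)))" by (rule smooth_on_compose[OF g' k']) simp
  then show ?thesis
  proof (rule smooth_on_cong[THEN iffD1, rotated])
   fix z assume "z : ph ` U"
   then show "g (k (inv_into U ph z)) = (?f o inv_into U ph) z"
    using hatlD(1)[OF M c] inv_into_into[of z ph U] by auto
  qed
 qed
 then show ?thesis by (auto simp: C_inf_def)
qed

lemma eventually_C_inf_compose:
 fixes k :: "'a => 'z::euclidean_space"
 assumes M: "hatl M" and p: "p : pts M" and k: "!!b. b : Basis ==> (%x. k x *i b) : C_inf M"
  and "open W" "k p : W" shows "ev (%x. k x : W) (nhm M p)"
proof -
 obtain e where e: "e > 0" "ball (k p) e <= W" using assms open_contains_ball by blast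
 obtain ka :: "'z => real" where ka: "Cinf UNIV ka" "!!x. dist (k p) x <= e/2 ==> ka x = 1"
  "!!x. dist (k p) x >= 2 * (e/2) ==> ka x = 0" using cutoff_exists[of "e/2" "k p"] e by auto
 have "k x : W" if "ka (k x) ~= 0" for x using ka(3)[of "k x"] that e by (force simp: not_le)
 moreover have "ka (k p) ~= 0" using ka(2)[of "k p"] e by simp
 ultimately show ?thesis
  by (intro ev_nhmI[OF M p C_inf_compose[OF M ka(1) k]]) (use p in "auto split: if_splits")
qed

lemma C_inf_compose_local:
 fixes k :: "'a => 'z::euclidean_space" and g :: "'z => real"
 assumes M: "hatl M" and p: "p : pts M" and k: "!!b. b : Basis ==> (%x. k x *i b) : C_inf M"
  and "open W" "k p : W" "Cinf W g" shows "EX G:C_inf M. ev (%x. G x = g (k x)) (nhm M p)"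
proof -
 obtain ka r where G: "r > 0" "!!x. dist (k p) x < r ==> x : W & ka x = 1"
  "Cinf UNIV (%x. if x : W then ka x * g x else 0)"
  using cutoff_uniform[OF assms(4,5)] assms(6) by metis
 have "ev (%x. k x : ball (k p) r) (nhm M p)"
  by (rule eventually_C_inf_compose[OF M p k]) (use G in auto)
 then have "ev (%x. (if x : pts M then if k x : W then ka (k x) * g (k x) else 0 else 0) = g (k x)) (nhm M p)"
  using ev_pts[OF M p] by eventually_elim (use G(2) in auto)
 then show ?thesis by (rule bexI[OF _ C_inf_compose[OF M G(3) k]])
qed

text \<open>The cutoff around the value \<open>h p\<close> with inner radius
  \<open>|h p| / 2\<close> vanishes at distance \<open>|h p|\<close>, in particular at the value 0;
  composed with \<open>h\<close> it is supported where \<open>h\<close> does not vanish.\<close>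

lemma bump_function: assumes M: "hatl M" and p: "p : pts M" and Q: "ev Q (nhm M p)"
 obtains u where "u : C_inf M" "ev (%x. u x = 1) (nhm M p)" "!!x. u x ~= 0 ==> Q x"
proof -
 obtain h where h: "h : C_inf M" "h p ~= 0" "ALL x. h x ~= 0 --> Q x" by (rule ev_nhmE[OF M p Q])
 let ?e = "\<bar>h p\<bar> / 2"
 obtain ka :: "real => real" where ka: "Cinf UNIV ka" "!!x. dist (h p) x <= ?e ==> ka x = 1"
  "!!x. dist (h p) x >= 2 * ?e ==> ka x = 0" using cutoff_exists[of ?e "h p"] h by auto
 let ?k = "%x. if x : pts M then ka (h x) else 0"
 have hb: "!!b. b : Basis ==> (%x. h x *i b) : C_inf M" using h by simp
 have "?k : C_inf M" by (rule C_inf_compose[OF M ka(1) hb])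
 moreover have "ev (%x. h x : ball (h p) ?e) (nhm M p)"
  by (rule eventually_C_inf_compose[OF M p hb]) (use h in auto)
 then have "ev (%x. ?k x = 1) (nhm M p)" using ev_pts[OF M p] by eventually_elim (use ka(2) in auto)
 moreover have "Q x" if "?k x ~= 0" for x
  using that ka(3)[of 0] h by (cases "h x = 0") (auto simp: dist_norm split: if_splits)
 ultimately show ?thesis by (rule that)
qed

subsection \<open>Charts as parametrizations\<close>

text \<open>A chart maps onto an open part of the subspace \<open>cspace\<close>. Preceding the
  inverse chart by the projection \<open>cproj\<close> gives the parametrization \<open>cpar\<close>
  on \<open>cdom\<close>, which is open in the full Euclidean space, so that Frechet derivatives and
  \<open>Cinf\<close> apply.\<close>

definition cspace :: "'a set \<times> ('a => 'e::euclidean_space) => 'e set" where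
 "cspace c = (SOME E. subspace E & openin (top_of_set E) (snd c ` fst c))"

definition cproj :: "'a set \<times> ('a => 'e::euclidean_space) => 'e => 'e" where
 "cproj c = (SOME P. linear P & range P <= cspace c & (ALL x:cspace c. P x = x))"

definition cdom :: "'a set \<times> ('a => 'e::euclidean_space) => 'e set" where
 "cdom c = cproj c -` (snd c ` fst c)"

definition cpar :: "'a set \<times> ('a => 'e::euclidean_space) => 'e => 'a" where
 "cpar c x = inv_into (fst c) (snd c) (cproj c x)"

lemma linear_projection_exists:
 fixes E :: "'e::euclidean_space set" assumes "subspace E"
 shows "EX P. linear P & range P <= E & (ALL x:E. P x = x)"
proof -
 obtain B where B: "B <= E" "independent B" "E <= span B" using basis_exists[of E] by metis
 obtain P :: "'e => 'e" where P: "linear P" "ALL x:B. P x = x" "range P = span (id ` B)"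
  using linear_independent_extend_subspace[OF B(2), of id] by auto
 have sE: "span B = E" using B assms by (simp add: span_subspace)
 have "P x = x" if "x : E" for x using linear_eq_on[OF P(1) linear_id, of x B] that P(2) sE by auto
 then show ?thesis using P sE by auto
qed

lemma chartD: assumes "is_chart n (U, ph)"
 shows "subspace (cspace (U, ph))" "openin (top_of_set (cspace (U, ph))) (ph ` U)"
  "linear (cproj (U, ph))" "cproj (U, ph) x : cspace (U, ph)"
  "y : cspace (U, ph) ==> cproj (U, ph) y = y" "ph ` U <= cspace (U, ph)"
proof -
 let ?E = "cspace (U, ph)" and ?P = "cproj (U, ph)"
 have "EX E. subspace E & openin (top_of_set E) (ph ` U)" using assms by (auto simp: is_chart_def)
 then have E: "subspace ?E & openin (top_of_set ?E) (ph ` U)"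
  unfolding cspace_def fst_conv snd_conv by (rule someI_ex)
 then have P: "linear ?P & range ?P <= ?E & (ALL x:?E. ?P x = x)"
  unfolding cproj_def by (intro someI_ex[OF linear_projection_exists]) auto
 show "subspace ?E" "openin (top_of_set ?E) (ph ` U)" "linear ?P" "?P x : ?E" "y : ?E ==> ?P y = y"
  using E P by auto
 show "ph ` U <= ?E" using E openin_imp_subset by blast
qed

lemma chart_dom_open: assumes c: "is_chart n (U, ph)" shows "open (cdom (U, ph))"
proof -
 let ?P = "cproj (U, ph)"
 obtain T where T: "open T" "ph ` U = cspace (U, ph) Int T"
  using chartD(2)[OF c] by (auto simp: openin_open)
 have "cdom (U, ph) = ?P -` T" using chartD(4)[OF c] T by (auto simp: cdom_def)
 moreover have "continuous_on UNIV ?P"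
  using chartD(3)[OF c] by (simp add: linear_continuous_on linear_conv_bounded_linear)
 ultimately show ?thesis using T(1) by (simp add: open_vimage)
qed

lemma cparD: assumes c: "is_chart n (U, ph)" shows "x : cdom (U, ph) ==> cpar (U, ph) x : U"
  "x : cdom (U, ph) ==> ph (cpar (U, ph) x) = cproj (U, ph) x"
  "m : U ==> ph m : cdom (U, ph)" "m : U ==> cpar (U, ph) (ph m) = m"
  "m : U ==> cproj (U, ph) (ph m) = ph m"
proof -
 have inj: "inj_on ph U" using c by (auto simp: is_chart_def)
 show m: "cproj (U, ph) (ph m) = ph m" if "m : U" for m using chartD(5,6)[OF c] that by blast
 show "x : cdom (U, ph) ==> cpar (U, ph) x : U"
  "x : cdom (U, ph) ==> ph (cpar (U, ph) x) = cproj (U, ph) x"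
  by (auto simp: cdom_def cpar_def inv_into_into f_inv_into_f)
 show "m : U ==> ph m : cdom (U, ph)" "m : U ==> cpar (U, ph) (ph m) = m"
  using m inj by (auto simp: cdom_def cpar_def)
qed

lemma Cinf_linear: "linear h ==> open W ==> Cinf W h"
 using Cinf_bounded_linear linear_conv_bounded_linear by blast

lemma Cinf_cpar: assumes c: "is_chart n (U, ph)" and f: "smooth_on (ph ` U) (f o inv_into U ph)"
 shows "Cinf (cdom (U, ph)) (%x. f (cpar (U, ph) x))"
 using smooth_on_compose_Cinf[OF f chart_dom_open[OF c] Cinf_linear[OF chartD(3)[OF c] chart_dom_open[OF c]]]
 by (auto simp: cpar_def cdom_def)

definition coords :: "('a, 'e::euclidean_space) mfd => ('a => 'e) => ('a => 'e) => 'a => bool" where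
 "coords M ph k p <-> (ALL b. (%x. k x *i b) : C_inf M) & ev (%x. k x = ph x) (nhm M p)"

text \<open>A manifold with enough smooth functions: the germ of every chart is that of globally defined
  coordinate functions. Hausdorffness is only used to obtain this.\<close>

definition mf :: "('a, 'e::euclidean_space) mfd => bool" where "mf M <-> hatl M &
   (ALL (U, ph):atlas M. ALL p:U. ev (%x. x : U) (nhm M p) & (EX k. coords M ph k p))"

lemma mf_has_atlas [simp]: "mf M ==> hatl M" by (simp add: mf_def)

lemma mf_chart: assumes "mf M" "p : pts M"
 obtains U ph k n where "(U, ph) : atlas M" "p : U" "is_chart n (U, ph)"
  "ev (%x. x : U) (nhm M p)" "coords M ph k p" "k p = ph p"
proof -
 have A: "hatl M" using assms(1) by simp
 obtain U ph where U: "(U, ph) : atlas M" "p : U" using hatlD(3)[OF A assms(2)] by blast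
 obtain n where n: "is_chart n (U, ph)" using A U(1) unfolding hatl_def by blast
 have "ev (%x. x : U) (nhm M p) & (EX k. coords M ph k p)" using assms(1) U unfolding mf_def by auto
 then obtain k where k: "coords M ph k p" "ev (%x. x : U) (nhm M p)" by blast
 have ev: "ev (%x. k x = ph x) (nhm M p)" using k(1) by (simp add: coords_def)
 show ?thesis by (rule that[OF U n k(2,1) ev_nhmD[OF A assms(2) ev]])
qed

lemma openin_mtop: assumes "!!U ph. (U, ph) : atlas M ==> inj_on ph U"
 shows "openin (mtop M) W <-> W <= pts M &
   (ALL (U, ph):atlas M. openin (top_of_set (ph ` U)) (ph ` (U Int W)))"
proof -
 let ?L = "%W. W <= pts M & (ALL U ph. (U, ph) : atlas M --> openin (top_of_set (ph ` U)) (ph ` (U Int W)))"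
 have L: "(ALL (U, ph):atlas M. openin (top_of_set (ph ` U)) (ph ` (U Int W))) <->
   (ALL U ph. (U, ph) : atlas M --> openin (top_of_set (ph ` U)) (ph ` (U Int W)))" for W by auto
 have "istopology ?L" unfolding istopology_def
 proof (intro conjI allI impI)
  fix S T U ph assume ST: "?L S" "?L T" and U: "(U, ph) : atlas M"
  have "ph ` (U Int (S Int T)) = ph ` (U Int S) Int ph ` (U Int T)"
   using assms[OF U] by (auto simp: inj_on_def)
  then show "openin (top_of_set (ph ` U)) (ph ` (U Int (S Int T)))" using ST U by (metis openin_Int)
 next
  fix K U ph assume K: "ALL S:K. ?L S" and U: "(U, ph) : atlas M"
  have "ph ` (U Int \<Union> K) = \<Union> ((%S. ph ` (U Int S)) ` K)" by auto
  then show "openin (top_of_set (ph ` U)) (ph ` (U Int \<Union> K))"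
   using K U by (metis (no_types, lifting) imageE openin_Union)
 qed auto
 then show ?thesis by (simp add: mtop_def topology_inverse' L)
qed

text \<open>A function supported in a small ball of the chart is extended by zero, and the point is
  smoothness at the rim. The closed ball is compact, so by the Hausdorff property its image in
  \<open>M\<close> is closed, and off that image the extension vanishes on an open set.\<close>

lemma smooth_manifold_bump: assumes M: "smooth_manifold M" and U: "(U, ph) : atlas M" and p: "p : U"
 obtains e where "e > 0"
  "!!g. Cinf UNIV g ==> (!!x. dist (ph p) x >= e ==> g x = 0) ==> (%x. if x : U then g (ph x) else 0) : C_inf M"
proof -
 obtain n where n: "!!c. c : atlas M ==> is_chart n c" using M by (auto simp: smooth_manifold_def)
 have inj: "inj_on ph U" if "(U, ph) : atlas M" for U ph using n[OF that] by (auto simp: is_chart_def)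
 have UM: "U <= pts M" if "(U, ph) : atlas M" for U ph
  using M that by (force simp: smooth_manifold_def)
 obtain T where T: "open T" "ph ` U = cspace (U, ph) Int T"
  using chartD(2)[OF n[OF U]] by (auto simp: openin_open)
 then obtain e where e: "e > 0" "cball (ph p) e <= T" using p open_contains_cball by blast
 let ?C = "cspace (U, ph) Int cball (ph p) e" and ?c = "inv_into U ph"
 have C: "?C <= ph ` U" using T e by auto
 have cc: "compact ?C"
  using closed_subspace[OF chartD(1)[OF n[OF U]]] by (simp add: closed_Int_compact)
 let ?K = "?c ` ?C"
 have op: "openin (mtop M) (pts M)"
 proof (subst openin_mtop[OF inj]; clarify?)
  have "U Int pts M = U" if "(U, ph) : atlas M" for U ph using UM[OF that] by auto
  then show "pts M <= pts M &
    (ALL (U, ph):atlas M. openin (top_of_set (ph ` U)) (ph ` (U Int pts M)))" by auto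
 qed
 have top: "topspace (mtop M) = pts M"
  using op openin_subset openin_mtop[OF inj] by (metis openin_topspace subset_antisym)
 have "continuous_map (top_of_set (ph ` U)) (mtop M) ?c" unfolding continuous_map_def
 proof (intro conjI allI impI)
  show "?c : topspace (top_of_set (ph ` U)) \<rightarrow> topspace (mtop M)"
   using UM[OF U] top inv_into_into[of _ ph U] by auto
  fix W assume "openin (mtop M) W"
  then have "openin (top_of_set (ph ` U)) (ph ` (U Int W))" using U openin_mtop[OF inj, where W=W] by auto
  moreover have "{x : topspace (top_of_set (ph ` U)). ?c x : W} = ph ` (U Int W)"
   using inj[OF U] by (auto simp: inv_into_f_f)
  ultimately show "openin (top_of_set (ph ` U)) {x : topspace (top_of_set (ph ` U)). ?c x : W}" by simp
 qed
 moreover have "compactin (top_of_set (ph ` U)) ?C" using cc C by (simp add: compactin_subtopology)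
 ultimately have "compactin (mtop M) ?K" by (rule image_compactin[rotated])
 then have "closedin (mtop M) ?K"
  using M by (intro compactin_imp_closedin) (auto simp: smooth_manifold_def)
 then have K: "openin (mtop M) (pts M - ?K)" using top by (simp add: closedin_def)
 show ?thesis
 proof (rule that[OF e(1)])
  fix g :: "'b => real" assume g: "Cinf UNIV g" "!!x. dist (ph p) x >= e ==> g x = 0"
  let ?f = "%x. if x : U then g (ph x) else 0"
  have "smooth_on (ps ` V) (?f o inv_into V ps)" if V: "(V, ps) : atlas M" for V ps
  proof (rule smooth_on_locally)
   fix z assume z: "z : ps ` V"
   then obtain y where y: "y : V" "z = ps y" by auto
   have co: "compatible_charts (U, ph) (V, ps)" using M U V unfolding smooth_manifold_def by blast
   show "EX W. openin (top_of_set (ps ` V)) W & z : W & smooth_on W (?f o inv_into V ps)"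
   proof (cases "y : U")
    case True
    have 1: "smooth_on UNIV g" using g by (simp add: smooth_on_Cinf)
    have 2: "smooth_on (ps ` (U Int V)) (ph o inv_into V ps)" using co by (simp add: compatible_charts_def)
    have "smooth_on (ps ` (U Int V)) (%x. g ((ph o inv_into V ps) x))"
     by (rule smooth_on_compose[OF 1 2]) simp
    then have "smooth_on (ps ` (U Int V)) (?f o inv_into V ps)"
     by (rule smooth_on_cong[THEN iffD1, rotated]) (use inj[OF V] in auto)
    then show ?thesis using co True y by (auto simp: compatible_charts_def)
   next
    case False
    let ?W = "ps ` (V Int (pts M - ?K))"
    have "?c ` ?C <= U" using C by (auto intro: inv_into_into)
    then have "z : ?W" using y False UM[OF V] by blast
    moreover have "openin (top_of_set (ps ` V)) ?W" using K V openin_mtop[OF inj] by auto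
    moreover have "?f x = 0" if "x : V" "x ~: ?K" for x
    proof (cases "x : U")
     case True
     have "ph x ~: cball (ph p) e"
     proof
      assume "ph x : cball (ph p) e"
      then have "ph x : ?C" using True chartD(6)[OF n[OF U]] by auto
      then have "?c (ph x) : ?K" by blast
      then show False using that True inj[OF U] by simp
     qed
     then show ?thesis using g(2) by auto
    qed simp
    then have "smooth_on ?W (?f o inv_into V ps)"
     by (intro smooth_on_cong[THEN iffD1, OF _ smooth_on_const[of _ 0]])
      (use inj[OF V] in "fastforce simp: inv_into_f_f")
    ultimately show ?thesis by blast
   qed
  qed
  then show "?f : C_inf M" using UM[OF U] by (auto simp: C_inf_def)
 qed
qed

lemma smooth_manifold_imp_mf: assumes M: "smooth_manifold M" shows "mf M"
proof -
 have A: "hatl M" using M by (auto simp: smooth_manifold_def hatl_def)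
 have "ev (%x. x : U) (nhm M p) & (EX k. coords M ph k p)" if U: "(U, ph) : atlas M" "p : U" for U ph p
 proof -
  have pM: "p : pts M" using U hatlD(1)[OF A] by blast
  obtain e where e: "e > 0"
   "!!g. Cinf UNIV g ==> (!!x. dist (ph p) x >= e ==> g x = 0) ==> (%x. if x : U then g (ph x) else 0) : C_inf M"
   using smooth_manifold_bump[OF M U] by metis
  obtain ka :: "'b => real" where ka: "Cinf UNIV ka" "!!x. dist (ph p) x <= e/2 ==> ka x = 1"
   "!!x. dist (ph p) x >= 2 * (e/2) ==> ka x = 0" using cutoff_exists[of "e/2" "ph p"] e by auto
  define k where "k x = (if x : U then ka (ph x) *r ph x else 0)" for x
  have kb: "(%x. k x *i b) : C_inf M" for b
  proof -
   have "Cinf UNIV (%x. ka x * (x *i b))" by (intro Cinf_mult Cinf_inner Cinf_ident ka) auto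
   then have "(%x. if x : U then ka (ph x) * (ph x *i b) else 0) : C_inf M"
    by (intro e(2)) (use ka(3) in auto)
   moreover have "(%x. if x : U then ka (ph x) * (ph x *i b) else 0) = (%x. k x *i b)"
    by (auto simp: k_def)
   ultimately show ?thesis by simp
  qed
  have ka': "(%x. if x : U then ka (ph x) else 0) : C_inf M" by (intro e(2)) (use ka in auto)
  have evU: "ev (%x. x : U) (nhm M p)"
   by (rule ev_nhmI[OF A pM ka']) (use U ka(2)[of "ph p"] e in "auto split: if_splits")
  \<comment> \<open>\<open>ka2\<close> lives within distance \<open>e/2\<close> of
    \<open>ph p\<close>, where \<open>ka\<close> equals 1; its non-vanishing set is therefore a
    neighbourhood on which \<open>k\<close> agrees with the chart.\<close>
  obtain ka2 :: "'b => real" where ka2: "Cinf UNIV ka2" "!!x. dist (ph p) x <= e/4 ==> ka2 x = 1"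
   "!!x. dist (ph p) x >= 2 * (e/4) ==> ka2 x = 0" using cutoff_exists[of "e/4" "ph p"] e by auto
  have ka2': "(%x. if x : U then ka2 (ph x) else 0) : C_inf M" by (intro e(2)) (use ka2 e in auto)
  have "k x = ph x" if "(if x : U then ka2 (ph x) else 0) ~= 0" for x
   using that ka(2)[of "ph x"] ka2(3)[of "ph x"] by (force simp: k_def not_le split: if_splits)
  then have "ev (%x. k x = ph x) (nhm M p)"
   by (intro ev_nhmI[OF A pM ka2']) (use U ka2(2)[of "ph p"] e in auto)
  then show ?thesis using evU kb by (auto simp: coords_def)
 qed
 then show ?thesis using A by (auto simp: mf_def)
qed

subsection \<open>Pullback-smooth maps\<close>

definition pb :: "('n, 'z) mfd => ('n => 'a) => ('a => real) => 'n => real" where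
 "pb N f F = (%n. if n : pts N then F (f n) else 0)"

text \<open>Smoothness tested by pulling back global functions. It composes without charts, also
  serves maps into and out of fibre products, and follows from \<open>smooth_map\<close> by
  \<open>smooth_map_imp_spb\<close>.\<close>

definition spb :: "('n, 'z::euclidean_space) mfd => ('a, 'e::euclidean_space) mfd => ('n => 'a) => bool" where
 "spb N M f <-> f ` pts N <= pts M & (ALL F:C_inf M. pb N f F : C_inf N)"

lemma spb_points: "spb N M f ==> n : pts N ==> f n : pts M" by (auto simp: spb_def)

lemma spb_pb: "spb N M f ==> F : C_inf M ==> pb N f F : C_inf N" by (auto simp: spb_def)

lemma pb_compose: "f ` pts N <= pts M ==> pb N f (pb M g F) = pb N (%n. g (f n)) F"
 by (auto simp: pb_def fun_eq_iff)

lemma pb_id: "F : C_inf M ==> pb M (%x. x) F = F" by (auto simp: pb_def fun_eq_iff C_inf_0)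

lemma pb_add: "pb N f (F + G) = pb N f F + pb N f G"
 and pb_mult: "pb N f (F * G) = pb N f F * pb N f G"
 and pb_scaleR: "pb N f (c *r F) = c *r pb N f F" by (auto simp: pb_def fun_eq_iff scaleR_fun_def)

lemma spb_compose: "spb N M f ==> spb M L g ==> spb N L (%n. g (f n))"
 unfolding spb_def by (auto simp flip: pb_compose)

lemma spb_id: "spb M M (%x. x)" by (auto simp: spb_def pb_id)

lemma pb_cong: "(!!n. n : pts N ==> f n = g n) ==> pb N f = pb N g"
 by (auto simp: pb_def fun_eq_iff)

lemma spb_const: "hatl N ==> p : pts M ==> spb N M (%n. p)"
 using C_inf_const[of N] by (auto simp: spb_def pb_def const_on_def[abs_def])

lemma spb_eventually: assumes "hatl N" "hatl M" "spb N M f" "n : pts N" "ev Q (nhm M (f n))"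
 shows "ev (%x. Q (f x)) (nhm N n)"
proof -
 obtain h where h: "h : C_inf M" "h (f n) ~= 0" "ALL x. h x ~= 0 --> Q x"
  using ev_nhmE[OF assms(2) spb_points[OF assms(3,4)] assms(5)] .
 show ?thesis by (rule ev_nhmI[OF assms(1,4) spb_pb[OF assms(3) h(1)]])
   (use h assms(4) in "auto simp: pb_def split: if_splits")
qed

lemma smooth_map_imp_spb: assumes N: "hatl N" and M: "hatl M" and f: "smooth_map N M f"
 shows "spb N M f" unfolding spb_def
proof (intro conjI ballI)
 show pts: "f ` pts N <= pts M" using f by (simp add: smooth_map_def)
 fix F assume F: "F : C_inf M"
 have "smooth_on (ph ` U) (pb N f F o inv_into U ph)" if U: "(U, ph) : atlas N" for U ph
 proof (rule smooth_on_locally)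
  fix y assume y: "y : ph ` U"
  then obtain n where n: "n : U" "y = ph n" by auto
  have UN: "U <= pts N" and inj: "inj_on ph U" using hatlD[OF N] U by auto
  have "f n : pts M" using pts UN n by auto
  then obtain V ps where V: "(V, ps) : atlas M" "f n : V" using hatlD(3)[OF M] by blast
  have injV: "inj_on ps V" using hatlD(2)[OF M V(1)] .
  let ?O = "ph ` (U Int f -` V)"
  have o: "openin (top_of_set (ph ` U)) ?O" and
   s: "smooth_on ?O (ps o f o inv_into U ph)" using f U V(1) unfolding smooth_map_def by auto
  have im: "(ps o f o inv_into U ph) ` ?O <= ps ` V" using inj by auto
  have "smooth_on ?O (%z. (F o inv_into V ps) ((ps o f o inv_into U ph) z))"
   by (rule smooth_on_compose[OF C_inf_chart[OF F V(1)] s im])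
  then have "smooth_on ?O (pb N f F o inv_into U ph)"
   by (rule smooth_on_cong[THEN iffD1, rotated]) (use inj injV UN in "auto simp: pb_def")
  moreover have "y : ?O" using n V by auto
  ultimately show "EX V. openin (top_of_set (ph ` U)) V & y : V & smooth_on V (pb N f F o inv_into U ph)"
   using o by blast
 qed
 then show "pb N f F : C_inf N" by (auto simp: C_inf_def pb_def)
qed

subsection \<open>Products\<close>

lemma points_prod [simp]: "pts (prod_mfd M N) = pts M \<times> pts N" by (simp add: prod_mfd_def)

lemma atlas_prod: "c : atlas (prod_mfd M N) <->
  (EX U ph V ps. c = (U \<times> V, map_prod ph ps) & (U, ph) : atlas M & (V, ps) : atlas N)"
 by (auto simp: prod_mfd_def)

lemma inv_into_map_prod: "inj_on ph U ==> inj_on ps V ==> z : ph ` U \<times> ps ` V ==>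
  inv_into (U \<times> V) (map_prod ph ps) z = (inv_into U ph (fst z), inv_into V ps (snd z))"
 by (rule inv_into_f_eq) (auto intro: map_prod_inj_on)

lemma is_chart_prod: assumes "is_chart m (U, ph)" "is_chart n (V, ps)"
 shows "EX k. is_chart k (U \<times> V, map_prod ph ps)"
proof -
 obtain E where E: "inj_on ph U" "subspace E" "openin (top_of_set E) (ph ` U)"
  using assms(1) by (auto simp: is_chart_def)
 obtain F where F: "inj_on ps V" "subspace F" "openin (top_of_set F) (ps ` V)"
  using assms(2) by (auto simp: is_chart_def)
 have "openin (top_of_set (E \<times> F)) (map_prod ph ps ` (U \<times> V))"
  using E(3) F(3) by (simp add: map_prod_surj_on[OF refl refl] openin_Times)
 then show ?thesis using E F unfolding is_chart_def
  by (intro exI[of _ "dim (E \<times> F)"]) (auto intro!: map_prod_inj_on exI[of _ "E \<times> F"] subspace_Times)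
qed

lemma hatl_prod: assumes "hatl M" "hatl N" shows "hatl (prod_mfd M N)" unfolding hatl_def
proof (intro conjI ballI)
 have "p : \<Union> (fst ` atlas (prod_mfd M N))" if pp: "p : pts M \<times> pts N" for p
 proof -
  obtain x y where p: "p = (x, y)" "x : pts M" "y : pts N" using pp by auto
  obtain U ph where "(U, ph) : atlas M" "x : U" using hatlD(3)[OF assms(1) p(2)] by blast
  moreover obtain V ps where "(V, ps) : atlas N" "y : V" using hatlD(3)[OF assms(2) p(3)] by blast
  ultimately have "(U \<times> V, map_prod ph ps) : atlas (prod_mfd M N)" "p : U \<times> V"
   using p by (auto simp: atlas_prod)
  then show ?thesis by force
 qed
 moreover have "fst c <= pts M \<times> pts N" if cc: "c : atlas (prod_mfd M N)" for c
 proof -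
  obtain U ph V ps where "c = (U \<times> V, map_prod ph ps)" "(U, ph) : atlas M" "(V, ps) : atlas N"
   using cc by (auto simp: atlas_prod)
  then show ?thesis using hatlD(1)[OF assms(1)] hatlD(1)[OF assms(2)] by fastforce
 qed
 ultimately show "pts (prod_mfd M N) = \<Union> (fst ` atlas (prod_mfd M N))"
  by (simp only: points_prod) blast
next
 fix c assume "c : atlas (prod_mfd M N)"
 then obtain U ph V ps where c: "c = (U \<times> V, map_prod ph ps)" "(U, ph) : atlas M" "(V, ps) : atlas N"
  by (auto simp: atlas_prod)
 obtain m where m: "is_chart m (U, ph)" using assms(1) c(2) by (auto simp: hatl_def)
 obtain n where n: "is_chart n (V, ps)" using assms(2) c(3) by (auto simp: hatl_def)
 show "EX n. is_chart n c" unfolding c by (rule is_chart_prod[OF m n])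
qed

lemma smooth_on_fst: "smooth_on A fst"
 by (rule Cinf_imp_smooth_on[OF open_UNIV Cinf_bounded_linear[OF bounded_linear_fst open_UNIV]]) simp

lemma smooth_on_snd: "smooth_on A snd"
 by (rule Cinf_imp_smooth_on[OF open_UNIV Cinf_bounded_linear[OF bounded_linear_snd open_UNIV]]) simp

lemma C_inf_prodI: assumes M: "hatl M" and N: "hatl N"
  and F: "!!U ph V ps. (U, ph) : atlas M ==> (V, ps) : atlas N ==>
   smooth_on (ph ` U \<times> ps ` V) (%z. F (inv_into U ph (fst z), inv_into V ps (snd z)))"
 shows "(%z. if z : pts (prod_mfd M N) then F z else 0) : C_inf (prod_mfd M N)" (is "?F : _")
proof -
 have "smooth_on (map_prod ph ps ` (U \<times> V)) (?F o inv_into (U \<times> V) (map_prod ph ps))"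
  if c: "(U, ph) : atlas M" "(V, ps) : atlas N" for U ph V ps
  unfolding map_prod_surj_on[OF refl refl]
 proof (rule smooth_on_cong[THEN iffD1, OF _ F[OF c]])
  fix z assume z: "z : ph ` U \<times> ps ` V"
  have "inv_into U ph (fst z) : U" "inv_into V ps (snd z) : V" using z by (auto intro: inv_into_into)
  then show "F (inv_into U ph (fst z), inv_into V ps (snd z)) = (?F o inv_into (U \<times> V) (map_prod ph ps)) z"
   using inv_into_map_prod[OF hatlD(2)[OF M c(1)] hatlD(2)[OF N c(2)] z]
    hatlD(1)[OF M c(1)] hatlD(1)[OF N c(2)] by auto
 qed
 then show ?thesis by (fastforce simp: C_inf_def atlas_prod)
qed

lemma spb_fst: assumes "hatl M" "hatl N" shows "spb (prod_mfd M N) M fst" unfolding spb_def pb_def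
proof (intro conjI ballI)
 fix F assume F: "F : C_inf M"
 show "(%z. if z : pts (prod_mfd M N) then F (fst z) else 0) : C_inf (prod_mfd M N)"
  by (rule C_inf_prodI[where F="%z. F (fst z)", OF assms])
   (simp, rule smooth_on_compose[OF C_inf_chart[OF F, unfolded o_def] smooth_on_fst], auto)
qed auto

lemma spb_snd: assumes "hatl M" "hatl N" shows "spb (prod_mfd M N) N snd" unfolding spb_def pb_def
proof (intro conjI ballI)
 fix F assume F: "F : C_inf N"
 show "(%z. if z : pts (prod_mfd M N) then F (snd z) else 0) : C_inf (prod_mfd M N)"
  by (rule C_inf_prodI[where F="%z. F (snd z)", OF assms])
   (simp, rule smooth_on_compose[OF C_inf_chart[OF F, unfolded o_def] smooth_on_snd], auto)
qed auto

lemma C_inf_pair_coords: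
 assumes "spb N M f" "spb N L g" "!!b. (%x. k x *i b) : C_inf M" "!!b. (%x. l x *i b) : C_inf L"
 shows "(%x. (if x : pts N then (k (f x), l (g x)) else 0) *i b) : C_inf N"
proof -
 have "pb N f (%x. k x *i fst b) + pb N g (%x. l x *i snd b) : C_inf N"
  by (intro C_inf_add spb_pb[OF assms(1)] spb_pb[OF assms(2)] assms(3,4))
 also have "pb N f (%x. k x *i fst b) + pb N g (%x. l x *i snd b) =
   (%x. (if x : pts N then (k (f x), l (g x)) else 0) *i b)"
  by (auto simp: fun_eq_iff pb_def inner_prod_def)
 finally show ?thesis .
qed

lemma mf_prod: assumes M: "mf M" and N: "mf N" shows "mf (prod_mfd M N)"
proof -
 let ?P = "prod_mfd M N"
 have AM: "hatl M" and AN: "hatl N" using M N by auto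
 have A: "hatl ?P" by (rule hatl_prod[OF AM AN])
 note f = spb_fst[OF AM AN] and s = spb_snd[OF AM AN]
 have "ev (%x. x : W) (nhm ?P p) & (EX k. coords ?P ze k p)"
  if W: "(W, ze) : atlas ?P" and p: "p : W" for W ze p
 proof -
  obtain U ph V ps where c: "W = U \<times> V" "ze = map_prod ph ps" "(U, ph) : atlas M" "(V, ps) : atlas N"
   using W by (auto simp: atlas_prod)
  have p': "fst p : U" "snd p : V" using p c by auto
  have pP: "p : pts ?P" using hatlD(1)[OF A W] p by auto
  have "ev (%x. x : U) (nhm M (fst p)) & (EX k. coords M ph k (fst p))"
   using M c(3) p' unfolding mf_def by auto
  then obtain k where k: "ev (%x. x : U) (nhm M (fst p))" "coords M ph k (fst p)" by blast
  have "ev (%x. x : V) (nhm N (snd p)) & (EX k. coords N ps k (snd p))"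
   using N c(4) p' unfolding mf_def by auto
  then obtain l where l: "ev (%x. x : V) (nhm N (snd p))" "coords N ps l (snd p)" by blast
  have evW: "ev (%x. x : W) (nhm ?P p)"
   using spb_eventually[OF A AM f pP k(1)] spb_eventually[OF A AN s pP l(1)]
   by eventually_elim (auto simp: c)
  define kl where "kl x = (if x : pts ?P then (k (fst x), l (snd x)) else 0)" for x
  have "(%x. kl x *i b) : C_inf ?P" for b
   unfolding kl_def by (rule C_inf_pair_coords[OF f s]) (use k(2) l(2) in "auto simp: coords_def")
  moreover have "ev (%x. kl x = ze x) (nhm ?P p)"
  proof -
   have "ev (%x. k x = ph x) (nhm M (fst p))" "ev (%x. l x = ps x) (nhm N (snd p))"
    using k(2) l(2) by (auto simp: coords_def)
   note e = spb_eventually[OF A AM f pP this(1)] spb_eventually[OF A AN s pP this(2)]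
   show ?thesis using e ev_pts[OF A pP] by eventually_elim (auto simp: kl_def c)
  qed
  ultimately have "coords ?P ze kl p" by (simp add: coords_def)
  then show ?thesis using evW by blast
 qed
 then show ?thesis using A by (auto simp: mf_def)
qed

lemma Cinf_prod_par: assumes M: "hatl M" and N: "hatl N" and H: "H : C_inf (prod_mfd M N)"
  and U: "(U, ph) : atlas M" "is_chart m (U, ph)" and V: "(V, ps) : atlas N" "is_chart n (V, ps)"
 shows "Cinf (cdom (U, ph) \<times> cdom (V, ps)) (%z. H (cpar (U, ph) (fst z), cpar (V, ps) (snd z)))"
proof -
 let ?P = "cproj (U, ph)" and ?Q = "cproj (V, ps)"
 let ?W = "cdom (U, ph) \<times> cdom (V, ps)"
 have o: "open ?W" by (intro open_Times chart_dom_open[OF U(2)] chart_dom_open[OF V(2)])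
 have im: "map_prod ph ps ` (U \<times> V) = ph ` U \<times> ps ` V" by (rule map_prod_surj_on[OF refl refl])
 have "(U \<times> V, map_prod ph ps) : atlas (prod_mfd M N)" using U V by (auto simp: atlas_prod)
 from C_inf_chart[OF H this]
 have s: "smooth_on (ph ` U \<times> ps ` V) (H o inv_into (U \<times> V) (map_prod ph ps))" by (simp add: im)
 have "linear (%z. (?P (fst z), ?Q (snd z)))"
  using chartD(3)[OF U(2)] chartD(3)[OF V(2)] by (auto simp: linear_iff)
 then have l: "Cinf ?W (%z. (?P (fst z), ?Q (snd z)))" by (rule Cinf_linear[OF _ o])
 have "Cinf ?W (%z. (H o inv_into (U \<times> V) (map_prod ph ps)) (?P (fst z), ?Q (snd z)))"
  by (rule smooth_on_compose_Cinf[OF s o l]) (auto simp: cdom_def)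
 moreover have "(H o inv_into (U \<times> V) (map_prod ph ps)) (?P (fst z), ?Q (snd z)) =
   H (cpar (U, ph) (fst z), cpar (V, ps) (snd z))" if "z : ?W" for z
  using inv_into_map_prod[OF hatlD(2)[OF M U(1)] hatlD(2)[OF N V(1)], of "(?P (fst z), ?Q (snd z))"] that
  by (auto simp: cdom_def cpar_def)
 ultimately show ?thesis by (rule Cinf_cong[OF o, THEN iffD1, rotated])
qed

lemma C_inf_pairing_local:
 assumes N: "hatl N" and f: "spb N M f" and g: "spb N L g" and n: "n : pts N"
  and M: "mf M" and L: "mf L"
  and k: "!!b. (%x. k x *i b) : C_inf M" and l: "!!b. (%x. l x *i b) : C_inf L"
  and W: "open W" "(k (f n), l (g n)) : W" "Cinf W H"
 shows "EX G:C_inf N. ev (%x. G x = H (k (f x), l (g x))) (nhm N n)"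
proof -
 define kl where "kl x = (if x : pts N then (k (f x), l (g x)) else 0)" for x
 have b: "(%x. kl x *i b) : C_inf N" for b unfolding kl_def by (rule C_inf_pair_coords[OF f g k l])
 have kln: "kl n : W" using n W by (simp add: kl_def)
 obtain G where G: "G : C_inf N" and ev: "ev (%x. G x = H (kl x)) (nhm N n)"
  using C_inf_compose_local[OF N n b W(1) kln W(3)] by blast
 have "ev (%x. G x = H (k (f x), l (g x))) (nhm N n)"
  using ev ev_pts[OF N n] by eventually_elim (simp add: kl_def)
 then show ?thesis by (rule bexI[OF _ G])
qed

text \<open>A smooth function on a product need not be a combination of pullbacks from the factors,
  so charts enter: near a point it is a smooth function of global coordinate functions of the two
  factors, and these pull back along \<open>f\<close> and \<open>g\<close>.\<close>

lemma spb_pair: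
 assumes N: "hatl N" and M: "mf M" and L: "mf L" and f: "spb N M f" and g: "spb N L g"
 shows "spb N (prod_mfd M L) (%n. (f n, g n))" unfolding spb_def
proof (intro conjI ballI)
 show "(%n. (f n, g n)) ` pts N <= pts (prod_mfd M L)" using spb_points[OF f] spb_points[OF g] by auto
 fix H assume H: "H : C_inf (prod_mfd M L)"
 show "pb N (%n. (f n, g n)) H : C_inf N"
 proof (rule C_infI[OF N])
  fix n assume n: "n : pts N"
  have AM: "hatl M" and AL: "hatl L" using M L by auto
  obtain U ph k i where U: "(U, ph) : atlas M" "f n : U" "is_chart i (U, ph)"
   "ev (%x. x : U) (nhm M (f n))" "coords M ph k (f n)" "k (f n) = ph (f n)"
   by (rule mf_chart[OF M spb_points[OF f n]])
  obtain V ps l j where V: "(V, ps) : atlas L" "g n : V" "is_chart j (V, ps)"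
   "ev (%x. x : V) (nhm L (g n))" "coords L ps l (g n)" "l (g n) = ps (g n)"
   by (rule mf_chart[OF L spb_points[OF g n]])
  let ?W = "cdom (U, ph) \<times> cdom (V, ps)"
  let ?H = "%z. H (cpar (U, ph) (fst z), cpar (V, ps) (snd z))"
  have o: "open ?W" by (intro open_Times chart_dom_open[OF U(3)] chart_dom_open[OF V(3)])
  have kW: "(k (f n), l (g n)) : ?W" using cparD(3)[OF U(3,2)] cparD(3)[OF V(3,2)] U V by simp
  have kb: "!!b. (%x. k x *i b) : C_inf M" "!!b. (%x. l x *i b) : C_inf L" using U(5) V(5) by (auto simp: coords_def)
  obtain G where G: "G : C_inf N" and ev: "ev (%x. G x = ?H (k (f x), l (g x))) (nhm N n)"
   using C_inf_pairing_local[OF N f g n M L kb o kW Cinf_prod_par[OF AM AL H U(1,3) V(1,3)]] by blast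
  have e1: "ev (%x. k (f x) = ph (f x)) (nhm N n)" "ev (%x. l (g x) = ps (g x)) (nhm N n)"
   using spb_eventually[OF N AM f n, of "%x. k x = ph x"] spb_eventually[OF N AL g n, of "%x. l x = ps x"]
    U(5) V(5) by (auto simp: coords_def)
  have "ev (%x. pb N (%n. (f n, g n)) H x = G x) (nhm N n)"
   using ev e1 spb_eventually[OF N AM f n U(4)] spb_eventually[OF N AL g n V(4)] ev_pts[OF N n]
   by eventually_elim (simp add: pb_def cparD(4)[OF U(3)] cparD(4)[OF V(3)])
  then show "EX G:C_inf N. ev (%x. pb N (%n. (f n, g n)) H x = G x) (nhm N n)" by (rule bexI[OF _ G])
 qed (simp add: pb_def)
qed

lemma sum_apply: "sum f I x = (SUM i:I. f i x)" by (induction I rule: infinite_finite_induct) auto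

lemma C_inf_slice1:
 assumes M: "mf M" and L: "mf L" and H: "H : C_inf (prod_mfd M L)" and l: "l : pts L"
 shows "(%m. H (m, l)) : C_inf M"
proof -
 have AM: "hatl M" using M by simp
 have "pb M (%m. (m, l)) H : C_inf M"
  by (rule spb_pb[OF spb_pair[OF AM M L spb_id spb_const[OF AM l]] H])
 moreover have "pb M (%m. (m, l)) H = (%m. H (m, l))" using C_inf_0[OF H] by (auto simp: pb_def)
 ultimately show ?thesis by simp
qed

lemma C_inf_slice2:
 assumes M: "mf M" and L: "mf L" and H: "H : C_inf (prod_mfd M L)" and m: "m : pts M"
 shows "(%l. H (m, l)) : C_inf L"
proof -
 have AL: "hatl L" using L by simp
 have "pb L (%l. (m, l)) H : C_inf L"
  by (rule spb_pb[OF spb_pair[OF AL M L spb_const[OF AL m] spb_id] H])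
 moreover have "pb L (%l. (m, l)) H = (%l. H (m, l))" using C_inf_0[OF H] by (auto simp: pb_def)
 ultimately show ?thesis by simp
qed

lemma C_inf_swap: assumes M: "mf M" and N: "mf N" and H: "H : C_inf (prod_mfd M N)"
 shows "(%z. H (snd z, fst z)) : C_inf (prod_mfd N M)"
proof -
 have A: "hatl N" "hatl M" using M N by auto
 have "pb (prod_mfd N M) (%z. (snd z, fst z)) H : C_inf (prod_mfd N M)"
  by (rule spb_pb[OF spb_pair[OF hatl_prod[OF A] M N spb_snd[OF A] spb_fst[OF A]] H])
 also have "pb (prod_mfd N M) (%z. (snd z, fst z)) H = (%z. H (snd z, fst z))"
  using C_inf_0[OF H] by (auto simp: pb_def fun_eq_iff)
 finally show ?thesis .
qed

subsection \<open>Tangent vectors\<close>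

lemma tangent_subspace: "subspace (TS M p)"
 by (rule subspaceI) (auto simp: tangent_space_def scaleR_fun_def algebra_simps)

lemma zero_tangent [simp]: "0 : TS M p" by (rule subspace_0[OF tangent_subspace])

lemma tangentD: assumes "v : TS M p" shows "f : C_inf M ==> g : C_inf M ==> v (f + g) = v f + v g"
  "f : C_inf M ==> g : C_inf M ==> v (f * g) = f p * v g + g p * v f"
  "f : C_inf M ==> v (c *r f) = c * v f" "f ~: C_inf M ==> v f = 0"
 using assms by (auto simp: tangent_space_def)

lemma tangent_zero: "v : TS M p ==> v 0 = 0" using tangentD(3)[of v M p 0 0] by simp

lemma tangent_diff: "v : TS M p ==> f : C_inf M ==> g : C_inf M ==> v (f - g) = v f - v g"
 using tangentD(1)[of v M p f "(-1) *r g"] tangentD(3)[of v M p g "-1"] C_inf_scaleR[of g M "-1"] by simp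

lemma tangent_sum:
 "v : TS M p ==> (!!i. i : I ==> f i : C_inf M) ==> v (sum f I) = (SUM i:I. v (f i))"
 by (induction I rule: infinite_finite_induct) (auto simp: tangent_zero tangentD(1) C_inf_sum)

lemma tangent_const: assumes M: "hatl M" and p: "p : pts M" and v: "v : TS M p"
 shows "v (const_on M c) = 0"
proof -
 have "const_on M 1 * const_on M 1 = const_on M 1" by (auto simp: const_on_def fun_eq_iff)
 then have "v (const_on M 1) = 0"
  using tangentD(2)[OF v C_inf_const[OF M, of 1] C_inf_const[OF M, of 1]] p by (simp add: const_on_def)
 moreover have "const_on M c = c *r const_on M 1" by (auto simp: const_on_def fun_eq_iff scaleR_fun_def)
 ultimately show ?thesis using tangentD(3)[OF v C_inf_const[OF M, of 1], of c] by simp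
qed

text \<open>If \<open>h\<close> does not vanish at \<open>p\<close> and
  \<open>h * (f - g) = 0\<close>, the Leibniz rule at \<open>p\<close> leaves
  \<open>h p * v (f - g) = 0\<close>.\<close>

lemma tangent_local: assumes M: "hatl M" and p: "p : pts M" and v: "v : TS M p"
  and f: "f : C_inf M" and g: "g : C_inf M" and ev: "ev (%x. f x = g x) (nhm M p)" shows "v f = v g"
proof -
 obtain h where h: "h : C_inf M" "h p ~= 0" "ALL x. h x ~= 0 --> f x = g x"
  by (rule ev_nhmE[OF M p ev])
 have "h * (f - g) = 0" using h(3) by (auto simp: fun_eq_iff)
 then have "h p * v (f - g) + (f - g) p * v h = 0"
  using tangentD(2)[OF v h(1) C_inf_diff[OF f g]] tangent_zero[OF v] by simp
 then have "v (f - g) = 0" using h by simp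
 then show ?thesis using tangent_diff[OF v f g] by simp
qed

lemma tmap_pb: "F : C_inf N ==> tmap M N f v F = v (pb M f F)" by (simp add: tmap_def pb_def)

lemma tmap_tangent: assumes f: "spb M N f" and p: "p : pts M" and v: "v : TS M p"
 shows "tmap M N f v : TS N (f p)" unfolding tangent_space_def
proof (intro CollectI conjI ballI allI impI)
 fix F G assume F: "F : C_inf N" and G: "G : C_inf N"
 note pF = spb_pb[OF f F] and pG = spb_pb[OF f G]
 show "tmap M N f v (F + G) = tmap M N f v F + tmap M N f v G"
  using F G tangentD(1)[OF v pF pG] by (simp add: tmap_pb C_inf_add pb_add)
 show "tmap M N f v (F * G) = F (f p) * tmap M N f v G + G (f p) * tmap M N f v F"
  using F G tangentD(2)[OF v pF pG] p by (simp add: tmap_pb C_inf_mult pb_mult) (simp add: pb_def)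
next
 fix F c assume F: "F : C_inf N"
 show "tmap M N f v (c *r F) = c * tmap M N f v F"
  using F tangentD(3)[OF v spb_pb[OF f F]] by (simp add: tmap_pb C_inf_scaleR pb_scaleR)
qed (simp add: tmap_def)

lemma tmap_compose: assumes f: "spb M N f" and g: "spb N L g"
 shows "tmap N L g (tmap M N f v) = tmap M L (%x. g (f x)) v"
proof
 fix F
 have "pb M f (pb N g F) = pb M (%x. g (f x)) F" using f by (intro pb_compose) (simp add: spb_def)
 then show "tmap N L g (tmap M N f v) F = tmap M L (%x. g (f x)) v F"
  using spb_pb[OF g] by (cases "F : C_inf L") (simp_all add: tmap_pb, simp add: tmap_def)
qed

lemma tmap_cong: "(!!x. x : pts M ==> f x = g x) ==> tmap M N f v = tmap M N g v"
 using pb_cong[of M f g] by (auto simp: fun_eq_iff tmap_def pb_def)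

lemma tmap_square:
 assumes "spb M N f" "spb N L g" "spb M N' f'" "spb N' L g'" "!!x. x : pts M ==> g (f x) = g' (f' x)"
 shows "tmap N L g (tmap M N f v) = tmap N' L g' (tmap M N' f' v)"
 unfolding tmap_compose[OF assms(1,2)] tmap_compose[OF assms(3,4)] by (rule tmap_cong[OF assms(5)])

lemma tmap_0 [simp]: "tmap M N f 0 = 0"
 and tmap_add: "tmap M N f (v + w) = tmap M N f v + tmap M N f w"
 and tmap_diff: "tmap M N f (v - w) = tmap M N f v - tmap M N f w"
 and tmap_minus: "tmap M N f (- v) = - tmap M N f v"
 and tmap_scaleR: "tmap M N f (c *r v) = c *r tmap M N f v"
 by (auto simp: tmap_def fun_eq_iff scaleR_fun_def)

lemma coords_eventually: assumes M: "hatl M" "p : pts M" and c: "coords M ph k p"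
 shows "ev (%x. coords M ph k x) (nhm M p)"
proof -
 have ev: "ev (%x. k x = ph x) (nhm M p)" using c by (simp add: coords_def)
 show ?thesis using ev_ev_nhm[OF M ev] by eventually_elim (use c in "auto simp: coords_def")
qed

text \<open>By Hadamard's lemma a derivation at \<open>p\<close> is a directional derivative in every chart.\<close>

lemma tangent_coords:
 fixes M :: "('a, 'e::euclidean_space) mfd"
 assumes M: "mf M" and U: "(U, ph) : atlas M" and c: "is_chart n (U, ph)" and p: "p : U"
  and k: "coords M ph k p" and v: "v : TS M p" and f: "f : C_inf M"
 shows "v f = FD (%x. f (cpar (U, ph) x)) (at (ph p)) (SUM b:Basis. v (%x. k x *i b) *r b)"
proof -
 have A: "hatl M" using M by simp
 have pM: "p : pts M" using hatlD(1)[OF A U] p by blast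
 let ?F = "%x. f (cpar (U, ph) x)" and ?a = "ph p"
 have F: "Cinf (cdom (U, ph)) ?F" by (rule Cinf_cpar[OF c C_inf_chart[OF f U]])
 obtain r where r: "r > 0" "ball ?a r <= cdom (U, ph)"
  using chart_dom_open[OF c] cparD(3)[OF c p] open_contains_ball by blast
 have FB: "Cinf (ball ?a r) ?F" by (rule Cinf_subset[OF F r(2)])
 define D where "D b = FD ?F (at ?a) b" for b
 define R where "R b = ray_mean ?a 0 (%x. FD ?F (at x) b)" for b
 have R: "Cinf (ball ?a r) (R b)" for b unfolding R_def
  by (rule Cinf_ray_mean[OF Cinf_derivative[OF FB]])
 have Ra: "R b ?a = D b" for b by (simp add: R_def ray_mean_def D_def)
 have kb: "(%x. k x *i b) : C_inf M" for b using k by (simp add: coords_def)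
 have ek: "ev (%x. k x = ph x) (nhm M p)" using k by (simp add: coords_def)
 have kp: "k p = ?a" by (rule ev_nhmD[OF A pM ek])
 have kB: "k p : ball ?a r" using r kp by simp
 have "EX G:C_inf M. ev (%x. G x = R b (k x)) (nhm M p)" for b
  by (rule C_inf_compose_local[OF A pM kb open_ball kB R])
 then obtain G where G: "!!b. G b : C_inf M" "!!b. ev (%x. G b x = R b (k x)) (nhm M p)" by metis
 define X where "X b = (%x. k x *i b) - const_on M (?a *i b)" for b
 have X: "X b : C_inf M" for b unfolding X_def by (intro C_inf_diff kb C_inf_const A)
 let ?g = "const_on M (f p) + (SUM b:Basis. X b * G b)"
 have g: "?g : C_inf M" by (intro C_inf_add C_inf_sum C_inf_mult X G C_inf_const A)
 have "ev (%x. x : U) (nhm M p)" using M U p unfolding mf_def by auto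
 moreover have "ev (%x. k x : ball ?a r) (nhm M p)"
  by (rule eventually_C_inf_compose[OF A pM kb open_ball kB])
 moreover have "ev (%x. ALL b:(Basis::'e set). G b x = R b (k x)) (nhm M p)"
  using G(2) by (intro eventually_ball_finite) auto
 ultimately have "ev (%x. f x = ?g x) (nhm M p)" using ek ev_pts[OF A pM]
 proof eventually_elim
  case (elim x)
  have "f x = ?F (k x)" using elim cparD(4)[OF c] by simp
  also have "... = ?F ?a + (SUM b:Basis. ((k x - ?a) *i b) * R b (k x))"
   unfolding R_def by (rule Hadamard[OF FB elim(2)])
  also have "?F ?a = f p" using cparD(4)[OF c p] by simp
  also have "f p + (SUM b:Basis. ((k x - ?a) *i b) * R b (k x)) = ?g x"
   using elim by (simp add: X_def const_on_def inner_diff_left sum_apply)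
  finally show ?case .
 qed
 then have "v f = v ?g" by (rule tangent_local[OF A pM v f g])
 also have "... = (SUM b:Basis. v (X b * G b))"
 proof -
  have XG: "X b * G b : C_inf M" for b by (intro C_inf_mult X G)
  have "v ?g = v (const_on M (f p)) + v (SUM b:Basis. X b * G b)"
   by (rule tangentD(1)[OF v C_inf_const[OF A] C_inf_sum[OF XG]])
  then show ?thesis by (simp add: tangent_const[OF A pM v] tangent_sum[OF v XG])
 qed
 also have "... = (SUM b:Basis. v (%x. k x *i b) * D b)"
 proof (rule sum.cong[OF refl])
  fix b :: 'e
  have "X b p = 0" using pM kp by (simp add: X_def const_on_def)
  moreover have "v (X b) = v (%x. k x *i b)" unfolding X_def
   by (simp add: tangent_diff[OF v kb] A tangent_const[OF A pM v])
  moreover have "G b p = D b" using ev_nhmD[OF A pM G(2), of b] by (simp add: kp Ra)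
  ultimately show "v (X b * G b) = v (%x. k x *i b) * D b"
   using tangentD(2)[OF v X[of b] G(1)[of b]] by simp
 qed
 also have "... = D (SUM b:Basis. v (%x. k x *i b) *r b)"
 proof -
  have "linear D" unfolding D_def[abs_def]
   using Cinf_has_derivative[OF FB, of ?a] r has_derivative_linear by simp
  then show ?thesis by (simp add: linear_sum linear_scale)
 qed
 finally show ?thesis by (simp add: D_def)
qed

subsection \<open>Velocities\<close>

text \<open>The velocity at time 0 as seen by smooth functions; no other regularity of the curve is
  asked for. Equality of tangent vectors is shown by exhibiting both as velocities of curves that
  agree near 0. The last clause makes \<open>v\<close> unique as a function on the type.\<close>

definition has_vel :: "('a, 'e::euclidean_space) mfd => (real => 'a) => 'a => 'a tvec => bool" where
 "has_vel M ga p v <-> ga 0 = p & (ALL F:C_inf M. ((%t. F (ga t)) has_real_derivative v F) (at 0)) &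
   (ALL F. F ~: C_inf M --> v F = 0)"

lemma has_velD: "has_vel M ga p v ==> F : C_inf M ==> ((%t. F (ga t)) has_real_derivative v F) (at 0)"
 by (simp add: has_vel_def)

lemma has_vel_0: "has_vel M ga p v ==> ga 0 = p" by (simp add: has_vel_def)

lemma has_vel_tangent: assumes "has_vel M ga p v" shows "v : TS M p" unfolding tangent_space_def
proof (intro CollectI conjI ballI allI impI)
 note d = has_velD[OF assms] and 0 = has_vel_0[OF assms]
 fix F G assume F: "F : C_inf M" and G: "G : C_inf M"
 show "v (F + G) = v F + v G"
  using DERIV_unique[OF d[OF C_inf_add[OF F G], unfolded plus_fun_def] DERIV_add[OF d[OF F] d[OF G]]]
  by (simp add: plus_fun_def)
 show "v (F * G) = F p * v G + G p * v F"
  using DERIV_unique[OF d[OF C_inf_mult[OF F G], unfolded times_fun_def] DERIV_mult[OF d[OF F] d[OF G]]]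
  by (simp add: times_fun_def 0)
next
 fix F c assume F: "F : C_inf M"
 show "v (c *r F) = c * v F"
  using DERIV_unique[OF has_velD[OF assms C_inf_scaleR[OF F, of c], unfolded scaleR_fun_def real_scaleR_def]
    DERIV_cmult[OF has_velD[OF assms F], of c]] by (simp add: scaleR_fun_def)
qed (use assms in "simp add: has_vel_def")

lemma has_vel_unique: "has_vel M ga p v ==> has_vel M ga q w ==> v = w"
 unfolding has_vel_def fun_eq_iff by (metis DERIV_unique)

lemma has_vel_eventually:
 assumes M: "hatl M" and p: "p : pts M" and v: "has_vel M ga p v" and Q: "ev Q (nhm M p)"
 shows "ev (%t. Q (ga t)) (nhds 0)"
proof -
 obtain h where h: "h : C_inf M" "h p ~= 0" "ALL x. h x ~= 0 --> Q x" by (rule ev_nhmE[OF M p Q])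
 have "isCont (%t. h (ga t)) 0" using has_velD[OF v h(1)] DERIV_isCont by blast
 then have "((%t. h (ga t)) \<longlongrightarrow> h (ga 0)) (nhds 0)"
  using tendsto_at_iff_tendsto_nhds[of "%t. h (ga t)" 0] by (simp add: isCont_def)
 then have "ev (%t. h (ga t) ~= 0) (nhds 0)"
  using h(2) has_vel_0[OF v] tendsto_imp_eventually_ne by fastforce
 then show ?thesis by eventually_elim (use h(3) in auto)
qed

lemma DERIV_cong_nhds:
 "ev (%t. f t = g t) (nhds x) ==> (f has_real_derivative d) (at x) ==> (g has_real_derivative d) (at x)"
 using DERIV_cong_ev[of x x f g d d] by simp

lemma has_vel_cong: assumes v: "has_vel M ga p v" and e: "ev (%t. ga t = de t) (nhds 0)"
 shows "has_vel M de p v" unfolding has_vel_def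
proof (intro conjI ballI)
 have "ga 0 = de 0" using e by (rule eventually_nhds_x_imp_x)
 then show "de 0 = p" using has_vel_0[OF v] by simp
 fix F assume F: "F : C_inf M"
 have "ev (%t. F (ga t) = F (de t)) (nhds 0)" using e by eventually_elim simp
 then show "((%t. F (de t)) has_real_derivative v F) (at 0)" by (rule DERIV_cong_nhds[OF _ has_velD[OF v F]])
qed (use v in "simp add: has_vel_def")

lemma has_vel_tmap:
 assumes N: "hatl N" and n: "n : pts N" and f: "spb N M f" and v: "has_vel N ga n v"
 shows "has_vel M (%t. f (ga t)) (f n) (tmap N M f v)" unfolding has_vel_def
proof (intro conjI ballI)
 show "f (ga 0) = f n" using has_vel_0[OF v] by simp
 fix F assume F: "F : C_inf M"
 have "ev (%t. pb N f F (ga t) = F (f (ga t))) (nhds 0)"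
  using has_vel_eventually[OF N n v ev_pts[OF N n]] by eventually_elim (simp add: pb_def)
 then show "((%t. F (f (ga t))) has_real_derivative tmap N M f v F) (at 0)"
  using DERIV_cong_nhds[OF _ has_velD[OF v spb_pb[OF f F]]] F by (simp add: tmap_pb)
qed (simp add: tmap_def)

lemma has_vel_chart: assumes U: "(U, ph) : atlas M" and c: "is_chart n (U, ph)" and p: "p : U"
 shows "has_vel M (%t. cpar (U, ph) (ph p + t *r e)) p
  (%F. if F : C_inf M then FD (%x. F (cpar (U, ph) x)) (at (ph p)) e else 0)" unfolding has_vel_def
proof (intro conjI ballI)
 fix F assume F: "F : C_inf M"
 let ?F = "%x. F (cpar (U, ph) x)"
 have d: "(?F has_derivative FD ?F (at (ph p))) (at (ph p + 0 *r e))"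
  using Cinf_has_derivative[OF Cinf_cpar[OF c C_inf_chart[OF F U]] cparD(3)[OF c p]] by simp
 have "((%t. ph p + t *r e) has_derivative (%t. t *r e)) (at 0)" by (auto intro!: derivative_eq_intros)
 from has_derivative_compose[OF this d] show "((%t. ?F (ph p + t *r e)) has_real_derivative
   (if F : C_inf M then FD ?F (at (ph p)) e else 0)) (at 0)"
  using F linear_scale[OF has_derivative_linear[OF d]] by (simp add: has_field_derivative_def mult_commute_abs)
qed (use cparD(4)[OF c p] in auto)

text \<open>By \<open>tangent_coords\<close> the vector is a directional derivative in a chart,
  hence the velocity of a straight line there, which \<open>cpar\<close> projects into the subspace
  of the chart.\<close>

lemma has_vel_exists: assumes M: "mf M" and p: "p : pts M" and v: "v : TS M p"
 shows "EX ga. has_vel M ga p v"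
proof -
 obtain U ph k n where U: "(U, ph) : atlas M" "p : U" "is_chart n (U, ph)"
   "ev (%x. x : U) (nhm M p)" "coords M ph k p" "k p = ph p" by (rule mf_chart[OF M p])
 have "(%F. if F : C_inf M then FD (%x. F (cpar (U, ph) x)) (at (ph p))
   (SUM b:Basis. v (%x. k x *i b) *r b) else 0) = v"
  using tangent_coords[OF M U(1,3,2,5) v] tangentD(4)[OF v] by auto
 then show ?thesis using has_vel_chart[OF U(1,3,2), of "SUM b:Basis. v (%x. k x *i b) *r b"] by auto
qed

lemma has_vel_coords:
 assumes v: "has_vel M ga p v" and k: "!!b. b : Basis ==> (%x. k x *i b) : C_inf M"
 shows "((%t. k (ga t)) has_derivative (%t. t *r (SUM b:Basis. v (%x. k x *i b) *r b))) (at 0)"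
proof -
 have "((%t. SUM b:Basis. (k (ga t) *i b) *r b) has_derivative
   (%t. SUM b:Basis. (v (%x. k x *i b) * t) *r b)) (at 0)"
  by (intro has_derivative_sum has_derivative_scaleR_left has_velD[OF v k, THEN has_field_derivative_imp_has_derivative])
 moreover have "(SUM b:Basis. (v (%x. k x *i b) * t) *r b) = t *r (SUM b:Basis. v (%x. k x *i b) *r b)" for t
  by (simp add: scaleR_sum_right mult.commute)
 ultimately show ?thesis by (simp add: euclidean_representation)
qed

text \<open>The differential of \<open>F\<close> in a product chart is additive, so the derivative
  along the pair is the sum of the derivatives along each curve with the other one held
  fixed.\<close>

lemma has_vel_pair: assumes M: "mf M" and L: "mf L" and p: "p : pts M" and q: "q : pts L"
  and v: "has_vel M ga p v" and w: "has_vel L de q w"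
 shows "has_vel (prod_mfd M L) (%t. (ga t, de t)) (p, q)
  (%F. if F : C_inf (prod_mfd M L) then v (%m. F (m, q)) + w (%l. F (p, l)) else 0)"
 unfolding has_vel_def
proof (intro conjI ballI)
 show "(ga 0, de 0) = (p, q)" using has_vel_0[OF v] has_vel_0[OF w] by simp
 fix F assume F: "F : C_inf (prod_mfd M L)"
 have AM: "hatl M" and AL: "hatl L" using M L by auto
 obtain U ph k n where U: "(U, ph) : atlas M" "p : U" "is_chart n (U, ph)"
   "ev (%x. x : U) (nhm M p)" "coords M ph k p" "k p = ph p" by (rule mf_chart[OF M p])
 obtain V ps l n' where V: "(V, ps) : atlas L" "q : V" "is_chart n' (V, ps)"
   "ev (%x. x : V) (nhm L q)" "coords L ps l q" "l q = ps q" by (rule mf_chart[OF L q])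
 let ?H = "%z. F (cpar (U, ph) (fst z), cpar (V, ps) (snd z))"
 let ?e = "SUM b:Basis. v (%x. k x *i b) *r b" and ?e' = "SUM b:Basis. w (%x. l x *i b) *r b"
 define D where "D = FD ?H (at (ph p, ps q))"
 have kq: "(ph p, ps q) : cdom (U, ph) \<times> cdom (V, ps)"
  using cparD(3)[OF U(3,2)] cparD(3)[OF V(3,2)] by simp
 have D: "(?H has_derivative D) (at (ph p, ps q))" unfolding D_def
  by (rule Cinf_has_derivative[OF Cinf_prod_par[OF AM AL F U(1,3) V(1,3)] kq])
 have lD: "linear D" by (rule has_derivative_linear[OF D])
 have kb: "!!b. (%x. k x *i b) : C_inf M" "!!b. (%x. l x *i b) : C_inf L" using U(5) V(5) by (auto simp: coords_def)
 have ek: "ev (%x. k x = ph x) (nhm M p)" "ev (%x. l x = ps x) (nhm L q)"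
  using U(5) V(5) by (auto simp: coords_def)
 note ev = has_vel_eventually[OF AM p v ek(1)] has_vel_eventually[OF AL q w ek(2)]
  has_vel_eventually[OF AM p v U(4)] has_vel_eventually[OF AL q w V(4)]
 \<comment> \<open>Stated for arbitrary curves because it is applied three times: with both curves
   moving, and with each one moving alone.\<close>
 have main: "((%t. F (x t, y t)) has_real_derivative D (ex, ey)) (at 0)"
  if "((%t. k (x t)) has_derivative (%t. t *r ex)) (at 0)" "((%t. l (y t)) has_derivative (%t. t *r ey)) (at 0)"
   "x 0 = p" "y 0 = q"
   "ev (%t. k (x t) = ph (x t) & x t : U) (nhds 0)" "ev (%t. l (y t) = ps (y t) & y t : V) (nhds 0)"
  for x y ex ey
 proof -
  have D': "(?H has_derivative D) (at (k (x 0), l (y 0)))" using D that U(6) V(6) by simp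
  have "((%t. (k (x t), l (y t))) has_derivative (%t. (t *r ex, t *r ey))) (at 0)"
   by (rule has_derivative_Pair[OF that(1,2)])
  from has_derivative_compose[OF this D']
  have "((%t. ?H (k (x t), l (y t))) has_derivative (%t. D (t *r ex, t *r ey))) (at 0)" .
  moreover have "D (t *r ex, t *r ey) = D (ex, ey) * t" for t
   using linear_scale[OF lD, of t "(ex, ey)"] by simp
  ultimately have "((%t. ?H (k (x t), l (y t))) has_real_derivative D (ex, ey)) (at 0)"
   by (simp add: has_field_derivative_def)
  moreover have "ev (%t. ?H (k (x t), l (y t)) = F (x t, y t)) (nhds 0)"
   using that(5,6) by eventually_elim (simp add: cparD(4)[OF U(3)] cparD(4)[OF V(3)])
  ultimately show ?thesis by (rule DERIV_cong_nhds[rotated])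
 qed
 have dk: "((%t. k (ga t)) has_derivative (%t. t *r ?e)) (at 0)" by (rule has_vel_coords[OF v kb(1)])
 have dl: "((%t. l (de t)) has_derivative (%t. t *r ?e')) (at 0)" by (rule has_vel_coords[OF w kb(2)])
 have c0: "((%t. c) has_derivative (%t::real. t *r 0)) (at 0)" for c :: "'z::real_normed_vector"
  by (auto intro!: derivative_eq_intros)
 have e1: "ev (%t. k (ga t) = ph (ga t) & ga t : U) (nhds 0)" using ev(1,3) by eventually_elim simp
 have e2: "ev (%t. l (de t) = ps (de t) & de t : V) (nhds 0)" using ev(2,4) by eventually_elim simp
 have "((%t. F (ga t, q)) has_real_derivative D (?e, 0)) (at 0)"
  by (rule main[OF dk c0 has_vel_0[OF v] refl e1]) (use V in simp)
 moreover have "((%t. F (ga t, q)) has_real_derivative v (%m. F (m, q))) (at 0)"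
  by (rule has_velD[OF v C_inf_slice1[OF M L F q]])
 ultimately have v': "v (%m. F (m, q)) = D (?e, 0)" by (rule DERIV_unique[rotated])
 have "((%t. F (p, de t)) has_real_derivative D (0, ?e')) (at 0)"
  by (rule main[OF c0 dl refl has_vel_0[OF w] _ e2]) (use U in simp)
 moreover have "((%t. F (p, de t)) has_real_derivative w (%l. F (p, l))) (at 0)"
  by (rule has_velD[OF w C_inf_slice2[OF M L F p]])
 ultimately have w': "w (%l. F (p, l)) = D (0, ?e')" by (rule DERIV_unique[rotated])
 have "((%t. F (ga t, de t)) has_real_derivative D (?e, ?e')) (at 0)"
  by (rule main[OF dk dl has_vel_0[OF v] has_vel_0[OF w] e1 e2])
 moreover have "D (?e, ?e') = D (?e, 0) + D (0, ?e')" using linear_add[OF lD, of "(?e, 0)" "(0, ?e')"] by simp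
 ultimately show "((%t. F (ga t, de t)) has_real_derivative
   (if F : C_inf (prod_mfd M L) then v (%m. F (m, q)) + w (%l. F (p, l)) else 0)) (at 0)"
  using F v' w' by simp
qed simp

text \<open>The splitting of the tangent space of a product: \<open>z\<close> is the velocity of
  some curve, and its components are the velocities of the two coordinate curves.\<close>

lemma tangent_prod: assumes M: "mf M" and L: "mf L" and p: "p : pts M" and q: "q : pts L"
  and z: "z : TS (prod_mfd M L) (p, q)" and F: "F : C_inf (prod_mfd M L)"
 shows "z F = tmap (prod_mfd M L) M fst z (%m. F (m, q)) + tmap (prod_mfd M L) L snd z (%l. F (p, l))"
proof -
 have AM: "hatl M" and AL: "hatl L" using M L by auto
 have A: "hatl (prod_mfd M L)" by (rule hatl_prod[OF AM AL])
 have pq: "(p, q) : pts (prod_mfd M L)" using p q by simp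
 obtain ga where g: "has_vel (prod_mfd M L) ga (p, q) z" using has_vel_exists[OF mf_prod[OF M L] pq z] by blast
 have 1: "has_vel M (%t. fst (ga t)) p (tmap (prod_mfd M L) M fst z)"
  using has_vel_tmap[OF A pq spb_fst[OF AM AL] g] by simp
 have 2: "has_vel L (%t. snd (ga t)) q (tmap (prod_mfd M L) L snd z)"
  using has_vel_tmap[OF A pq spb_snd[OF AM AL] g] by simp
 from has_vel_unique[OF g has_vel_pair[OF M L p q 1 2, unfolded prod.collapse]] F
 show ?thesis by (simp add: fun_eq_iff)
qed

text \<open>Differentiation of \<open>H\<close> in its first variable along a field that is smooth
  against functions of that variable. In coordinates the field is a combination of partial
  derivatives with smooth coefficients \<open>A c\<close>, and the partial derivatives of
  \<open>H\<close> at \<open>(e n, b n)\<close> depend smoothly on \<open>n\<close>.\<close>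

lemma C_inf_field_along:
 fixes M :: "('a, 'e::euclidean_space) mfd"
 assumes N: "hatl N" and M: "mf M" and L: "mf L" and e: "spb N M e" and b: "spb N L b"
  and a: "!!n. n : pts N ==> a n : TS M (e n)"
  and sm: "!!F. F : C_inf M ==> (%n. if n : pts N then a n F else 0) : C_inf N"
  and H: "H : C_inf (prod_mfd M L)"
 shows "(%n. if n : pts N then a n (%m. H (m, b n)) else 0) : C_inf N"
proof (rule C_infI[OF N])
 fix n0 assume n0: "n0 : pts N"
 have AM: "hatl M" and AL: "hatl L" using M L by auto
 obtain U ph k n where U: "(U, ph) : atlas M" "e n0 : U" "is_chart n (U, ph)"
   "ev (%x. x : U) (nhm M (e n0))" "coords M ph k (e n0)" "k (e n0) = ph (e n0)"
  by (rule mf_chart[OF M spb_points[OF e n0]])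
 obtain V ps l n' where V: "(V, ps) : atlas L" "b n0 : V" "is_chart n' (V, ps)"
   "ev (%x. x : V) (nhm L (b n0))" "coords L ps l (b n0)" "l (b n0) = ps (b n0)"
  by (rule mf_chart[OF L spb_points[OF b n0]])
 let ?W = "cdom (U, ph) \<times> cdom (V, ps)"
 let ?H = "%z. H (cpar (U, ph) (fst z), cpar (V, ps) (snd z))"
 have HC: "Cinf ?W ?H" by (rule Cinf_prod_par[OF AM AL H U(1,3) V(1,3)])
 have o: "open ?W" by (intro open_Times chart_dom_open[OF U(3)] chart_dom_open[OF V(3)])
 have kW: "(k (e n0), l (b n0)) : ?W" using cparD(3)[OF U(3,2)] cparD(3)[OF V(3,2)] U V by simp
 have kb: "!!b. (%x. k x *i b) : C_inf M" "!!b. (%x. l x *i b) : C_inf L" using U(5) V(5) by (auto simp: coords_def)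
 have "ALL c. EX G. G : C_inf N & ev (%x. G x = FD ?H (at (k (e x), l (b x))) (c, 0)) (nhm N n0)"
  using C_inf_pairing_local[OF N e b n0 M L kb o kW Cinf_derivative[OF HC]] unfolding Bex_def by (rule allI)
 from choice[OF this] obtain G where G': "ALL c. G c : C_inf N &
   ev (%x. G c x = FD ?H (at (k (e x), l (b x))) (c, 0)) (nhm N n0)" ..
 have G: "G c : C_inf N" "ev (%x. G c x = FD ?H (at (k (e x), l (b x))) (c, 0)) (nhm N n0)" for c
  using G'[rule_format, of c] by simp_all
 define A where "A c = (%n. if n : pts N then a n (%x. k x *i c) else 0)" for c
 have A: "A c : C_inf N" for c unfolding A_def by (rule sm[OF kb(1)])
 let ?g = "SUM c:Basis. A c * G c"
 have ek: "ev (%x. l x = ps x) (nhm L (b n0))" using V(5) by (simp add: coords_def)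
 have "ev (%x. ALL c:(Basis::'e set). G c x = FD ?H (at (k (e x), l (b x))) (c, 0)) (nhm N n0)"
  using G(2) by (intro eventually_ball_finite) auto
 then have "ev (%x. (if x : pts N then a x (%m. H (m, b x)) else 0) = ?g x) (nhm N n0)"
  using spb_eventually[OF N AM e n0 U(4)] spb_eventually[OF N AL b n0 V(4)] spb_eventually[OF N AL b n0 ek]
   spb_eventually[OF N AM e n0 coords_eventually[OF AM spb_points[OF e n0] U(5)]] ev_pts[OF N n0]
 proof eventually_elim
  case (elim x)
  have xM: "e x : pts M" and xL: "b x : pts L" using spb_points[OF e] spb_points[OF b] elim by auto
  have ke: "k (e x) = ph (e x)"
   using elim(5) ev_nhmD[OF AM xM, of "%x. k x = ph x"] by (simp add: coords_def)
  let ?v = "SUM c:Basis. a x (%x. k x *i c) *r c" and ?z = "(ph (e x), ps (b x))"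
  have zW: "?z : ?W" using cparD(3)[OF U(3)] cparD(3)[OF V(3)] elim by simp
  have D: "(?H has_derivative FD ?H (at ?z)) (at ?z)" by (rule Cinf_has_derivative[OF HC zW])
  have "((%y. (y, ps (b x))) has_derivative (%c. (c, 0))) (at (ph (e x)))" by (auto intro!: derivative_eq_intros)
  from has_derivative_compose[OF this D]
  have "((%y. H (cpar (U, ph) y, b x)) has_derivative (%c. FD ?H (at ?z) (c, 0))) (at (ph (e x)))"
   using cparD(4)[OF V(3)] elim by simp
  then have fd: "FD (%y. H (cpar (U, ph) y, b x)) (at (ph (e x))) =
   (%c. FD ?H (at ?z) (c, 0))" by (rule frechet_derivative_at[symmetric])
  have "a x (%m. H (m, b x)) = FD (%y. H (cpar (U, ph) y, b x)) (at (ph (e x))) ?v"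
   by (rule tangent_coords[OF M U(1,3) elim(2,5) a[OF elim(6)] C_inf_slice1[OF M L H xL]])
  also have "... = FD ?H (at ?z) (?v, 0)" by (simp add: fd)
  also have "(?v, 0) = (SUM c:Basis. a x (%x. k x *i c) *r (c, 0))"
   by (simp add: sum_prod[symmetric] prod_eq_iff fst_sum snd_sum)
  also have "FD ?H (at ?z) ... = (SUM c:Basis. a x (%x. k x *i c) * FD ?H (at ?z) (c, 0))"
   by (simp only: linear_sum[OF has_derivative_linear[OF D]] linear_scale[OF has_derivative_linear[OF D]] real_scaleR_def)
  also have "... = ?g x" using elim by (simp add: A_def ke sum_apply)
  finally show ?case using elim by simp
 qed
 moreover have "?g : C_inf N" by (intro C_inf_sum C_inf_mult A G)
 ultimately show "EX g:C_inf N. ev (%x. (if x : pts N then a x (%m. H (m, b x)) else 0) = g x) (nhm N n0)"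
  by (rule bexI)
qed simp

section \<open>Submersions and fibre products\<close>

lemma eventually_chart_par:
 assumes M: "mf M" and U: "(U, ph) : atlas M" and c: "is_chart n (U, ph)" and p: "p : U"
  and Q: "ev Q (nhm M p)" shows "ev (%x. Q (cpar (U, ph) x)) (nhds (ph p))"
proof -
 have A: "hatl M" using M by simp
 have pM: "p : pts M" using hatlD(1)[OF A U] p by blast
 obtain h where h: "h : C_inf M" "h p ~= 0" "ALL x. h x ~= 0 --> Q x" by (rule ev_nhmE[OF A pM Q])
 have "continuous_on (cdom (U, ph)) (%x. h (cpar (U, ph) x))"
  by (rule Cinf_continuous_on[OF Cinf_cpar[OF c C_inf_chart[OF h(1) U]]])
 then have "isCont (%x. h (cpar (U, ph) x)) (ph p)"
  using chart_dom_open[OF c] cparD(3)[OF c p] continuous_on_eq_continuous_at by blast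
 then have "((%x. h (cpar (U, ph) x)) \<longlongrightarrow> h p) (nhds (ph p))"
  using tendsto_at_iff_tendsto_nhds[of "%x. h (cpar (U, ph) x)" "ph p"]
  by (simp add: isCont_def cparD(4)[OF c p])
 then have "ev (%x. h (cpar (U, ph) x) ~= 0) (nhds (ph p))"
  using h(2) tendsto_imp_eventually_ne by blast
 then show ?thesis by eventually_elim (use h(3) in auto)
qed

text \<open>The converse of \<open>tangent_coords\<close>: a direction in the subspace of the chart
  is realized by a line. It is used to turn surjectivity of the abstract tangent map into
  surjectivity of a linear map in \<open>submersion_normal_form\<close>.\<close>

lemma chart_vector_exists:
 fixes M :: "('a, 'e::euclidean_space) mfd"
 assumes M: "mf M" and U: "(U, ph) : atlas M" and c: "is_chart n (U, ph)" and p: "p : U"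
  and k: "coords M ph k p" and e: "e : cspace (U, ph)"
 shows "EX v:TS M p. ALL b:Basis. v (%x. k x *i b) = e *i b"
proof -
 have A: "hatl M" using M by simp
 have pM: "p : pts M" using hatlD(1)[OF A U] p by blast
 let ?ga = "%t. cpar (U, ph) (ph p + t *r e)"
 define v where "v = (%F. if F : C_inf M then FD (%x. F (cpar (U, ph) x)) (at (ph p)) e else 0)"
 note vel = has_vel_chart[OF U c p, of e, folded v_def]
 have ek: "ev (%x. k x = ph x) (nhm M p)" using k by (simp add: coords_def)
 have "v (%x. k x *i b) = e *i b" for b
 proof -
  have kb: "(%x. k x *i b) : C_inf M" using k by (simp add: coords_def)
  have "filterlim (%t. ph p + t *r e) (nhds (ph p)) (nhds 0)"
   using tendsto_at_iff_tendsto_nhds[of "%t. ph p + t *r e" 0] by (auto intro!: tendsto_eq_intros)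
  moreover have "ev (%x. k (cpar (U, ph) x) = ph (cpar (U, ph) x) & x : cdom (U, ph)) (nhds (ph p))"
   using eventually_chart_par[OF M U c p ek] eventually_nhds_in_open[OF chart_dom_open[OF c] cparD(3)[OF c p]]
   by eventually_elim simp
  ultimately have "ev (%t. k (?ga t) = ph (?ga t) & ph p + t *r e : cdom (U, ph)) (nhds 0)"
   by (rule eventually_compose_filterlim[rotated])
  then have "ev (%t. (ph p *i b) + t * (e *i b) = k (?ga t) *i b) (nhds 0)"
  proof eventually_elim
   case (elim t)
   have "ph p + t *r e : cspace (U, ph)"
    using chartD(1)[OF c] chartD(6)[OF c] p e by (blast intro: subspace_add subspace_scale)
   then have "k (?ga t) = ph p + t *r e" using elim cparD(2)[OF c] chartD(5)[OF c] by simp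
   then show ?case by (simp add: inner_add_left)
  qed
  moreover have "((%t. (ph p *i b) + t * (e *i b)) has_real_derivative e *i b) (at 0)"
   by (auto intro!: derivative_eq_intros)
  ultimately have "((%t. k (?ga t) *i b) has_real_derivative e *i b) (at 0)" by (rule DERIV_cong_nhds)
  then show ?thesis by (rule DERIV_unique[OF has_velD[OF vel kb]])
 qed
 then show ?thesis using has_vel_tangent[OF vel] by blast
qed

text \<open>Let \<open>fh\<close> be \<open>f\<close> in charts, \<open>A\<close> its derivative at
  \<open>ph p\<close> and \<open>B\<close> a linear right inverse of \<open>A\<close>. Then
  \<open>Th x = x + (B (fh x) - B (A x))\<close> has the identity as derivative at
  \<open>ph p\<close> and satisfies \<open>A (Th x) = fh x\<close>: it is a change of coordinates
  that makes \<open>f\<close> linear. It moves points along \<open>cspace (U, ph)\<close> only and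
  so respects that subspace.\<close>

lemma submersion_normal_form:
 fixes M :: "('a, 'e::euclidean_space) mfd" and N :: "('b, 'd::euclidean_space) mfd"
 assumes M: "mf M" and N: "mf N" and f: "submersion M N f"
  and U: "(U, ph) : atlas M" "is_chart n (U, ph)" and p: "p : U"
  and V: "(V, ps) : atlas N" "is_chart n' (V, ps)" and fp: "f p : V"
 obtains O' :: "'e set" and Th :: "'e => 'e" and A :: "'e => 'd" and B :: "'d => 'e"
 where "open O'" "ph p : O'" "O' <= cdom (U, ph)" "ALL x:O'. f (cpar (U, ph) x) : V"
  "Cinf O' Th" "inj_on Th O'" "open (Th ` O')" "Cinf (Th ` O') (inv_into O' Th)"
  "linear A" "linear B" "range B <= cspace (U, ph)"
  "ALL x:O'. A (Th x) = ps (f (cpar (U, ph) x))" "ALL y:cspace (V, ps). A (B y) = y"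
  "ALL x:O'. Th x : cspace (U, ph) <-> x : cspace (U, ph)" "Cinf O' (%x. ps (f (cpar (U, ph) x)))"
proof -
 have AM: "hatl M" and AN: "hatl N" using M N by auto
 have pM: "p : pts M" using hatlD(1)[OF AM U(1)] p by blast
 have sm: "smooth_map M N f" using f by (simp add: submersion_def)
 have sf: "spb M N f" by (rule smooth_map_imp_spb[OF AM AN sm])
 let ?E = "cspace (U, ph)" and ?E' = "cspace (V, ps)"
 let ?P = "cproj (U, ph)" and ?Q = "cproj (V, ps)"
 let ?O = "ph ` (U Int f -` V)"
 have oO: "openin (top_of_set (ph ` U)) ?O" and sO: "smooth_on ?O (ps o f o inv_into U ph)"
  using sm U(1) V(1) unfolding smooth_map_def by auto
 have "openin (top_of_set ?E) ?O" using openin_trans[OF oO chartD(2)[OF U(2)]] .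
 then obtain T where T: "open T" "?O = ?E Int T" by (auto simp: openin_open)
 define W where "W = ?P -` ?O"
 have "W = ?P -` T" using chartD(4)[OF U(2)] T by (auto simp: W_def)
 moreover have "continuous_on UNIV ?P"
  using chartD(3)[OF U(2)] by (simp add: linear_continuous_on linear_conv_bounded_linear)
 ultimately have oW: "open W" using T(1) by (simp add: open_vimage)
 have inj: "inj_on ph U" by (rule hatlD(2)[OF AM U(1)])
 have injV: "inj_on ps V" by (rule hatlD(2)[OF AN V(1)])
 have Wdom: "W <= cdom (U, ph)" by (auto simp: W_def cdom_def)
 have pW: "ph p : W" using cparD(5)[OF U(2) p] p fp by (auto simp: W_def)
 have WV: "f (cpar (U, ph) x) : V" if "x : W" for x using that inj by (auto simp: W_def cpar_def)
 define fh where "fh x = ps (f (cpar (U, ph) x))" for x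
 have fh: "Cinf W fh" using smooth_on_compose_Cinf[OF sO oW Cinf_linear[OF chartD(3)[OF U(2)] oW]]
  by (simp add: fh_def[abs_def] cpar_def W_def)
 have fhP: "fh (?P x) = fh x" for x
  using chartD(5)[OF U(2) chartD(4)[OF U(2)], of x] by (simp add: fh_def cpar_def)
 have fhE: "fh x : ?E'" if "x : W" for x using WV[OF that] chartD(6)[OF V(2)] by (auto simp: fh_def)
 define A where "A = FD fh (at (ph p))"
 have dA: "(fh has_derivative A) (at (ph p))" unfolding A_def by (rule Cinf_has_derivative[OF fh pW])
 have lA: "linear A" by (rule has_derivative_linear[OF dA])
 have AP: "A (?P x) = A x" for x
 proof -
  have bP: "(?P has_derivative ?P) (at (ph p))"
   using chartD(3)[OF U(2)] by (simp add: bounded_linear_imp_has_derivative linear_conv_bounded_linear)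
  have "((%x. fh (?P x)) has_derivative (%x. A (?P x))) (at (ph p))"
   by (rule has_derivative_compose[OF bP]) (simp add: cparD(5)[OF U(2) p] dA)
  then have "(%x. A (?P x)) = A" unfolding fhP by (rule has_derivative_unique[OF _ dA])
  then show ?thesis by (rule fun_cong)
 qed
 have AE': "A x : ?E'" for x
 proof -
  have bQ: "(?Q has_derivative ?Q) (at (fh (ph p)))"
   using chartD(3)[OF V(2)] by (simp add: bounded_linear_imp_has_derivative linear_conv_bounded_linear)
  have "((%x. ?Q (fh x)) has_derivative (%x. ?Q (A x))) (at (ph p))"
   by (rule has_derivative_compose[OF dA bQ])
  then have "(fh has_derivative (%x. ?Q (A x))) (at (ph p))"
   by (rule has_derivative_transform_within_open[OF _ oW pW]) (use fhE chartD(5)[OF V(2)] in auto)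
  then have "(%x. ?Q (A x)) = A" by (rule has_derivative_unique[OF _ dA])
  then have "A x = ?Q (A x)" by metis
  then show ?thesis using chartD(4)[OF V(2)] by metis
 qed
 \<comment> \<open>Surjectivity of the tangent map is an assertion about derivations; testing a
   preimage of the chart vector on the coordinate functions of \<open>N\<close> makes it one about
   \<open>A\<close>.\<close>
 have surj: "e : A ` ?E" if e: "e : ?E'" for e
 proof -
  obtain k where k: "coords M ph k p" using M U(1) p unfolding mf_def by fast
  obtain l where l: "coords N ps l (f p)" using N V(1) fp unfolding mf_def by fast
  obtain w where w: "w : TS N (f p)" "ALL b:Basis. w (%x. l x *i b) = e *i b"
   using chart_vector_exists[OF N V fp l e] by blast
  obtain v where v: "v : TS M p" "tmap M N f v = w"
   using f w(1) pM unfolding submersion_def by (metis imageE)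
  let ?e = "SUM b:Basis. v (%x. k x *i b) *r b"
  have "A ?e *i b = e *i b" if b: "b : Basis" for b
  proof -
   have lb: "(%x. l x *i b) : C_inf N" using l by (simp add: coords_def)
   have el: "ev (%x. l x = ps x) (nhm N (f p))" using l by (simp add: coords_def)
   let ?G = "pb M f (%x. l x *i b)"
   have "ev (%x. l (f (cpar (U, ph) x)) = ps (f (cpar (U, ph) x))) (nhds (ph p))"
    by (rule eventually_chart_par[OF M U p spb_eventually[OF AM AN sf pM el]])
   moreover have "ev (%x. x : W) (nhds (ph p))" by (rule eventually_nhds_in_open[OF oW pW])
   ultimately have "ev (%x. fh x *i b = ?G (cpar (U, ph) x)) (nhds (ph p))"
   proof eventually_elim
    case (elim x)
    have "cpar (U, ph) x : pts M" using elim(2) Wdom cparD(1)[OF U(2)] hatlD(1)[OF AM U(1)] by blast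
    then show ?case using elim by (simp add: pb_def fh_def)
   qed
   then obtain S where S: "open S" "ph p : S" "!!x. x : S ==> fh x *i b = ?G (cpar (U, ph) x)"
    unfolding eventually_nhds by blast
   have "((%x. fh x *i b) has_derivative (%e. A e *i b)) (at (ph p))" by (rule has_derivative_inner_left[OF dA])
   then have "((%x. ?G (cpar (U, ph) x)) has_derivative (%e. A e *i b)) (at (ph p))"
    by (rule has_derivative_transform_within_open[OF _ S])
   then have "FD (%x. ?G (cpar (U, ph) x)) (at (ph p)) = (%e. A e *i b)"
    by (rule frechet_derivative_at[symmetric])
   then have "v ?G = A ?e *i b" using tangent_coords[OF M U p k v(1) spb_pb[OF sf lb]] by simp
   moreover have "v ?G = w (%x. l x *i b)" using v(2) lb by (simp add: tmap_pb flip: v(2))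
   ultimately show ?thesis using w(2) b by simp
  qed
  then have "A ?e = e" by (rule euclidean_eqI)
  then have "A (?P ?e) = e" by (simp add: AP)
  then show ?thesis using chartD(4)[OF U(2)] by blast
 qed
 obtain B where B: "range B <= ?E" "linear B" "ALL y:A ` ?E. A (B y) = y"
  using linear_exists_right_inverse_on[OF lA chartD(1)[OF U(2)]] by blast
 have AB: "A (B y) = y" if "y : ?E'" for y using B(3) surj[OF that] by blast
 define Th where "Th x = x + (B (fh x) - B (A x))" for x
 have bB: "bounded_linear B" and bA: "bounded_linear A" using B(2) lA by (auto simp: linear_conv_bounded_linear)
 have Th: "Cinf W Th" unfolding Th_def[abs_def]
  by (intro Cinf_add Cinf_diff oW Cinf_ident Cinf_compose_bounded_linear[OF bB oW] fh Cinf_bounded_linear[OF bA oW])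
 have "(Th has_derivative (%v. v + (B (A v) - B (A v)))) (at (ph p))" unfolding Th_def[abs_def]
  by (intro has_derivative_add has_derivative_ident has_derivative_diff
    bounded_linear.has_derivative[OF bB] dA bounded_linear.has_derivative[OF bA])
 then have "FD Th (at (ph p)) = (%v. v)" using frechet_derivative_at by fastforce
 from local_inverse[OF oW Th pW this] obtain O' where O: "open O'" "ph p : O'" "O' <= W" "inj_on Th O'"
  "open (Th ` O')" "Cinf (Th ` O') (inv_into O' Th)" by metis
 have sE: "subspace ?E" by (rule chartD(1)[OF U(2)])
 have 1: "A (Th x) = fh x" if "x : O'" for x
 proof -
  have "fh x : ?E'" using fhE that O(3) by blast
  then show ?thesis by (simp add: Th_def linear_add[OF lA] linear_diff[OF lA] AB AE')
 qed
 have 2: "Th x : ?E <-> x : ?E" for x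
 proof -
  have "B (fh x) - B (A x) : ?E" using B(1) sE by (auto intro: subspace_diff)
  then show ?thesis unfolding Th_def using subspace_add[OF sE] subspace_diff[OF sE] by (metis add_diff_cancel_right')
 qed
 show ?thesis
 proof (rule that[of O' Th A B])
  show "Cinf O' Th" by (rule Cinf_subset[OF Th O(3)])
  show "O' <= cdom (U, ph)" using O(3) Wdom by auto
  show "Cinf O' (%x. ps (f (cpar (U, ph) x)))" using Cinf_subset[OF fh O(3)] by (simp add: fh_def[abs_def])
 qed (use O lA B AB 1 2 WV in "auto simp: fh_def")
qed

text \<open>In the normal form, \<open>si m n\<close> is obtained from \<open>m\<close> by moving the base coordinate to \<open>n\<close>.\<close>

lemma submersion_section:
 fixes M :: "('a, 'e::euclidean_space) mfd" and N :: "('b, 'd::euclidean_space) mfd"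
 assumes M: "mf M" and N: "mf N" and f: "submersion M N f" and p: "p : pts M"
 obtains si h where "h : C_inf (prod_mfd M N)" "h (p, f p) ~= 0"
  "ALL m n. h (m, n) ~= 0 --> si m n : pts M & f (si m n) = n"
  "ALL m. h (m, f m) ~= 0 --> si m (f m) = m"
  "ALL F:C_inf M. EX G:C_inf (prod_mfd M N). ALL m n. h (m, n) ~= 0 --> G (m, n) = F (si m n)"
proof -
 let ?MN = "prod_mfd M N"
 have AM: "hatl M" and AN: "hatl N" using M N by auto
 have A': "hatl ?MN" by (rule hatl_prod[OF AM AN])
 have sf: "spb M N f" using smooth_map_imp_spb[OF AM AN] f by (simp add: submersion_def)
 have fpN: "f p : pts N" by (rule spb_points[OF sf p])
 have pfp: "(p, f p) : pts ?MN" using p fpN by simp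
 obtain U ph k n where U: "(U, ph) : atlas M" "p : U" "is_chart n (U, ph)"
   "ev (%x. x : U) (nhm M p)" "coords M ph k p" "k p = ph p" by (rule mf_chart[OF M p])
 obtain V ps l n' where V: "(V, ps) : atlas N" "f p : V" "is_chart n' (V, ps)"
   "ev (%x. x : V) (nhm N (f p))" "coords N ps l (f p)" "l (f p) = ps (f p)" by (rule mf_chart[OF N fpN])
 have injV: "inj_on ps V" by (rule hatlD(2)[OF AN V(1)])
 obtain O' :: "'e set" and Th :: "'e => 'e" and A :: "'e => 'd" and B :: "'d => 'e"
 where O: "open O'" "ph p : O'" "O' <= cdom (U, ph)" "ALL x:O'. f (cpar (U, ph) x) : V"
  and Th: "Cinf O' Th" "inj_on Th O'" "open (Th ` O')" "Cinf (Th ` O') (inv_into O' Th)"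
  and AB: "linear A" "linear B" "range B <= cspace (U, ph)"
  "ALL x:O'. A (Th x) = ps (f (cpar (U, ph) x))" "ALL y:cspace (V, ps). A (B y) = y"
  "ALL x:O'. Th x : cspace (U, ph) <-> x : cspace (U, ph)"
  and fh: "Cinf O' (%x. ps (f (cpar (U, ph) x)))"
  by (rule submersion_normal_form[OF M N f U(1,3,2) V(1,3,2)])
 let ?fh = "%x. ps (f (cpar (U, ph) x))"
 define T where "T z = Th (fst z) + B (snd z - ?fh (fst z))" for z
 define S where "S = (O' \<times> UNIV) Int T -` (Th ` O')"
 have oOU: "open (O' \<times> (UNIV :: 'd set))" using O(1) by (simp add: open_Times)
 have cfst: "Cinf (O' \<times> (UNIV :: 'd set)) fst" and csnd: "Cinf (O' \<times> (UNIV :: 'd set)) snd"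
  by (rule Cinf_bounded_linear[OF bounded_linear_fst oOU], rule Cinf_bounded_linear[OF bounded_linear_snd oOU])
 have bB: "bounded_linear B" using AB(2) by (simp add: linear_conv_bounded_linear)
 have sub: "fst ` (O' \<times> (UNIV :: 'd set)) <= O'" by auto
 have CT: "Cinf (O' \<times> UNIV) T" unfolding T_def[abs_def]
  by (intro Cinf_add oOU Cinf_compose[OF oOU O(1) sub Th(1) cfst] Cinf_compose_bounded_linear[OF bB oOU]
    Cinf_diff csnd Cinf_compose[OF oOU O(1) sub fh cfst])
 have oS: "open S" unfolding S_def
  by (rule continuous_open_preimage[OF Cinf_continuous_on[OF CT] oOU Th(3)])
 define s where "s z = inv_into O' Th (T z)" for z
 have sS: "s z : O'" "Th (s z) = T z" if "z : S" for z
  using that by (auto simp: s_def S_def inv_into_into f_inv_into_f)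
 have Cs: "Cinf S s" unfolding s_def[abs_def]
  by (rule Cinf_compose[OF oS Th(3) _ Th(4) Cinf_subset[OF CT]]) (auto simp: S_def)
 have par0: "cpar (U, ph) (ph p) = p" by (rule cparD(4)[OF U(3,2)])
 have zS: "(ph p, ps (f p)) : S" using O(2) par0 linear_0[OF AB(2)] by (auto simp: S_def T_def)
 obtain ka r where ka: "r > 0" "!!x. dist (ph p, ps (f p)) x < r ==> x : S & ka x = 1"
  "!!g::'e \<times> 'd => real. Cinf S g ==> Cinf UNIV (%x. if x : S then ka x * g x else 0)"
  by (rule cutoff_uniform[OF oS zS]) (rule that; assumption)
 define kl where "kl x = (if x : pts ?MN then (k (fst x), l (snd x)) else 0)" for x
 have kb: "(%x. kl x *i b) : C_inf ?MN" for b unfolding kl_def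
  by (rule C_inf_pair_coords[OF spb_fst[OF AM AN] spb_snd[OF AM AN]]) (use U(5) V(5) in "auto simp: coords_def")
 have klp: "kl (p, f p) = (ph p, ps (f p))" using pfp U(6) V(6) by (simp add: kl_def)
 have ek: "ev (%x. k x = ph x) (nhm M p)" and el: "ev (%x. l x = ps x) (nhm N (f p))"
  using U(5) V(5) by (auto simp: coords_def)
 let ?Q = "%z. z : pts ?MN & k (fst z) = ph (fst z) & l (snd z) = ps (snd z) & fst z : U & snd z : V &
  kl z : ball (ph p, ps (f p)) r"
 note e1 = spb_eventually[OF A' AM spb_fst[OF AM AN] pfp, unfolded fst_conv]
  and e2 = spb_eventually[OF A' AN spb_snd[OF AM AN] pfp, unfolded snd_conv]
 have e3: "ev (%z. kl z : ball (ph p, ps (f p)) r) (nhm ?MN (p, f p))"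
  by (rule eventually_C_inf_compose[OF A' pfp kb open_ball]) (use klp ka(1) in simp)
 have "ev ?Q (nhm ?MN (p, f p))"
  using e1[OF ek] e1[OF U(4)] e2[OF el] e2[OF V(4)] e3 ev_pts[OF A' pfp] by eventually_elim blast
 then obtain h where h: "h : C_inf ?MN" "h (p, f p) ~= 0" "ALL z. h z ~= 0 --> ?Q z"
  by (rule ev_nhmE[OF A' pfp])
 define si where "si m n = cpar (U, ph) (s (kl (m, n)))" for m n
 show ?thesis
 proof (rule that[of h si]; (intro allI ballI impI)?)
  fix m n assume "h (m, n) ~= 0"
  then have Q: "?Q (m, n)" using h(3) by blast
  let ?z = "kl (m, n)"
  have z: "?z = (ph m, ps n)" using Q by (simp add: kl_def)
  have zS: "?z : S" using Q ka(2) by simp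
  then have mO: "ph m : O'" unfolding z S_def by auto
  have sd: "s ?z : cdom (U, ph)" using sS(1)[OF zS] O(3) by blast
  have 1: "si m n : pts M" unfolding si_def using cparD(1)[OF U(3) sd] hatlD(1)[OF AM U(1)] by blast
  have fE: "?fh (ph m) : cspace (V, ps)" "ps n : cspace (V, ps)"
   using bspec[OF O(4) mO] chartD(6)[OF V(3)] Q by auto
  have "ps (f (si m n)) = A (Th (s ?z))" unfolding si_def using bspec[OF AB(4) sS(1)[OF zS]] by simp
  also have "... = A (Th (ph m)) + A (B (ps n - ?fh (ph m)))"
   unfolding sS(2)[OF zS] by (simp add: T_def z linear_add[OF AB(1)])
  also have "... = ps n"
   using bspec[OF AB(4) mO] bspec[OF AB(5) subspace_diff[OF chartD(1)[OF V(3)] fE(2,1)]] by simp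
  finally have "ps (f (si m n)) = ps n" .
  moreover have "f (si m n) : V" unfolding si_def by (rule bspec[OF O(4) sS(1)[OF zS]])
  ultimately have "f (si m n) = n" using injV Q by (auto dest: inj_onD)
  then show "si m n : pts M & f (si m n) = n" using 1 by simp
 next
  fix m assume "h (m, f m) ~= 0"
  then have Q: "?Q (m, f m)" using h(3) by blast
  let ?z = "kl (m, f m)"
  have z: "?z = (ph m, ps (f m))" using Q by (simp add: kl_def)
  have zS: "?z : S" using Q ka(2) by simp
  then have mO: "ph m : O'" unfolding z S_def by auto
  have mU: "m : U" using Q by simp
  have "T ?z = Th (ph m)" unfolding T_def z using cparD(4)[OF U(3) mU] linear_0[OF AB(2)] by simp
  then have "s ?z = ph m" unfolding s_def using Th(2) mO by simp
  then show "si m (f m) = m" unfolding si_def using cparD(4)[OF U(3) mU] by simp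
 next
  fix F assume F: "F : C_inf M"
  have "Cinf S (%z. F (cpar (U, ph) (s z)))"
   by (rule Cinf_compose[OF oS chart_dom_open[OF U(3)] _ Cinf_cpar[OF U(3) C_inf_chart[OF F U(1)]] Cs])
    (use sS O(3) in auto)
  note g = ka(3)[OF this]
  have "ALL m n. h (m, n) ~= 0 --> (if (m, n) : pts ?MN then
   (if kl (m, n) : S then ka (kl (m, n)) * F (cpar (U, ph) (s (kl (m, n)))) else 0) else 0) = F (si m n)"
   using h(3) ka(2) by (auto simp: si_def)
  then show "EX G:C_inf ?MN. ALL m n. h (m, n) ~= 0 --> G (m, n) = F (si m n)"
   by (rule bexI[OF _ C_inf_compose[OF A' g kb]])
 qed (use h in auto)
qed

text \<open>Any curve \<open>ga0\<close> with velocity \<open>v\<close> is corrected to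
  \<open>si (ga0 t) (de t)\<close>, which lies over \<open>de\<close>. This does not change the
  velocity: \<open>de\<close> and \<open>f (ga0 t)\<close> have the same velocity, so
  \<open>G\<close> has the same derivative along \<open>(ga0 t, de t)\<close> as along
  \<open>(ga0 t, f (ga0 t))\<close>, and on the latter pair \<open>si\<close> returns
  \<open>ga0 t\<close>.\<close>

lemma lift_velocity: assumes M: "mf M" and N: "mf N" and f: "submersion M N f" and p: "p : pts M"
  and v: "v : TS M p" and de: "has_vel N de (f p) (tmap M N f v)"
 shows "EX ga. has_vel M ga p v & ev (%t. f (ga t) = de t) (nhds 0)"
proof -
 let ?MN = "prod_mfd M N"
 have AM: "hatl M" and AN: "hatl N" using M N by auto
 have A': "hatl ?MN" by (rule hatl_prod[OF AM AN])
 have sf: "spb M N f" using smooth_map_imp_spb[OF AM AN] f by (simp add: submersion_def)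
 have fpN: "f p : pts N" by (rule spb_points[OF sf p])
 have pfp: "(p, f p) : pts ?MN" using p fpN by simp
 obtain ga0 where ga0: "has_vel M ga0 p v" using has_vel_exists[OF M p v] ..
 obtain si h where h: "h : C_inf ?MN" "h (p, f p) ~= 0"
  "ALL m n. h (m, n) ~= 0 --> si m n : pts M & f (si m n) = n"
  "ALL m. h (m, f m) ~= 0 --> si m (f m) = m"
  "ALL F:C_inf M. EX G:C_inf ?MN. ALL m n. h (m, n) ~= 0 --> G (m, n) = F (si m n)"
  by (rule submersion_section[OF M N f p])
 have eh: "ev (%z. h z ~= 0) (nhm ?MN (p, f p))" by (rule ev_nhmI[OF A' pfp h(1,2)])
 define ga where "ga t = si (ga0 t) (de t)" for t
 note fga = has_vel_tmap[OF AM p sf ga0]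
 note P1 = has_vel_pair[OF M N p fpN ga0 de] and P2 = has_vel_pair[OF M N p fpN ga0 fga]
 have E1: "ev (%t. h (ga0 t, de t) ~= 0) (nhds 0)" by (rule has_vel_eventually[OF A' pfp P1 eh])
 have E2: "ev (%t. h (ga0 t, f (ga0 t)) ~= 0) (nhds 0)" by (rule has_vel_eventually[OF A' pfp P2 eh])
 have "has_vel M ga p v" unfolding has_vel_def
 proof (intro conjI ballI)
  show "ga 0 = p" using h(4)[rule_format, of p] h(2) has_vel_0[OF ga0] has_vel_0[OF de] by (simp add: ga_def)
  fix F assume F: "F : C_inf M"
  obtain G where G: "G : C_inf ?MN" "ALL m n. h (m, n) ~= 0 --> G (m, n) = F (si m n)" using bspec[OF h(5) F] by blast
  let ?d = "v (%m. G (m, f p)) + tmap M N f v (%l. G (p, l))"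
  have 1: "((%t. G (ga0 t, de t)) has_real_derivative ?d) (at 0)" using has_velD[OF P1 G(1)] G(1) by simp
  have 2: "((%t. G (ga0 t, f (ga0 t))) has_real_derivative ?d) (at 0)" using has_velD[OF P2 G(1)] G(1) by simp
  have "ev (%t. G (ga0 t, f (ga0 t)) = F (ga0 t)) (nhds 0)"
   using E2 by eventually_elim (use G(2) h(4) in auto)
  from DERIV_cong_nhds[OF this 2] have "?d = v F" by (rule DERIV_unique[OF _ has_velD[OF ga0 F]])
  moreover have "ev (%t. G (ga0 t, de t) = F (ga t)) (nhds 0)"
   using E1 by eventually_elim (use G(2) in "auto simp: ga_def")
  from DERIV_cong_nhds[OF this 1] have "((%t. F (ga t)) has_real_derivative ?d) (at 0)" .
  ultimately show "((%t. F (ga t)) has_real_derivative v F) (at 0)" by simp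
 qed (use tangentD(4)[OF v] in auto)
 moreover have "ev (%t. f (ga t) = de t) (nhds 0)"
  using E1 by eventually_elim (use h(3) in "auto simp: ga_def")
 ultimately show ?thesis by blast
qed

lemma compatible_charts_prod:
 assumes c: "compatible_charts (U, ph) (U', ph')" and d: "compatible_charts (V, ps) (V', ps')"
  and inj: "inj_on ph U" "inj_on ph' U'" "inj_on ps V" "inj_on ps' V'"
 shows "compatible_charts (U \<times> V, map_prod ph ps) (U' \<times> V', map_prod ph' ps')"
proof -
 have i: "(U \<times> V) Int (U' \<times> V') = (U Int U') \<times> (V Int V')" by auto
 have im: "map_prod f g ` (X \<times> Y) = f ` X \<times> g ` Y" for f g X Y by (rule map_prod_surj_on[OF refl refl])
 have sm: "smooth_on (a ` (X Int X') \<times> b ` (Y Int Y')) (map_prod a' b' o inv_into (X \<times> Y) (map_prod a b))"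
  if "smooth_on (a ` (X Int X')) (a' o inv_into X a)" "smooth_on (b ` (Y Int Y')) (b' o inv_into Y b)"
   "inj_on a X" "inj_on b Y" for a a' X X' b b' Y Y'
 proof -
  have "smooth_on (a ` (X Int X') \<times> b ` (Y Int Y'))
    (%z. ((a' o inv_into X a) (fst z), (b' o inv_into Y b) (snd z)))"
   by (rule smooth_on_Pair[OF smooth_on_compose[OF that(1) smooth_on_fst] smooth_on_compose[OF that(2) smooth_on_snd]]) auto
  then show ?thesis
   by (rule smooth_on_cong[THEN iffD1, rotated]) (use inv_into_map_prod[OF that(3,4)] in fastforce)
 qed
 show ?thesis unfolding compatible_charts_def prod.case i im
 proof (intro conjI)
  show "smooth_on (ph ` (U Int U') \<times> ps ` (V Int V')) (map_prod ph' ps' o inv_into (U \<times> V) (map_prod ph ps))"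
   by (rule sm) (use c d inj in "auto simp: compatible_charts_def")
  have "smooth_on (ph' ` (U' Int U) \<times> ps' ` (V' Int V)) (map_prod ph ps o inv_into (U' \<times> V') (map_prod ph' ps'))"
   by (rule sm) (use c d inj in "auto simp: compatible_charts_def Int_commute")
  then show "smooth_on (ph' ` (U Int U') \<times> ps' ` (V Int V')) (map_prod ph ps o inv_into (U' \<times> V') (map_prod ph' ps'))"
   by (simp add: Int_commute)
 qed (use c d in "auto simp: compatible_charts_def openin_Times")
qed

lemma compatible_charts_sym: "compatible_charts c d ==> compatible_charts d c"
 by (auto simp: compatible_charts_def Int_commute split: prod.splits)

text \<open>A single comparison, with a chart whose domain contains \<open>D\<close>, is enough:
  every other chart of the atlas is reached through that one.\<close>

lemma max_atlasI:
 fixes M :: "('a, 'e::euclidean_space) mfd"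
 assumes M: "hatl M" and compat: "ALL c:atlas M. ALL d:atlas M. compatible_charts c d"
  and U: "(U, ph) : atlas M" and D: "D <= U" "openin (top_of_set (ph ` U)) (ph ` D)"
  and Ph: "is_chart n (D, Ph)"
  and s1: "smooth_on (ph ` D) (Ph o inv_into U ph)" and s2: "smooth_on (Ph ` D) (ph o inv_into D Ph)"
 shows "(D, Ph) : max_atlas M"
proof -
 have injU: "inj_on ph U" by (rule hatlD(2)[OF M U])
 have injD: "inj_on Ph D" using Ph by (auto simp: is_chart_def)
 have "compatible_charts (V, ps) (D, Ph)" if V: "(V, ps) : atlas M" for V ps
 proof -
  have injV: "inj_on ps V" by (rule hatlD(2)[OF M V])
  have c: "compatible_charts (U, ph) (V, ps)" using compat U V by blast
  have o1: "openin (top_of_set (ph ` U)) (ph ` (U Int V))" and o2: "openin (top_of_set (ps ` V)) (ps ` (U Int V))"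
   and t1: "smooth_on (ph ` (U Int V)) (ps o inv_into U ph)" and t2: "smooth_on (ps ` (U Int V)) (ph o inv_into V ps)"
   using c by (auto simp: compatible_charts_def)
  have DV: "ps ` (V Int D) = ps ` (U Int V) Int (ph o inv_into V ps) -` (ph ` D)"
   using D(1) injV injU by (auto simp: inj_on_eq_iff subset_iff)
  have 1: "openin (top_of_set (ps ` V)) (ps ` (V Int D))"
  proof (rule openin_trans[OF _ o2])
   obtain T where T: "open T" "ph ` D = ph ` U Int T" using D(2) by (auto simp: openin_open)
   have "ps ` (V Int D) = ps ` (U Int V) Int (ph o inv_into V ps) -` T"
    unfolding DV using T injV by auto
   then show "openin (top_of_set (ps ` (U Int V))) (ps ` (V Int D))"
    using continuous_openin_preimage_gen[OF smooth_on_continuous[OF t2] T(1)] by simp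
  qed
  have 2: "openin (top_of_set (Ph ` D)) (Ph ` (V Int D))"
  proof -
   obtain T where T: "open T" "ph ` (U Int V) = ph ` U Int T" using o1 by (auto simp: openin_open)
   have "Ph ` (V Int D) = Ph ` D Int (ph o inv_into D Ph) -` T"
   proof (intro Set.set_eqI iffI)
    fix y assume "y : Ph ` (V Int D)"
    then obtain x where x: "x : V" "x : D" "y = Ph x" by auto
    then have "ph x : ph ` (U Int V)" using D(1) by auto
    then show "y : Ph ` D Int (ph o inv_into D Ph) -` T" using x injD T(2) by auto
   next
    fix y assume "y : Ph ` D Int (ph o inv_into D Ph) -` T"
    then obtain x where x: "x : D" "y = Ph x" "ph x : T" using injD by auto
    then have "ph x : ph ` (U Int V)" using T(2) D(1) by auto
    then have "x : V" using injU D(1) x(1) by (auto simp: inj_on_eq_iff subset_iff)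
    then show "y : Ph ` (V Int D)" using x by auto
   qed
   then show ?thesis
    using continuous_openin_preimage_gen[OF smooth_on_continuous[OF s2] T(1)] by simp
  qed
  have im3: "(ph o inv_into V ps) ` ps ` (V Int D) <= ph ` D" using injV by auto
  have "smooth_on (ps ` (V Int D)) (ph o inv_into V ps)" by (rule smooth_on_subset[OF t2]) (use D(1) in auto)
  from smooth_on_compose[OF s1 this im3]
  have "smooth_on (ps ` (V Int D)) (%x. (Ph o inv_into U ph) ((ph o inv_into V ps) x))" .
  then have 3: "smooth_on (ps ` (V Int D)) (Ph o inv_into V ps)"
   by (rule smooth_on_cong[THEN iffD1, rotated]) (use injV injU D(1) in "auto simp: subset_iff")
  have im4: "(ph o inv_into D Ph) ` Ph ` (V Int D) <= ph ` (U Int V)" using injD D(1) by auto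
  have "smooth_on (Ph ` (V Int D)) (ph o inv_into D Ph)" by (rule smooth_on_subset[OF s2]) auto
  from smooth_on_compose[OF t1 this im4]
  have "smooth_on (Ph ` (V Int D)) (%x. (ps o inv_into U ph) ((ph o inv_into D Ph) x))" .
  then have 4: "smooth_on (Ph ` (V Int D)) (ps o inv_into D Ph)"
   by (rule smooth_on_cong[THEN iffD1, rotated]) (use injD injU D(1) in "auto simp: subset_iff")
  show ?thesis using 1 2 3 4 by (simp add: compatible_charts_def)
 qed
 then show ?thesis using Ph D(1) hatlD(1)[OF M U] by (auto simp: max_atlas_def intro: compatible_charts_sym)
qed

lemma points_sub_mfd [simp]: "pts (sub_mfd M S) = S" by (simp add: sub_mfd_def)

lemma hatl_sub_mfd:
 assumes "!!p. p : S ==> EX U ph F. (U, ph) : max_atlas M & p : U & subspace F & ph ` (U Int S) = ph ` U Int F"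
 shows "hatl (sub_mfd M S)" unfolding hatl_def
proof (intro conjI ballI)
 have "p : \<Union> (fst ` atlas (sub_mfd M S))" if p: "p : S" for p
 proof -
  obtain U ph F where "(U, ph) : max_atlas M" "p : U" "subspace F" "ph ` (U Int S) = ph ` U Int F"
   using assms[OF p] by blast
  then have "(U Int S, ph) : atlas (sub_mfd M S)" by (simp add: sub_mfd_def) blast
  then show ?thesis using p `p : U` by (intro UN_I[of "(U Int S, ph)"]) auto
 qed
 then show "pts (sub_mfd M S) = \<Union> (fst ` atlas (sub_mfd M S))" by (auto simp: sub_mfd_def)
 fix c assume "c : atlas (sub_mfd M S)"
 then obtain U ph F where c: "c = (U Int S, ph)" "(U, ph) : max_atlas M" "subspace F" "ph ` (U Int S) = ph ` U Int F"
  by (auto simp: sub_mfd_def)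
 then obtain n where n: "is_chart n (U, ph)" by (auto simp: max_atlas_def)
 then obtain E where E: "inj_on ph U" "subspace E" "openin (top_of_set E) (ph ` U)" by (auto simp: is_chart_def)
 obtain T where T: "open T" "ph ` U = E Int T" using E(3) by (auto simp: openin_open)
 have "openin (top_of_set (E Int F)) (ph ` (U Int S))"
  unfolding c(4) T(2) openin_open using T(1) by blast
 then show "EX n. is_chart n c" unfolding c(1) is_chart_def
  using E c(3) by (auto intro!: exI[of _ "E Int F"] subspace_inter inj_on_subset[OF E(1)])
qed

lemma spb_sub_mfd: assumes M: "hatl M" and S: "S <= pts M" shows "spb (sub_mfd M S) M (%x. x)"
 unfolding spb_def
proof (intro conjI ballI)
 show "(%x. x) ` pts (sub_mfd M S) <= pts M" using S by simp
 fix H assume H: "H : C_inf M"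
 let ?H = "pb (sub_mfd M S) (%x. x) H"
 have "smooth_on (ph ` W) (?H o inv_into W ph)" if W: "(W, ph) : atlas (sub_mfd M S)" for W ph
 proof -
  obtain U where U: "W = U Int S" "(U, ph) : max_atlas M" using W by (auto simp: sub_mfd_def)
  then have inj: "inj_on ph U" by (auto simp: max_atlas_def is_chart_def)
  have "smooth_on (ph ` U) (H o inv_into U ph)"
  proof (rule smooth_on_locally)
   fix y assume "y : ph ` U"
   then obtain x where x: "x : U" "y = ph x" by auto
   then have "x : pts M" using U(2) by (auto simp: max_atlas_def)
   then obtain V ps where V: "(V, ps) : atlas M" "x : V" using hatlD(3)[OF M] by blast
   have injV: "inj_on ps V" by (rule hatlD(2)[OF M V(1)])
   have c: "compatible_charts (V, ps) (U, ph)"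
    using U(2) V(1) by (auto simp: max_atlas_def intro: compatible_charts_sym)
   have im: "(ps o inv_into U ph) ` ph ` (V Int U) <= ps ` V" using inj by auto
   have "smooth_on (ph ` (V Int U)) (ps o inv_into U ph)" using c by (simp add: compatible_charts_def)
   from smooth_on_compose[OF C_inf_chart[OF H V(1)] this im]
   have "smooth_on (ph ` (V Int U)) (H o inv_into U ph)"
    by (rule smooth_on_cong[THEN iffD1, rotated]) (use inj injV in auto)
   moreover have "openin (top_of_set (ph ` U)) (ph ` (V Int U))" using c by (simp add: compatible_charts_def)
   ultimately show "EX V. openin (top_of_set (ph ` U)) V & y : V & smooth_on V (H o inv_into U ph)"
    using x V by (intro exI[of _ "ph ` (V Int U)"]) auto
  qed
  then have "smooth_on (ph ` W) (H o inv_into U ph)" by (rule smooth_on_subset) (use U in auto)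
  then show ?thesis
  proof (rule smooth_on_cong[THEN iffD1, rotated])
   fix y assume "y : ph ` W"
   then obtain x where x: "x : U" "x : S" "y = ph x" using U by auto
   have "inj_on ph W" using inj U by (auto intro: inj_on_subset)
   then show "(H o inv_into U ph) y = (?H o inv_into W ph) y" using x inj U by (simp add: pb_def)
  qed
 qed
 then show "?H : C_inf (sub_mfd M S)" by (auto simp: C_inf_def pb_def)
qed

text \<open>Smoothness in a slice chart means, by the definition of \<open>smooth_on\<close>, being
  locally the restriction of a smooth function of the ambient linear space. That function is pulled
  back to \<open>M\<close> through global coordinate functions.\<close>

lemma C_inf_sub_mfd_extend:
 fixes M :: "('a, 'e::euclidean_space) mfd"
 assumes M: "mf M" and p: "p : S" and U: "(U, ph) : max_atlas M" "p : U"
  and F: "subspace F" "ph ` (U Int S) = ph ` U Int F" and h: "h : C_inf (sub_mfd M S)"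
 shows "EX H:C_inf M. ev (%z. z : S --> H z = h z) (nhm M p)"
proof -
 have A: "hatl M" using M by simp
 have pM: "p : pts M" using U by (auto simp: max_atlas_def)
 have inj: "inj_on ph U" using U by (auto simp: max_atlas_def is_chart_def)
 have injW: "inj_on ph (U Int S)" by (rule inj_on_subset[OF inj]) auto
 have "(U Int S, ph) : atlas (sub_mfd M S)" using U F by (auto simp: sub_mfd_def)
 from C_inf_chart[OF h this] have sh: "smooth_on (ph ` (U Int S)) (h o inv_into (U Int S) ph)" .
 have "ph p : ph ` (U Int S)" using p U by auto
 then obtain W g where W: "open W" "ph p : W" "Cinf W g" "ALL y:W Int ph ` (U Int S). g y = (h o inv_into (U Int S) ph) y"
  by (rule smooth_onE[OF sh])
 obtain V ps l n where V: "(V, ps) : atlas M" "p : V" "is_chart n (V, ps)"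
   "ev (%x. x : V) (nhm M p)" "coords M ps l p" "l p = ps p" by (rule mf_chart[OF M pM])
 have injV: "inj_on ps V" by (rule hatlD(2)[OF A V(1)])
 have c: "compatible_charts (V, ps) (U, ph)"
  using U(1) V(1) by (auto simp: max_atlas_def intro: compatible_charts_sym)
 have sc: "smooth_on (ps ` (V Int U)) (ph o inv_into V ps)" and oc: "openin (top_of_set (ps ` V)) (ps ` (V Int U))"
  using c by (auto simp: compatible_charts_def)
 have "ps p : ps ` (V Int U)" using U V by auto
 then obtain W' g' where W': "open W'" "ps p : W'" "Cinf W' g'" "ALL y:W' Int ps ` (V Int U). g' y = (ph o inv_into V ps) y"
  by (rule smooth_onE[OF sc])
 obtain T where T: "open T" "ps ` (V Int U) = ps ` V Int T" using oc by (auto simp: openin_open)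
 let ?Z = "(W' Int g' -` W) Int T"
 have oZ0: "open (W' Int g' -` W)" by (rule continuous_open_preimage[OF Cinf_continuous_on[OF W'(3)] W'(1) W(1)])
 have oZ: "open ?Z" using oZ0 T(1) by (rule open_Int)
 have CZ: "Cinf ?Z (%x. g (g' x))"
  by (rule Cinf_compose[OF oZ W(1) _ W(3) Cinf_subset[OF W'(3)]]) auto
 have "g' (ps p) = ph p" using W' injV V U by auto
 moreover have "ps p : T" using T U V by auto
 ultimately have lZ: "l p : ?Z" using W' W V by simp
 have lb: "(%x. l x *i b) : C_inf M" for b using V(5) by (simp add: coords_def)
 have el: "ev (%x. l x = ps x) (nhm M p)" using V(5) by (simp add: coords_def)
 obtain H where H: "H : C_inf M" "ev (%x. H x = g (g' (l x))) (nhm M p)"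
  using C_inf_compose_local[OF A pM lb oZ lZ CZ] by blast
 have "ev (%z. z : S --> H z = h z) (nhm M p)"
  using H(2) el V(4) eventually_C_inf_compose[OF A pM lb oZ lZ]
 proof eventually_elim
  case (elim z)
  show ?case
  proof
   assume zS: "z : S"
   have "ps z : ps ` (V Int U)" using T elim by auto
   then have zU: "z : U" using injV elim(3) by (auto simp: inj_on_eq_iff)
   have "g' (ps z) = ph z" using W'(4) elim zU injV by auto
   then have "H z = g (ph z)" "ph z : W" using elim by auto
   then show "H z = h z" using W(4) zU zS injW by auto
  qed
 qed
 then show ?thesis using H(1) by (rule bexI)
qed

subsection \<open>Fibre products over submersions\<close>

definition fib :: "('a, 'e::euclidean_space) mfd => ('b, 'd::euclidean_space) mfd => ('a => 'x) => ('b => 'x) => ('a \<times> 'b) set" where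
 "fib M N f g = {(x, y). x : pts M & y : pts N & f x = g y}"

text \<open>Take \<open>A\<close>, \<open>B\<close>, \<open>Th\<close> from the normal form of
  \<open>f\<close> and the chart \<open>(x, y) \<mapsto> (Th (ph x) - B (c (g y)), ps y)\<close>.
  Then \<open>A\<close> of the first component is \<open>c (f x) - c (g y)\<close>, so the fibre
  product is cut out by a linear subspace.\<close>

lemma fib_slice:
 fixes M :: "('a, 'e::euclidean_space) mfd" and N :: "('b, 'd::euclidean_space) mfd"
  and X :: "('x, 'c::euclidean_space) mfd"
 assumes M: "smooth_manifold M" and N: "smooth_manifold N" and X: "smooth_manifold X"
  and f: "submersion M X f" and g: "smooth_map N X g" and z: "z : fib M N f g"
 shows "EX D Ph F. (D, Ph) : max_atlas (prod_mfd M N) & z : D & subspace F & Ph ` (D Int fib M N f g) = Ph ` D Int F"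
proof -
 have mM: "mf M" and mN: "mf N" and mX: "mf X" using M N X by (auto intro: smooth_manifold_imp_mf)
 have AM: "hatl M" and AN: "hatl N" and AX: "hatl X" using mM mN mX by auto
 have sf: "smooth_map M X f" using f by (simp add: submersion_def)
 obtain p q where pq: "z = (p, q)" "p : pts M" "q : pts N" "f p = g q" using z by (auto simp: fib_def)
 obtain U ph k n where U: "(U, ph) : atlas M" "p : U" "is_chart n (U, ph)" by (rule mf_chart[OF mM pq(2)])
 obtain V ps l n' where V: "(V, ps) : atlas N" "q : V" "is_chart n' (V, ps)" by (rule mf_chart[OF mN pq(3)])
 have fpX: "f p : pts X" by (rule spb_points[OF smooth_map_imp_spb[OF AM AX sf] pq(2)])
 obtain C c j m where C: "(C, c) : atlas X" "f p : C" "is_chart m (C, c)" by (rule mf_chart[OF mX fpX])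
 have injU: "inj_on ph U" and injV: "inj_on ps V" and injC: "inj_on c C"
  using hatlD(2)[OF AM U(1)] hatlD(2)[OF AN V(1)] hatlD(2)[OF AX C(1)] by auto
 obtain O' :: "'e set" and Th :: "'e => 'e" and A :: "'e => 'c" and B :: "'c => 'e"
 where O: "open O'" "ph p : O'" "O' <= cdom (U, ph)" "ALL x:O'. f (cpar (U, ph) x) : C"
  and Th: "Cinf O' Th" "inj_on Th O'" "open (Th ` O')" "Cinf (Th ` O') (inv_into O' Th)"
  and AB: "linear A" "linear B" "range B <= cspace (U, ph)"
  "ALL x:O'. A (Th x) = c (f (cpar (U, ph) x))" "ALL y:cspace (C, c). A (B y) = y"
  "ALL x:O'. Th x : cspace (U, ph) <-> x : cspace (U, ph)"
  and fh: "Cinf O' (%x. c (f (cpar (U, ph) x)))"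
  by (rule submersion_normal_form[OF mM mX f U(1,3,2) C(1,3,2)])
 let ?E = "cspace (U, ph)" and ?E' = "cspace (V, ps)"
 let ?P = "cproj (V, ps)"
 let ?VC = "V Int g -` C"
 have oV: "openin (top_of_set (ps ` V)) (ps ` ?VC)" and sg: "smooth_on (ps ` ?VC) (c o g o inv_into V ps)"
  using g V(1) C(1) unfolding smooth_map_def by auto
 have "openin (top_of_set ?E') (ps ` ?VC)" using openin_trans[OF oV chartD(2)[OF V(3)]] .
 then obtain T where T: "open T" "ps ` ?VC = ?E' Int T" by (auto simp: openin_open)
 define W where "W = ?P -` (ps ` ?VC)"
 have "W = ?P -` T" using chartD(4)[OF V(3)] T by (auto simp: W_def)
 moreover have "continuous_on UNIV ?P"
  using chartD(3)[OF V(3)] by (simp add: linear_continuous_on linear_conv_bounded_linear)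
 ultimately have oW: "open W" using T(1) by (simp add: open_vimage)
 define gh where "gh y = c (g (cpar (V, ps) y))" for y
 have gh: "Cinf W gh" using smooth_on_compose_Cinf[OF sg oW Cinf_linear[OF chartD(3)[OF V(3)] oW]]
  by (simp add: gh_def[abs_def] cpar_def W_def)
 have VW: "ps y : W" "gh (ps y) = c (g y)" if "y : ?VC" for y
  using that cparD(4,5)[OF V(3)] by (auto simp: W_def gh_def)
 have WE: "EX y:?VC. x = ps y" if "x : W" "x : ?E'" for x
  using that chartD(5)[OF V(3)] by (auto simp: W_def)
 have bB: "bounded_linear B" using AB(2) by (simp add: linear_conv_bounded_linear)
 define Z where "Z = (UNIV \<times> W) Int (%z. fst z + B (gh (snd z))) -` (Th ` O')"
 have oUW: "open ((UNIV :: 'e set) \<times> W)" using oW by (simp add: open_Times)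
 have cghs: "Cinf ((UNIV :: 'e set) \<times> W) (%z. gh (snd z))"
  by (rule Cinf_compose[OF oUW oW _ gh Cinf_bounded_linear[OF bounded_linear_snd oUW]]) auto
 have CT: "Cinf (UNIV \<times> W) (%z. fst z + B (gh (snd z)))"
  by (rule Cinf_add[OF oUW Cinf_bounded_linear[OF bounded_linear_fst oUW] Cinf_compose_bounded_linear[OF bB oUW cghs]])
 have oZ: "open Z" unfolding Z_def
  by (rule continuous_open_preimage[OF Cinf_continuous_on[OF CT] oUW Th(3)])
 define D where "D = (U Int ph -` O') \<times> ?VC"
 define Ph where "Ph = (%(x, y). (Th (ph x) - B (c (g y)), ps y))"
 have DU: "D <= U \<times> V" by (auto simp: D_def)
 have injD: "inj_on Ph D"
 proof (rule inj_onI)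
  fix r s assume rs: "r : D" "s : D" "Ph r = Ph s"
  then have "ps (snd r) = ps (snd s)" by (auto simp: Ph_def split_beta)
  then have 1: "snd r = snd s" using injV rs by (auto simp: D_def inj_on_eq_iff)
  then have "Th (ph (fst r)) = Th (ph (fst s))" using rs by (auto simp: Ph_def split_beta)
  then have "ph (fst r) = ph (fst s)" using Th(2) rs by (auto simp: D_def inj_on_eq_iff)
  then have "fst r = fst s" using injU rs by (auto simp: D_def inj_on_eq_iff)
  with 1 show "r = s" by (simp add: prod_eq_iff)
 qed
 have BE: "B y : ?E" for y using AB(3) by auto
 have sE: "subspace ?E" and sE': "subspace ?E'" using chartD(1) U(3) V(3) by auto
 have im: "Ph ` D = (?E \<times> ?E') Int Z"
 proof (rule Set.set_eqI, rule iffI)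
  fix w assume "w : Ph ` D"
  then obtain x y where xy: "w = Ph (x, y)" "x : U" "ph x : O'" "y : ?VC" by (auto simp: D_def)
  have "ph x : ?E" using chartD(6)[OF U(3)] xy by auto
  then have "Th (ph x) : ?E" using AB(6) xy by blast
  then have "Th (ph x) - B (c (g y)) : ?E" using BE sE by (blast intro: subspace_diff)
  moreover have "ps y : ?E'" using chartD(6)[OF V(3)] xy by auto
  ultimately show "w : (?E \<times> ?E') Int Z" using VW[OF xy(4)] xy by (auto simp: Ph_def Z_def)
 next
  fix w assume w: "w : (?E \<times> ?E') Int Z"
  then obtain y where y: "y : ?VC" "snd w = ps y" using WE[of "snd w"] by (auto simp: Z_def)
  obtain x where x: "x : O'" "Th x = fst w + B (c (g y))" using w VW(2)[OF y(1)] y by (auto simp: Z_def)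
  have "Th x : ?E" using x w BE sE by (auto intro: subspace_add)
  then have xE: "x : ?E" using AB(6) x by blast
  have xd: "x : cdom (U, ph)" using x O(3) by blast
  let ?m = "cpar (U, ph) x"
  have "ph ?m = x" "?m : U" using cparD(1,2)[OF U(3) xd] chartD(5)[OF U(3) xE] by auto
  then have "(?m, y) : D" "Ph (?m, y) = w" using x y by (auto simp: D_def Ph_def prod_eq_iff)
  then show "w : Ph ` D" by (metis image_eqI)
 qed
 have chart: "is_chart (dim (?E \<times> ?E')) (D, Ph)" unfolding is_chart_def prod.case
 proof (intro conjI exI[of _ "?E \<times> ?E'"])
  show "openin (top_of_set (?E \<times> ?E')) (Ph ` D)" unfolding im using oZ by (rule openin_open_Int)
 qed (use injD sE sE' in "auto intro: subspace_Times")
 have AMN: "hatl (prod_mfd M N)" by (rule hatl_prod[OF AM AN])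
 have compat: "ALL c:atlas (prod_mfd M N). ALL d:atlas (prod_mfd M N). compatible_charts c d"
 proof (intro ballI)
  fix c d assume "c : atlas (prod_mfd M N)" "d : atlas (prod_mfd M N)"
  then obtain U ph V ps U' ph' V' ps' where cd: "c = (U \<times> V, map_prod ph ps)" "d = (U' \<times> V', map_prod ph' ps')"
   and a: "(U, ph) : atlas M" "(V, ps) : atlas N" "(U', ph') : atlas M" "(V', ps') : atlas N"
   unfolding atlas_prod by blast
  have "compatible_charts (U, ph) (U', ph')" "compatible_charts (V, ps) (V', ps')"
   using M N a unfolding smooth_manifold_def by blast+
  then show "compatible_charts c d" unfolding cd
   by (rule compatible_charts_prod) (use a hatlD(2)[OF AM] hatlD(2)[OF AN] in auto)
 qed
 let ?ze = "map_prod ph ps"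
 have UV: "(U \<times> V, ?ze) : atlas (prod_mfd M N)" using U V by (auto simp: atlas_prod)
 have imUV: "?ze ` (U \<times> V) = ph ` U \<times> ps ` V" by (rule map_prod_surj_on[OF refl refl])
 have imD: "?ze ` D = (ph ` U Int O') \<times> ps ` ?VC" unfolding D_def map_prod_surj_on[OF refl refl] by auto
 have 1: "openin (top_of_set (?ze ` (U \<times> V))) (?ze ` D)"
  unfolding imUV imD by (rule openin_Times[OF openin_open_Int[OF O(1)] oV])
 have inv: "inv_into (U \<times> V) ?ze w = (inv_into U ph (fst w), inv_into V ps (snd w))" if "w : ph ` U \<times> ps ` V" for w
  by (rule inv_into_map_prod[OF injU injV that])
 have oOW: "open (O' \<times> W)" using O(1) oW by (rule open_Times)
 have "Cinf (O' \<times> W) (%w. (Th (fst w) - B (gh (snd w)), snd w))"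
  by (intro Cinf_Pair Cinf_diff oOW Cinf_compose[OF oOW O(1) _ Th(1) Cinf_bounded_linear[OF bounded_linear_fst oOW]]
    Cinf_compose_bounded_linear[OF bB oOW] Cinf_compose[OF oOW oW _ gh Cinf_bounded_linear[OF bounded_linear_snd oOW]]
    Cinf_bounded_linear[OF bounded_linear_snd oOW]) auto
 then have "smooth_on (?ze ` D) (%w. (Th (fst w) - B (gh (snd w)), snd w))"
  by (rule Cinf_imp_smooth_on[OF oOW]) (use VW in "auto simp: imD")
 then have 2: "smooth_on (?ze ` D) (Ph o inv_into (U \<times> V) ?ze)"
 proof (rule smooth_on_cong[THEN iffD1, rotated])
  fix w assume w: "w : ?ze ` D"
  then obtain x y where xy: "w = (ph x, ps y)" "x : U" "y : ?VC" by (auto simp: D_def)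
  then show "(Th (fst w) - B (gh (snd w)), snd w) = (Ph o inv_into (U \<times> V) ?ze) w"
   using inv[of w] injU injV VW(2)[OF xy(3)] by (auto simp: Ph_def)
 qed
 have "Cinf Z (%w. (inv_into O' Th (fst w + B (gh (snd w))), snd w))"
  by (intro Cinf_Pair oZ Cinf_compose[OF oZ Th(3) _ Th(4) Cinf_subset[OF CT]]
    Cinf_bounded_linear[OF bounded_linear_snd oZ]) (auto simp: Z_def)
 then have "smooth_on (Ph ` D) (%w. (inv_into O' Th (fst w + B (gh (snd w))), snd w))"
  by (rule Cinf_imp_smooth_on[OF oZ]) (auto simp: im)
 then have 3: "smooth_on (Ph ` D) (?ze o inv_into D Ph)"
 proof (rule smooth_on_cong[THEN iffD1, rotated])
  fix w assume "w : Ph ` D"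
  then obtain x y where xy: "w = Ph (x, y)" "x : U" "ph x : O'" "y : ?VC" "(x, y) : D" by (auto simp: D_def)
  have "inv_into D Ph w = (x, y)" using injD xy by simp
  moreover have "fst w + B (gh (snd w)) = Th (ph x)" using xy VW(2)[OF xy(4)] by (simp add: Ph_def)
  ultimately show "(inv_into O' Th (fst w + B (gh (snd w))), snd w) = (?ze o inv_into D Ph) w"
   using Th(2) xy by (simp add: Ph_def)
 qed
 have max: "(D, Ph) : max_atlas (prod_mfd M N)"
  by (rule max_atlasI[OF AMN compat UV DU 1 chart 2 3])
 have zD: "z : D" using pq U V C O by (auto simp: D_def)
 let ?F = "{w :: 'e \<times> 'd. A (fst w) = 0}"
 have F: "subspace ?F"
  by (rule subspaceI) (auto simp: linear_0[OF AB(1)] linear_add[OF AB(1)] linear_scale[OF AB(1)])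
 have key: "A (fst (Ph (x, y))) = 0 <-> f x = g y" if "(x, y) : D" for x y
 proof -
  have xy: "x : U" "ph x : O'" "y : ?VC" using that by (auto simp: D_def)
  have fx: "f x : C" "A (Th (ph x)) = c (f x)"
   using bspec[OF O(4) xy(2)] bspec[OF AB(4) xy(2)] cparD(4)[OF U(3) xy(1)] by auto
  have "A (B (c (g y))) = c (g y)" using AB(5) chartD(6)[OF C(3)] xy by blast
  then have "A (fst (Ph (x, y))) = c (f x) - c (g y)" using fx by (simp add: Ph_def linear_diff[OF AB(1)])
  then show ?thesis using injC fx xy by (auto simp: inj_on_eq_iff)
 qed
 have "Ph ` (D Int fib M N f g) = Ph ` D Int ?F"
 proof -
  have "D Int fib M N f g = {w : D. A (fst (Ph w)) = 0}"
  proof (intro Set.set_eqI)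
   fix w :: "'a \<times> 'b"
   obtain x y where w: "w = (x, y)" by (cases w)
   have "x : pts M & y : pts N" if "(x, y) : D"
    using that DU hatlD(1)[OF AM U(1)] hatlD(1)[OF AN V(1)] by blast
   then show "w : D Int fib M N f g <-> w : {w : D. A (fst (Ph w)) = 0}"
    unfolding w using key[of x y] by (auto simp: fib_def)
  qed
  then show ?thesis by auto
 qed
 then show ?thesis using max zD F by blast
qed

locale fibre_product =
 fixes M :: "('a, 'e::euclidean_space) mfd" and N :: "('b, 'd::euclidean_space) mfd"
  and X :: "('x, 'c::euclidean_space) mfd" and f :: "'a => 'x" and g :: "'b => 'x"
 assumes M: "smooth_manifold M" and N: "smooth_manifold N" and X: "smooth_manifold X"
  and f: "submersion M X f" and g: "smooth_map N X g"
begin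

abbreviation "FP == sub_mfd (prod_mfd M N) (fib M N f g)"

lemma mf [simp]: "mf M" "mf N" "mf X" using M N X by (auto intro: smooth_manifold_imp_mf)

lemma atl [simp]: "hatl M" "hatl N" "hatl X" "hatl (prod_mfd M N)" by (auto intro: hatl_prod)

lemma spb_f: "spb M X f" using f by (intro smooth_map_imp_spb) (auto simp: submersion_def)

lemma spb_g: "spb N X g" using g by (intro smooth_map_imp_spb) auto

lemma fib_points: "fib M N f g <= pts (prod_mfd M N)" by (auto simp: fib_def)

lemma fibD: "z : fib M N f g ==> f (fst z) = g (snd z)" by (auto simp: fib_def)

lemma atl_FP [simp]: "hatl FP" by (rule hatl_sub_mfd, rule fib_slice[OF M N X f g])

lemma spb_incl: "spb FP (prod_mfd M N) (%z. z)" by (rule spb_sub_mfd[OF atl(4) fib_points])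

lemma spb_p1: "spb FP M fst" using spb_compose[OF spb_incl spb_fst[OF atl(1,2)]] .

lemma spb_p2: "spb FP N snd" using spb_compose[OF spb_incl spb_snd[OF atl(1,2)]] .

lemma extend: assumes h: "h : C_inf FP" and z: "z : fib M N f g"
 obtains H where "H : C_inf (prod_mfd M N)"
  "ev (%w. w : fib M N f g --> H w = h w) (nhm (prod_mfd M N) z)"
proof -
 obtain D Ph F where "(D, Ph) : max_atlas (prod_mfd M N)" "z : D" "subspace F"
  "Ph ` (D Int fib M N f g) = Ph ` D Int F" using fib_slice[OF M N X f g z] by blast
 then have "EX H:C_inf (prod_mfd M N). ev (%w. w : fib M N f g --> H w = h w) (nhm (prod_mfd M N) z)"
  using C_inf_sub_mfd_extend[OF mf_prod[OF mf(1,2)] z _ _ _ _ h] by blast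
 then show ?thesis using that by blast
qed

lemma eventually_incl: "z : fib M N f g ==> ev Q (nhm (prod_mfd M N) z) ==> ev Q (nhm FP z)"
 using spb_eventually[OF atl_FP atl(4) spb_incl, of z Q] by simp

text \<open>A smooth function on the fibre product becomes differentiable along the pair of curves
  once it is extended to the product; this uses that the pair stays in the fibre product for times
  near 0.\<close>

lemma velocity:
 assumes v: "has_vel M ga p v" and w: "has_vel N de q w" and pq: "(p, q) : fib M N f g"
  and e: "ev (%t. f (ga t) = g (de t)) (nhds 0)"
 obtains z where "has_vel FP (%t. (ga t, de t)) (p, q) z" "z : TS FP (p, q)"
  "tmap FP M fst z = v" "tmap FP N snd z = w"
proof -
 have p: "p : pts M" and q: "q : pts N" using pq by (auto simp: fib_def)
 have pts: "(p, q) : pts (prod_mfd M N)" using p q by simp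
 have pqF: "(p, q) : pts FP" using pq by simp
 note P = has_vel_pair[OF mf(1,2) p q v w]
 have "ev (%t. ga t : pts M) (nhds 0)"
  by (rule has_vel_eventually[OF atl(1) p v ev_pts[OF atl(1) p]])
 moreover have "ev (%t. de t : pts N) (nhds 0)"
  by (rule has_vel_eventually[OF atl(2) q w ev_pts[OF atl(2) q]])
 ultimately have inS: "ev (%t. (ga t, de t) : fib M N f g) (nhds 0)"
  using e by eventually_elim (simp add: fib_def)
 have ex: "EX d. ((%t. h (ga t, de t)) has_real_derivative d) (at 0)" if h: "h : C_inf FP" for h
 proof -
  obtain H where H: "H : C_inf (prod_mfd M N)"
   "ev (%w. w : fib M N f g --> H w = h w) (nhm (prod_mfd M N) (p, q))" by (rule extend[OF h pq])
  have "ev (%t. H (ga t, de t) = h (ga t, de t)) (nhds 0)"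
   using has_vel_eventually[OF atl(4) pts P H(2)] inS by eventually_elim simp
  from DERIV_cong_nhds[OF this has_velD[OF P H(1)]] show ?thesis by blast
 qed
 define z where "z h = (if h : C_inf FP then (SOME d. ((%t. h (ga t, de t)) has_real_derivative d) (at 0)) else 0)" for h
 have "has_vel FP (%t. (ga t, de t)) (p, q) z"
  using has_vel_0[OF v] has_vel_0[OF w] someI_ex[OF ex] by (auto simp: has_vel_def z_def)
 moreover from this have "z : TS FP (p, q)" by (rule has_vel_tangent)
 moreover have "tmap FP M fst z = v"
  using has_vel_unique[OF has_vel_tmap[OF atl_FP pqF spb_p1 calculation(1)]] v by simp
 moreover have "tmap FP N snd z = w"
  using has_vel_unique[OF has_vel_tmap[OF atl_FP pqF spb_p2 calculation(1)]] w by simp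
 ultimately show ?thesis by (rule that)
qed

lemma tangent_FP: assumes z: "z : TS FP (p, q)" and pq: "(p, q) : fib M N f g" and h: "h : C_inf FP"
  and H: "H : C_inf (prod_mfd M N)"
  and e: "ev (%w. w : fib M N f g --> H w = h w) (nhm (prod_mfd M N) (p, q))"
 shows "z h = tmap FP M fst z (%x. H (x, q)) + tmap FP N snd z (%y. H (p, y))"
proof -
 have p: "p : pts M" and q: "q : pts N" using pq by (auto simp: fib_def)
 let ?i = "%z::'a \<times> 'b. z" and ?P = "prod_mfd M N"
 have pqF: "(p, q) : pts FP" using pq by simp
 have "ev (%w. h w = pb FP ?i H w) (nhm FP (p, q))"
  using eventually_incl[OF pq e] ev_pts[OF atl_FP pqF] by eventually_elim (simp add: pb_def)
 then have "z h = z (pb FP ?i H)" by (rule tangent_local[OF atl_FP pqF z h spb_pb[OF spb_incl H]])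
 also have "... = tmap FP ?P ?i z H" by (rule tmap_pb[OF H, symmetric])
 also have "... = tmap ?P M fst (tmap FP ?P ?i z) (%x. H (x, q)) + tmap ?P N snd (tmap FP ?P ?i z) (%y. H (p, y))"
  by (rule tangent_prod[OF mf(1,2) p q tmap_tangent[OF spb_incl pqF z] H])
 also have "tmap ?P M fst (tmap FP ?P ?i z) = tmap FP M fst z"
  by (rule tmap_compose[OF spb_incl spb_fst[OF atl(1,2)]])
 also have "tmap ?P N snd (tmap FP ?P ?i z) = tmap FP N snd z"
  by (rule tmap_compose[OF spb_incl spb_snd[OF atl(1,2)]])
 finally show ?thesis .
qed

lemma tangent_unique: assumes "z : TS FP (p, q)" "z' : TS FP (p, q)" and pq: "(p, q) : fib M N f g"
  and "tmap FP M fst z = tmap FP M fst z'" "tmap FP N snd z = tmap FP N snd z'" shows "z = z'"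
proof
 fix h
 show "z h = z' h"
 proof (cases "h : C_inf FP")
  case True
  obtain H where H: "H : C_inf (prod_mfd M N)"
   "ev (%w. w : fib M N f g --> H w = h w) (nhm (prod_mfd M N) (p, q))" by (rule extend[OF True pq])
  show ?thesis
   using tangent_FP[OF assms(1) pq True H] tangent_FP[OF assms(2) pq True H] assms(4,5) by simp
 qed (use tangentD(4)[OF assms(1)] tangentD(4)[OF assms(2)] in simp)
qed

text \<open>The second curve is chosen freely; the first is obtained by lifting the image of the
  second under \<open>g\<close> through the submersion \<open>f\<close>.\<close>

lemma curves_exist: assumes v: "v : TS M p" and w: "w : TS N q" and pq: "(p, q) : fib M N f g"
  and e: "tmap M X f v = tmap N X g w"
 obtains ga de where "has_vel M ga p v" "has_vel N de q w" "ev (%t. f (ga t) = g (de t)) (nhds 0)"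
proof -
 have p: "p : pts M" and q: "q : pts N" and fg: "f p = g q" using pq by (auto simp: fib_def)
 obtain de where de: "has_vel N de q w" using has_vel_exists[OF mf(2) q w] by blast
 have "has_vel X (%t. g (de t)) (f p) (tmap M X f v)"
  using has_vel_tmap[OF atl(2) q spb_g de] fg e by simp
 from lift_velocity[OF mf(1,3) f p v this] de that show ?thesis by blast
qed

text \<open>The description that occurs in \<open>tcmp\<close>, isolated so that existence and
  uniqueness can be supplied, by the lemmas \<open>fpair\<close> and
  \<open>fpair_eq\<close>.\<close>

definition fpair :: "'a \<times> 'b => 'a tvec => 'b tvec => ('a \<times> 'b) tvec" where
 "fpair x v w = (THE z. z : TS FP x & tmap FP M fst z = v & tmap FP N snd z = w)"

lemma fpair_eq:
 assumes "z : TS FP (p, q)" "(p, q) : fib M N f g" "tmap FP M fst z = v" "tmap FP N snd z = w"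
 shows "fpair (p, q) v w = z" unfolding fpair_def
proof (rule the_equality)
 fix z' assume "z' : TS FP (p, q) & tmap FP M fst z' = v & tmap FP N snd z' = w"
 then show "z' = z" using assms(3,4) by (intro tangent_unique[OF _ assms(1,2)]) auto
qed (use assms in auto)

lemma fpair: assumes v: "v : TS M p" and w: "w : TS N q" and pq: "(p, q) : fib M N f g"
  and e: "tmap M X f v = tmap N X g w"
 shows "fpair (p, q) v w : TS FP (p, q)" "tmap FP M fst (fpair (p, q) v w) = v"
  "tmap FP N snd (fpair (p, q) v w) = w"
proof -
 obtain ga de where *: "has_vel M ga p v" "has_vel N de q w" "ev (%t. f (ga t) = g (de t)) (nhds 0)"
  by (rule curves_exist[OF assms])
 obtain z where "has_vel FP (%t. (ga t, de t)) (p, q) z" and z: "z : TS FP (p, q)"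
  "tmap FP M fst z = v" "tmap FP N snd z = w" by (rule velocity[OF *(1,2) pq *(3)])
 then show "fpair (p, q) v w : TS FP (p, q)" "tmap FP M fst (fpair (p, q) v w) = v"
  "tmap FP N snd (fpair (p, q) v w) = w" using fpair_eq[OF z(1) pq z(2,3)] by auto
qed

lemma fpair_velocity: assumes "has_vel M ga p v" "has_vel N de q w" "(p, q) : fib M N f g"
  "ev (%t. f (ga t) = g (de t)) (nhds 0)"
 shows "has_vel FP (%t. (ga t, de t)) (p, q) (fpair (p, q) v w)"
proof -
 obtain z where z: "has_vel FP (%t. (ga t, de t)) (p, q) z" "z : TS FP (p, q)"
  "tmap FP M fst z = v" "tmap FP N snd z = w" by (rule velocity[OF assms])
 then show ?thesis using fpair_eq[OF z(2) assms(3) z(3,4)] by simp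
qed

text \<open>By \<open>tangent_FP\<close> the value on \<open>h\<close> is the sum of the partial
  derivatives of a local extension \<open>H\<close>; both are smooth by
  \<open>C_inf_field_along\<close>, the second after swapping the factors.\<close>

lemma C_inf_fpair: assumes a: "!!z. z : fib M N f g ==> a z : TS M (fst z)"
  and b: "!!z. z : fib M N f g ==> b z : TS N (snd z)"
  and ab: "!!z. z : fib M N f g ==> tmap M X f (a z) = tmap N X g (b z)"
  and sa: "!!F. F : C_inf M ==> (%z. if z : pts FP then a z F else 0) : C_inf FP"
  and sb: "!!F. F : C_inf N ==> (%z. if z : pts FP then b z F else 0) : C_inf FP"
  and h: "h : C_inf FP" shows "(%z. if z : pts FP then fpair z (a z) (b z) h else 0) : C_inf FP"
proof (rule C_infI[OF atl_FP])
 fix z0 assume "z0 : pts FP"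
 then have z0: "z0 : fib M N f g" by simp
 let ?P = "prod_mfd M N"
 obtain H where H: "H : C_inf ?P"
   "ev (%w. w : fib M N f g --> H w = h w) (nhm ?P z0)" by (rule extend[OF h z0])
 have z0P: "z0 : pts ?P" using z0 fib_points by blast
 let ?A = "%z. if z : pts FP then a z (%x. H (x, snd z)) else 0"
 let ?B = "%z. if z : pts FP then b z (%y. H (fst z, y)) else 0"
 have A: "?A : C_inf FP"
  by (rule C_inf_field_along[where a=a, OF atl_FP mf(1,2) spb_p1 spb_p2 _ sa H(1)]) (use a in auto)
 have H': "(%z. H (snd z, fst z)) : C_inf (prod_mfd N M)" by (rule C_inf_swap[OF mf(1,2) H(1)])
 have B: "?B : C_inf FP"
  using C_inf_field_along[where a=b, OF atl_FP mf(2,1) spb_p2 spb_p1 _ sb H', unfolded fst_conv snd_conv] b by simp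
 have "ev (%z. (if z : pts FP then fpair z (a z) (b z) h else 0) = (?A + ?B) z) (nhm FP z0)"
  using eventually_incl[OF z0 ev_ev_nhm[OF atl(4) z0P H(2)]]
 proof eventually_elim
  case (elim z)
  show ?case
  proof (cases "z : fib M N f g")
   case True
   obtain p q where z: "z = (p, q)" by (cases z)
   have pq: "(p, q) : fib M N f g" using True z by simp
   have "a (p, q) : TS M p" "b (p, q) : TS N q" using a[OF pq] b[OF pq] by auto
   note fp = fpair[OF this pq ab[OF pq]]
   show ?thesis using tangent_FP[OF fp(1) pq h H(1)] elim True unfolding z fp by simp
  qed simp
 qed
 then show "EX g:C_inf FP. ev (%z. (if z : pts FP then fpair z (a z) (b z) h else 0) = g z) (nhm FP z0)"
  using C_inf_add[OF A B] by blast
qed simp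

end

section \<open>Vector fields\<close>

lemma vfD: assumes "xi : VF M" shows "p : pts M ==> xi p : TS M p" "p ~: pts M ==> xi p = 0"
  "f : C_inf M ==> lie_der xi f : C_inf M" using assms by (auto simp: vector_fields_def lie_der_def)

lemma vfI: assumes "!!p. p : pts M ==> xi p : TS M p" "!!p. p ~: pts M ==> xi p = 0"
  "!!f. f : C_inf M ==> (%p. if p : pts M then xi p f else 0) : C_inf M" shows "xi : VF M"
proof -
 have "(%p. xi p f) : C_inf M" if "f : C_inf M" for f
 proof -
  have "(%p. if p : pts M then xi p f else 0) = (%p. xi p f)" using assms(2) by auto
  then show ?thesis using assms(3)[OF that] by simp
 qed
 then show ?thesis using assms(1,2) by (auto simp: vector_fields_def)
qed

lemma vf_subspace: "subspace (VF M)"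
proof (rule subspaceI)
 show "0 : VF M"
  using C_inf_zero[of M] subspace_0[OF tangent_subspace] by (auto simp: vector_fields_def zero_fun_def)
next
 fix xi et assume "xi : VF M" "et : VF M"
 then show "xi + et : VF M"
  using C_inf_add subspace_add[OF tangent_subspace] by (fastforce simp: vector_fields_def plus_fun_def)
next
 fix c :: real and xi assume "xi : VF M"
 then show "c *r xi : VF M" using C_inf_scaleR subspace_scale[OF tangent_subspace]
  by (fastforce simp: vector_fields_def scaleR_fun_def)
qed

lemma lie_der_add: "xi : VF M ==> f : C_inf M ==> g : C_inf M ==> lie_der xi (f + g) = lie_der xi f + lie_der xi g"
 using vfD(1,2) tangentD(1) by (fastforce simp: lie_der_def fun_eq_iff)

lemma lie_der_scaleR: "xi : VF M ==> f : C_inf M ==> lie_der xi (c *r f) = c *r lie_der xi f"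
 using vfD(1,2) tangentD(3) by (fastforce simp: lie_der_def fun_eq_iff scaleR_fun_def)

lemma lie_der_mult: "xi : VF M ==> f : C_inf M ==> g : C_inf M ==>
  lie_der xi (f * g) = f * lie_der xi g + g * lie_der xi f"
 using vfD(1,2) tangentD(2) by (fastforce simp: lie_der_def fun_eq_iff)

lemma lbr_apply: "f : C_inf M ==> lbr M xi et p f = xi p (lie_der et f) - et p (lie_der xi f)"
 by (simp add: lie_bracket_def)

lemma lie_der_bracket: "f : C_inf M ==> lie_der (lbr M xi et) f = lie_der xi (lie_der et f) - lie_der et (lie_der xi f)"
 by (auto simp: lie_der_def lie_bracket_def fun_eq_iff)

lemma lbr_vector_field: assumes xi: "xi : VF M" and et: "et : VF M" shows "lbr M xi et : VF M"
 unfolding vector_fields_def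
proof (intro CollectI conjI ballI allI impI)
 note d = vfD(3)[OF xi] vfD(3)[OF et]
 show "lbr M xi et p : TS M p" if p: "p : pts M" for p unfolding tangent_space_def
 proof (intro CollectI conjI ballI allI impI)
  note t = vfD(1)[OF xi p] vfD(1)[OF et p]
  fix f g assume f: "f : C_inf M" and g: "g : C_inf M"
  show "lbr M xi et p (f + g) = lbr M xi et p f + lbr M xi et p g"
   using f g d tangentD(1)[OF t(1)] tangentD(1)[OF t(2)]
   by (simp add: lbr_apply C_inf_add lie_der_add[OF xi] lie_der_add[OF et])
  show "lbr M xi et p (f * g) = f p * lbr M xi et p g + g p * lbr M xi et p f"
   using f g d tangentD(1,2)[OF t(1)] tangentD(1,2)[OF t(2)]
   by (simp add: lbr_apply C_inf_mult lie_der_mult[OF xi] lie_der_mult[OF et])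
    (simp add: lie_der_def algebra_simps)
 next
  note t = vfD(1)[OF xi p] vfD(1)[OF et p]
  fix f c assume f: "f : C_inf M"
  show "lbr M xi et p (c *r f) = c * lbr M xi et p f"
   using f d tangentD(3)[OF t(1)] tangentD(3)[OF t(2)]
   by (simp add: lbr_apply C_inf_scaleR lie_der_scaleR[OF xi] lie_der_scaleR[OF et] algebra_simps)
 qed (simp add: lie_bracket_def)
 show "lbr M xi et p = 0" if "p ~: pts M" for p
  using vfD(2)[OF xi that] vfD(2)[OF et that] by (auto simp: lie_bracket_def)
 show "(%p. lbr M xi et p f) : C_inf M" if f: "f : C_inf M" for f
  using C_inf_diff[OF vfD(3)[OF xi vfD(3)[OF et f]] vfD(3)[OF et vfD(3)[OF xi f]]]
  by (simp add: lie_der_bracket[OF f, unfolded lie_der_def] lie_der_def)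
qed

lemma lbr_skew: "lbr M xi et = - lbr M et xi" by (auto simp: lie_bracket_def fun_eq_iff)

lemma lbr_linear2: assumes xi: "xi : VF M" and et: "et : VF M" and ze: "ze : VF M"
 shows "lbr M xi (b *r et + c *r ze) = b *r lbr M xi et + c *r lbr M xi ze"
proof (intro ext)
 fix p f
 show "lbr M xi (b *r et + c *r ze) p f = (b *r lbr M xi et + c *r lbr M xi ze) p f"
 proof (cases "f : C_inf M & p : pts M")
  case True
  have "lie_der (b *r et + c *r ze) f = b *r lie_der et f + c *r lie_der ze f"
   by (simp add: lie_der_def fun_eq_iff scaleR_fun_def)
  moreover have "xi p (b *r lie_der et f + c *r lie_der ze f) = b * xi p (lie_der et f) + c * xi p (lie_der ze f)"
   using True vfD(3)[OF et] vfD(3)[OF ze] by (simp add: tangentD[OF vfD(1)[OF xi]] C_inf_scaleR)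
  ultimately show ?thesis using True by (simp add: lbr_apply scaleR_fun_def algebra_simps)
 next
  case False
  then show ?thesis using vfD(2)[OF xi] vfD(2)[OF et] vfD(2)[OF ze]
   by (auto simp: lie_bracket_def scaleR_fun_def)
 qed
qed

lemma lbr_zero [simp]: assumes xi: "xi : VF M" shows "lbr M xi 0 = 0" "lbr M 0 xi = 0"
proof -
 show "lbr M xi 0 = 0" using lbr_linear2[OF xi xi xi, of 0 0] by simp
 then show "lbr M 0 xi = 0" using lbr_skew[of M 0 xi] by simp
qed

lemma lbr_jacobi: assumes xi: "xi : VF M" and et: "et : VF M" and ze: "ze : VF M"
 shows "lbr M (lbr M xi et) ze =
  lbr M xi (lbr M et ze) - lbr M et (lbr M xi ze)"
proof (intro ext)
 fix p f
 show "lbr M (lbr M xi et) ze p f = (lbr M xi (lbr M et ze) - lbr M et (lbr M xi ze)) p f"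
 proof (cases "f : C_inf M & p : pts M")
  case True
  then have f: "f : C_inf M" and p: "p : pts M" by auto
  note C = vfD(3)[OF xi] vfD(3)[OF et] vfD(3)[OF ze]
  note t = tangent_diff[OF vfD(1)[OF xi p]] tangent_diff[OF vfD(1)[OF et p]]
   tangent_diff[OF vfD(1)[OF ze p]]
  show ?thesis by (simp add: lbr_apply lie_der_bracket f C t)
 next
  case False
  then show ?thesis using vfD(2)[OF xi] vfD(2)[OF et] vfD(2)[OF ze] by (auto simp: lie_bracket_def)
 qed
qed

definition related :: "('a, 'e::euclidean_space) mfd => ('b, 'd::euclidean_space) mfd => ('a => 'b) =>
  ('a => 'a tvec) => ('b => 'b tvec) => bool" where
 "related M N f xi et <-> (ALL p:pts M. tmap M N f (xi p) = et (f p))"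

lemma related_lie_der: assumes r: "related M N f xi et" and xi: "xi : VF M" and g: "g : C_inf N"
 shows "lie_der xi (pb M f g) = pb M f (lie_der et g)"
proof
 fix p
 show "lie_der xi (pb M f g) p = pb M f (lie_der et g) p"
  using r tmap_pb[OF g, of M f "xi p"] vfD(2)[OF xi, of p]
  by (cases "p : pts M") (auto simp: related_def lie_der_def pb_def)
qed

lemma related_bracket: assumes f: "spb M N f" and r: "related M N f xi et" "related M N f xi' et'"
  and xi: "xi : VF M" "xi' : VF M" and et: "et : VF N" "et' : VF N"
 shows "related M N f (lbr M xi xi') (lbr N et et')" unfolding related_def
proof (intro ballI ext)
 fix p g assume p: "p : pts M"
 show "tmap M N f (lbr M xi xi' p) g = lbr N et et' (f p) g"
 proof (cases "g : C_inf N")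
  case True
  note pg = spb_pb[OF f True]
  have "tmap M N f (lbr M xi xi' p) g =
    xi p (pb M f (lie_der et' g)) - xi' p (pb M f (lie_der et g))"
   by (simp add: tmap_pb[OF True] lbr_apply[OF pg]
     related_lie_der[OF r(1) xi(1) True] related_lie_der[OF r(2) xi(2) True])
  also have "... = tmap M N f (xi p) (lie_der et' g) - tmap M N f (xi' p) (lie_der et g)"
   using vfD(3)[OF et(1) True] vfD(3)[OF et(2) True] by (simp add: tmap_pb)
  also have "... = lbr N et et' (f p) g" using r p by (simp add: related_def lbr_apply[OF True])
  finally show ?thesis .
 qed (simp add: tmap_def lie_bracket_def)
qed

section \<open>Tangent calculus on Lie groupoids\<close>

lemma subspaceI2: assumes "0 : S" "!!x y b c. x : S ==> y : S ==> b *r x + c *r y : S"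
 shows "subspace S"
 using assms(1) assms(2)[of _ _ 1 1] assms(2)[of _ _ _ 0] by (intro subspaceI) fastforce+

locale lgroupoid =
 fixes X :: "('o, 'a, 'e::euclidean_space) lgpd" assumes groupoid: "lie_groupoid X"
begin

abbreviation "A == Arr X"
abbreviation "Ob == Obj X"
abbreviation "Cp == fib A A (src X) (tgt X)"
abbreviation "mul x y == cmp X x y"

sublocale fibre_product A A Ob "src X" "tgt X"
 using groupoid by unfold_locales (auto simp: lie_groupoid_def submersion_def)

lemma composables_FP: "composables X = FP" by (simp add: composables_def fib_def)

lemma sub_src: "submersion A Ob (src X)" and sub_tgt: "submersion A Ob (tgt X)"
 using groupoid by (auto simp: lie_groupoid_def)

lemma spb_unt: "spb Ob A (unt X)"
 using groupoid by (intro smooth_map_imp_spb) (auto simp: lie_groupoid_def)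

lemma spb_ginv: "spb A A (ginv X)"
 using groupoid by (intro smooth_map_imp_spb) (auto simp: lie_groupoid_def)

lemma spb_mul: "spb FP A (%(x, y). mul x y)"
 using groupoid by (intro smooth_map_imp_spb) (auto simp: lie_groupoid_def composables_FP)

lemma Cp_iff: "(x, y) : Cp <-> x : pts A & y : pts A & src X x = tgt X y" by (auto simp: fib_def)

lemma src_points [simp]: "x : pts A ==> src X x : pts Ob"
 and tgt_points [simp]: "x : pts A ==> tgt X x : pts Ob"
 and unt_points [simp]: "u : pts Ob ==> unt X u : pts A"
 and ginv_points [simp]: "x : pts A ==> ginv X x : pts A"
 using spb_points[OF spb_f] spb_points[OF spb_g] spb_points[OF spb_unt] spb_points[OF spb_ginv] by auto

lemma mul_points: "(x, y) : Cp ==> mul x y : pts A"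
 using spb_points[OF spb_mul, of "(x, y)"] by simp

lemma src_unt [simp]: "u : pts Ob ==> src X (unt X u) = u"
 and tgt_unt [simp]: "u : pts Ob ==> tgt X (unt X u) = u"
 using groupoid by (auto simp: lie_groupoid_def)

lemma src_mul: "(x, y) : Cp ==> src X (mul x y) = src X y"
 and tgt_mul: "(x, y) : Cp ==> tgt X (mul x y) = tgt X x"
 using groupoid by (auto simp: lie_groupoid_def composables_FP)

lemma mul_assoc: "(x, y) : Cp ==> (y, z) : Cp ==> mul (mul x y) z = mul x (mul y z)"
 using groupoid by (auto simp: lie_groupoid_def Cp_iff)

lemma gpd_simps [simp]: assumes "x : pts A"
 shows "mul x (unt X (src X x)) = x" "mul (unt X (tgt X x)) x = x"
  "src X (ginv X x) = tgt X x" "tgt X (ginv X x) = src X x"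
  "mul x (ginv X x) = unt X (tgt X x)" "mul (ginv X x) x = unt X (src X x)"
 using groupoid assms by (auto simp: lie_groupoid_def)

lemma ginv_unique: assumes "(x, y) : Cp" "mul x y = unt X (src X y)" shows "x = ginv X y"
proof -
 have y: "y : pts A" and x: "x : pts A" and e: "src X x = tgt X y" using assms(1) by (auto simp: Cp_iff)
 have "x = mul x (unt X (tgt X y))" using x e[symmetric] by simp
 also have "... = mul x (mul y (ginv X y))" using y by simp
 also have "... = mul (mul x y) (ginv X y)" using x y e by (intro mul_assoc[symmetric]) (auto simp: Cp_iff)
 also have "... = ginv X y" using y gpd_simps(2)[of "ginv X y"] by (simp add: assms(2))
 finally show ?thesis .
qed

lemma ginv_ginv: "x : pts A ==> ginv X (ginv X x) = x"
 by (rule ginv_unique[symmetric]) (auto simp: Cp_iff)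

lemma ginv_unt: "u : pts Ob ==> ginv X (unt X u) = unt X u"
 using gpd_simps(1)[of "unt X u"] by (intro ginv_unique[symmetric]) (auto simp: Cp_iff)

lemma ginv_mul: assumes xy: "(x, y) : Cp" shows "ginv X (mul x y) = mul (ginv X y) (ginv X x)"
proof (rule ginv_unique[symmetric])
 have p: "x : pts A" "y : pts A" "src X x = tgt X y" using xy by (auto simp: Cp_iff)
 have c: "(ginv X y, ginv X x) : Cp" "(ginv X x, x) : Cp" "(ginv X y, y) : Cp" "(ginv X x, mul x y) : Cp"
  using p mul_points[OF xy] tgt_mul[OF xy] by (auto simp: Cp_iff)
 show "(mul (ginv X y) (ginv X x), mul x y) : Cp"
  using mul_points[OF xy] mul_points[OF c(1)] src_mul[OF c(1)] tgt_mul[OF xy] p by (simp add: Cp_iff)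
 have "mul (mul (ginv X y) (ginv X x)) (mul x y) = mul (ginv X y) (mul (ginv X x) (mul x y))"
  by (rule mul_assoc[OF c(1,4)])
 also have "mul (ginv X x) (mul x y) = mul (mul (ginv X x) x) y" by (rule mul_assoc[OF c(2) xy, symmetric])
 also have "... = y" using p by simp
 finally show "mul (mul (ginv X y) (ginv X x)) (mul x y) = unt X (src X (mul x y))"
  using p src_mul[OF xy] by simp
qed

abbreviation "Ts == tmap A Ob (src X)"
abbreviation "Tt == tmap A Ob (tgt X)"
abbreviation "Tu == tmap Ob A (unt X)"
abbreviation "Ti == tmap A A (ginv X)"

text \<open>The tangent multiplication is the velocity of the product of composable curves.\<close>

lemma tcmp_fpair: "tcmp X x v y w = tmap FP A (%(x, y). mul x y) (fpair (x, y) v w)"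
 by (simp add: tcmp_def fpair_def composables_FP)

lemma tcmp_velocity: assumes "has_vel A ga x v" "has_vel A de y w" "(x, y) : Cp"
  "ev (%t. src X (ga t) = tgt X (de t)) (nhds 0)"
 shows "has_vel A (%t. mul (ga t) (de t)) (mul x y) (tcmp X x v y w)"
 using has_vel_tmap[OF atl_FP _ spb_mul fpair_velocity[OF assms]] assms(3) by (simp add: tcmp_fpair)

text \<open>The unit, inverse and associativity laws of the tangent groupoid and its naturality are
  derived by this rule from the same laws for curves of arrows, which have to hold near time
  0.\<close>

lemma tcmp_eqI: assumes "has_vel A ga x v" "has_vel A de y w" "(x, y) : Cp" "has_vel A ep z u"
  and e: "ev (%t. src X (ga t) = tgt X (de t) & mul (ga t) (de t) = ep t) (nhds 0)"
 shows "tcmp X x v y w = u"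
proof -
 have "ev (%t. src X (ga t) = tgt X (de t)) (nhds 0)" "ev (%t. mul (ga t) (de t) = ep t) (nhds 0)"
  using e by (auto elim: eventually_mono)
 from has_vel_unique[OF has_vel_cong[OF tcmp_velocity[OF assms(1-3) this(1)] this(2)] assms(4)]
 show ?thesis .
qed

lemma tcmp_tangent: assumes "v : TS A x" "w : TS A y" "(x, y) : Cp" "Ts v = Tt w"
 shows "tcmp X x v y w : TS A (mul x y)"
 using tmap_tangent[OF spb_mul _ fpair(1)[OF assms]] assms(3) by (simp add: tcmp_fpair)

lemma tcmp_src_tgt: assumes "v : TS A x" "w : TS A y" "(x, y) : Cp" "Ts v = Tt w"
 shows "Ts (tcmp X x v y w) = Ts w" "Tt (tcmp X x v y w) = Tt v"
 using fpair[OF assms] tmap_square[OF spb_mul spb_f spb_p2 spb_f] tmap_square[OF spb_mul spb_g spb_p1 spb_g]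
 by (simp_all add: tcmp_fpair src_mul tgt_mul split_beta)

lemma tcmp_linear: assumes "v : TS A x" "w : TS A y" "(x, y) : Cp" "Ts v = Tt w"
  and "v' : TS A x" "w' : TS A y" "Ts v' = Tt w'"
 shows "tcmp X x (b *r v + c *r v') y (b *r w + c *r w') = b *r tcmp X x v y w + c *r tcmp X x v' y w'"
proof -
 note f1 = fpair[OF assms(1-4)] and f2 = fpair[OF assms(5,6,3,7)]
 have "fpair (x, y) (b *r v + c *r v') (b *r w + c *r w') = b *r fpair (x, y) v w + c *r fpair (x, y) v' w'"
  using f1 f2 by (intro fpair_eq[OF _ assms(3)])
   (auto simp: tmap_add tmap_scaleR intro: subspace_add[OF tangent_subspace] subspace_scale[OF tangent_subspace])
 then show ?thesis by (simp add: tcmp_fpair tmap_add tmap_scaleR)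
qed

lemma tcmp_add: assumes "v : TS A x" "w : TS A y" "(x, y) : Cp" "Ts v = Tt w"
  and "v' : TS A x" "w' : TS A y" "Ts v' = Tt w'"
 shows "tcmp X x (v + v') y (w + w') = tcmp X x v y w + tcmp X x v' y w'"
 using tcmp_linear[OF assms, of 1 1] by simp

lemma tcmp_minus: assumes "v : TS A x" "w : TS A y" "(x, y) : Cp" "Ts v = Tt w"
 shows "tcmp X x (- v) y (- w) = - tcmp X x v y w"
 using tcmp_linear[OF assms assms(1,2,4), of "-1" 0] by simp

lemma tcmp_0: "(x, y) : Cp ==> tcmp X x 0 y 0 = 0" using tcmp_linear[of 0 x 0 y 0 0 0 0] by simp

lemma eventually_in_points: assumes "x : pts A" "has_vel A ga x v"
 shows "ev (%t. ga t : pts A) (nhds 0)"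
 by (rule has_vel_eventually[OF atl(1) assms ev_pts[OF atl(1) assms(1)]])

lemma tcmp_unit_left: assumes w: "w : TS A y" and y: "y : pts A"
 shows "tcmp X (unt X (tgt X y)) (Tu (Tt w)) y w = w"
proof -
 obtain de where de: "has_vel A de y w" using has_vel_exists[OF mf(1) y w] by blast
 note g = has_vel_tmap[OF atl(3) tgt_points[OF y] spb_unt has_vel_tmap[OF atl(1) y spb_g de]]
 have C: "(unt X (tgt X y), y) : Cp" using y by (simp add: Cp_iff)
 have "ev (%t. src X (unt X (tgt X (de t))) = tgt X (de t) & mul (unt X (tgt X (de t))) (de t) = de t) (nhds 0)"
  using eventually_in_points[OF y de] by eventually_elim simp
 from tcmp_eqI[OF g de C de this] show ?thesis .
qed

lemma tcmp_unit_right: assumes v: "v : TS A x" and x: "x : pts A"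
 shows "tcmp X x v (unt X (src X x)) (Tu (Ts v)) = v"
proof -
 obtain ga where ga: "has_vel A ga x v" using has_vel_exists[OF mf(1) x v] by blast
 note g = has_vel_tmap[OF atl(3) src_points[OF x] spb_unt has_vel_tmap[OF atl(1) x spb_f ga]]
 have C: "(x, unt X (src X x)) : Cp" using x by (simp add: Cp_iff)
 have "ev (%t. src X (ga t) = tgt X (unt X (src X (ga t))) & mul (ga t) (unt X (src X (ga t))) = ga t) (nhds 0)"
  using eventually_in_points[OF x ga] by eventually_elim simp
 from tcmp_eqI[OF ga g C ga this] show ?thesis .
qed

lemma tcmp_inverse: assumes v: "v : TS A x" and x: "x : pts A"
 shows "tcmp X (ginv X x) (Ti v) x v = Tu (Ts v)"
proof -
 obtain ga where ga: "has_vel A ga x v" using has_vel_exists[OF mf(1) x v] by blast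
 note g = has_vel_tmap[OF atl(1) x spb_ginv ga]
 note u = has_vel_tmap[OF atl(3) src_points[OF x] spb_unt has_vel_tmap[OF atl(1) x spb_f ga]]
 have C: "(ginv X x, x) : Cp" using x by (simp add: Cp_iff)
 have "ev (%t. src X (ginv X (ga t)) = tgt X (ga t) & mul (ginv X (ga t)) (ga t) = unt X (src X (ga t))) (nhds 0)"
  using eventually_in_points[OF x ga] by eventually_elim simp
 from tcmp_eqI[OF g ga C u this] show ?thesis .
qed

lemma Ti_tcmp: assumes v: "v : TS A x" and w: "w : TS A y" and C: "(x, y) : Cp" and e: "Ts v = Tt w"
 shows "Ti (tcmp X x v y w) = tcmp X (ginv X y) (Ti w) (ginv X x) (Ti v)"
proof -
 have x: "x : pts A" and y: "y : pts A" using C by (auto simp: Cp_iff)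
 obtain ga de where *: "has_vel A ga x v" "has_vel A de y w" "ev (%t. src X (ga t) = tgt X (de t)) (nhds 0)"
  by (rule curves_exist[OF v w C e])
 note ev = eventually_in_points[OF x *(1)] eventually_in_points[OF y *(2)] *(3)
 note 1 = has_vel_tmap[OF atl(1) mul_points[OF C] spb_ginv tcmp_velocity[OF *(1,2) C *(3)]]
 have C': "(ginv X y, ginv X x) : Cp" using C by (simp add: Cp_iff)
 have "ev (%t. src X (ginv X (de t)) = tgt X (ginv X (ga t)) &
   mul (ginv X (de t)) (ginv X (ga t)) = ginv X (mul (ga t) (de t))) (nhds 0)"
  using ev by eventually_elim (simp add: ginv_mul Cp_iff)
 from tcmp_eqI[OF has_vel_tmap[OF atl(1) y spb_ginv *(2)] has_vel_tmap[OF atl(1) x spb_ginv *(1)] C' 1 this]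
 show ?thesis by (rule sym)
qed

lemma tcmp_assoc: assumes v: "v : TS A x" and w: "w : TS A y" and u: "u : TS A z"
  and C: "(x, y) : Cp" and C': "(y, z) : Cp" and e: "Ts v = Tt w" and e': "Ts w = Tt u"
 shows "tcmp X (mul x y) (tcmp X x v y w) z u = tcmp X x v (mul y z) (tcmp X y w z u)"
proof -
 have x: "x : pts A" and y: "y : pts A" and z: "z : pts A" and syz: "src X y = tgt X z"
  using C C' by (auto simp: Cp_iff)
 obtain ga de where *: "has_vel A ga x v" "has_vel A de y w" "ev (%t. src X (ga t) = tgt X (de t)) (nhds 0)"
  by (rule curves_exist[OF v w C e])
 \<comment> \<open>The first two curves are composable by choice; the third is lifted along
   \<open>tgt\<close>, so that its target follows the source of \<open>de\<close>.\<close>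
 have "has_vel Ob (%t. src X (de t)) (tgt X z) (Tt u)"
  using has_vel_tmap[OF atl(1) y spb_f *(2)] syz e' by simp
 from lift_velocity[OF mf(1,3) sub_tgt z u this]
 obtain ep where ep: "has_vel A ep z u" "ev (%t. tgt X (ep t) = src X (de t)) (nhds 0)" by blast
 note ev = eventually_in_points[OF x *(1)] eventually_in_points[OF y *(2)] eventually_in_points[OF z ep(1)] *(3) ep(2)
 have s: "ev (%t. src X (de t) = tgt X (ep t)) (nhds 0)" using ep(2) by eventually_elim simp
 note P = tcmp_velocity[OF *(1,2) C *(3)] and Q = tcmp_velocity[OF *(2) ep(1) C' s]
 have 1: "(mul x y, z) : Cp" "(x, mul y z) : Cp"
  using C C' mul_points[OF C] mul_points[OF C'] src_mul[OF C] tgt_mul[OF C'] by (auto simp: Cp_iff)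
 have "ev (%t. src X (mul (ga t) (de t)) = tgt X (ep t)) (nhds 0)"
  using ev by eventually_elim (simp add: src_mul Cp_iff)
 note R = tcmp_velocity[OF P ep(1) 1(1) this]
 have "ev (%t. src X (ga t) = tgt X (mul (de t) (ep t)) &
   mul (ga t) (mul (de t) (ep t)) = mul (mul (ga t) (de t)) (ep t)) (nhds 0)"
  using ev by eventually_elim (simp add: tgt_mul mul_assoc Cp_iff)
 from tcmp_eqI[OF *(1) Q 1(2) R this] show ?thesis by (rule sym)
qed

subsection \<open>Brackets of composable vector fields\<close>

text \<open>The field \<open>(xi1, xi2)\<close> on composable pairs is related to \<open>xi3\<close>
  by the multiplication. Allowing three different fields covers multiplicative fields
  \<open>(xi, xi, xi)\<close>, right invariant ones \<open>(R a, 0, R a)\<close> and left invariant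
  ones \<open>(0, L a, L a)\<close> together, so that one bracket lemma serves all mixed
  brackets.\<close>

definition mulrel :: "('a => 'a tvec) => ('a => 'a tvec) => ('a => 'a tvec) => bool" where
 "mulrel xi1 xi2 xi3 <-> (ALL x y. (x, y) : Cp --> Ts (xi1 x) = Tt (xi2 y) & xi3 (mul x y) = tcmp X x (xi1 x) y (xi2 y))"

definition pair_field :: "('a => 'a tvec) => ('a => 'a tvec) => 'a \<times> 'a => ('a \<times> 'a) tvec" where
 "pair_field xi1 xi2 z = (if z : pts FP then fpair z (xi1 (fst z)) (xi2 (snd z)) else 0)"

lemma pair_field: assumes m: "mulrel xi1 xi2 xi3" and xi: "xi1 : VF A" "xi2 : VF A"
 shows "pair_field xi1 xi2 : VF FP" "related FP A fst (pair_field xi1 xi2) xi1"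
  "related FP A snd (pair_field xi1 xi2) xi2" "related FP A (%(x, y). mul x y) (pair_field xi1 xi2) xi3"
proof -
 have t: "xi1 (fst z) : TS A (fst z)" "xi2 (snd z) : TS A (snd z)"
  "Ts (xi1 (fst z)) = Tt (xi2 (snd z))" if "z : Cp" for z
  using that m vfD(1)[OF xi(1)] vfD(1)[OF xi(2)] by (auto simp: mulrel_def fib_def)
 have F: "fpair (x, y) (xi1 x) (xi2 y) : TS FP (x, y)"
  "tmap FP A fst (fpair (x, y) (xi1 x) (xi2 y)) = xi1 x" "tmap FP A snd (fpair (x, y) (xi1 x) (xi2 y)) = xi2 y"
  if "(x, y) : Cp" for x y
  using fpair[OF t(1)[OF that, unfolded fst_conv] t(2)[OF that, unfolded snd_conv] that
    t(3)[OF that, unfolded fst_conv snd_conv]] by auto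
 have S: "(%z. if z : pts FP then fpair z (xi1 (fst z)) (xi2 (snd z)) h else 0) : C_inf FP" if "h : C_inf FP" for h
 proof (rule C_inf_fpair[OF _ _ _ _ _ that])
  fix G assume G: "G : C_inf A"
  show "(%z. if z : pts FP then xi1 (fst z) G else 0) : C_inf FP"
   using spb_pb[OF spb_p1 vfD(3)[OF xi(1) G]] by (simp add: pb_def lie_der_def)
  show "(%z. if z : pts FP then xi2 (snd z) G else 0) : C_inf FP"
   using spb_pb[OF spb_p2 vfD(3)[OF xi(2) G]] by (simp add: pb_def lie_der_def)
 qed (use t in auto)
 show "pair_field xi1 xi2 : VF FP"
 proof (rule vfI)
  fix h assume "h : C_inf FP"
  have "(%p. if p : pts FP then pair_field xi1 xi2 p h else 0) =
   (%z. if z : pts FP then fpair z (xi1 (fst z)) (xi2 (snd z)) h else 0)" by (auto simp: pair_field_def)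
  then show "(%p. if p : pts FP then pair_field xi1 xi2 p h else 0) : C_inf FP" using S[OF `h : C_inf FP`] by simp
 qed (use F in "auto simp: pair_field_def")
 show "related FP A fst (pair_field xi1 xi2) xi1" "related FP A snd (pair_field xi1 xi2) xi2"
  "related FP A (%(x, y). mul x y) (pair_field xi1 xi2) xi3"
  using F m by (auto simp: related_def pair_field_def mulrel_def tcmp_fpair)
qed

lemma FP_tangent_compat: "Ts (tmap FP A fst z) = Tt (tmap FP A snd z)"
 by (rule tmap_square[OF spb_p1 spb_f spb_p2 spb_g]) (simp add: fibD)

text \<open>Brackets of related fields are related; this is applied to the fields on composable
  pairs and the three maps \<open>fst\<close>, \<open>snd\<close> and multiplication.\<close>

lemma mulrel_bracket: assumes m: "mulrel xi1 xi2 xi3" "mulrel et1 et2 et3"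
  and xi: "xi1 : VF A" "xi2 : VF A" "xi3 : VF A" and et: "et1 : VF A" "et2 : VF A" "et3 : VF A"
 shows "mulrel (lbr A xi1 et1) (lbr A xi2 et2) (lbr A xi3 et3)" unfolding mulrel_def
proof (intro allI impI)
 fix x y assume C: "(x, y) : Cp"
 note P = pair_field[OF m(1) xi(1,2)] and Q = pair_field[OF m(2) et(1,2)]
 let ?B = "lbr FP (pair_field xi1 xi2) (pair_field et1 et2)"
 have B: "?B : VF FP" by (rule lbr_vector_field[OF P(1) Q(1)])
 have t: "?B (x, y) : TS FP (x, y)" by (rule vfD(1)[OF B]) (simp add: C)
 have r: "tmap FP A fst (?B (x, y)) = lbr A xi1 et1 x" "tmap FP A snd (?B (x, y)) = lbr A xi2 et2 y"
  "tmap FP A (%(x, y). mul x y) (?B (x, y)) = lbr A xi3 et3 (mul x y)"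
  using related_bracket[OF spb_p1 P(2) Q(2) P(1) Q(1) xi(1) et(1)] related_bracket[OF spb_p2 P(3) Q(3) P(1) Q(1) xi(2) et(2)]
   related_bracket[OF spb_mul P(4) Q(4) P(1) Q(1) xi(3) et(3)] C by (auto simp: related_def)
 show "Ts (lbr A xi1 et1 x) = Tt (lbr A xi2 et2 y) &
   lbr A xi3 et3 (mul x y) = tcmp X x (lbr A xi1 et1 x) y (lbr A xi2 et2 y)"
  using FP_tangent_compat[of "?B (x, y)"] fpair_eq[OF t C r(1,2)] r(3) by (simp add: r(1,2) tcmp_fpair)
qed

end

lemma scaleR_app: "(c *r f) x = c *r f x" by (simp add: scaleR_fun_def)

lemma pb_apply: "pb N f F n = (if n : pts N then F (f n) else 0)" by (simp add: pb_def)

section \<open>Crossed modules\<close>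

text \<open>The bracket of \<open>low\<close> is not part of the data; it would be
  \<open>action (bdry u) v\<close>, so the Peiffer identity appears as the antisymmetry of this
  expression, which is the form in which it enters the square of the coderivation.\<close>

locale crossed_mod =
 fixes C :: "('c::real_vector, 'm::real_vector) crossed_module"
 assumes low: "subspace (low C)" and up: "subspace (up C)"
  and brk_up: "x : up C ==> y : up C ==> brk C x y : up C"
  and brk_skew: "x : up C ==> y : up C ==> brk C x y = - brk C y x"
  and brk_linear: "x : up C ==> y : up C ==> z : up C ==>
   brk C x (b *r y + c *r z) = b *r brk C x y + c *r brk C x z"
  and brk_jacobi: "x : up C ==> y : up C ==> z : up C ==>
   brk C (brk C x y) z = brk C x (brk C y z) - brk C y (brk C x z)"
  and bdry_up: "u : low C ==> bdry C u : up C"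
  and bdry_linear: "u : low C ==> v : low C ==> bdry C (b *r u + c *r v) = b *r bdry C u + c *r bdry C v"
  and action_low: "x : up C ==> u : low C ==> action C x u : low C"
  and action_linear: "x : up C ==> u : low C ==> v : low C ==>
   action C x (b *r u + c *r v) = b *r action C x u + c *r action C x v"
  and action_linear_left: "x : up C ==> y : up C ==> u : low C ==>
   action C (b *r x + c *r y) u = b *r action C x u + c *r action C y u"
  and action_brk: "x : up C ==> y : up C ==> u : low C ==>
   action C (brk C x y) u = action C x (action C y u) - action C y (action C x u)"
  and bdry_action: "x : up C ==> u : low C ==> bdry C (action C x u) = brk C x (bdry C u)"
  and peiffer: "u : low C ==> v : low C ==> action C (bdry C u) v + action C (bdry C v) u = 0"

lemma crossed_mod_sub:
 assumes "crossed_mod C" and "subspace l" "l <= low C" "subspace m" "m <= up C"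
  and "!!x y. x : m ==> y : m ==> brk C x y : m" "!!u. u : l ==> bdry C u : m"
  and "!!x u. x : m ==> u : l ==> action C x u : l" shows "crossed_mod (C\<lparr>low := l, up := m\<rparr>)"
proof -
 interpret crossed_mod C by fact
 have l: "u : l ==> u : low C" and m: "x : m ==> x : up C" for u x using assms(3,5) by auto
 show ?thesis by unfold_locales
   (auto simp: assms(2,4,6,7,8) l m brk_linear brk_jacobi bdry_linear action_linear
    action_linear_left action_brk bdry_action peiffer intro: brk_skew)
qed

lemma related_linear:
 "related M N f xi et ==> related M N f xi' et' ==> related M N f (b *r xi + c *r xi') (b *r et + c *r et')"
 by (simp add: related_def tmap_add tmap_scaleR scaleR_app scaleR_app
   scaleR_app scaleR_app)

lemma related_diff:
 "related M N f xi et ==> related M N f xi' et' ==> related M N f (xi - xi') (et - et')"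
 by (simp add: related_def tmap_diff)

lemma lbr_linear1: assumes "xi : VF M" "et : VF M" "ze : VF M"
 shows "lbr M (b *r et + c *r ze) xi = b *r lbr M et xi + c *r lbr M ze xi"
proof -
 have "lbr M (b *r et + c *r ze) xi = - (b *r lbr M xi et + c *r lbr M xi ze)"
  by (subst lbr_skew) (simp add: lbr_linear2[OF assms])
 then show ?thesis by (subst (2) lbr_skew, subst (3) lbr_skew) simp
qed

lemma lbr_diff1: assumes "xi : VF M" "et : VF M" "ze : VF M"
 shows "lbr M (et - ze) xi = lbr M et xi - lbr M ze xi"
 using lbr_linear1[OF assms, of 1 "-1"] by simp

lemma lbr_diff2: assumes "xi : VF M" "et : VF M" "ze : VF M"
 shows "lbr M xi (et - ze) = lbr M xi et - lbr M xi ze"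
 using lbr_linear2[OF assms, of 1 "-1"] by simp

section \<open>The Lie 2-algebra of multiplicative vector fields\<close>

context lgroupoid
begin

lemma asD: assumes "a : AS X"
 shows "u : pts Ob ==> a u : TS A (unt X u)" "u : pts Ob ==> Ts (a u) = 0"
  "u ~: pts Ob ==> a u = 0" "F : C_inf A ==> (%u. a u F) : C_inf Ob"
 using assms by (auto simp: algebroid_sections_def)

lemma algebroid_sections_subspace: "subspace (AS X)"
proof (rule subspaceI2)
 show "0 : AS X" unfolding algebroid_sections_def
 proof (intro CollectI conjI ballI allI impI)
  fix F
  have "(%u. (0 :: 'o => 'a tvec) u F) = 0" by (simp add: fun_eq_iff)
  then show "(%u. (0 :: 'o => 'a tvec) u F) : C_inf Ob" using C_inf_zero by metis
 qed auto
next
 fix a a' and b c :: real assume a: "a : AS X" and a': "a' : AS X"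
 let ?s = "b *r a + c *r a'"
 have s: "?s u = b *r a u + c *r a' u" for u by (simp add: scaleR_fun_def)
 have "(%u. ?s u F) : C_inf Ob" if F: "F : C_inf A" for F
 proof -
  have "b *r (%u. a u F) + c *r (%u. a' u F) : C_inf Ob"
   by (intro C_inf_add C_inf_scaleR asD(4)[OF a F] asD(4)[OF a' F])
  then show ?thesis by (simp add: scaleR_fun_def plus_fun_def)
 qed
 moreover have "?s u : TS A (unt X u)" if "u : pts Ob" for u unfolding s
  by (intro subspace_add[OF tangent_subspace] subspace_scale[OF tangent_subspace]
    asD(1)[OF a that] asD(1)[OF a' that])
 moreover have "Ts (?s u) = 0" if "u : pts Ob" for u unfolding s
  using asD(2)[OF a that] asD(2)[OF a' that] by (simp add: tmap_add tmap_scaleR)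
 moreover have "?s u = 0" if "u ~: pts Ob" for u unfolding s
  using asD(3)[OF a that] asD(3)[OF a' that] by simp
 ultimately show "?s : AS X" unfolding algebroid_sections_def by blast
qed

abbreviation "R a == right_inv X a"
abbreviation "L a == left_inv X a"

lemma right_inv_eq: "x : pts A ==> R a x = tcmp X (unt X (tgt X x)) (a (tgt X x)) x 0"
 by (simp add: right_inv_def)

lemma right_inv_out: "x ~: pts A ==> R a x = 0" by (simp add: right_inv_def)

lemma left_inv_out: "x ~: pts A ==> L a x = 0" by (simp add: left_inv_def)

lemma unit_comp: "x : pts A ==> (unt X (tgt X x), x) : Cp" "x : pts A ==> (x, unt X (src X x)) : Cp"
 "u : pts Ob ==> (unt X u, unt X u) : Cp" by (auto simp: Cp_iff)

lemma right_inv_props: assumes a: "a : AS X" and x: "x : pts A"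
 shows "R a x : TS A x" "Ts (R a x) = 0" "Tt (R a x) = Tt (a (tgt X x))"
proof -
 have t: "tgt X x : pts Ob" using x by simp
 have e: "Ts (a (tgt X x)) = Tt 0" using asD(2)[OF a t] by simp
 note T = asD(1)[OF a t] zero_tangent unit_comp(1)[OF x] e
 show "R a x : TS A x" using tcmp_tangent[OF T] x by (simp add: right_inv_eq)
 show "Ts (R a x) = 0" "Tt (R a x) = Tt (a (tgt X x))" using tcmp_src_tgt[OF T] x by (auto simp: right_inv_eq)
qed

text \<open>\<open>R a x\<close> tests \<open>F\<close> through the multiplication at the pair of
  the unit over \<open>tgt x\<close> and \<open>x\<close>. After \<open>F\<close> is pulled back to
  composable pairs and extended to \<open>H\<close> on the product, the value is the derivative of
  \<open>H\<close> in its first variable along \<open>a\<close>, and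
  \<open>C_inf_field_along\<close> applies.\<close>

lemma right_inv_vector_field: assumes a: "a : AS X" shows "R a : VF A"
proof (rule vfI)
 fix F assume F: "F : C_inf A"
 let ?h = "pb FP (%(x, y). mul x y) F" and ?P = "prod_mfd A A" and ?j = "%x. (unt X (tgt X x), x)"
 have h: "?h : C_inf FP" by (rule spb_pb[OF spb_mul F])
 have sut: "spb A A (%x. unt X (tgt X x))" by (rule spb_compose[OF spb_g spb_unt])
 have sj: "spb A ?P ?j" by (rule spb_pair[OF atl(1) mf(1,1) sut spb_id])
 show "(%x. if x : pts A then R a x F else 0) : C_inf A"
 proof (rule C_infI[OF atl(1)])
  fix x0 assume x0: "x0 : pts A"
  obtain H where H: "H : C_inf ?P" "ev (%w. w : Cp --> H w = ?h w) (nhm ?P (?j x0))"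
   by (rule extend[OF h unit_comp(1)[OF x0]])
  let ?G = "%x. if x : pts A then a (tgt X x) (%y. H (y, x)) else 0"
  have G: "?G : C_inf A"
  proof (rule C_inf_field_along[where a="%x. a (tgt X x)" and b="%x. x", OF atl(1) mf(1,1) sut spb_id _ _ H(1)])
   fix F' assume "F' : C_inf A"
   from spb_pb[OF spb_g asD(4)[OF a this]]
   show "(%x. if x : pts A then a (tgt X x) F' else 0) : C_inf A" by (simp add: pb_def)
  qed (use asD(1)[OF a] in auto)
  have jP: "?j x0 : pts ?P" using x0 by simp
  have "ev (%x. (if x : pts A then R a x F else 0) = ?G x) (nhm A x0)"
   using spb_eventually[OF atl(1,4) sj x0 ev_ev_nhm[OF atl(4) jP H(2)]] ev_pts[OF atl(1) x0]
  proof eventually_elim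
   case (elim x)
   then have x: "x : pts A" by simp
   have e: "Ts (a (tgt X x)) = Tt 0" using asD(2)[OF a] x by simp
   have t: "a (tgt X x) : TS A (unt X (tgt X x))" using asD(1)[OF a] x by simp
   note fp = fpair[OF t zero_tangent unit_comp(1)[OF x] e]
   have "R a x F = fpair (?j x) (a (tgt X x)) 0 ?h"
    by (simp add: right_inv_eq[OF x] tcmp_fpair tmap_pb[OF F])
   also have "... = a (tgt X x) (%y. H (y, x))"
    using tangent_FP[OF fp(1) unit_comp(1)[OF x] h H(1)] elim by (simp add: fp)
   finally show ?case using x by simp
  qed
  then show "EX g:C_inf A. ev (%x. (if x : pts A then R a x F else 0) = g x) (nhm A x0)"
   by (rule bexI[OF _ G])
 qed simp
qed (use right_inv_props[OF a] in "auto simp: right_inv_def")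

lemma right_inv_unit: assumes a: "a : AS X" and u: "u : pts Ob" shows "R a (unt X u) = a u"
proof -
 have "tcmp X (unt X u) (a u) (unt X u) 0 = a u"
  using tcmp_unit_right[OF asD(1)[OF a u]] asD(2)[OF a u] u by simp
 then show ?thesis using u by (simp add: right_inv_eq)
qed

lemma right_inv_linear: assumes a: "a : AS X" and a': "a' : AS X"
 shows "R (b *r a + c *r a') = b *r R a + c *r R a'"
proof
 fix x
 show "R (b *r a + c *r a') x = (b *r R a + c *r R a') x"
 proof (cases "x : pts A")
  case True
  then have t: "tgt X x : pts Ob" by simp
  have "tcmp X (unt X (tgt X x)) (b *r a (tgt X x) + c *r a' (tgt X x)) x (b *r 0 + c *r 0) =
   b *r tcmp X (unt X (tgt X x)) (a (tgt X x)) x 0 + c *r tcmp X (unt X (tgt X x)) (a' (tgt X x)) x 0"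
   by (rule tcmp_linear) (use unit_comp(1)[OF True] asD(1,2)[OF a t] asD(1,2)[OF a' t] in auto)
  then show ?thesis using True by (simp add: right_inv_eq scaleR_app scaleR_app
   scaleR_app scaleR_app)
 qed (simp add: right_inv_out scaleR_app)
qed

text \<open>Associativity of the tangent multiplication, with the zero vector at a product of arrows
  written as a product of zero vectors.\<close>

lemma right_inv_mulrel: assumes a: "a : AS X" shows "mulrel (R a) 0 (R a)" unfolding mulrel_def
proof (intro allI impI conjI)
 fix x y assume C: "(x, y) : Cp"
 have x: "x : pts A" and y: "y : pts A" using C by (auto simp: Cp_iff)
 show "Ts (R a x) = Tt (0 y)" using right_inv_props(2)[OF a x] by simp
 have t: "tgt X x : pts Ob" using x by simp
 have e: "Ts (a (tgt X x)) = Tt 0" using asD(2)[OF a t] by simp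
 have "R a (mul x y) = tcmp X (unt X (tgt X x)) (a (tgt X x)) (mul x y) 0"
  using mul_points[OF C] tgt_mul[OF C] by (simp add: right_inv_eq)
 also have "... = tcmp X (unt X (tgt X x)) (a (tgt X x)) (mul x y) (tcmp X x 0 y 0)" by (simp add: tcmp_0[OF C])
 also have "... = tcmp X (mul (unt X (tgt X x)) x) (tcmp X (unt X (tgt X x)) (a (tgt X x)) x 0) y 0"
  by (rule tcmp_assoc[symmetric]) (use asD(1)[OF a t] unit_comp(1)[OF x] C e in auto)
 finally show "R a (mul x y) = tcmp X x (R a x) y (0 y)" using x by (simp add: right_inv_eq)
qed

lemma Ti_tangent: assumes a: "a : AS X" and u: "u : pts Ob"
 shows "Ti (a u) : TS A (unt X u)" "Tt (Ti (a u)) = 0" "Ts (Ti (a u)) = Tt (a u)"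
proof -
 show "Ti (a u) : TS A (unt X u)"
  using tmap_tangent[OF spb_ginv _ asD(1)[OF a u]] u by (simp add: ginv_unt)
 have "Tt (Ti (a u)) = Ts (a u)" unfolding tmap_compose[OF spb_ginv spb_g] by (rule tmap_cong) simp
 then show "Tt (Ti (a u)) = 0" using asD(2)[OF a u] by simp
 show "Ts (Ti (a u)) = Tt (a u)" unfolding tmap_compose[OF spb_ginv spb_f] by (rule tmap_cong) simp
qed

lemma left_inv_eq: "x : pts A ==> L a x = - tcmp X x 0 (unt X (src X x)) (Ti (a (src X x)))"
 by (simp add: left_inv_def)

text \<open>Inversion exchanges left and right translations. Smoothness, linearity, invariance and
  naturality of left invariant fields are imported from the right invariant ones by this
  formula.\<close>

lemma left_inv_right_inv: assumes a: "a : AS X" and x: "x : pts A"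
 shows "L a x = - Ti (R a (ginv X x))"
proof -
 have s: "src X x : pts Ob" using x by simp
 have e: "Ts (a (src X x)) = Tt 0" using asD(2)[OF a s] by simp
 have "Ti (R a (ginv X x)) = Ti (tcmp X (unt X (src X x)) (a (src X x)) (ginv X x) 0)"
  using x by (simp add: right_inv_eq)
 also have "... = tcmp X (ginv X (ginv X x)) (Ti 0) (ginv X (unt X (src X x))) (Ti (a (src X x)))"
  by (rule Ti_tcmp) (use asD(1)[OF a s] x e in "auto simp: Cp_iff")
 finally show ?thesis using x by (simp add: left_inv_eq ginv_ginv ginv_unt)
qed

lemma left_inv_vector_field: assumes a: "a : AS X" shows "L a : VF A"
proof (rule vfI)
 fix x assume x: "x : pts A"
 have "Ti (R a (ginv X x)) : TS A (ginv X (ginv X x))"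
  by (rule tmap_tangent[OF spb_ginv _ right_inv_props(1)[OF a]]) (use x in auto)
 then show "L a x : TS A x"
  using subspace_neg[OF tangent_subspace] x by (simp add: left_inv_right_inv[OF a] ginv_ginv)
next
 fix F assume F: "F : C_inf A"
 have "- pb A (ginv X) (lie_der (R a) (pb A (ginv X) F)) : C_inf A"
  by (intro C_inf_minus spb_pb[OF spb_ginv] vfD(3)[OF right_inv_vector_field[OF a]] F)
 moreover have "- pb A (ginv X) (lie_der (R a) (pb A (ginv X) F)) = (%x. if x : pts A then L a x F else 0)"
  by (auto simp: fun_eq_iff pb_apply lie_der_def left_inv_right_inv[OF a] left_inv_out tmap_pb[OF F])
 ultimately show "(%x. if x : pts A then L a x F else 0) : C_inf A" by simp
qed (simp add: left_inv_def)

lemma left_inv_props: assumes a: "a : AS X" and x: "x : pts A"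
 shows "Tt (L a x) = 0" "Ts (L a x) = - Tt (a (src X x))"
proof -
 have s: "src X x : pts Ob" using x by simp
 have e: "Ts 0 = Tt (Ti (a (src X x)))" using Ti_tangent(2)[OF a s] by simp
 note st = tcmp_src_tgt[OF zero_tangent Ti_tangent(1)[OF a s] unit_comp(2)[OF x] e]
 show "Tt (L a x) = 0" "Ts (L a x) = - Tt (a (src X x))"
  using st Ti_tangent(3)[OF a s] x by (simp_all add: left_inv_eq tmap_minus)
qed

lemma left_inv_mulrel: assumes a: "a : AS X" shows "mulrel 0 (L a) (L a)" unfolding mulrel_def
proof (intro allI impI conjI)
 fix x y assume C: "(x, y) : Cp"
 have x: "x : pts A" and y: "y : pts A" using C by (auto simp: Cp_iff)
 have s: "src X y : pts Ob" using y by simp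
 show z: "Ts (0 x) = Tt (L a y)" using left_inv_props(1)[OF a y] by simp
 let ?w = "Ti (a (src X y))" and ?u = "unt X (src X y)"
 have e: "Ts 0 = Tt ?w" using Ti_tangent(2)[OF a s] by simp
 have "L a (mul x y) = - tcmp X (mul x y) 0 ?u ?w"
  using mul_points[OF C] src_mul[OF C] by (simp add: left_inv_eq)
 also have "tcmp X (mul x y) 0 ?u ?w = tcmp X (mul x y) (tcmp X x 0 y 0) ?u ?w" by (simp add: tcmp_0[OF C])
 also have "... = tcmp X x 0 (mul y ?u) (tcmp X y 0 ?u ?w)"
  by (rule tcmp_assoc) (use Ti_tangent(1)[OF a s] unit_comp(2)[OF y] C e in auto)
 also have "... = tcmp X x (- 0) y (- L a y)" using y by (simp add: left_inv_eq)
 also have "... = - tcmp X x 0 y (L a y)"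
  by (rule tcmp_minus) (use vfD(1)[OF left_inv_vector_field[OF a] y] C z in auto)
 finally show "L a (mul x y) = tcmp X x (0 x) y (L a y)" by simp
qed

lemma mult_fields_iff: "(xi, u) : MF X <-> xi : VF A & u : VF Ob &
  related A Ob (src X) xi u & related A Ob (tgt X) xi u & mulrel xi xi xi"
 by (auto simp: mult_fields_def related_def mulrel_def composables_FP fib_def)

lemma mult_fieldsD: assumes "(xi, u) : MF X"
 shows "xi : VF A" "u : VF Ob" "related A Ob (src X) xi u" "related A Ob (tgt X) xi u" "mulrel xi xi xi"
 using assms by (auto simp: mult_fields_iff)

lemma mulrel_linear: assumes m: "mulrel xi1 xi2 xi3" "mulrel et1 et2 et3"
  and xi: "xi1 : VF A" "xi2 : VF A" and et: "et1 : VF A" "et2 : VF A"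
 shows "mulrel (b *r xi1 + c *r et1) (b *r xi2 + c *r et2) (b *r xi3 + c *r et3)"
 unfolding mulrel_def
proof (intro allI impI)
 fix x y assume C: "(x, y) : Cp"
 have x: "x : pts A" and y: "y : pts A" using C by (auto simp: Cp_iff)
 have s: "(b *r ze + c *r ze') z = b *r ze z + c *r ze' z" for ze ze' :: "'a => 'a tvec" and z
  by (simp add: scaleR_app scaleR_app)
 have e: "Ts (xi1 x) = Tt (xi2 y)" "Ts (et1 x) = Tt (et2 y)"
  "xi3 (mul x y) = tcmp X x (xi1 x) y (xi2 y)" "et3 (mul x y) = tcmp X x (et1 x) y (et2 y)"
  using m C unfolding mulrel_def by blast+
 show "Ts ((b *r xi1 + c *r et1) x) = Tt ((b *r xi2 + c *r et2) y) & (b *r xi3 + c *r et3) (mul x y) =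
   tcmp X x ((b *r xi1 + c *r et1) x) y ((b *r xi2 + c *r et2) y)" unfolding s e(3,4) using e(1,2)
  by (auto simp: tmap_add tmap_scaleR intro!: tcmp_linear[symmetric] vfD(1)[OF xi(1) x]
   vfD(1)[OF xi(2) y] vfD(1)[OF et(1) x] vfD(1)[OF et(2) y] C)
qed

lemma mult_fields_subspace: "subspace (MF X)"
proof (rule subspaceI2)
 have "mulrel 0 0 0" by (simp add: mulrel_def tcmp_0)
 then show "0 : MF X" using subspace_0[OF vf_subspace[of A]] subspace_0[OF vf_subspace[of Ob]]
  by (simp add: zero_prod_def mult_fields_iff related_def)
next
 fix p q :: "('o, 'a) mfield" and b c :: real
 assume p: "p : MF X" and q: "q : MF X"
 obtain xi u et w where pq: "p = (xi, u)" "q = (et, w)" by (cases p, cases q)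
 note P = mult_fieldsD[OF p[unfolded pq]] and Q = mult_fieldsD[OF q[unfolded pq]]
 show "b *r p + c *r q : MF X" unfolding pq
  by (simp add: mult_fields_iff related_linear[OF P(3) Q(3)] related_linear[OF P(4) Q(4)]
    mulrel_linear[OF P(5) Q(5) P(1,1) Q(1,1)] P Q subspace_add[OF vf_subspace] subspace_scale[OF vf_subspace])
qed

text \<open>A multiplicative vector field is idempotent at a unit, and the tangent units are the only
  idempotents.\<close>

lemma mult_field_unit: assumes xi: "(xi, u) : MF X" and p: "p : pts Ob"
 shows "xi (unt X p) = Tu (u p)"
proof -
 note D = mult_fieldsD[OF xi]
 let ?e = "unt X p" and ?w = "xi (unt X p)"
 have e: "?e : pts A" using p by simp
 have w: "?w : TS A ?e" by (rule vfD(1)[OF D(1) e])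
 have st: "Ts ?w = u p" "Tt ?w = u p" using D(3,4) e p by (auto simp: related_def)
 have id: "?w = tcmp X ?e ?w ?e ?w"
  using D(5) unit_comp(3)[OF p] gpd_simps(1)[OF e] p by (force simp: mulrel_def)
 have ie: "ginv X ?e = ?e" using p by (rule ginv_unt)
 have iw: "Ti ?w : TS A ?e" using tmap_tangent[OF spb_ginv e w] ie by simp
 have siw: "Ts (Ti ?w) = Tt ?w" unfolding tmap_compose[OF spb_ginv spb_f] by (rule tmap_cong) simp
 have inv: "tcmp X ?e (Ti ?w) ?e ?w = Tu (u p)" using tcmp_inverse[OF w e] ie st by simp
 have ee: "mul ?e ?e = ?e" using gpd_simps(1)[OF e] p by simp
 have "tcmp X (mul ?e ?e) (tcmp X ?e (Ti ?w) ?e ?w) ?e ?w = tcmp X ?e (Ti ?w) (mul ?e ?e) (tcmp X ?e ?w ?e ?w)"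
  by (rule tcmp_assoc[OF iw w w unit_comp(3)[OF p] unit_comp(3)[OF p]]) (use siw st in auto)
 then have "tcmp X ?e (Tu (u p)) ?e ?w = Tu (u p)" unfolding ee inv id[symmetric] .
 moreover have "tcmp X ?e (Tu (u p)) ?e ?w = ?w" using tcmp_unit_left[OF w e] st p by simp
 ultimately show ?thesis by simp
qed

lemma LTX_simps [simp]: "low (LTX X) = AS X" "up (LTX X) = MF X"
 "bdry (LTX X) a = (R a - L a, %x. Tt (a x))"
 "brk (LTX X) (xi, u) (et, w) = (lbr A xi et, lbr Ob u w)"
 "action (LTX X) (xi, u) a x = (if x : pts Ob then lbr A xi (R a) (unt X x) else 0)"
 by (simp_all add: LTX_def)

lemma related_right_inv: assumes a: "a : AS X"
 shows "related A Ob (src X) (R a) 0" "related A Ob (tgt X) (R a) (%x. Tt (a x))"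
 using right_inv_props(2,3)[OF a] by (auto simp: related_def)

lemma anchor_vector_field: assumes a: "a : AS X" shows "(%x. Tt (a x)) : VF Ob"
proof (rule vfI)
 fix p assume p: "p : pts Ob"
 show "Tt (a p) : TS Ob p" using tmap_tangent[OF spb_g _ asD(1)[OF a p]] p by simp
next
 fix F assume F: "F : C_inf Ob"
 have "(%x. a x (pb A (tgt X) F)) : C_inf Ob" by (rule asD(4)[OF a spb_pb[OF spb_g F]])
 moreover have "(%x. a x (pb A (tgt X) F)) = (%p. if p : pts Ob then Tt (a p) F else 0)"
  using asD(3)[OF a] by (auto simp: tmap_pb[OF F])
 ultimately show "(%p. if p : pts Ob then Tt (a p) F else 0) : C_inf Ob" by simp
qed (simp add: asD(3)[OF a])

text \<open>Additivity of the tangent multiplication splits the product of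
  \<open>R a x - L a x\<close> with \<open>R a y - L a y\<close> into three: \<open>R a x\<close>
  with 0, \<open>- L a x\<close> with \<open>R a y\<close>, and 0 with \<open>- L a y\<close>. The
  outer ones are \<open>R a\<close> and \<open>- L a\<close> at the product arrow. The middle one
  vanishes, since by associativity it contains the product of the inverse of \<open>a\<close> with
  \<open>a\<close> at the common unit.\<close>

lemma bdry_mult_field: assumes a: "a : AS X" shows "(R a - L a, %x. Tt (a x)) : MF X"
 unfolding mult_fields_iff
proof (intro conjI)
 note vR = right_inv_vector_field[OF a] and vL = left_inv_vector_field[OF a]
 show "R a - L a : VF A" by (rule subspace_diff[OF vf_subspace vR vL])
 show "(%x. Tt (a x)) : VF Ob" by (rule anchor_vector_field[OF a])
 show "related A Ob (src X) (R a - L a) (%x. Tt (a x))" "related A Ob (tgt X) (R a - L a) (%x. Tt (a x))"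
  using right_inv_props(2,3)[OF a] left_inv_props[OF a] by (auto simp: related_def tmap_diff)
 show "mulrel (R a - L a) (R a - L a) (R a - L a)" unfolding mulrel_def
 proof (intro allI impI)
  fix x y assume C: "(x, y) : Cp"
  have x: "x : pts A" and y: "y : pts A" and xy: "src X x = tgt X y" using C by (auto simp: Cp_iff)
  let ?u = "unt X (tgt X y)" and ?a = "a (tgt X y)"
  have u: "tgt X y : pts Ob" using y by simp
  note t = vfD(1)[OF vR] vfD(1)[OF vL]
  note rp = right_inv_props(2,3)[OF a] and lp = left_inv_props[OF a]
  note ta = asD(1,2)[OF a u] and ti = Ti_tangent[OF a u]
  have Cu: "(x, ?u) : Cp" "(?u, y) : Cp" "(?u, ?u) : Cp"
   using unit_comp(2)[OF x] unit_comp(1)[OF y] unit_comp(3)[OF u] xy by auto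
  have xu: "mul x ?u = x" "mul ?u y = y" "mul ?u ?u = ?u"
   using gpd_simps(1)[OF x] gpd_simps(2)[OF y] gpd_simps(1)[of ?u] u xy by auto
  have Rmul: "R a (mul x y) = tcmp X x (R a x) y 0" and Lmul: "L a (mul x y) = tcmp X x 0 y (L a y)"
   using right_inv_mulrel[OF a] left_inv_mulrel[OF a] C by (auto simp: mulrel_def)
  have "tcmp X ?u (Ti ?a) ?u ?a = 0" using tcmp_inverse[OF ta(1)] u ta(2) by (simp add: ginv_unt)
  moreover have "tcmp X (mul ?u ?u) (tcmp X ?u (Ti ?a) ?u ?a) y 0 = tcmp X ?u (Ti ?a) (mul ?u y) (tcmp X ?u ?a y 0)"
   by (rule tcmp_assoc[OF ti(1) ta(1) zero_tangent Cu(3,2)]) (use ti ta in auto)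
  ultimately have 1: "tcmp X ?u (Ti ?a) y (R a y) = 0"
   using tcmp_0[OF Cu(2)] xu by (simp add: right_inv_eq[OF y])
  have "tcmp X (mul x ?u) (tcmp X x 0 ?u (Ti ?a)) y (R a y) = tcmp X x 0 (mul ?u y) (tcmp X ?u (Ti ?a) y (R a y))"
   by (rule tcmp_assoc[OF zero_tangent ti(1) t(1)[OF y] Cu(1,2)]) (use ti rp(2)[OF y] in auto)
  then have mid: "tcmp X x (- L a x) y (R a y) = 0"
   using tcmp_0[OF C] xu 1 by (simp add: left_inv_eq[OF x] xy)
  have e: "Ts (R a x) = Tt 0" "Ts (- L a x) = Tt (R a y)" "Ts 0 = Tt (- L a y)"
   "Ts (R a x + - L a x) = Tt (0 + R a y)"
   using rp(1)[OF x] rp(2)[OF y] lp(1)[OF y] lp(2)[OF x] xy by (auto simp: tmap_minus tmap_add tmap_diff)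
  have n: "- L a x : TS A x" "- L a y : TS A y"
   using subspace_neg[OF tangent_subspace t(2)[OF x]] subspace_neg[OF tangent_subspace t(2)[OF y]] by auto
  have "tcmp X x (R a x - L a x) y (R a y - L a y) =
    tcmp X x ((R a x + - L a x) + 0) y ((0 + R a y) + - L a y)" by simp
  also have "... = tcmp X x (R a x + - L a x) y (0 + R a y) + tcmp X x 0 y (- L a y)"
   by (rule tcmp_add[OF subspace_add[OF tangent_subspace] subspace_add[OF tangent_subspace]])
    (use C e t x y n in auto)
  also have "tcmp X x (R a x + - L a x) y (0 + R a y) = tcmp X x (R a x) y 0 + tcmp X x (- L a x) y (R a y)"
   by (rule tcmp_add) (use C e t x y n in auto)
  also have "tcmp X x 0 y (- L a y) = - tcmp X x 0 y (L a y)"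
   using tcmp_minus[OF zero_tangent t(2)[OF y] C] lp(1)[OF y] by simp
  finally have E: "tcmp X x (R a x - L a x) y (R a y - L a y) =
   tcmp X x (R a x) y 0 + tcmp X x (- L a x) y (R a y) + - tcmp X x 0 y (L a y)" .
  have "tcmp X x ((R a - L a) x) y ((R a - L a) y) = (R a - L a) (mul x y)"
   unfolding minus_apply E mid Rmul Lmul by (simp add: fun_eq_iff)
  moreover have "Ts ((R a - L a) x) = Tt ((R a - L a) y)"
   using rp lp x y xy by (simp add: tmap_diff)
  ultimately show "Ts ((R a - L a) x) = Tt ((R a - L a) y) &
   (R a - L a) (mul x y) = tcmp X x ((R a - L a) x) y ((R a - L a) y)" by simp
 qed
qed

text \<open>The bracket of a multiplicative field with a right invariant one is of type
  \<open>(B, 0, B)\<close> for \<open>mulrel\<close>, that is, right invariant, and such a field is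
  recovered from its values at the units.\<close>

lemma action_section: assumes xi: "(xi, u) : MF X" and a: "a : AS X"
 shows "action (LTX X) (xi, u) a : AS X" "R (action (LTX X) (xi, u) a) = lbr A xi (R a)"
proof -
 note D = mult_fieldsD[OF xi] and vR = right_inv_vector_field[OF a]
 let ?B = "lbr A xi (R a)" and ?b = "action (LTX X) (xi, u) a"
 have B: "?B : VF A" by (rule lbr_vector_field[OF D(1) vR])
 have z: "0 : VF M" for M :: "('z, 'y::euclidean_space) mfd" by (rule subspace_0[OF vf_subspace])
 have "related A Ob (src X) ?B (lbr Ob u 0)"
  by (rule related_bracket[OF spb_f D(3) related_right_inv(1)[OF a] D(1) vR D(2) z])
 then have sB: "Ts (?B x) = 0" if "x : pts A" for x using that D(2) by (simp add: related_def)
 have m: "mulrel ?B 0 ?B"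
  using mulrel_bracket[OF D(5) right_inv_mulrel[OF a] D(1,1,1) vR z vR] D(1) by simp
 show "?b : AS X" unfolding algebroid_sections_def
 proof (intro CollectI conjI ballI allI impI)
  fix F assume F: "F : C_inf A"
  have "(%x. ?b x F) = pb Ob (unt X) (lie_der ?B F)" by (auto simp: pb_def lie_der_def)
  then show "(%x. ?b x F) : C_inf Ob" using spb_pb[OF spb_unt vfD(3)[OF B F]] by simp
 qed (use vfD(1)[OF B] sB in auto)
 show "R ?b = ?B"
 proof
  fix x show "R ?b x = ?B x"
  proof (cases "x : pts A")
   case True
   have "?B (mul (unt X (tgt X x)) x) = tcmp X (unt X (tgt X x)) (?B (unt X (tgt X x))) x 0"
    using m unit_comp(1)[OF True] by (auto simp: mulrel_def)
   then show ?thesis using True by (simp add: right_inv_eq)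
  qed (use vfD(2)[OF B] in "auto simp: right_inv_def")
 qed
qed

text \<open>For \<open>mulrel\<close> the types \<open>(0, L a, L a)\<close> and
  \<open>(R b, 0, R b)\<close> have a bracket of type \<open>(0, 0, [L a, R b])\<close>. Evaluated
  at \<open>x\<close> times a unit, the third field is a product of zero vectors.\<close>

lemma left_right_commute: assumes a: "a : AS X" and b: "b : AS X" shows "lbr A (L a) (R b) = 0"
proof
 fix x
 note vL = left_inv_vector_field[OF a] and vR = right_inv_vector_field[OF b]
 have z: "0 : VF A" by (rule subspace_0[OF vf_subspace])
 have m: "mulrel 0 0 (lbr A (L a) (R b))"
  using mulrel_bracket[OF left_inv_mulrel[OF a] right_inv_mulrel[OF b] z vL vL vR z vR] vL vR by simp
 show "lbr A (L a) (R b) x = 0 x"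
 proof (cases "x : pts A")
  case True
  then show ?thesis using m unit_comp(2)[OF True] tcmp_0[OF unit_comp(2)[OF True]] by (force simp: mulrel_def)
 qed (use vfD(2)[OF lbr_vector_field[OF vL vR]] in auto)
qed

text \<open>The boundary of \<open>action\<close> and the bracket with the boundary of
  \<open>a\<close> are both multiplicative with the same anchor, hence agree at units by
  \<open>mult_field_unit\<close>. Their right invariant parts agree, so the left invariant parts
  agree at units, and left invariance spreads this to all arrows.\<close>

lemma left_inv_bracket: assumes xi: "(xi, u) : MF X" and a: "a : AS X"
 shows "L (action (LTX X) (xi, u) a) = lbr A xi (L a)"
  and "(%x. Tt (action (LTX X) (xi, u) a x)) = lbr Ob u (%x. Tt (a x))"
proof -
 note D = mult_fieldsD[OF xi] and vR = right_inv_vector_field[OF a] and vL = left_inv_vector_field[OF a]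
 note av = anchor_vector_field[OF a]
 let ?b = "action (LTX X) (xi, u) a" and ?B = "lbr A xi (L a)"
 note b = action_section[OF xi a]
 have z: "0 : VF A" by (rule subspace_0[OF vf_subspace])
 have vB: "?B : VF A" by (rule lbr_vector_field[OF D(1) vL])
 have r: "related A Ob (tgt X) (lbr A xi (R a)) (lbr Ob u (%x. Tt (a x)))"
  by (rule related_bracket[OF spb_g D(4) related_right_inv(2)[OF a] D(1) vR D(2) av])
 show anch: "(%x. Tt (?b x)) = lbr Ob u (%x. Tt (a x))"
 proof
  fix x
  show "Tt (?b x) = lbr Ob u (%x. Tt (a x)) x" using r vfD(2)[OF lbr_vector_field[OF D(2) av]]
   by (cases "x : pts Ob") (auto simp: related_def)
 qed
 note da = mult_fieldsD[OF bdry_mult_field[OF a]]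
 have "(lbr A xi (R a - L a), lbr Ob u (%x. Tt (a x))) : MF X" unfolding mult_fields_iff
  by (intro conjI lbr_vector_field related_bracket[OF spb_f] related_bracket[OF spb_g] mulrel_bracket D da)
 note U = mult_field_unit[OF this] mult_field_unit[OF bdry_mult_field[OF b(1)]]
 have unit: "L ?b (unt X p) = ?B (unt X p)" if p: "p : pts Ob" for p
 proof -
  have "R ?b (unt X p) - L ?b (unt X p) = lbr A xi (R a) (unt X p) - ?B (unt X p)"
   using U[OF p] fun_cong[OF anch, of p] by (simp add: lbr_diff2[OF D(1) vR vL] del: LTX_simps(5))
  then show ?thesis by (simp add: b(2))
 qed
 have mB: "mulrel 0 ?B ?B"
  using mulrel_bracket[OF D(5) left_inv_mulrel[OF a] D(1,1,1) z vL vL] D(1) by simp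
 show "L ?b = ?B"
 proof
  fix x show "L ?b x = ?B x"
  proof (cases "x : pts A")
   case True
   let ?e = "unt X (src X x)"
   have "L ?b (mul x ?e) = tcmp X x 0 ?e (L ?b ?e)" "?B (mul x ?e) = tcmp X x 0 ?e (?B ?e)"
    using left_inv_mulrel[OF b(1)] mB unit_comp(2)[OF True] by (auto simp: mulrel_def)
   then show ?thesis using True unit by simp
  qed (use vfD(2)[OF vB] in "auto simp: left_inv_def")
 qed
qed

lemma left_inv_linear: assumes a: "a : AS X" and a': "a' : AS X"
 shows "L (b *r a + c *r a') = b *r L a + c *r L a'"
proof
 fix x
 have s: "b *r a + c *r a' : AS X"
  by (intro subspace_add[OF algebroid_sections_subspace] subspace_scale[OF algebroid_sections_subspace] a a')
 show "L (b *r a + c *r a') x = (b *r L a + c *r L a') x"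
 proof (cases "x : pts A")
  case True
  then show ?thesis
   by (simp add: left_inv_right_inv[OF a] left_inv_right_inv[OF a'] left_inv_right_inv[OF s] right_inv_linear[OF a a']
     scaleR_app scaleR_app scaleR_app scaleR_app
     tmap_add tmap_scaleR)
 qed (simp add: left_inv_out scaleR_app)
qed

lemma crossed_mod_LTX: "crossed_mod (LTX X)"
proof
 note V = mult_fieldsD(1) and W = mult_fieldsD(2)
 note aR = right_inv_vector_field
 show "subspace (low (LTX X))" "subspace (up (LTX X))"
  by (simp_all add: algebroid_sections_subspace mult_fields_subspace)
 fix x y z :: "('o, 'a) mfield" and u v :: "'o => 'a tvec" and b c :: real
 obtain xi al et be ze ga where e: "x = (xi, al)" "y = (et, be)" "z = (ze, ga)" by (cases x, cases y, cases z)
 {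
  assume "x : up (LTX X)" then have x: "(xi, al) : MF X" by (simp add: e)
  assume "y : up (LTX X)" then have y: "(et, be) : MF X" by (simp add: e)
  note x' = mult_fieldsD[OF x] and y' = mult_fieldsD[OF y]
  show "brk (LTX X) x y : up (LTX X)" unfolding e LTX_simps mult_fields_iff
   by (intro conjI lbr_vector_field related_bracket[OF spb_f] related_bracket[OF spb_g] mulrel_bracket x' y')
  show "brk (LTX X) x y = - brk (LTX X) y x"
   unfolding e using lbr_skew[of A xi et] lbr_skew[of Ob al be] by simp
  {
   assume "z : up (LTX X)" then have z: "(ze, ga) : MF X" by (simp add: e)
   note z' = mult_fieldsD[OF z]
   show "brk (LTX X) x (b *r y + c *r z) = b *r brk (LTX X) x y + c *r brk (LTX X) x z"
    unfolding e by (simp add: lbr_linear2[OF x'(1) y'(1) z'(1)] lbr_linear2[OF x'(2) y'(2) z'(2)])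
   show "brk (LTX X) (brk (LTX X) x y) z = brk (LTX X) x (brk (LTX X) y z) - brk (LTX X) y (brk (LTX X) x z)"
    unfolding e by (simp add: lbr_jacobi[OF x'(1) y'(1) z'(1)] lbr_jacobi[OF x'(2) y'(2) z'(2)])
  }
  assume u: "u : low (LTX X)" then have u': "u : AS X" by simp
  show "action (LTX X) (b *r x + c *r y) u = b *r action (LTX X) x u + c *r action (LTX X) y u"
   unfolding e by (rule ext) (simp add: lbr_linear1[OF aR[OF u'] x'(1) y'(1)] scaleR_app)
  note au = action_section[OF x u'] action_section[OF y u']
  have bx: "(lbr A xi et, lbr Ob al be) : MF X" unfolding mult_fields_iff
   by (intro conjI lbr_vector_field related_bracket[OF spb_f] related_bracket[OF spb_g] mulrel_bracket x' y')
  show "action (LTX X) (brk (LTX X) x y) u = action (LTX X) x (action (LTX X) y u) - action (LTX X) y (action (LTX X) x u)"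
   unfolding e by (rule ext) (simp add: au lbr_jacobi[OF x'(1) y'(1) aR[OF u']])
 }
 {
  assume "u : low (LTX X)" then have u: "u : AS X" by simp
  show "bdry (LTX X) u : up (LTX X)" using bdry_mult_field[OF u] by simp
  {
   assume "v : low (LTX X)" then have v: "v : AS X" by simp
   show "bdry (LTX X) (b *r u + c *r v) = b *r bdry (LTX X) u + c *r bdry (LTX X) v"
    by (simp add: right_inv_linear[OF u v] left_inv_linear[OF u v] algebra_simps)
     (simp add: fun_eq_iff scaleR_fun_def tmap_def)
   \<comment> \<open>Left and right invariant fields commute, so the two terms are brackets of
     \<open>R u\<close> and \<open>R v\<close> along the units, in opposite order.\<close>
   show "action (LTX X) (bdry (LTX X) u) v + action (LTX X) (bdry (LTX X) v) u = 0"
    using lbr_skew[of A "R u" "R v"]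
    by (intro ext) (simp add: lbr_diff1 aR u v left_inv_vector_field left_right_commute)
  }
  assume "x : up (LTX X)" then have x: "(xi, al) : MF X" by (simp add: e)
  show "action (LTX X) x u : low (LTX X)" unfolding e using action_section(1)[OF x u] by simp
  show "bdry (LTX X) (action (LTX X) x u) = brk (LTX X) x (bdry (LTX X) u)"
   unfolding e using left_inv_bracket[OF x u] action_section(2)[OF x u]
   by (simp add: lbr_diff2[OF V[OF x] aR[OF u] left_inv_vector_field[OF u]] del: LTX_simps(5))
  assume "v : low (LTX X)" then have v: "v : AS X" by simp
  show "action (LTX X) x (b *r u + c *r v) = b *r action (LTX X) x u + c *r action (LTX X) x v"
   unfolding e by (rule ext)
    (simp add: right_inv_linear[OF u v] lbr_linear2[OF V[OF x] aR[OF u] aR[OF v]] scaleR_app)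
 }
qed

subsection \<open>The coefficients\<close>

lemma mult_funs_iff: "F : mult_funs X <-> F : C_inf A & (ALL x y. (x, y) : Cp --> F (mul x y) = F x + F y)"
 by (auto simp: mult_funs_def composables_FP)

lemma mult_funs_subspace: "subspace (mult_funs X)"
proof (rule subspaceI2)
 fix F G and b c :: real assume "F : mult_funs X" "G : mult_funs X"
 then show "b *r F + c *r G : mult_funs X"
  by (simp add: mult_funs_iff C_inf_add C_inf_scaleR scaleR_app algebra_simps)
qed (simp add: mult_funs_iff)

lemma subspace_FX: "subspace (FX X i)" unfolding FX_def grading_def
 using C_inf_subspace[of Ob] mult_funs_subspace by (auto intro: subspace_Times subspace_single_0)

end

section \<open>Principal bundles and horizontal lifts\<close>

text \<open>Instantiated twice for a 2-bundle, on arrows and on objects.\<close>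

locale principal_bundle =
 fixes M :: "('p, 'e::euclidean_space) mfd" and N :: "('g, 'f::euclidean_space) mfd"
  and H :: "'g monoid" and act :: "'p => 'g => 'p"
  and Y :: "('x, 'd::euclidean_space) mfd" and q :: "'p => 'x"
 assumes mfd: "smooth_manifold M" "smooth_manifold N" "smooth_manifold Y"
  and grp: "group H" "carrier H = pts N" and action: "right_group_action (pts M) H act"
  and spb_act: "spb (prod_mfd M N) M (%(p, g). act p g)" and sub_q: "submersion M Y q"
  and diffeo: "diffeomorphism (prod_mfd M N) (sub_mfd (prod_mfd M M) (fib M M q q)) (%(p, g). (p, act p g))"
begin

sublocale K: fibre_product M M Y q q using mfd sub_q by unfold_locales (auto simp: submersion_def)

lemma mf_N [simp]: "mf N" and atl_N [simp]: "hatl N" and atl_MN [simp]: "hatl (prod_mfd M N)"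
proof -
 show "mf N" using mfd by (auto intro: smooth_manifold_imp_mf)
 then show "hatl N" by simp
 then show "hatl (prod_mfd M N)" by (intro hatl_prod) auto
qed

lemma one_point [simp]: "\<one>\<^bsub>H\<^esub> : pts N"
 using grp monoid.one_closed[of H] by (simp add: group.is_monoid)

lemma act_one [simp]: "p : pts M ==> act p \<one>\<^bsub>H\<^esub> = p"
 using action by (simp add: right_group_action_def)

lemma act_points [simp]: "p : pts M ==> g : pts N ==> act p g : pts M"
 using spb_points[OF spb_act, of "(p, g)"] by simp

lemma q_act [simp]: "p : pts M ==> g : pts N ==> q (act p g) = q p"
proof -
 assume "p : pts M" "g : pts N"
 then have "(p, act p g) : fib M M q q"
  using diffeo by (force simp: diffeomorphism_def bij_betw_def)
 then show ?thesis by (simp add: fib_def)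
qed

lemma spb_right: "g : pts N ==> spb M M (%p. act p g)"
 using spb_compose[OF spb_pair[OF K.atl(1) K.mf(1) mf_N spb_id spb_const[OF K.atl(1)]] spb_act] by simp

lemma spb_orbit: "p : pts M ==> spb N M (act p)"
 using spb_compose[OF spb_pair[OF atl_N K.mf(1) mf_N spb_const[OF atl_N] spb_id] spb_act] by simp

abbreviation "Tq == tmap M Y q"
abbreviation "fund p == tmap N M (act p)"

lemma fund_tangent: "p : pts M ==> v : TS N \<one>\<^bsub>H\<^esub> ==> fund p v : TS M p"
 using tmap_tangent[OF spb_orbit one_point, of p v] by simp

lemma Tq_fund: assumes p: "p : pts M" and v: "v : TS N \<one>\<^bsub>H\<^esub>" shows "Tq (fund p v) = 0"
proof
 fix F
 have "Tq (fund p v) = tmap N Y (%g. q (act p g)) v" by (rule tmap_compose[OF spb_orbit[OF p] K.spb_f])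
 also have "... = tmap N Y (%g. q p) v" by (rule tmap_cong) (use p in simp)
 finally have e: "Tq (fund p v) = tmap N Y (%g. q p) v" .
 show "Tq (fund p v) F = 0 F"
 proof (cases "F : C_inf Y")
  case True
  have "pb N (%g. q p) F = const_on N (F (q p))" by (auto simp: pb_def const_on_def)
  then show ?thesis using tangent_const[OF atl_N one_point v] by (simp add: e tmap_pb[OF True])
 qed (simp add: tmap_def)
qed

text \<open>The tangent vector \<open>(0, v)\<close> of the fibre product is transported to \<open>M \<times> N\<close> by the inverse of
  \<open>(p, g) \<mapsto> (p, p g)\<close>.\<close>

lemma vertical: assumes p: "p : pts M" and v: "v : TS M p" and q0: "Tq v = 0"
 shows "EX a:TS N \<one>\<^bsub>H\<^esub>. v = fund p a"
proof -
 let ?P = "prod_mfd M N" and ?D = "%(p, g). (p, act p g)"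
 let ?I = "inv_into (pts ?P) ?D"
 have bij: "bij_betw ?D (pts ?P) (pts K.FP)" and sD: "spb ?P K.FP ?D" and sI: "spb K.FP ?P ?I"
  using diffeo smooth_map_imp_spb[OF atl_MN K.atl_FP] smooth_map_imp_spb[OF K.atl_FP atl_MN]
  by (auto simp: diffeomorphism_def)
 have pp: "(p, p) : fib M M q q" using p by (simp add: fib_def)
 have ppF: "(p, p) : pts K.FP" using pp by simp
 have Ipp: "?I (p, p) = (p, \<one>\<^bsub>H\<^esub>)" using bij p by (intro inv_into_f_eq) (auto simp: bij_betw_def)
 have fI: "fst (?I z) = fst z" if "z : pts K.FP" for z
 proof -
  have "z : ?D ` pts ?P" using bij that by (simp add: bij_betw_def)
  then have "?D (?I z) = z" by (rule f_inv_into_f)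
  then show ?thesis by (metis (mono_tags, lifting) case_prod_unfold fst_conv)
 qed
 note z = K.fpair[OF zero_tangent v pp, unfolded tmap_0 q0, OF refl]
 let ?z = "K.fpair (p, p) 0 v" and ?z' = "tmap K.FP ?P ?I (K.fpair (p, p) 0 v)"
 have z': "?z' : TS ?P (p, \<one>\<^bsub>H\<^esub>)" using tmap_tangent[OF sI ppF z(1)] Ipp by simp
 have "tmap ?P M fst ?z' = tmap K.FP M (%x. fst (?I x)) ?z"
  by (rule tmap_compose[OF sI spb_fst]) auto
 also have "... = tmap K.FP M fst ?z" by (rule tmap_cong[OF fI])
 finally have f0: "tmap ?P M fst ?z' = 0" using z(2) by simp
 let ?a = "tmap ?P N snd ?z'"
 have a: "?a : TS N \<one>\<^bsub>H\<^esub>"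
 proof -
  have "(p, \<one>\<^bsub>H\<^esub>) : pts ?P" using p by simp
  from tmap_tangent[OF spb_snd[OF K.atl(1) atl_N] this z'] show ?thesis by simp
 qed
 have "tmap ?P M (%(p, g). act p g) ?z' = tmap K.FP M (%x. (%(p, g). act p g) (?I x)) ?z"
  by (rule tmap_compose[OF sI spb_act])
 also have "... = tmap K.FP M snd ?z"
 proof (rule tmap_cong)
  fix z assume "z : pts K.FP"
  then have "z : ?D ` pts ?P" using bij by (simp add: bij_betw_def)
  then have "?D (?I z) = z" by (rule f_inv_into_f)
  then show "(%(p, g). act p g) (?I z) = snd z" by (metis (mono_tags, lifting) case_prod_unfold snd_conv)
 qed
 finally have v': "v = tmap ?P M (%(p, g). act p g) ?z'" using z(3) by simp
 have "v = fund p ?a"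
 proof
  fix F show "v F = fund p ?a F"
  proof (cases "F : C_inf M")
   case True
   have "v F = ?z' (pb ?P (%(p, g). act p g) F)" by (subst v') (rule tmap_pb[OF True])
   also have "... = ?a (%g. pb ?P (%(p, g). act p g) F (p, g))"
    using tangent_prod[OF K.mf(1) mf_N p one_point z' spb_pb[OF spb_act True]] by (simp only: f0) simp
   also have "(%g. pb ?P (%(p, g). act p g) F (p, g)) = pb N (act p) F" using p by (auto simp: pb_def)
   finally show ?thesis unfolding tmap_pb[OF True] .
  qed (use tangentD(4)[OF v] in "simp add: tmap_def")
 qed
 then show ?thesis using a by blast
qed

context
 fixes th :: "'p => 'p tvec => 'g tvec" assumes conn: "principal_connection M N H act th"
begin

lemma conn_tangent: "p : pts M ==> v : TS M p ==> th p v : TS N \<one>\<^bsub>H\<^esub>"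
 and conn_add: "p : pts M ==> v : TS M p ==> w : TS M p ==> th p (v + w) = th p v + th p w"
 and conn_scaleR: "p : pts M ==> v : TS M p ==> th p (c *r v) = c *r th p v"
 and conn_fund: "p : pts M ==> a : TS N \<one>\<^bsub>H\<^esub> ==> th p (fund p a) = a"
 and conn_smooth: "xi : VF M ==> f : C_inf N ==> (%p. if p : pts M then th p (xi p) f else 0) : C_inf M"
 and conn_equiv: "p : pts M ==> g : pts N ==> v : TS M p ==>
   th (act p g) (tmap M M (%q. act q g) v) = tmap N N (%k. inv\<^bsub>H\<^esub> g \<otimes>\<^bsub>H\<^esub> k \<otimes>\<^bsub>H\<^esub> g) (th p v)"
 using conn grp(2) unfolding principal_connection_def by auto

lemma conn_linear: assumes "p : pts M" "v : TS M p" "w : TS M p"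
 shows "th p (b *r v + c *r w) = b *r th p v + c *r th p w"
 using assms by (simp add: conn_add conn_scaleR subspace_scale[OF tangent_subspace])

lemma conn_0: "p : pts M ==> th p 0 = 0" using conn_scaleR[of p 0 0] by simp

lemma horizontal_unique: assumes p: "p : pts M" and v: "v : TS M p" "v' : TS M p"
  and "Tq v = Tq v'" "th p v = 0" "th p v' = 0" shows "v = v'"
proof -
 have d: "v - v' : TS M p" by (rule subspace_diff[OF tangent_subspace v])
 have "th p (v - v') = 0" using conn_linear[OF p v, of 1 "-1"] assms by simp
 moreover obtain a where a: "a : TS N \<one>\<^bsub>H\<^esub>" "v - v' = fund p a"
  using vertical[OF p d] assms(4) by (auto simp: tmap_diff)
 ultimately have "a = 0" using conn_fund[OF p a(1)] by simp
 then show ?thesis using a(2) by simp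
qed

abbreviation "hl == hor_lift M Y q th"

lemma hor_lift_eq: assumes "p : pts M" "v : TS M p" "Tq v = w" "th p v = 0" shows "hl p w = v"
 unfolding hor_lift_def
proof (rule the_equality)
 fix v' assume v': "v' : TS M p & Tq v' = w & th p v' = 0"
 show "v' = v" by (rule horizontal_unique[OF assms(1) _ assms(2) _ _ assms(4)]) (use v' assms(3) in auto)
qed (use assms in auto)

text \<open>Subtracting from a lift the fundamental vector of its connection value makes it
  horizontal. This gives the existence of horizontal lifts and also the formula by which their
  smoothness is shown.\<close>

lemma hor_part: assumes p: "p : pts M" and v: "v : TS M p"
 shows "v - fund p (th p v) : TS M p" "Tq (v - fund p (th p v)) = Tq v"
  "th p (v - fund p (th p v)) = 0" "hl p (Tq v) = v - fund p (th p v)"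
proof -
 note c = conn_tangent[OF p v]
 note f = fund_tangent[OF p c]
 show 1: "v - fund p (th p v) : TS M p" by (rule subspace_diff[OF tangent_subspace v f])
 show 2: "Tq (v - fund p (th p v)) = Tq v" using Tq_fund[OF p c] by (simp add: tmap_diff)
 show 3: "th p (v - fund p (th p v)) = 0" using conn_linear[OF p v f, of 1 "-1"] conn_fund[OF p c] by simp
 show "hl p (Tq v) = v - fund p (th p v)" by (rule hor_lift_eq[OF p 1 2 3])
qed

lemma hor_lift: assumes p: "p : pts M" and w: "w : TS Y (q p)"
 shows "hl p w : TS M p" "Tq (hl p w) = w" "th p (hl p w) = 0"
proof -
 have "w : Tq ` TS M p" using sub_q p w by (simp add: submersion_def)
 then obtain v where v: "v : TS M p" "w = Tq v" by blast
 show "hl p w : TS M p" "Tq (hl p w) = w" "th p (hl p w) = 0"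
  unfolding v(2) hor_part(4)[OF p v(1)] using hor_part[OF p v(1)] by auto
qed

lemma hor_lift_linear: assumes p: "p : pts M" and w: "w : TS Y (q p)" "w' : TS Y (q p)"
 shows "hl p (b *r w + c *r w') = b *r hl p w + c *r hl p w'"
 using hor_lift[OF p w(1)] hor_lift[OF p w(2)] by (intro hor_lift_eq[OF p])
  (auto simp: tmap_add tmap_scaleR conn_linear[OF p] intro!: subspace_add[OF tangent_subspace] subspace_scale[OF tangent_subspace])

lemma hor_lift_0: "p : pts M ==> hl p 0 = 0" by (rule hor_lift_eq) (auto simp: conn_0)

lemma hor_lift_equiv: assumes p: "p : pts M" and g: "g : pts N" and w: "w : TS Y (q p)"
 shows "hl (act p g) w = tmap M M (%q. act q g) (hl p w)"
proof (rule hor_lift_eq)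
 note h = hor_lift[OF p w]
 show "act p g : pts M" using p g by simp
 show "tmap M M (%q. act q g) (hl p w) : TS M (act p g)" by (rule tmap_tangent[OF spb_right[OF g] p h(1)])
 have "Tq (tmap M M (%q. act q g) (hl p w)) = tmap M Y (%p. q (act p g)) (hl p w)"
  by (rule tmap_compose[OF spb_right[OF g] K.spb_f])
 also have "... = Tq (hl p w)" by (rule tmap_cong) (use g in simp)
 finally show "Tq (tmap M M (%q. act q g) (hl p w)) = w" using h(2) by simp
 show "th (act p g) (tmap M M (%q. act q g) (hl p w)) = 0" using conn_equiv[OF p g h(1)] h(3) by simp
qed

definition hfield :: "('x => 'x tvec) => 'p => 'p tvec" where
 "hfield xi p = (if p : pts M then hl p (xi (q p)) else 0)"

text \<open>Near each point a lift of \<open>xi\<close> is obtained from a local section of \<open>q\<close>; its horizontal part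
  is smooth and agrees with the horizontal lift.\<close>

lemma hfield_smooth: assumes xi: "xi : VF Y" shows "hfield xi : VF M"
proof (rule vfI)
 have qY: "p : pts M ==> q p : pts Y" for p by (rule spb_points[OF K.spb_f])
 have xit: "p : pts M ==> xi (q p) : TS Y (q p)" for p using vfD(1)[OF xi qY] .
 show "p : pts M ==> hfield xi p : TS M p" for p
  using hor_lift(1)[OF _ xit] by (simp add: hfield_def)
 show "p ~: pts M ==> hfield xi p = 0" for p by (simp add: hfield_def)
 fix F assume F: "F : C_inf M"
 show "(%p. if p : pts M then hfield xi p F else 0) : C_inf M"
 proof (rule C_infI[OF K.atl(1)])
  fix p0 assume p0: "p0 : pts M"
  let ?P = "prod_mfd M Y"
  have AP: "hatl ?P" by (rule hatl_prod[OF K.atl(1,3)])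
  obtain si h where h: "h : C_inf ?P" "h (p0, q p0) ~= 0"
   "ALL m n. h (m, n) ~= 0 --> si m n : pts M & q (si m n) = n" "ALL m. h (m, q m) ~= 0 --> si m (q m) = m"
   "ALL F:C_inf M. EX G:C_inf ?P. ALL m n. h (m, n) ~= 0 --> G (m, n) = F (si m n)"
   by (rule submersion_section[OF K.mf(1,3) sub_q p0])
  define G where "G F = (SOME G. G : C_inf ?P & (ALL m n. h (m, n) ~= 0 --> G (m, n) = F (si m n)))" for F
  have G: "G F : C_inf ?P" "h (m, n) ~= 0 ==> G F (m, n) = F (si m n)" if "F : C_inf M" for F m n
  proof -
   have "EX G. G : C_inf ?P & (ALL m n. h (m, n) ~= 0 --> G (m, n) = F (si m n))" using h(5) that by blast
   from someI_ex[OF this, folded G_def] show "G F : C_inf ?P" "h (m, n) ~= 0 ==> G F (m, n) = F (si m n)" by auto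
  qed
  \<comment> \<open>The velocity of \<open>si p (de t)\<close> for any curve \<open>de\<close> with
    velocity \<open>w\<close>, written through the functions \<open>G F\<close>, so that its
    dependence on \<open>p\<close> is visibly smooth.\<close>
  define ta where "ta p w = (%F. if F : C_inf M then w (%n. G F (p, n)) else 0)" for p and w :: "'x tvec"
  have ta: "ta p w : TS M p" "Tq (ta p w) = w"
   if p: "p : pts M" and hp: "h (p, q p) ~= 0" and w: "w : TS Y (q p)" for p w
  proof -
   obtain de where de: "has_vel Y de (q p) w" using has_vel_exists[OF K.mf(3) qY[OF p] w] by blast
   have "ev (%n. h (p, n) ~= 0) (nhm Y (q p))"
    by (rule ev_nhmI[OF K.atl(3) qY[OF p] C_inf_slice2[OF K.mf(1,3) h(1) p] hp])
   note ev = has_vel_eventually[OF K.atl(3) qY[OF p] de this]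
   have v: "has_vel M (%t. si p (de t)) p (ta p w)" unfolding has_vel_def
   proof (intro conjI ballI)
    show "si p (de 0) = p" using h(4) hp has_vel_0[OF de] by simp
    fix F assume F: "F : C_inf M"
    have "ev (%t. G F (p, de t) = F (si p (de t))) (nhds 0)" using ev by eventually_elim (simp add: G(2)[OF F])
    from DERIV_cong_nhds[OF this has_velD[OF de C_inf_slice2[OF K.mf(1,3) G(1)[OF F] p]]]
    show "((%t. F (si p (de t))) has_real_derivative ta p w F) (at 0)" using F by (simp add: ta_def)
   qed (simp add: ta_def)
   show "ta p w : TS M p" by (rule has_vel_tangent[OF v])
   have "ev (%t. q (si p (de t)) = de t) (nhds 0)" using ev by eventually_elim (use h(3) in auto)
   from has_vel_unique[OF has_vel_cong[OF has_vel_tmap[OF K.atl(1) p K.spb_f v] this] de]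
   show "Tq (ta p w) = w" .
  qed
  have pP: "(p0, q p0) : pts ?P" using p0 qY by simp
  have evh: "ev (%x. h x ~= 0) (nhm ?P (p0, q p0))" by (rule ev_nhmI[OF AP pP h(1,2)])
  obtain u where u: "u : C_inf ?P" "ev (%x. u x = 1) (nhm ?P (p0, q p0))" "!!x. u x ~= 0 ==> h x ~= 0"
   by (rule bump_function[OF AP pP evh]) (rule that; assumption)
  have sgr: "spb M ?P (%p. (p, q p))" by (rule spb_pair[OF K.atl(1) K.mf(1,3) spb_id K.spb_f])
  define k where "k = pb M (%p. (p, q p)) u"
  have k: "k : C_inf M" unfolding k_def by (rule spb_pb[OF sgr u(1)])
  define v where "v p = (if p : pts M then k p *r ta p (xi (q p)) else 0)" for p
  have vt: "v p : TS M p" "Tq (v p) = k p *r xi (q p)" if p: "p : pts M" for p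
  proof -
   have "v p : TS M p & Tq (v p) = k p *r xi (q p)"
   proof (cases "k p = 0")
    case False
    then have "h (p, q p) ~= 0" using p u(3) by (auto simp: k_def pb_def)
    note ta[OF p this xit[OF p]]
    then show ?thesis using p subspace_scale[OF tangent_subspace] by (simp add: v_def tmap_scaleR)
   qed (use p in "simp add: v_def")
   then show "v p : TS M p" "Tq (v p) = k p *r xi (q p)" by auto
  qed
  have v: "v : VF M"
  proof (rule vfI)
   fix F assume F: "F : C_inf M"
   have "(%p. if p : pts M then xi (q p) (%n. G F (p, n)) else 0) : C_inf M"
    using C_inf_field_along[where a="%p. xi (q p)" and b="%p. p", OF K.atl(1) K.mf(3,1) K.spb_f spb_id xit _
      C_inf_swap[OF K.mf(1,3) G(1)[OF F]]] spb_pb[OF K.spb_f vfD(3)[OF xi]]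
    by (simp add: pb_def lie_der_def cong: if_cong)
   then have "k * (%p. if p : pts M then xi (q p) (%n. G F (p, n)) else 0) : C_inf M"
    by (rule C_inf_mult[OF k])
   moreover have "k * (%p. if p : pts M then xi (q p) (%n. G F (p, n)) else 0) = (%p. if p : pts M then v p F else 0)"
    using F by (auto simp: v_def ta_def scaleR_app)
   ultimately show "(%p. if p : pts M then v p F else 0) : C_inf M" by simp
  qed (use vt in "auto simp: v_def")
  \<comment> \<open>The vertical part of \<open>v\<close>: the derivative of the action in the group
    variable at the identity, in the direction of the connection value. With the constant map to the
    identity as base map, \<open>C_inf_field_along\<close> covers it.\<close>
  define w where "w p = fund p (th p (v p))" for p
  have w: "(%p. if p : pts M then w p F else 0) : C_inf M"
  proof -
   have "(%p. if p : pts M then th p (v p) (%g. pb (prod_mfd M N) (%(p, g). act p g) F (p, g)) else 0) : C_inf M"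
    using C_inf_field_along[where a="%p. th p (v p)" and b="%p. p" and e="%p. \<one>\<^bsub>H\<^esub>",
      OF K.atl(1) mf_N K.mf(1) spb_const[OF K.atl(1) one_point] spb_id conn_tangent[OF _ vt(1)]
      conn_smooth[OF v] C_inf_swap[OF K.mf(1) mf_N spb_pb[OF spb_act F]]] by (simp cong: if_cong)
   moreover have "(%g. pb (prod_mfd M N) (%(p, g). act p g) F (p, g)) = pb N (act p) F" if "p : pts M" for p
    using that by (auto simp: pb_def)
   ultimately show ?thesis by (simp add: w_def tmap_pb[OF F] cong: if_cong)
  qed
  let ?g = "(%p. if p : pts M then v p F else 0) - (%p. if p : pts M then w p F else 0)"
  have g: "?g : C_inf M" using v vfD(3)[OF v F] by (intro C_inf_diff w) (auto simp: lie_der_def v_def cong: if_cong elim!: back_subst[of "%x. x : C_inf M"])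
  have "ev (%p. k p = 1) (nhm M p0)"
   using spb_eventually[OF K.atl(1) AP sgr p0 u(2)] ev_pts[OF K.atl(1) p0]
   by eventually_elim (simp add: k_def pb_def)
  then have "ev (%p. (if p : pts M then hfield xi p F else 0) = ?g p) (nhm M p0)"
   using ev_pts[OF K.atl(1) p0]
  proof eventually_elim
   case (elim p)
   have "hl p (xi (q p)) = v p - w p" using hor_part(4)[OF elim(2) vt(1)[OF elim(2)]] vt(2)[OF elim(2)] elim(1) by (simp add: w_def)
   then show ?case using elim by (simp add: hfield_def)
  qed
  then show "EX g:C_inf M. ev (%p. (if p : pts M then hfield xi p F else 0) = g p) (nhm M p0)"
   by (rule bexI[OF _ g])
 qed simp
qed

end

end

section \<open>Morphisms of Lie groupoids\<close>

text \<open>Preservation of units is not a clause of \<open>lgpd_morphism\<close>; it is derived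
  from this, because the image of a unit is idempotent. The same argument shows that units act on
  units by units.\<close>

lemma (in lgroupoid) idempotent_unit:
 assumes e: "e : pts A" "src X e = u" "tgt X e = u" and id: "cmp X e e = e" shows "e = unt X u"
proof -
 have C: "(ginv X e, e) : Cp" "(e, e) : Cp" using e by (auto simp: Cp_iff)
 have "cmp X (cmp X (ginv X e) e) e = cmp X (ginv X e) (cmp X e e)" by (rule mul_assoc[OF C])
 then show ?thesis using gpd_simps(2,6)[OF e(1)] e id by simp
qed

locale lgpd_pair = P: lgroupoid P + X: lgroupoid X
 for P :: "('o, 'a, 'e::euclidean_space) lgpd" and X :: "('p, 'b, 'd::euclidean_space) lgpd"
begin

text \<open>Three maps are allowed instead of one morphism because translating a product by a
  product of group arrows translates the factors by different arrows; \<open>TR_tcmp\<close> is that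
  case.\<close>

lemma tcmp_natural: assumes spb: "spb P.A X.A f" "spb P.A X.A g" "spb P.A X.A k"
  and fg: "!!x y. (x, y) : P.Cp ==> (f x, g y) : X.Cp & k (cmp P x y) = cmp X (f x) (g y)"
  and v: "v : TS P.A x" and w: "w : TS P.A y" and C: "(x, y) : P.Cp" and e: "P.Ts v = P.Tt w"
 shows "tmap P.A X.A k (tcmp P x v y w) = tcmp X (f x) (tmap P.A X.A f v) (g y) (tmap P.A X.A g w)"
proof -
 have x: "x : pts P.A" and y: "y : pts P.A" using C by (auto simp: P.Cp_iff)
 obtain ga de where *: "has_vel P.A ga x v" "has_vel P.A de y w" "ev (%t. src P (ga t) = tgt P (de t)) (nhds 0)"
  by (rule P.curves_exist[OF v w C e])
 have "ev (%t. (ga t, de t) : P.Cp) (nhds 0)"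
  using P.eventually_in_points[OF x *(1)] P.eventually_in_points[OF y *(2)] *(3)
  by eventually_elim (simp add: P.Cp_iff)
 then have ev: "ev (%t. src X (f (ga t)) = tgt X (g (de t)) &
   cmp X (f (ga t)) (g (de t)) = k (cmp P (ga t) (de t))) (nhds 0)"
  by eventually_elim (use fg in "simp add: X.Cp_iff")
 have fgC: "(f x, g y) : X.Cp" using fg[OF C] by simp
 show ?thesis
  by (rule X.tcmp_eqI[OF has_vel_tmap[OF P.atl(1) x spb(1) *(1)] has_vel_tmap[OF P.atl(1) y spb(2) *(2)] fgC
     has_vel_tmap[OF P.atl(1) P.mul_points[OF C] spb(3) P.tcmp_velocity[OF *(1,2) C *(3)]] ev, symmetric])
qed

end

locale lgpd_mor = lgpd_pair P X
 for P :: "('o, 'a, 'e::euclidean_space) lgpd" and X :: "('p, 'b, 'd::euclidean_space) lgpd" +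
 fixes F1 F0 assumes mor: "lgpd_morphism P X F1 F0"
begin

lemma spb1: "spb P.A X.A F1" and spb0: "spb P.Ob X.Ob F0"
 using mor by (auto simp: lgpd_morphism_def intro!: smooth_map_imp_spb)

lemma mor_src: "x : pts P.A ==> src X (F1 x) = F0 (src P x)"
 and mor_tgt: "x : pts P.A ==> tgt X (F1 x) = F0 (tgt P x)"
 and mor_mul: "(x, y) : P.Cp ==> F1 (cmp P x y) = cmp X (F1 x) (F1 y)"
 using mor by (auto simp: lgpd_morphism_def P.composables_FP)

lemma mor_points [simp]: "x : pts P.A ==> F1 x : pts X.A" "u : pts P.Ob ==> F0 u : pts X.Ob"
 using spb_points[OF spb1] spb_points[OF spb0] by auto

lemma mor_Cp: "(x, y) : P.Cp ==> (F1 x, F1 y) : X.Cp"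
 using mor_src mor_tgt by (auto simp: P.Cp_iff X.Cp_iff)

lemma mor_unt: "u : pts P.Ob ==> F1 (unt P u) = unt X (F0 u)"
 using mor_mul[of "unt P u" "unt P u"] P.unit_comp(3) P.gpd_simps(1)[of "unt P u"]
 by (intro X.idempotent_unit) (auto simp: mor_src mor_tgt)

lemma mor_ginv: assumes x: "x : pts P.A" shows "F1 (ginv P x) = ginv X (F1 x)"
proof (rule X.ginv_unique)
 have C: "(ginv P x, x) : P.Cp" using x by (simp add: P.Cp_iff)
 show "(F1 (ginv P x), F1 x) : X.Cp" by (rule mor_Cp[OF C])
 show "cmp X (F1 (ginv P x)) (F1 x) = unt X (src X (F1 x))"
  using mor_mul[OF C] x mor_unt[of "src P x"] mor_src by simp
qed

abbreviation "T1 == tmap P.A X.A F1"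
abbreviation "T0 == tmap P.Ob X.Ob F0"

lemma T_src: "X.Ts (T1 v) = T0 (P.Ts v)" by (rule tmap_square[OF spb1 X.spb_f P.spb_f spb0 mor_src])

lemma T_tgt: "X.Tt (T1 v) = T0 (P.Tt v)" by (rule tmap_square[OF spb1 X.spb_g P.spb_g spb0 mor_tgt])

lemma T_ginv: "X.Ti (T1 v) = T1 (P.Ti v)"
 by (rule tmap_square[OF spb1 X.spb_ginv P.spb_ginv spb1 mor_ginv[symmetric]])

lemma T_tcmp: "v : TS P.A x ==> w : TS P.A y ==> (x, y) : P.Cp ==> P.Ts v = P.Tt w ==>
  T1 (tcmp P x v y w) = tcmp X (F1 x) (T1 v) (F1 y) (T1 w)"
 by (rule tcmp_natural[OF spb1 spb1 spb1]) (simp_all add: mor_Cp mor_mul)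

definition rel_low :: "('o => 'a tvec) => ('p => 'b tvec) => bool" where
 "rel_low a b <-> (ALL p:pts P.Ob. T1 (a p) = b (F0 p))"

lemma rel_right_inv: assumes a: "a : AS P" and r: "rel_low a b"
 shows "related P.A X.A F1 (right_inv P a) (right_inv X b)" unfolding related_def
proof
 fix x assume x: "x : pts P.A"
 have t: "tgt P x : pts P.Ob" using x by simp
 have e: "P.Ts (a (tgt P x)) = P.Tt 0" using P.asD(2)[OF a t] by simp
 have "T1 (right_inv P a x) = tcmp X (F1 (unt P (tgt P x))) (T1 (a (tgt P x))) (F1 x) (T1 0)"
  unfolding P.right_inv_eq[OF x] by (rule T_tcmp[OF P.asD(1)[OF a t] zero_tangent P.unit_comp(1)[OF x] e])
 also have "... = right_inv X b (F1 x)"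
  using x r t by (simp add: X.right_inv_eq mor_unt mor_tgt rel_low_def)
 finally show "T1 (right_inv P a x) = right_inv X b (F1 x)" .
qed

lemma rel_left_inv: assumes a: "a : AS P" and b: "b : AS X" and r: "rel_low a b"
 shows "related P.A X.A F1 (left_inv P a) (left_inv X b)" unfolding related_def
proof
 fix x assume x: "x : pts P.A"
 have "T1 (left_inv P a x) = - X.Ti (T1 (right_inv P a (ginv P x)))"
  by (simp add: P.left_inv_right_inv[OF a x] tmap_minus T_ginv)
 also have "T1 (right_inv P a (ginv P x)) = right_inv X b (ginv X (F1 x))"
  using rel_right_inv[OF a r] x by (simp add: related_def mor_ginv)
 finally show "T1 (left_inv P a x) = left_inv X b (F1 x)" using x by (simp add: X.left_inv_right_inv[OF b] fun_Compl_def)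
qed

lemma rel_anchor: "rel_low a b ==> related P.Ob X.Ob F0 (%x. P.Tt (a x)) (%x. X.Tt (b x))"
 by (simp add: rel_low_def related_def flip: T_tgt)

lemma rel_action: assumes a: "a : AS P" and b: "b : AS X" and r: "rel_low a b"
  and xi: "(xi, u) : MF P" and et: "(et, w) : MF X" and r': "related P.A X.A F1 xi et"
 shows "rel_low (action (LTX P) (xi, u) a) (action (LTX X) (et, w) b)"
proof -
 have "related P.A X.A F1 (lbr P.A xi (right_inv P a)) (lbr X.A et (right_inv X b))"
  by (rule related_bracket[OF spb1 r' rel_right_inv[OF a r] P.mult_fieldsD(1)[OF xi] P.right_inv_vector_field[OF a]
   X.mult_fieldsD(1)[OF et] X.right_inv_vector_field[OF b]])
 then show ?thesis by (simp add: rel_low_def related_def mor_unt)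
qed

end

section \<open>Principal 2-bundles\<close>

locale two_bundle_loc =
 fixes B :: "('p0, 'p1, 'e::euclidean_space, 'g0, 'g1, 'f::euclidean_space,
   'x0, 'x1, 'd::euclidean_space) two_bundle" assumes is_bundle: "principal_2_bundle B"
begin

abbreviation "P == Tot B"
abbreviation "G == gpd (Grp B)"
abbreviation "X == Base B"
abbreviation "e1 == \<one>\<^bsub>AGrp (Grp B)\<^esub>"

sublocale G: lgroupoid G
 using is_bundle by unfold_locales (auto simp: principal_2_bundle_def lie_2_group_def)

sublocale lgpd_mor P X "proj1 B" "proj0 B"
 using is_bundle by unfold_locales (auto simp: principal_2_bundle_def fibration_def)

lemma groups: "group (AGrp (Grp B))" "carrier (AGrp (Grp B)) = pts G.A"
 "group (OGrp (Grp B))" "carrier (OGrp (Grp B)) = pts G.Ob" "unt G \<one>\<^bsub>OGrp (Grp B)\<^esub> = e1"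
 using is_bundle by (auto simp: principal_2_bundle_def lie_2_group_def)

lemma act_mor: "lgpd_morphism (prod_lgpd P G) P (%(p, g). act1 B p g) (%(p, g). act0 B p g)"
 using is_bundle by (simp add: principal_2_bundle_def)

lemma sub_proj0: "submersion P.Ob X.Ob (proj0 B)" "proj0 B ` pts P.Ob = pts X.Ob"
 using is_bundle by (auto simp: principal_2_bundle_def fibration_def surjective_submersion_def)

sublocale Q: fibre_product X.A P.Ob X.Ob "src X" "proj0 B" using X.sub_src P.X X.M X.X sub_proj0(1)
 by unfold_locales (auto simp: submersion_def)

lemma fib_map: "surjective_submersion P.A Q.FP (%p. (proj1 B p, src P p))"
 using is_bundle by (simp add: principal_2_bundle_def fibration_def fib_def)

text \<open>The fibration condition concerns the map to the fibre product of base arrows with total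
  objects. Given a vector \<open>w\<close> at the image arrow, its source is lifted to a vector on
  objects; the two together are a tangent vector of that fibre product, and a preimage of it maps to
  \<open>w\<close>.\<close>

lemma sub_proj1: "submersion P.A X.A (proj1 B)" "proj1 B ` pts P.A = pts X.A"
proof -
 let ?f = "%p. (proj1 B p, src P p)"
 have sub: "submersion P.A Q.FP ?f" and surj: "?f ` pts P.A = pts Q.FP"
  using fib_map by (auto simp: surjective_submersion_def)
 have sf: "spb P.A Q.FP ?f" using sub by (intro smooth_map_imp_spb) (auto simp: submersion_def)
 show "submersion P.A X.A (proj1 B)" unfolding submersion_def
 proof (intro conjI ballI)
  show "smooth_map P.A X.A (proj1 B)" using mor by (simp add: lgpd_morphism_def)
  fix p assume p: "p : pts P.A"
  show "T1 ` TS P.A p = TS X.A (proj1 B p)"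
  proof (intro subset_antisym subsetI)
   fix w assume w: "w : TS X.A (proj1 B p)"
   have sp: "src P p : pts P.Ob" using p by simp
   have "X.Ts w : TS X.Ob (proj0 B (src P p))"
    using tmap_tangent[OF X.spb_f mor_points(1)[OF p] w] mor_src[OF p] by simp
   then have "X.Ts w : T0 ` TS P.Ob (src P p)" using sub_proj0(1) sp by (simp add: submersion_def)
   then obtain v where v: "v : TS P.Ob (src P p)" "X.Ts w = T0 v" by blast
   have C: "(proj1 B p, src P p) : fib X.A P.Ob (src X) (proj0 B)"
    using p mor_src by (simp add: fib_def)
   note z = Q.fpair[OF w v(1) C v(2)]
   have "Q.fpair (proj1 B p, src P p) w v : tmap P.A Q.FP ?f ` TS P.A p"
    using sub p z(1) by (simp add: submersion_def)
   then obtain y where y: "y : TS P.A p" "Q.fpair (proj1 B p, src P p) w v = tmap P.A Q.FP ?f y" by blast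
   have "tmap Q.FP X.A fst (tmap P.A Q.FP ?f y) = tmap P.A X.A (%p. fst (?f p)) y"
    by (rule tmap_compose[OF sf Q.spb_p1])
   then have "T1 y = w" using z(2) y(2) by simp
   then show "w : T1 ` TS P.A p" using y(1) by blast
  qed (use tmap_tangent[OF spb1 p] in auto)
 qed
 show "proj1 B ` pts P.A = pts X.A"
 proof (intro subset_antisym subsetI)
  fix x assume x: "x : pts X.A"
  then have "src X x : proj0 B ` pts P.Ob" using sub_proj0(2) by simp
  then obtain p0 where "p0 : pts P.Ob" "src X x = proj0 B p0" by blast
  then have "(x, p0) : pts Q.FP" using x by (simp add: fib_def)
  then have "(x, p0) : ?f ` pts P.A" using surj by simp
  then show "x : proj1 B ` pts P.A" by auto
 qed auto
qed

lemma prod_lgpd_simps [simp]: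
 "Arr (prod_lgpd P' G') = prod_mfd (Arr P') (Arr G')" "Obj (prod_lgpd P' G') = prod_mfd (Obj P') (Obj G')"
 "src (prod_lgpd P' G') = map_prod (src P') (src G')" "tgt (prod_lgpd P' G') = map_prod (tgt P') (tgt G')"
 "cmp (prod_lgpd P' G') = (%(x, y) (x', y'). (cmp P' x x', cmp G' y y'))"
 by (simp_all add: prod_lgpd_def)

lemma spb_act1: "spb (prod_mfd P.A G.A) P.A (%(p, g). act1 B p g)"
 and spb_act0: "spb (prod_mfd P.Ob G.Ob) P.Ob (%(p, g). act0 B p g)"
 using act_mor by (auto simp: lgpd_morphism_def intro!: smooth_map_imp_spb hatl_prod)

lemma act_src: "p : pts P.A ==> g : pts G.A ==> src P (act1 B p g) = act0 B (src P p) (src G g)"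
 and act_tgt: "p : pts P.A ==> g : pts G.A ==> tgt P (act1 B p g) = act0 B (tgt P p) (tgt G g)"
 using act_mor by (auto simp: lgpd_morphism_def)

lemma act_mul: "(x, y) : P.Cp ==> (g, h) : G.Cp ==> act1 B (cmp P x y) (cmp G g h) = cmp P (act1 B x g) (act1 B y h)"
 using act_mor by (auto simp: lgpd_morphism_def composables_def P.Cp_iff G.Cp_iff)

lemma kernel_pair_simps:
 "Arr (kernel_pair P (proj1 B) (proj0 B)) = sub_mfd (prod_mfd P.A P.A) (fib P.A P.A (proj1 B) (proj1 B))"
 "Obj (kernel_pair P (proj1 B) (proj0 B)) = sub_mfd (prod_mfd P.Ob P.Ob) (fib P.Ob P.Ob (proj0 B) (proj0 B))"
 by (simp_all add: kernel_pair_def fib_def)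

lemma is_principal_bundle: "principal_bundle P.A G.A (AGrp (Grp B)) (act1 B) X.A (proj1 B)"
 "principal_bundle P.Ob G.Ob (OGrp (Grp B)) (act0 B) X.Ob (proj0 B)"
proof -
 have "right_group_action (pts P.A) (AGrp (Grp B)) (act1 B)"
  "right_group_action (pts P.Ob) (OGrp (Grp B)) (act0 B)"
  "lgpd_isomorphism (prod_lgpd P G) (kernel_pair P (proj1 B) (proj0 B))
    (%(p, g). (p, act1 B p g)) (%(p, g). (p, act0 B p g))"
  using is_bundle unfolding principal_2_bundle_def by blast+
 note r = this(1,2) this(3)[unfolded lgpd_isomorphism_def kernel_pair_simps prod_lgpd_simps]
 show "principal_bundle P.A G.A (AGrp (Grp B)) (act1 B) X.A (proj1 B)"
  by (rule principal_bundle.intro[OF P.M G.M X.M groups(1,2) r(1) spb_act1 sub_proj1(1)]) (use r(3) in blast)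
 show "principal_bundle P.Ob G.Ob (OGrp (Grp B)) (act0 B) X.Ob (proj0 B)"
  by (rule principal_bundle.intro[OF P.X G.X X.X groups(3,4) r(2) spb_act0 sub_proj0(1)]) (use r(3) in blast)
qed

sublocale b1: principal_bundle P.A G.A "AGrp (Grp B)" "act1 B" X.A "proj1 B"
 by (rule is_principal_bundle)

sublocale b0: principal_bundle P.Ob G.Ob "OGrp (Grp B)" "act0 B" X.Ob "proj0 B"
 by (rule is_principal_bundle)

abbreviation "TR1 g == tmap P.A P.A (%q. act1 B q g)"
abbreviation "TR0 g == tmap P.Ob P.Ob (%q. act0 B q g)"

lemma act_Cp: "(x, y) : P.Cp ==> (g, h) : G.Cp ==> (act1 B x g, act1 B y h) : P.Cp"
 using act_src act_tgt by (auto simp: P.Cp_iff G.Cp_iff)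

lemma act_unt: "p : pts P.Ob ==> g : pts G.Ob ==> unt P (act0 B p g) = act1 B (unt P p) (unt G g)"
 using act_mul[of "unt P p" "unt P p" "unt G g" "unt G g"] P.unit_comp(3) G.unit_comp(3)
  P.gpd_simps(1)[of "unt P p"] G.gpd_simps(1)[of "unt G g"]
 by (intro P.idempotent_unit[symmetric]) (auto simp: act_src act_tgt)

lemma act_ginv: assumes x: "x : pts P.A" and g: "g : pts G.A"
 shows "ginv P (act1 B x g) = act1 B (ginv P x) (ginv G g)"
proof (rule P.ginv_unique[symmetric])
 have C: "(ginv P x, x) : P.Cp" "(ginv G g, g) : G.Cp" using x g by (auto simp: P.Cp_iff G.Cp_iff)
 show "(act1 B (ginv P x) (ginv G g), act1 B x g) : P.Cp" by (rule act_Cp[OF C])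
 show "cmp P (act1 B (ginv P x) (ginv G g)) (act1 B x g) = unt P (src P (act1 B x g))"
  using act_mul[OF C] x g act_unt[of "src P x" "src G g"] by (simp add: act_src)
qed

lemma TR_tcmp: assumes "v : TS P.A x" "w : TS P.A y" "(x, y) : P.Cp"
  "P.Ts v = P.Tt w" and gh: "(g, h) : G.Cp"
 shows "TR1 (cmp G g h) (tcmp P x v y w) = tcmp P (act1 B x g) (TR1 g v) (act1 B y h) (TR1 h w)"
proof -
 interpret PP: lgpd_pair P P ..
 have "g : pts G.A" "h : pts G.A" using gh by (auto simp: G.Cp_iff)
 then show ?thesis
  by (intro PP.tcmp_natural[OF b1.spb_right b1.spb_right b1.spb_right] assms) (use gh act_Cp act_mul G.mul_points in auto)
qed

subsection \<open>The Lie 2-algebra of invariant fields\<close>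

lemma LAt_simps: "a : low (LAt B) <-> a : AS P &
   (ALL p:pts P.Ob. ALL g:pts G.Ob. a (act0 B p g) = TR1 (unt G g) (a p))"
 "(xi, u) : up (LAt B) <-> (xi, u) : MF P &
   (ALL g:pts G.A. related P.A P.A (%q. act1 B q g) xi xi) & (ALL g:pts G.Ob. related P.Ob P.Ob (%q. act0 B q g) u u)"
 "brk (LAt B) = brk (LTX P)" "bdry (LAt B) = bdry (LTX P)" "action (LAt B) = action (LTX P)"
 using groups by (auto simp: LAt_def Let_def LTX_def related_def)

lemma TR_commute: assumes g: "g : pts G.A" shows "P.Tt (TR1 g v) = TR0 (tgt G g) (P.Tt v)"
  "P.Ti (TR1 g v) = TR1 (ginv G g) (P.Ti v)"
proof -
 note r = b1.spb_right[OF g]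
 have sg: "tgt G g : pts G.Ob" "ginv G g : pts G.A" using g by auto
 show "P.Tt (TR1 g v) = TR0 (tgt G g) (P.Tt v)"
  by (rule tmap_square[OF r P.spb_g P.spb_g b0.spb_right[OF sg(1)]]) (simp add: act_tgt g)
 show "P.Ti (TR1 g v) = TR1 (ginv G g) (P.Ti v)"
  by (rule tmap_square[OF r P.spb_ginv P.spb_ginv b1.spb_right[OF sg(2)]]) (simp add: act_ginv g)
qed

text \<open>For \<open>a\<close> only translations by units are given. A general arrow
  \<open>g\<close> is the unit at its target times \<open>g\<close>; by the interchange law the unit
  then translates \<open>a\<close> and \<open>g\<close> translates the zero vector at
  \<open>x\<close>.\<close>

lemma right_inv_invariant: assumes a: "a : low (LAt B)" and g: "g : pts G.A"
 shows "related P.A P.A (%q. act1 B q g) (right_inv P a) (right_inv P a)" unfolding related_def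
proof
 fix x assume x: "x : pts P.A"
 have as: "a : AS P" using a by (simp add: LAt_simps)
 have t: "tgt P x : pts P.Ob" "tgt G g : pts G.Ob" using x g by auto
 have e: "P.Ts (a (tgt P x)) = P.Tt 0" using P.asD(2)[OF as t(1)] by simp
 have "TR1 (cmp G (unt G (tgt G g)) g) (right_inv P a x) =
   tcmp P (act1 B (unt P (tgt P x)) (unt G (tgt G g))) (TR1 (unt G (tgt G g)) (a (tgt P x))) (act1 B x g) (TR1 g 0)"
  unfolding P.right_inv_eq[OF x]
  by (rule TR_tcmp[OF P.asD(1)[OF as t(1)] zero_tangent P.unit_comp(1)[OF x] e G.unit_comp(1)[OF g]])
 also have "... = right_inv P a (act1 B x g)"
  using a x g t by (simp add: LAt_simps P.right_inv_eq act_tgt act_unt)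
 finally show "TR1 g (right_inv P a x) = right_inv P a (act1 B x g)" using g by simp
qed

lemma left_inv_invariant: assumes a: "a : low (LAt B)" and g: "g : pts G.A"
 shows "related P.A P.A (%q. act1 B q g) (left_inv P a) (left_inv P a)" unfolding related_def
proof
 fix x assume x: "x : pts P.A"
 have as: "a : AS P" using a by (simp add: LAt_simps)
 have ig: "ginv G g : pts G.A" using g by simp
 have "left_inv P a (act1 B x g) = - P.Ti (right_inv P a (act1 B (ginv P x) (ginv G g)))"
  using x g by (simp add: P.left_inv_right_inv[OF as] act_ginv)
 also have "right_inv P a (act1 B (ginv P x) (ginv G g)) = TR1 (ginv G g) (right_inv P a (ginv P x))"
  using right_inv_invariant[OF a ig] x by (simp add: related_def)
 also have "- P.Ti (TR1 (ginv G g) (right_inv P a (ginv P x))) = TR1 g (left_inv P a x)"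
  using x g by (simp add: TR_commute(2)[OF ig] G.ginv_ginv P.left_inv_right_inv[OF as] tmap_minus)
 finally show "TR1 g (left_inv P a x) = left_inv P a (act1 B x g)" by simp
qed

lemma crossed_mod_LAt: "crossed_mod (LAt B)"
proof -
 have e: "LAt B = (LTX P)\<lparr>low := low (LAt B), up := up (LAt B)\<rparr>" by (simp add: LAt_def Let_def)
 show ?thesis
 proof (subst e, rule crossed_mod_sub[OF P.crossed_mod_LTX])
  show "low (LAt B) <= low (LTX P)" "up (LAt B) <= up (LTX P)" by (auto simp: LAt_simps)
  show "subspace (low (LAt B))"
  proof (rule subspaceI2)
   fix a a' and b c :: real assume "a : low (LAt B)" "a' : low (LAt B)"
   then show "b *r a + c *r a' : low (LAt B)"
    by (simp add: LAt_simps scaleR_app tmap_add tmap_scaleR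
     subspace_add[OF P.algebroid_sections_subspace] subspace_scale[OF P.algebroid_sections_subspace])
  qed (simp add: LAt_simps subspace_0[OF P.algebroid_sections_subspace])
  show "subspace (up (LAt B))"
  proof (rule subspaceI2)
   show "0 : up (LAt B)"
    using subspace_0[OF P.mult_fields_subspace] by (simp add: LAt_simps zero_prod_def related_def)
   fix x y :: "('p0, 'p1) mfield" and b c :: real assume *: "x : up (LAt B)" "y : up (LAt B)"
   obtain xi u et w where xy: "x = (xi, u)" "y = (et, w)" by (cases x, cases y)
   have "b *r x + c *r y : MF P"
    using * by (intro subspace_add[OF P.mult_fields_subspace] subspace_scale[OF P.mult_fields_subspace])
     (auto simp: xy LAt_simps)
   then show "b *r x + c *r y : up (LAt B)" using * by (simp add: xy LAt_simps related_linear)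
  qed
  show "brk (LTX P) x y : up (LAt B)" if *: "x : up (LAt B)" "y : up (LAt B)" for x y
  proof -
   obtain xi u et w where xy: "x = (xi, u)" "y = (et, w)" by (cases x, cases y)
   have m: "(xi, u) : MF P" "(et, w) : MF P" using * by (auto simp: xy LAt_simps)
   note D = P.mult_fieldsD[OF m(1)] and E = P.mult_fieldsD[OF m(2)]
   have "brk (LTX P) (xi, u) (et, w) : MF P"
    using crossed_mod.brk_up[OF P.crossed_mod_LTX, of "(xi, u)" "(et, w)"] m by simp
   then show ?thesis using *
    by (auto simp: xy LAt_simps intro!: related_bracket[OF b1.spb_right _ _ D(1) E(1) D(1) E(1)]
      related_bracket[OF b0.spb_right _ _ D(2) E(2) D(2) E(2)])
  qed
  show "bdry (LTX P) a : up (LAt B)" if a: "a : low (LAt B)" for a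
  proof -
   have as: "a : AS P" using a by (simp add: LAt_simps)
   have "related P.Ob P.Ob (%q. act0 B q g) (%x. P.Tt (a x)) (%x. P.Tt (a x))" if g: "g : pts G.Ob" for g
    unfolding related_def
   proof
    fix p assume p: "p : pts P.Ob"
    have "a (act0 B p g) = TR1 (unt G g) (a p)" using a p g by (simp add: LAt_simps)
    then show "TR0 g (P.Tt (a p)) = P.Tt (a (act0 B p g))" using TR_commute(1)[of "unt G g"] g by simp
   qed
   then show ?thesis
    using right_inv_invariant[OF a] left_inv_invariant[OF a] P.bdry_mult_field[OF as]
    by (simp add: LAt_simps related_diff)
  qed
  show "action (LTX P) x a : low (LAt B)" if x: "x : up (LAt B)" and a: "a : low (LAt B)" for x a
  proof -
   obtain xi u where xu: "x = (xi, u)" by (cases x)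
   have as: "a : AS P" and m: "(xi, u) : MF P" using a x by (auto simp: LAt_simps xu)
   note v = P.mult_fieldsD(1)[OF m] and r = P.right_inv_vector_field[OF as]
   have inv: "related P.A P.A (%q. act1 B q (unt G g)) (lbr P.A xi (right_inv P a)) (lbr P.A xi (right_inv P a))"
    if g: "g : pts G.Ob" for g
   proof -
    have "unt G g : pts G.A" using g by simp
    then show ?thesis
     using x by (intro related_bracket[OF b1.spb_right _ right_inv_invariant[OF a] v r v r]) (auto simp: xu LAt_simps)
   qed
   then show ?thesis unfolding xu LAt_simps(1) using P.action_section(1)[OF m as]
    by (auto simp: related_def act_unt)
  qed
 qed
qed

subsection \<open>Projectable fields\<close>

definition proj_low :: "('p0 => 'p1 tvec) => ('x0 => 'x1 tvec) => bool" where
 "proj_low a b <-> a : low (LAt B) & b : AS X & rel_low a b"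

definition proj_up :: "('p0, 'p1) mfield => ('x0, 'x1) mfield => bool" where
 "proj_up x y <-> x : up (LAt B) & y : MF X &
   related P.A X.A (proj1 B) (fst x) (fst y) & related P.Ob X.Ob (proj0 B) (snd x) (snd y)"

text \<open>Surjectivity of the projection makes the related section unique. Here and in
  \<open>push_up_eq\<close> the definite descriptions of the push-forwards are resolved.\<close>

lemma push_low_eq: assumes "proj_low a b" shows "push_low B a = b" unfolding push_low_def
proof (rule the_equality)
 fix b' assume b': "b' : AS X & (ALL p:pts P.Ob. T1 (a p) = b' (proj0 B p))"
 show "b' = b"
 proof
  fix x show "b' x = b x"
  proof (cases "x : pts X.Ob")
   case True
   then obtain p where "p : pts P.Ob" "x = proj0 B p" using sub_proj0(2) by blast
   then show ?thesis using b' assms by (auto simp: proj_low_def rel_low_def)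
  qed (use b' assms X.asD(3) in "auto simp: proj_low_def")
 qed
qed (use assms in "auto simp: proj_low_def rel_low_def")

lemma push_field_eq: assumes "et : VF N" "related M N q xi et" "q ` pts M = pts N"
 shows "push_field M N q xi = et" unfolding push_field_def
proof (rule the_equality)
 fix et' assume et': "et' : VF N & (ALL p:pts M. tmap M N q (xi p) = et' (q p))"
 show "et' = et"
 proof
  fix x show "et' x = et x"
  proof (cases "x : pts N")
   case True
   then obtain p where "p : pts M" "x = q p" using assms(3) by blast
   then show ?thesis using et' assms(2) by (auto simp: related_def)
  qed (use et' assms(1) vfD(2)[of et' N x] vfD(2)[of et N x] in auto)
 qed
qed (use assms in "auto simp: related_def")

lemma push_up_eq: "proj_up x y ==> push_up B x = y"
 using push_field_eq[OF _ _ sub_proj1(2)] push_field_eq[OF _ _ sub_proj0(2)] X.mult_fieldsD(1,2)[of "fst y" "snd y"]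
 by (auto simp: proj_up_def push_up_def prod_eq_iff)

lemma proj_low_linear: "proj_low a b ==> proj_low a' b' ==> proj_low (c *r a + d *r a') (c *r b + d *r b')"
 using crossed_mod.low[OF crossed_mod_LAt] X.algebroid_sections_subspace
 by (auto simp: proj_low_def rel_low_def scaleR_app tmap_add tmap_scaleR intro!: subspace_add subspace_scale)

lemma proj_up_linear: "proj_up a b ==> proj_up a' b' ==> proj_up (c *r a + d *r a') (c *r b + d *r b')"
 using crossed_mod.up[OF crossed_mod_LAt] X.mult_fields_subspace
 by (auto simp: proj_up_def intro!: related_linear subspace_add subspace_scale)

lemma proj_low_0: "proj_low 0 0"
 using crossed_mod.low[OF crossed_mod_LAt] X.algebroid_sections_subspace
 by (auto simp: proj_low_def rel_low_def subspace_0)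

lemma proj_up_0: "proj_up 0 0" using crossed_mod.up[OF crossed_mod_LAt] X.mult_fields_subspace
 by (auto simp: proj_up_def related_def subspace_0)

lemma proj_brk: assumes "proj_up x y" "proj_up x' y'"
 shows "proj_up (brk (LAt B) x x') (brk (LTX X) y y')"
proof -
 obtain xi u et w xi' u' et' w' where e: "x = (xi, u)" "y = (et, w)" "x' = (xi', u')" "y' = (et', w')"
  by (cases x, cases y, cases x', cases y')
 have m: "(xi, u) : MF P" "(et, w) : MF X" "(xi', u') : MF P" "(et', w') : MF X"
  using assms by (auto simp: proj_up_def e LAt_simps)
 note D = P.mult_fieldsD(1,2)[OF m(1)] X.mult_fieldsD(1,2)[OF m(2)] P.mult_fieldsD(1,2)[OF m(3)] X.mult_fieldsD(1,2)[OF m(4)]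
 have "brk (LAt B) x x' : up (LAt B)" using assms crossed_mod.brk_up[OF crossed_mod_LAt] by (simp add: proj_up_def)
 moreover have "brk (LTX X) y y' : MF X" using m crossed_mod.brk_up[OF X.crossed_mod_LTX] by (simp add: e del: X.LTX_simps(4))
 ultimately show ?thesis
  using assms by (auto simp: proj_up_def e LAt_simps(3) intro!: related_bracket[OF spb1 _ _ D(1,5,3,7)]
    related_bracket[OF spb0 _ _ D(2,6,4,8)])
qed

lemma proj_bdry: assumes "proj_low a b" shows "proj_up (bdry (LAt B) a) (bdry (LTX X) b)"
proof -
 have a: "a : AS P" "b : AS X" "rel_low a b" using assms by (auto simp: proj_low_def LAt_simps)
 have "bdry (LAt B) a : up (LAt B)" using assms crossed_mod.bdry_up[OF crossed_mod_LAt] by (simp add: proj_low_def)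
 then show ?thesis
  using X.bdry_mult_field[OF a(2)] rel_right_inv[OF a(1,3)] rel_left_inv[OF a] rel_anchor[OF a(3)]
  by (simp add: proj_up_def LAt_simps(4) related_diff)
qed

lemma proj_action: assumes "proj_up x y" "proj_low a b"
 shows "proj_low (action (LAt B) x a) (action (LTX X) y b)"
proof -
 obtain xi u et w where e: "x = (xi, u)" "y = (et, w)" by (cases x, cases y)
 have a: "a : AS P" "b : AS X" "rel_low a b" using assms by (auto simp: proj_low_def LAt_simps)
 have m: "(xi, u) : MF P" "(et, w) : MF X" using assms by (auto simp: proj_up_def e LAt_simps)
 have "action (LAt B) x a : low (LAt B)"
  using assms crossed_mod.action_low[OF crossed_mod_LAt] by (simp add: proj_low_def proj_up_def)
 then show ?thesis using X.action_section(1)[OF m(2) a(2)] rel_action[OF a m] assms(1)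
  by (simp add: proj_low_def e LAt_simps(5) proj_up_def)
qed

end

section \<open>Horizontal lifts of multiplicative fields and of sections\<close>

context two_bundle_loc
begin

context
 fixes th :: "('p0, 'p1, 'g0, 'g1) forms" assumes two_conn: "two_connection B th"
begin

abbreviation "H1 == hor_lift P.A X.A (proj1 B) (fst th)"
abbreviation "H0 == hor_lift P.Ob X.Ob (proj0 B) (snd th)"

abbreviation "hf1 == b1.hfield (fst th)"
abbreviation "hf0 == b0.hfield (snd th)"

lemma conns: "principal_connection P.A G.A (AGrp (Grp B)) (act1 B) (fst th)"
  "principal_connection P.Ob G.Ob (OGrp (Grp B)) (act0 B) (snd th)"
 using two_conn by (auto simp: two_connection_def Let_def split: prod.splits)

lemma form_src_tgt: assumes "p : pts P.A" "v : TS P.A p"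
 shows "G.Ts (fst th p v) = snd th (src P p) (P.Ts v)" "G.Tt (fst th p v) = snd th (tgt P p) (P.Tt v)"
 using two_conn assms by (auto simp: two_connection_def Let_def split: prod.splits)

lemma form_mul: assumes "(p, q) : P.Cp" "v : TS P.A p" "w : TS P.A q" "P.Ts v = P.Tt w"
 shows "fst th (cmp P p q) (tcmp P p v q w) = tcmp G e1 (fst th p v) e1 (fst th q w)"
 using two_conn assms by (auto simp: two_connection_def Let_def P.composables_FP split: prod.splits)

lemma lift_src_tgt: assumes p: "p : pts P.A" and w: "w : TS X.A (proj1 B p)"
 shows "P.Ts (H1 p w) = H0 (src P p) (X.Ts w)" "P.Tt (H1 p w) = H0 (tgt P p) (X.Tt w)"
proof -
 note h = b1.hor_lift[OF conns(1) p w]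
 show "P.Ts (H1 p w) = H0 (src P p) (X.Ts w)"
 proof (rule b0.hor_lift_eq[OF conns(2), symmetric])
  show "P.Ts (H1 p w) : TS P.Ob (src P p)" by (rule tmap_tangent[OF P.spb_f p h(1)])
 qed (use p h in "simp_all flip: T_src form_src_tgt(1)")
 show "P.Tt (H1 p w) = H0 (tgt P p) (X.Tt w)"
 proof (rule b0.hor_lift_eq[OF conns(2), symmetric])
  show "P.Tt (H1 p w) : TS P.Ob (tgt P p)" by (rule tmap_tangent[OF P.spb_g p h(1)])
 qed (use p h in "simp_all flip: T_tgt form_src_tgt(2)")
qed

text \<open>Horizontal vectors are closed under the tangent multiplication, because the connection
  is a groupoid morphism and zero vectors at the identity multiply to zero. Uniqueness of horizontal
  lifts then identifies the product of the lifts.\<close>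

lemma lift_mul:
 assumes C: "(p, q) : P.Cp" and v: "v : TS X.A (proj1 B p)" and w: "w : TS X.A (proj1 B q)"
  and e: "X.Ts v = X.Tt w"
 shows "H1 (cmp P p q) (tcmp X (proj1 B p) v (proj1 B q) w) = tcmp P p (H1 p v) q (H1 q w)"
proof (rule b1.hor_lift_eq[OF conns(1)])
 have p: "p : pts P.A" and q: "q : pts P.A" and st: "src P p = tgt P q" using C by (auto simp: P.Cp_iff)
 note hv = b1.hor_lift[OF conns(1) p v] and hw = b1.hor_lift[OF conns(1) q w]
 have c: "P.Ts (H1 p v) = P.Tt (H1 q w)" using lift_src_tgt(1)[OF p v] lift_src_tgt(2)[OF q w] st e by simp
 show "cmp P p q : pts P.A" by (rule P.mul_points[OF C])
 show "tcmp P p (H1 p v) q (H1 q w) : TS P.A (cmp P p q)" by (rule P.tcmp_tangent[OF hv(1) hw(1) C c])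
 show "T1 (tcmp P p (H1 p v) q (H1 q w)) = tcmp X (proj1 B p) v (proj1 B q) w"
  using T_tcmp[OF hv(1) hw(1) C c] hv(2) hw(2) by simp
 have o: "\<one>\<^bsub>OGrp (Grp B)\<^esub> : pts G.Ob" by (rule b0.one_point)
 have "(e1, e1) : G.Cp" using o G.src_unt[OF o] G.tgt_unt[OF o] b1.one_point by (simp add: groups(5) G.Cp_iff)
 then show "fst th (cmp P p q) (tcmp P p (H1 p v) q (H1 q w)) = 0"
  using form_mul[OF C hv(1) hw(1) c] hv(3) hw(3) G.tcmp_0 by simp
qed

lemma split_up_eq: "split_up B th x = (hf1 (fst x), hf0 (snd x))"
 by (auto simp: split_up_def b1.hfield_def[OF conns(1)] b0.hfield_def[OF conns(2)] split: prod.splits)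

lemma hfield_related: "xi : VF X.A ==> related P.A X.A (proj1 B) (hf1 xi) xi"
 "u : VF X.Ob ==> related P.Ob X.Ob (proj0 B) (hf0 u) u"
 using b1.hor_lift(2)[OF conns(1)] b0.hor_lift(2)[OF conns(2)]
  vfD(1)[of xi X.A] vfD(1)[of u X.Ob]
 by (auto simp: related_def b1.hfield_def[OF conns(1)] b0.hfield_def[OF conns(2)])

lemma hfield_invariant:
 "xi : VF X.A ==> g : pts G.A ==> related P.A P.A (%q. act1 B q g) (hf1 xi) (hf1 xi)"
 "u : VF X.Ob ==> g' : pts G.Ob ==> related P.Ob P.Ob (%q. act0 B q g') (hf0 u) (hf0 u)"
 using b1.hor_lift_equiv[OF conns(1)] b0.hor_lift_equiv[OF conns(2)]
  vfD(1)[of xi X.A] vfD(1)[of u X.Ob]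
 by (auto simp: related_def b1.hfield_def[OF conns(1)] b0.hfield_def[OF conns(2)])

lemma proj_split_up: assumes x: "x : MF X" shows "proj_up (split_up B th x) x"
proof -
 obtain xi u where e: "x = (xi, u)" by (cases x)
 note D = X.mult_fieldsD[OF x[unfolded e]]
 let ?xi = "hf1 xi" and ?u = "hf0 u"
 have t: "xi (proj1 B p) : TS X.A (proj1 B p)" if "p : pts P.A" for p
  using vfD(1)[OF D(1)] that by simp
 have "related P.A P.Ob (src P) ?xi ?u" "related P.A P.Ob (tgt P) ?xi ?u"
  using lift_src_tgt[OF _ t] D(3,4)
  by (auto simp: related_def b1.hfield_def[OF conns(1)] b0.hfield_def[OF conns(2)] mor_src mor_tgt)
 moreover have "P.mulrel ?xi ?xi ?xi" unfolding P.mulrel_def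
 proof (intro allI impI)
  fix p q assume C: "(p, q) : P.Cp"
  then have p: "p : pts P.A" "q : pts P.A" "src P p = tgt P q" by (auto simp: P.Cp_iff)
  have m: "X.Ts (xi (proj1 B p)) = X.Tt (xi (proj1 B q))"
   "xi (cmp X (proj1 B p) (proj1 B q)) = tcmp X (proj1 B p) (xi (proj1 B p)) (proj1 B q) (xi (proj1 B q))"
   using D(5) mor_Cp[OF C] by (auto simp: X.mulrel_def)
  show "P.Ts (?xi p) = P.Tt (?xi q) & ?xi (cmp P p q) = tcmp P p (?xi p) q (?xi q)"
   using p lift_mul[OF C t t m(1)] m lift_src_tgt[OF p(1) t[OF p(1)]] lift_src_tgt[OF p(2) t[OF p(2)]] P.mul_points[OF C]
   by (simp add: b1.hfield_def[OF conns(1)] mor_mul[OF C])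
 qed
 ultimately have "(?xi, ?u) : MF P"
  unfolding P.mult_fields_iff using b1.hfield_smooth[OF conns(1) D(1)] b0.hfield_smooth[OF conns(2) D(2)] by blast
 then show ?thesis
  using x hfield_related hfield_invariant D(1,2) by (simp add: proj_up_def split_up_eq LAt_simps e)
qed

text \<open>The lift of a section is the restriction to units of the horizontal lift of its right
  invariant field; in this way its smoothness and invariance reduce to those of
  \<open>hfield\<close>.\<close>

lemma split_low_eq: assumes a: "a : AS X" and p: "p : pts P.Ob"
 shows "split_low B th a p = hf1 (right_inv X a) (unt P p)"
 using assms by (simp add: split_low_def b1.hfield_def[OF conns(1)] mor_unt X.right_inv_unit)

lemma proj_split_low: assumes a: "a : AS X" shows "proj_low (split_low B th a) a"
proof -
 let ?a = "split_low B th a"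
 note r = X.right_inv_vector_field[OF a]
 note h = b1.hfield_smooth[OF conns(1) r]
 have t: "a (proj0 B p) : TS X.A (proj1 B (unt P p))" if p: "p : pts P.Ob" for p
  using X.asD(1)[OF a] p by (simp add: mor_unt)
 have l: "?a p = H1 (unt P p) (a (proj0 B p))" if "p : pts P.Ob" for p using that by (simp add: split_low_def)
 have "P.Ts (?a p) = 0" if p: "p : pts P.Ob" for p
  using lift_src_tgt(1)[OF _ t[OF p]] X.asD(2)[OF a, of "proj0 B p"] b0.hor_lift_0[OF conns(2) p] p
  by (simp add: l)
 moreover have "(%p. ?a p F) : C_inf P.Ob" if F: "F : C_inf P.A" for F
 proof -
  have "pb P.Ob (unt P) (%p. hf1 (right_inv X a) p F) : C_inf P.Ob"
   using spb_pb[OF P.spb_unt vfD(3)[OF h F]] by (simp add: lie_der_def)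
  moreover have "pb P.Ob (unt P) (%p. hf1 (right_inv X a) p F) = (%p. ?a p F)"
   using split_low_eq[OF a] by (auto simp: pb_def fun_eq_iff split_low_def)
  ultimately show ?thesis by simp
 qed
 moreover have "?a p : TS P.A (unt P p)" if p: "p : pts P.Ob" for p
  using b1.hor_lift(1)[OF conns(1) _ t[OF p]] p by (simp add: l)
 ultimately have s: "?a : AS P" unfolding algebroid_sections_def by (simp add: split_low_def)
 moreover have "?a (act0 B p g) = TR1 (unt G g) (?a p)" if p: "p : pts P.Ob" and g: "g : pts G.Ob" for p g
  using hfield_invariant(1)[OF r, of "unt G g"] p g by (simp add: split_low_eq[OF a] related_def act_unt)
 moreover have "T1 (?a p) = a (proj0 B p)" if p: "p : pts P.Ob" for p
  using b1.hor_lift(2)[OF conns(1) _ t[OF p]] p by (simp add: l)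
 ultimately show ?thesis using a by (simp add: proj_low_def LAt_simps rel_low_def)
qed

lemma split_low_linear: assumes a: "a : AS X" "a' : AS X"
 shows "split_low B th (b *r a + c *r a') = b *r split_low B th a + c *r split_low B th a'"
proof
 fix p
 show "split_low B th (b *r a + c *r a') p = (b *r split_low B th a + c *r split_low B th a') p"
  using b1.hor_lift_linear[OF conns(1), of "unt P p" "a (proj0 B p)" "a' (proj0 B p)" b c]
   X.asD(1)[OF a(1), of "proj0 B p"] X.asD(1)[OF a(2), of "proj0 B p"]
  by (cases "p : pts P.Ob") (auto simp: split_low_def scaleR_app mor_unt)
qed

lemma hfield_linear: "xi : VF X.A ==> xi' : VF X.A ==>
  hf1 (b *r xi + c *r xi') = b *r hf1 xi + c *r hf1 xi'" "u : VF X.Ob ==> u' : VF X.Ob ==>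
  hf0 (b *r u + c *r u') = b *r hf0 u + c *r hf0 u'"
 by (auto simp: fun_eq_iff b1.hfield_def[OF conns(1)] b0.hfield_def[OF conns(2)] scaleR_app
   b1.hor_lift_linear[OF conns(1)] b0.hor_lift_linear[OF conns(2)] vfD(1))

lemma split_up_linear: assumes "x : MF X" "y : MF X"
 shows "split_up B th (b *r x + c *r y) = b *r split_up B th x + c *r split_up B th y"
 using X.mult_fieldsD(1,2)[of "fst x" "snd x"] X.mult_fieldsD(1,2)[of "fst y" "snd y"] assms
 by (simp add: split_up_eq hfield_linear)

end

end

section \<open>The symmetric coalgebra\<close>

lemma psign_if: "psign n = (if even n then 1 else -1)"
proof (cases "n >= 0")
 case True
 then show ?thesis by (simp add: power_int_def minus_one_power_iff even_nat_iff)
next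
 case False
 then show ?thesis by (simp add: power_int_def minus_one_power_iff even_nat_iff flip: power_inverse)
qed

lemma psign_add: "psign (a + b) = psign a * psign b" by (simp add: power_int_add)

lemma deg_simps [simp]: "deg [] = 0" "deg (x # w) = fst x + deg w" "deg (u @ v) = deg u + deg v"
 by (simp_all add: deg_def)

text \<open>\<open>cop w b\<close> sums \<open>b\<close> over the terms of the coproduct of \<open>w\<close>, distributing one letter at a time.\<close>

primrec cop :: "'v word => ('v word => 'v word => 'w::real_vector) => 'w" where "cop [] b = b [] []"
| "cop (x # w) b = cop w (%u v. b (x # u) v) + cop w (%u v. psign (fst x * deg u) *r b u (x # v))"

text \<open>The Koszul sign of moving the letters at the positions \<open>A\<close> to the front:
  each of them passes the earlier letters that stay behind.\<close>

definition sel_sign :: "'v word => nat set => real" where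
 "sel_sign w A = (PROD b:A. PROD a:{..<b} - A. psign (fst (w ! b) * fst (w ! a)))"

definition sel :: "'v word => nat set => 'v word" where
 "sel w A = map (nth w) (sorted_list_of_set A)"

lemma sorted_list_of_set_Suc: "finite A ==> sorted_list_of_set (Suc ` A) = map Suc (sorted_list_of_set A)"
 by (rule sorted_distinct_set_unique) (auto simp: sorted_map distinct_map intro: sorted_wrt_mono_rel[of _ "(<=)"])

lemma sel_Cons: "finite A ==> sel (x # w) (Suc ` A) = sel w A"
 "finite A ==> sel (x # w) (insert 0 (Suc ` A)) = x # sel w A"
 by (simp_all add: sel_def sorted_list_of_set_Suc insort_is_Cons)

lemma psign_prod: "finite A ==> (PROD b:A. psign (f b * c)) = psign (c * (SUM b:A. f b))"
 by (induction A rule: finite_induct) (auto simp: psign_add algebra_simps)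

lemma deg_sel: "finite A ==> deg (sel w A) = (SUM b:A. fst (w ! b))"
 by (simp add: deg_def sel_def comp_def flip: sum.distinct_set_conv_list)

lemma sel_sign_Cons: assumes A: "finite A"
 shows "sel_sign (x # w) (insert 0 (Suc ` A)) = sel_sign w A"
  "sel_sign (x # w) (Suc ` A) = psign (fst x * deg (sel w A)) * sel_sign w A"
proof -
 have "{..<Suc b} - insert 0 (Suc ` A) = Suc ` ({..<b} - A)" for b
 proof (rule Set.set_eqI)
  show "j : {..<Suc b} - insert 0 (Suc ` A) <-> j : Suc ` ({..<b} - A)" for j by (cases j) auto
 qed
 then show "sel_sign (x # w) (insert 0 (Suc ` A)) = sel_sign w A"
  using A by (simp add: sel_sign_def prod.reindex)
 have s: "{..<Suc b} - Suc ` A = insert 0 (Suc ` ({..<b} - A))" for b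
 proof (rule Set.set_eqI)
  show "j : {..<Suc b} - Suc ` A <-> j : insert 0 (Suc ` ({..<b} - A))" for j by (cases j) auto
 qed
 show "sel_sign (x # w) (Suc ` A) = psign (fst x * deg (sel w A)) * sel_sign w A"
  using A by (simp add: sel_sign_def s prod.reindex prod.distrib psign_prod deg_sel)
qed

text \<open>A term of the coproduct is a choice of the positions that go to the left factor; the two
  summands of the recursion are the choices with and without position 0.\<close>

lemma cop_subsets:
 "cop w b = (SUM A:Pow {..<length w}. sel_sign w A *r b (sel w A) (sel w ({..<length w} - A)))"
proof (induction w arbitrary: b)
 case Nil
 then show ?case by (simp add: sel_sign_def sel_def)
next
 case (Cons x w)
 let ?n = "length w"
 let ?F = "%A. sel_sign (x # w) A *r b (sel (x # w) A) (sel (x # w) ({..<Suc ?n} - A))"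
 let ?i = "%A. insert 0 (Suc ` A)" and ?j = "%A. Suc ` A"
 have e: "{..<Suc ?n} = insert 0 (Suc ` {..<?n})" by (rule lessThan_Suc_eq_insert_0)
 have i: "inj_on ?i (Pow {..<?n})" "inj_on ?j (Pow {..<?n})" by (auto simp: inj_on_def)
 have P: "Pow {..<Suc ?n} = ?i ` Pow {..<?n} Un ?j ` Pow {..<?n}" (is "?l = ?r")
 proof (intro subset_antisym subsetI)
  fix A assume A: "A : ?l"
  show "A : ?r"
  proof (cases "0 : A")
   case True
   have "A = ?i {b. Suc b : A}" using True by (auto simp: image_iff) (metis not0_implies_Suc)
   moreover have "{b. Suc b : A} : Pow {..<?n}" using A by auto
   ultimately show ?thesis by blast
  next
   case False
   have "A = ?j {b. Suc b : A}" using False by (auto simp: image_iff) (metis not0_implies_Suc)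
   moreover have "{b. Suc b : A} : Pow {..<?n}" using A by auto
   ultimately show ?thesis by blast
  qed
 qed auto
 have "(SUM A:Pow {..<Suc ?n}. ?F A) = (SUM A:Pow {..<?n}. ?F (?i A)) + (SUM A:Pow {..<?n}. ?F (?j A))"
  unfolding P by (subst sum.union_disjoint) (auto simp: sum.reindex[OF i(1)] sum.reindex[OF i(2)])
 also have "(SUM A:Pow {..<?n}. ?F (?i A)) = cop w (%u v. b (x # u) v)" unfolding Cons.IH
 proof (rule sum.cong[OF refl])
  fix A assume "A : Pow {..<?n}"
  then have "finite A" by (auto intro: finite_subset)
  moreover have "{..<Suc ?n} - ?i A = Suc ` ({..<?n} - A)" by (auto simp: e)
  ultimately show "?F (?i A) = sel_sign w A *r b (x # sel w A) (sel w ({..<?n} - A))"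
   by (simp add: sel_Cons sel_sign_Cons)
 qed
 also have "(SUM A:Pow {..<?n}. ?F (?j A)) = cop w (%u v. psign (fst x * deg u) *r b u (x # v))"
  unfolding Cons.IH
 proof (rule sum.cong[OF refl])
  fix A assume "A : Pow {..<?n}"
  then have "finite A" by (auto intro: finite_subset)
  moreover have "{..<Suc ?n} - ?j A = ?i ({..<?n} - A)" by (auto simp: e)
  ultimately show "?F (?j A) = sel_sign w A *r psign (fst x * deg (sel w A)) *r b (sel w A) (x # sel w ({..<?n} - A))"
   by (simp add: sel_Cons sel_sign_Cons)
 qed
 finally show ?case by simp
qed

lemma Sh_lists: assumes k: "k <= n" and s: "si : Sh k (n - k)"
 shows "map si [0..<k] = sorted_list_of_set (si ` {..<k})"
  "map si [k..<n] = sorted_list_of_set ({..<n} - si ` {..<k})" "si ` {..<k} <= {..<n}"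
proof -
 have p: "si permutes {..<n}" and m: "strict_mono_on {..<k} si" "strict_mono_on {k..<n} si"
  using s k by (auto simp: Sh_def)
 have i: "inj si" using p by (rule permutes_inj)
 have a: "{..<n} = {..<k} Un {k..<n}" using k by auto
 have "si ` {..<n} = {..<n}" using p by (rule permutes_image)
 then have im: "si ` {..<k} Un si ` {k..<n} = {..<n}" unfolding a by (simp add: image_Un)
 have disj: "si ` {..<k} Int si ` {k..<n} = {}" unfolding image_Int[OF i, symmetric] by auto
 show "si ` {..<k} <= {..<n}" using im by blast
 show "map si [0..<k] = sorted_list_of_set (si ` {..<k})"
 proof (rule sorted_distinct_set_unique)
  show "sorted (map si [0..<k])" using m(1) by (auto simp: sorted_iff_nth_mono strict_mono_on_leD)
 qed (use i in "auto simp: distinct_map inj_on_subset[OF _ subset_UNIV] lessThan_atLeast0")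
 have "si ` {k..<n} = {..<n} - si ` {..<k}" using im disj by blast
 then show "map si [k..<n] = sorted_list_of_set ({..<n} - si ` {..<k})"
 proof (intro sorted_distinct_set_unique)
  show "sorted (map si [k..<n])" using m(2) by (auto simp: sorted_iff_nth_mono strict_mono_on_leD)
 qed (use i in "auto simp: distinct_map inj_on_subset[OF _ subset_UNIV]")
qed

text \<open>A shuffle lists a set of positions in increasing order, then its complement; so it is
  determined by the image of its first block.\<close>

lemma Sh_bij: "bij_betw (%(k, si). si ` {..<k}) (SIGMA k:{..n}. Sh k (n - k)) (Pow {..<n})"
proof (rule bij_betw_imageI)
 show "inj_on (%(k, si). si ` {..<k}) (SIGMA k:{..n}. Sh k (n - k))"
 proof (rule inj_onI, clarify)
  fix k si l ta assume k: "k <= n" and s: "si : Sh k (n - k)" and l: "l <= n" and t: "ta : Sh l (n - l)"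
   and e: "si ` {..<k} = ta ` {..<l}"
  have p: "si permutes {..<n}" "ta permutes {..<n}" using s t k l by (auto simp: Sh_def)
  have "card (si ` {..<k}) = k" "card (ta ` {..<l}) = l"
   using p by (auto simp: card_image inj_on_subset[OF permutes_inj])
  then have kl: "k = l" using e by simp
  have "map si [0..<k] @ map si [k..<n] = map ta [0..<k] @ map ta [k..<n]"
   using Sh_lists[OF k s] Sh_lists[OF l t] e kl by simp
  then have "map si [0..<n] = map ta [0..<n]"
   unfolding map_append[symmetric] using upt_add_eq_append[of 0 k "n - k"] k by simp
  then have "si i = ta i" if "i < n" for i using that by simp
  moreover have "si i = ta i" if "~  i < n" for i using p that by (auto simp: permutes_def)
  ultimately show "k = l & si = ta" using kl by auto
 qed
 show "(%(k, si). si ` {..<k}) ` (SIGMA k:{..n}. Sh k (n - k)) = Pow {..<n}"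
 proof (intro subset_antisym subsetI)
  fix A assume "A : Pow {..<n}"
  then have A: "A <= {..<n}" "finite A" by (auto intro: finite_subset)
  let ?a = "sorted_list_of_set A" and ?c = "sorted_list_of_set ({..<n} - A)"
  let ?l = "?a @ ?c"
  define si where "si i = (if i < n then ?l ! i else i)" for i
  have k: "card A <= n" using card_mono[OF _ A(1)] by simp
  have len: "length ?l = n" using A k by (simp add: card_Diff_subset)
  have sl: "set ?l = {..<n}" "distinct ?l" using A by auto
  have "bij_betw si {..<n} {..<n}"
  proof (rule bij_betw_imageI)
   show "inj_on si {..<n}" using sl(2) len by (auto simp: inj_on_def si_def nth_eq_iff_index_eq)
   have "(%i. ?l ! i) ` {..<n} = set ?l" using len by (auto simp: set_conv_nth image_iff)
   then show "si ` {..<n} = {..<n}" using sl(1) by (auto simp: si_def image_iff)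
  qed
  then have p: "si permutes {..<n}" by (rule bij_imp_permutes) (simp add: si_def)
  have "strict_mono_on {..<card A} si"
   using k A sorted_wrt_nth_less[OF strict_sorted_list_of_set[of A]]
   by (auto intro!: strict_mono_onI simp: si_def nth_append)
  moreover have "strict_mono_on {card A..<n} si"
   using k A len sorted_wrt_nth_less[OF strict_sorted_list_of_set[of "{..<n} - A"]]
   by (auto intro!: strict_mono_onI simp: si_def nth_append)
  ultimately have "si : Sh (card A) (n - card A)" using p k by (simp add: Sh_def)
  moreover have "si ` {..<card A} = A"
  proof -
   have "si ` {..<card A} = (%i. ?a ! i) ` {..<length ?a}" using k A by (auto simp: si_def nth_append image_iff)
   also have "... = set ?a" by (auto simp: set_conv_nth image_iff)
   finally show ?thesis using A by simp
  qed
  ultimately show "A : (%(k, si). si ` {..<k}) ` (SIGMA k:{..n}. Sh k (n - k))"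
   using k by (intro image_eqI[of _ _ "(card A, si)"]) auto
 qed (use Sh_lists(3) in fastforce)
qed

text \<open>A shuffle inverts only pairs with one index in each block, and these are the pairs
  counted by \<open>sel_sign\<close>.\<close>

lemma koszul_Sh: assumes k: "k <= length w" and s: "si : Sh k (length w - k)"
 shows "koszul si w = sel_sign w (si ` {..<k})"
proof -
 let ?n = "length w" and ?A = "si ` {..<k}"
 have p: "si permutes {..<?n}" and m: "strict_mono_on {..<k} si" "strict_mono_on {k..<?n} si"
  using s k by (auto simp: Sh_def)
 have i: "inj si" using p by (rule permutes_inj)
 have A: "?A <= {..<?n}" by (rule Sh_lists(3)[OF k s])
 have inv_k: "i < k & k <= j" if "i < j" "j < ?n" "si j < si i" for i j
  using strict_mono_onD[OF m(1), of i j] strict_mono_onD[OF m(2), of i j] that by force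
 have "sel_sign w ?A = (PROD (b, a):(SIGMA b:?A. {..<b} - ?A). psign (fst (w ! b) * fst (w ! a)))"
  unfolding sel_sign_def by (rule prod.Sigma) auto
 also have "(SIGMA b:?A. {..<b} - ?A) = map_prod si si ` {(i, j). i < j & j < ?n & si j < si i}" (is "?l = ?r")
 proof (intro subset_antisym subsetI)
  fix z assume "z : ?l"
  then obtain i a where z: "z = (si i, a)" "i < k" "a < si i" "a ~: ?A" by auto
  have "si i < ?n" using A z(2) by auto
  then have "a < ?n" using z(3) by simp
  then obtain j where j: "a = si j" "j < ?n" using permutes_image[OF p] by (metis imageE lessThan_iff)
  have "~  j < k" using z(4) j by blast
  then show "z : ?r" using z j by (auto intro!: image_eqI[of _ _ "(i, j)"])
 next
  fix z assume "z : ?r"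
  then obtain i j where z: "z = (si i, si j)" "i < j" "j < ?n" "si j < si i" by auto
  have "i < k & k <= j" by (rule inv_k[OF z(2-4)])
  moreover have "si j ~: ?A" using calculation inj_image_mem_iff[OF i, of j "{..<k}"] by simp
  ultimately show "z : ?l" using z by auto
 qed
 also have "(PROD (b, a):map_prod si si ` {(i, j). i < j & j < ?n & si j < si i}. psign (fst (w ! b) * fst (w ! a))) = koszul si w"
  unfolding koszul_def
  by (subst prod.reindex[OF inj_on_subset[OF map_prod_inj_on[OF i i]]]) (simp_all add: case_prod_unfold)
 finally show ?thesis by simp
qed

text \<open>From here on the sum over shuffles is replaced by the letter-wise recursion, so that the
  coalgebra laws become inductions on the word.\<close>

lemma coprod_cop: "coprod w b = cop w b"
proof -
 let ?n = "length w"
 let ?F = "%A. sel_sign w A *r b (sel w A) (sel w ({..<?n} - A))"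
 have "koszul si w *r b (take k (permute_list si w)) (drop k (permute_list si w)) = ?F (si ` {..<k})"
  if k: "k <= ?n" and s: "si : Sh k (?n - k)" for k si
 proof -
  have "permute_list si w = map (nth w) (map si [0..<?n])" by (simp add: permute_list_def)
  then have "take k (permute_list si w) = map (nth w) (map si [0..<k])" "drop k (permute_list si w) = map (nth w) (map si [k..<?n])"
   using k by (simp_all add: take_map drop_map)
  then show ?thesis unfolding Sh_lists(1,2)[OF k s] by (simp add: koszul_Sh[OF k s] sel_def)
 qed
 then have "coprod w b = (SUM k<=?n. SUM si:Sh k (?n - k). ?F (si ` {..<k}))" unfolding coprod_def by simp
 also have "... = (SUM z:(SIGMA k:{..?n}. Sh k (?n - k)). ?F ((%(k, si). si ` {..<k}) z))"
  by (subst sum.Sigma) (auto simp: case_prod_unfold Sh_def intro: finite_subset[OF _ finite_permutations[of "{..<?n}"]])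
 also have "... = (SUM A:Pow {..<?n}. ?F A)" by (rule sum.reindex_bij_betw[OF Sh_bij])
 finally show ?thesis by (simp add: cop_subsets)
qed

lemma words_simps [simp]: "[] : words V" "x # w : words V <-> snd x : V (fst x) & w : words V"
 "u @ v : words V <-> u : words V & v : words V" by (auto simp: words_def)

lemma words_iff: "w : words V <-> (ALL x:set w. snd x : V (fst x))" by (auto simp: words_def)

text \<open>The multiset equation records what has to be remembered of a shuffle: lengths, degrees
  and membership of the letters. \<open>split_word\<close> extracts these.\<close>

lemma cop_cong: assumes "!!u v. mset u + mset v = mset w ==> b u v = b' u v"
 shows "cop w b = cop w b'" using assms
proof (induction w arbitrary: b b')
 case (Cons x w)
 have "cop w (%u v. b (x # u) v) = cop w (%u v. b' (x # u) v)" by (rule Cons.IH) (simp add: Cons.prems)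
 moreover have "cop w (%u v. psign (fst x * deg u) *r b u (x # v)) = cop w (%u v. psign (fst x * deg u) *r b' u (x # v))"
  by (rule Cons.IH) (simp add: Cons.prems)
 ultimately show ?case by simp
qed simp

lemma deg_mset: "deg u = (SUM x:#mset u. fst x)" by (induction u) auto

lemma split_word: assumes "mset u + mset v = mset w"
 shows "length u + length v = length w" "deg u + deg v = deg w" "w : words V ==> u : words V & v : words V"
proof -
 have "size (mset u + mset v) = size (mset w)" "set_mset (mset u + mset v) = set_mset (mset w)"
  "(SUM x:#mset u + mset v. fst x) = (SUM x:#mset w. fst x)" by (simp_all only: assms)
 then show "length u + length v = length w" "deg u + deg v = deg w" "w : words V ==> u : words V & v : words V"
  by (auto simp: deg_mset words_def)
qed

lemma cop_words_cong:
 assumes "w : words V" "!!u v. u : words V ==> v : words V ==> deg u + deg v = deg w ==> b u v = b' u v"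
 shows "cop w b = cop w b'"
proof (rule cop_cong)
 fix u v assume "mset u + mset v = mset w"
 from split_word[OF this] assms(1) show "b u v = b' u v" by (intro assms(2)) auto
qed

lemma cop_linear: "cop w (%u v. c *r b u v + d *r b' u v) = c *r cop w b + d *r cop w b'"
proof (induction w arbitrary: b b')
 case (Cons x w)
 have "psign (fst x * deg u) *r (c *r b u (x # v) + d *r b' u (x # v)) =
   c *r psign (fst x * deg u) *r b u (x # v) + d *r psign (fst x * deg u) *r b' u (x # v)" for u v
  by (simp add: scaleR_add_right mult.commute)
 then show ?case by (simp only: cop.simps Cons.IH scaleR_add_right add_ac)
qed simp

lemma cop_add: "cop w (%u v. b u v + b' u v) = cop w b + cop w b'"
 using cop_linear[of w 1 b 1 b'] by simp

lemma cop_scaleR: "cop w (%u v. c *r b u v) = c *r cop w b" using cop_linear[of w c b 0 b] by simp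

lemma cop_zero [simp]: "cop w (%u v. 0) = 0" using cop_scaleR[of w 0 "%u v. 0"] by simp

lemma cop_sum: "cop w (%u v. SUM i:I. b i u v) = (SUM i:I. cop w (b i))"
 by (induction I rule: infinite_finite_induct) (simp_all add: cop_add)

text \<open>\<open>L\<close> is linear on the subspace \<open>S\<close> only, as is the case for
  splittings and representations, which are linear in each degree separately. Membership in
  \<open>S\<close> is therefore carried along with the commutation.\<close>

lemma cop_map: assumes S: "subspace S" and w: "w : words V"
  and b: "!!u v. u : words V ==> v : words V ==> deg u + deg v = deg w ==> b u v : S"
  and L: "!!x y c d. x : S ==> y : S ==> L (c *r x + d *r y) = c *r L x + d *r L y"
 shows "cop w b : S & L (cop w b) = cop w (%u v. L (b u v))"
proof -
 have Ls: "L (c *r x) = c *r L x" if "x : S" for c x using L[OF that that, of c 0] by simp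
 have La: "L (x + y) = L x + L y" if "x : S" "y : S" for x y using L[OF that, of 1 1] by simp
 have "ALL u v. mset u + mset v = mset w --> b u v : S"
 proof (intro allI impI)
  fix u v assume "mset u + mset v = mset w"
  from split_word[OF this] w show "b u v : S" by (intro b) auto
 qed
 then show ?thesis
 proof (induction w arbitrary: b)
  case (Cons x w)
  have "cop w (%u v. b (x # u) v) : S & L (cop w (%u v. b (x # u) v)) = cop w (%u v. L (b (x # u) v))"
   by (rule Cons.IH) (simp add: Cons.prems)
  moreover have "cop w (%u v. psign (fst x * deg u) *r b u (x # v)) : S &
    L (cop w (%u v. psign (fst x * deg u) *r b u (x # v))) = cop w (%u v. L (psign (fst x * deg u) *r b u (x # v)))"
   by (rule Cons.IH) (simp add: Cons.prems subspace_scale[OF S])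
  moreover have "cop w (%u v. L (psign (fst x * deg u) *r b u (x # v))) = cop w (%u v. psign (fst x * deg u) *r L (b u (x # v)))"
   by (rule cop_cong) (simp add: Ls Cons.prems)
  ultimately show ?case by (simp add: subspace_add[OF S] La)
 qed simp
qed

lemma cop_sub: assumes S: "subspace S" and w: "w : words V"
  and b: "!!u v. u : words V ==> v : words V ==> deg u + deg v = deg w ==> b u v : S"
 shows "cop w b : S" using cop_map[where L="%x. x", OF assms] by simp

lemma cop_comm: "cop w b = cop w (%u v. psign (deg u * deg v) *r b v u)"
proof (induction w arbitrary: b)
 case (Cons x w)
 have "cop w (%u v. b (x # u) v) = cop w (%u v. psign (fst x * deg u) *r psign (deg u * deg (x # v)) *r b (x # v) u)"
  by (subst Cons.IH, rule cop_cong) (simp add: psign_if)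
 moreover have "cop w (%u v. psign (fst x * deg u) *r b u (x # v)) = cop w (%u v. psign (deg (x # u) * deg v) *r b v (x # u))"
  by (subst Cons.IH, rule cop_cong) (auto simp: psign_if)
 ultimately show ?case by (simp add: add.commute)
qed simp

lemma cop_assoc:
 fixes w :: "'v word"
 shows "cop w (%u v. cop u (%u1 u2. b u1 u2 v)) = cop w (%u v. cop v (%v1 v2. b u v1 v2))"
proof (induction w arbitrary: b)
 case (Cons x w)
 let ?s = "%u. psign (fst x * deg u)"
 have "cop (x # w) (%u v. cop u (%u1 u2. b u1 u2 v)) =
   cop w (%u v. cop u (%u1 u2. b (x # u1) u2 v)) + cop w (%u v. cop u (%u1 u2. ?s u1 *r b u1 (x # u2) v)) +
   cop w (%u v. ?s u *r cop u (%u1 u2. b u1 u2 (x # v)))" by (simp add: cop_add)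
 also have "cop w (%u v. ?s u *r cop u (%u1 u2. b u1 u2 (x # v))) =
   cop w (%u v. cop u (%u1 u2. ?s u1 *r ?s u2 *r b u1 u2 (x # v)))" unfolding cop_scaleR[symmetric]
 proof (rule cop_cong, rule cop_cong)
  fix u v u1 u2 :: "'v word" assume "mset u1 + mset u2 = mset u"
  from split_word(2)[OF this, symmetric] show "?s u *r b u1 u2 (x # v) = ?s u1 *r ?s u2 *r b u1 u2 (x # v)"
   by (auto simp: psign_if)
 qed
 also have "cop w (%u v. cop u (%u1 u2. b (x # u1) u2 v)) + cop w (%u v. cop u (%u1 u2. ?s u1 *r b u1 (x # u2) v)) +
   cop w (%u v. cop u (%u1 u2. ?s u1 *r ?s u2 *r b u1 u2 (x # v))) = cop (x # w) (%u v. cop v (%v1 v2. b u v1 v2))"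
  by (simp add: Cons.IH cop_add cop_scaleR scaleR_add_right del: scaleR_scaleR)
 finally show ?case .
qed simp

lemma cop_hmap:
 fixes w :: "'v word"
 shows "cop (map (map_prod id h) w) b = cop w (%u v. b (map (map_prod id h) u) (map (map_prod id h) v))"
proof (induction w arbitrary: b)
 case (Cons x w)
 have "deg (map (map_prod id h) u) = deg u" for u :: "'v word" by (induction u) auto
 then show ?case unfolding list.map cop.simps Cons.IH by simp
qed simp

text \<open>The map \<open>w \<mapsto> \<Sigma> \<lambda>(w1) \<or> w2\<close> is a coderivation.\<close>

lemma cop_coder: assumes lam: "!!u. fst (d u) = deg u + 1" shows "cop w (%u v. cop (d u # v) b) =
  cop w (%u v. cop u (%u1 u2. b (d u1 # u2) v)) + cop w (%u v. psign (deg u) *r cop v (%v1 v2. b u (d v1 # v2)))"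
proof -
 let ?s = "%u v. psign ((deg u + 1) * deg v)"
 have "cop w (%u v. cop (d u # v) b) =
   cop w (%u v. cop v (%v1 v2. b (d u # v1) v2)) + cop w (%u v. cop v (%v1 v2. ?s u v1 *r b v1 (d u # v2)))"
  by (simp add: cop_add lam)
 also have "cop w (%u v. cop v (%v1 v2. b (d u # v1) v2)) = cop w (%u v. cop u (%u1 u2. b (d u1 # u2) v))"
  by (simp add: cop_assoc)
 also have "cop w (%u v. cop v (%v1 v2. ?s u v1 *r b v1 (d u # v2))) = cop w (%u v. cop u (%u1 u2. ?s u1 u2 *r b u2 (d u1 # v)))"
  by (simp add: cop_assoc)
 also have "... = cop w (%u v. cop u (%u1 u2. psign (deg u1) *r b u1 (d u2 # v)))"
  by (subst (2) cop_comm, intro cop_cong) (auto simp: psign_if)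
 also have "... = cop w (%u v. psign (deg u) *r cop v (%v1 v2. b u (d v1 # v2)))"
  by (simp add: cop_assoc cop_scaleR)
 finally show ?thesis .
qed

subsection \<open>Graded symmetric maps\<close>

text \<open>Symmetry under adjacent transpositions is the form that passes through the recursion of
  \<open>cop\<close>; the sign rule for all permutations is recovered in
  \<open>swap_sym_koszul\<close>.\<close>

definition swap_sym :: "'v::real_vector grading => ('v word => 'w::real_vector) => bool" where
 "swap_sym V al <-> (ALL w1:words V. ALL w2:words V. ALL x y. snd x : V (fst x) --> snd y : V (fst y) -->
   al (w1 @ x # y # w2) = psign (fst x * fst y) *r al (w1 @ y # x # w2))"

lemma swap_symD:
 "swap_sym V al ==> w1 @ x # y # w2 : words V ==> al (w1 @ x # y # w2) = psign (fst x * fst y) *r al (w1 @ y # x # w2)"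
 unfolding swap_sym_def words_simps by blast

lemma swap_sym_Cons: assumes "swap_sym V al" "snd x : V (fst x)" shows "swap_sym V (%w. al (x # w))"
 unfolding swap_sym_def
proof (intro ballI allI impI)
 fix w1 w2 y z
 assume "w1 : words V" "w2 : words V" "snd y : V (fst y)" "snd z : V (fst z)"
 then have "(x # w1) @ y # z # w2 : words V" using assms(2) by simp
 from swap_symD[OF assms(1) this]
 show "al (x # w1 @ y # z # w2) = psign (fst y * fst z) *r al (x # w1 @ z # y # w2)"
  unfolding append_Cons .
qed

lemma swap_sym_scaleR:
 assumes "swap_sym V al" "!!w1 w2 x y. c (w1 @ x # y # w2) = c (w1 @ y # x # w2)"
 shows "swap_sym V (%w. c w *r al w)" unfolding swap_sym_def
proof (intro ballI allI impI)
 fix w1 w2 x y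
 assume "w1 : words V" "w2 : words V" "snd x : V (fst x)" "snd y : V (fst y)"
 then have "w1 @ x # y # w2 : words V" by simp
 from swap_symD[OF assms(1) this]
 show "c (w1 @ x # y # w2) *r al (w1 @ x # y # w2) = psign (fst x * fst y) *r c (w1 @ y # x # w2) *r al (w1 @ y # x # w2)"
  unfolding assms(2)[of w1 x y w2] by (simp add: mult.commute)
qed

lemma multilinear_Cons: "multilin V al ==> snd x : V (fst x) ==> multilin V (%w. al (x # w))"
 unfolding multilinear_on_def
proof (intro ballI allI)
 fix w1 w2 i u v and b c :: real
 assume *: "ALL w1:words V. ALL w2:words V. ALL i. ALL u:V i. ALL v:V i. ALL b c. al (w1 @ (i, b *r u + c *r v) # w2) =
   b *r al (w1 @ (i, u) # w2) + c *r al (w1 @ (i, v) # w2)" "snd x : V (fst x)" "w1 : words V" "w2 : words V" "u : V i" "v : V i"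
 have "x # w1 : words V" using * by simp
 with * have "al ((x # w1) @ (i, b *r u + c *r v) # w2) = b *r al ((x # w1) @ (i, u) # w2) + c *r al ((x # w1) @ (i, v) # w2)"
  by blast
 then show "al (x # w1 @ (i, b *r u + c *r v) # w2) = b *r al (x # w1 @ (i, u) # w2) + c *r al (x # w1 @ (i, v) # w2)"
  by simp
qed

lemma multilinearD: "multilin V al ==> w1 : words V ==> w2 : words V ==> u : V i ==> v : V i ==>
  al (w1 @ (i, b *r u + c *r v) # w2) = b *r al (w1 @ (i, u) # w2) + c *r al (w1 @ (i, v) # w2)"
 by (simp add: multilinear_on_def)

lemma multilinear_hd: "multilin V al ==> w : words V ==> u : V i ==> v : V i ==>
  al ((i, b *r u + c *r v) # w) = b *r al ((i, u) # w) + c *r al ((i, v) # w)"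
 using multilinearD[of V al "[]" w u i v b c] by simp

lemma cop_multilinear:
 assumes "!!v. v : words V ==> multilin V (%u. b u v)" "!!u. u : words V ==> multilin V (%v. b u v)"
 shows "multilin V (%w. cop w b)" unfolding multilinear_on_def
proof (intro ballI allI)
 fix w1 w2 i x y and c d :: real
 assume w1: "w1 : words V" and w2: "w2 : words V" and x: "x : V i" and y: "y : V i"
 show "cop (w1 @ (i, c *r x + d *r y) # w2) b = c *r cop (w1 @ (i, x) # w2) b + d *r cop (w1 @ (i, y) # w2) b"
  using w1 assms
 proof (induction w1 arbitrary: b)
  case Nil
  have "cop w2 (%u v. b ((i, c *r x + d *r y) # u) v) = cop w2 (%u v. c *r b ((i, x) # u) v + d *r b ((i, y) # u) v)"
   by (rule cop_words_cong[OF w2]) (rule multilinear_hd[OF Nil(2) _ x y])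
  moreover have "cop w2 (%u v. psign (i * deg u) *r b u ((i, c *r x + d *r y) # v)) =
    cop w2 (%u v. c *r psign (i * deg u) *r b u ((i, x) # v) + d *r psign (i * deg u) *r b u ((i, y) # v))"
   by (rule cop_words_cong[OF w2]) (simp add: multilinear_hd[OF Nil(3) _ x y] scaleR_add_right mult.commute)
  ultimately show ?case by (simp only: append_Nil cop.simps fst_conv cop_linear scaleR_add_right add_ac)
 next
  case (Cons z w1)
  let ?s = "%u. psign (fst z * deg u)"
  have z: "snd z : V (fst z)" "w1 : words V" using Cons.prems(1) by auto
  have 1: "cop (w1 @ (i, c *r x + d *r y) # w2) (%u v. b (z # u) v) =
    c *r cop (w1 @ (i, x) # w2) (%u v. b (z # u) v) + d *r cop (w1 @ (i, y) # w2) (%u v. b (z # u) v)"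
   by (rule Cons.IH[OF z(2) multilinear_Cons[OF Cons.prems(2) z(1)] Cons.prems(3)]) (use z in auto)
  have 2: "cop (w1 @ (i, c *r x + d *r y) # w2) (%u v. ?s u *r b u (z # v)) =
    c *r cop (w1 @ (i, x) # w2) (%u v. ?s u *r b u (z # v)) + d *r cop (w1 @ (i, y) # w2) (%u v. ?s u *r b u (z # v))"
  proof (rule Cons.IH[OF z(2)])
   fix v assume "v : words V"
   then have "multilin V (%u. b u (z # v))" using z Cons.prems(2) by simp
   then show "multilin V (%u. ?s u *r b u (z # v))"
    by (simp add: multilinear_on_def scaleR_add_right mult.commute)
  next
   fix u assume "u : words V"
   then have "multilin V (%v. b u (z # v))" by (rule multilinear_Cons[OF Cons.prems(3) z(1)])
   then show "multilin V (%v. ?s u *r b u (z # v))"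
    by (simp add: multilinear_on_def scaleR_add_right mult.commute)
  qed
  show ?case using 1 2 by (simp add: scaleR_add_right)
 qed
qed

lemma cop_swap_sym:
 assumes "!!v. v : words V ==> swap_sym V (%u. b u v)" "!!u. u : words V ==> swap_sym V (%v. b u v)"
 shows "swap_sym V (%w. cop w b)" unfolding swap_sym_def
proof (intro ballI allI impI)
 fix w1 w2 x y
 assume w1: "w1 : words V" and w2: "w2 : words V" and x: "snd x : V (fst x)" and y: "snd y : V (fst y)"
 let ?e = "psign (fst x * fst y)"
 show "cop (w1 @ x # y # w2) b = ?e *r cop (w1 @ y # x # w2) b" using w1 assms
 proof (induction w1 arbitrary: b)
  case Nil
  have s1: "b (x # y # u) v = ?e *r b (y # x # u) v" "b u (x # y # v) = ?e *r b u (y # x # v)"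
   if "u : words V" "v : words V" for u v
   using swap_symD[OF Nil(2)[OF that(2)], of "[]" x y u] swap_symD[OF Nil(3)[OF that(1)], of "[]" x y v] x y that by auto
  let ?s = "%x u. psign (fst x * deg u)"
  let ?a = "cop w2 (%u v. b (y # x # u) v)" and ?b = "cop w2 (%u v. ?s x (y # u) *r b (y # u) (x # v))"
   and ?c = "cop w2 (%u v. ?s y u *r b (x # u) (y # v))" and ?d = "cop w2 (%u v. ?s y u *r ?s x u *r b u (y # x # v))"
  have "cop w2 (%u v. b (x # y # u) v) = ?e *r ?a" "cop w2 (%u v. ?s y u *r ?s x u *r b u (x # y # v)) = ?e *r ?d"
   unfolding cop_scaleR[symmetric] by (rule cop_words_cong[OF w2]; simp add: s1 mult_ac)+
  moreover have "cop w2 (%u v. ?s y (x # u) *r b (x # u) (y # v)) = ?e *r ?c" "?b = ?e *r cop w2 (%u v. ?s x u *r b (y # u) (x # v))"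
   unfolding cop_scaleR[symmetric] by (rule cop_cong; auto simp: psign_if)+
  moreover have "?e *r ?e *r z = z" for z :: 'b by simp
  ultimately show ?case by (simp add: cop_add scaleR_add_right cop_scaleR mult_ac)
 next
  case (Cons z w1)
  let ?s = "%u. psign (fst z * deg u)"
  have z: "snd z : V (fst z)" "w1 : words V" using Cons.prems(1) by auto
  have 1: "cop (w1 @ x # y # w2) (%u v. b (z # u) v) = ?e *r cop (w1 @ y # x # w2) (%u v. b (z # u) v)"
   by (rule Cons.IH[OF z(2) swap_sym_Cons[OF Cons.prems(2) z(1)] Cons.prems(3)]) (use z in auto)
  have 2: "cop (w1 @ x # y # w2) (%u v. ?s u *r b u (z # v)) = ?e *r cop (w1 @ y # x # w2) (%u v. ?s u *r b u (z # v))"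
  proof (rule Cons.IH[OF z(2)])
   fix v assume "v : words V"
   then have "swap_sym V (%u. b u (z # v))" using z Cons.prems(2) by simp
   then show "swap_sym V (%u. ?s u *r b u (z # v))" by (rule swap_sym_scaleR) (simp add: add.left_commute)
  next
   fix u assume "u : words V"
   then have "swap_sym V (%v. b u (z # v))" by (rule swap_sym_Cons[OF Cons.prems(3) z(1)])
   then show "swap_sym V (%v. ?s u *r b u (z # v))" by (rule swap_sym_scaleR) simp
  qed
  show ?case using 1 2 by (simp add: scaleR_add_right)
 qed
qed

text \<open>The Koszul sign of sorting a list of positions by insertion: inserting \<open>a\<close>
  moves its letter past those of smaller position.\<close>

primrec kos :: "'v word => nat list => real" where "kos w [] = 1"
| "kos w (a # I) = (PROD b:{b : set I. b < a}. psign (fst (w ! a) * fst (w ! b))) * kos w I"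

lemma kos_insort:
 assumes "swap_sym V al" "w : words V" "sorted J" "distinct J" "a ~: set J" "set (a # J) <= {..<length w}"
 shows "al (map (nth w) (insort a J)) = (PROD b:{b : set J. b < a}. psign (fst (w ! a) * fst (w ! b))) *r al (w ! a # map (nth w) J)"
 using assms
proof (induction J arbitrary: al)
 case (Cons b J)
 have wn: "snd (w ! i) : V (fst (w ! i))" if "i < length w" for i
  using assms(2) nth_mem[OF that] by (auto simp: words_def)
 show ?case
 proof (cases "a <= b")
  case True
  have "{c : set (b # J). c < a} = {}" using True Cons.prems(3) by auto
  then show ?thesis using True by (simp only: insort_key.simps if_True) simp
 next
  case False
  have s: "swap_sym V (%u. al (w ! b # u))" using Cons.prems wn by (intro swap_sym_Cons) auto
  have "al (map (nth w) (insort a (b # J))) = al (w ! b # map (nth w) (insort a J))" using False by simp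
  also have "... = (PROD c:{c : set J. c < a}. psign (fst (w ! a) * fst (w ! c))) *r al (w ! b # w ! a # map (nth w) J)"
   by (rule Cons.IH[OF s]) (use Cons.prems in auto)
  also have "al (w ! b # w ! a # map (nth w) J) = psign (fst (w ! a) * fst (w ! b)) *r al (w ! a # w ! b # map (nth w) J)"
  proof -
   have "map (nth w) J : words V" using Cons.prems(6) wn by (auto simp: words_iff)
   then show ?thesis using swap_symD[OF Cons.prems(1), of "[]" "w ! b" "w ! a" "map (nth w) J"] Cons.prems(6) wn
    by (simp add: mult.commute)
  qed
  also have "{c : set (b # J). c < a} = insert b {c : set J. c < a}" using False by auto
  then have "(PROD c:{c : set J. c < a}. psign (fst (w ! a) * fst (w ! c))) *r psign (fst (w ! a) * fst (w ! b)) *r al (w ! a # w ! b # map (nth w) J)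
   = (PROD c:{c : set (b # J). c < a}. psign (fst (w ! a) * fst (w ! c))) *r al (w ! a # map (nth w) (b # J))"
   using Cons.prems(4) by (simp add: mult.commute)
  finally show ?thesis .
 qed
qed simp

lemma kos_sort: assumes "swap_sym V al" "w : words V" "distinct I" "set I <= {..<length w}"
 shows "al (map (nth w) (sort I)) = kos w I *r al (map (nth w) I)" using assms
proof (induction I arbitrary: al)
 case (Cons a I)
 have "snd (w ! a) : V (fst (w ! a))"
  using assms(2) Cons.prems(4) nth_mem[of a w] by (auto simp: words_def)
 then have s: "swap_sym V (%u. al (w ! a # u))" by (rule swap_sym_Cons[OF Cons.prems(1)])
 have "al (map (nth w) (sort (a # I))) = (PROD b:{b : set (sort I). b < a}. psign (fst (w ! a) * fst (w ! b))) *r al (w ! a # map (nth w) (sort I))"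
  unfolding sort_key_simps using Cons.prems by (intro kos_insort[where V=V]) auto
 also have "al (w ! a # map (nth w) (sort I)) = kos w I *r al (w ! a # map (nth w) I)"
  by (rule Cons.IH[OF s]) (use Cons.prems in auto)
 finally show ?case by simp
qed simp

lemma kos_pairs:
 "distinct I ==> kos w I = (PROD (i, j):{(i, j). i < j & j < length I & I ! j < I ! i}. psign (fst (w ! (I ! i)) * fst (w ! (I ! j))))"
proof (induction I)
 case (Cons a I)
 let ?g = "%I (i, j). psign (fst (w ! (I ! i)) * fst (w ! (I ! j)))"
 let ?S = "%I. {(i, j). i < j & j < length I & I ! j < I ! i}"
 let ?T = "{j. j < length I & I ! j < a}"
 have fin: "finite (?S I)" by (rule finite_subset[of _ "{..<length I} \<times> {..<length I}"]) auto
 have S: "?S (a # I) = (%j. (0, Suc j)) ` ?T Un map_prod Suc Suc ` ?S I" (is "?l = ?r")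
 proof (intro subset_antisym subsetI)
  fix z assume z: "z : ?l"
  obtain i j where ij: "z = (i, j)" by (cases z)
  obtain j' where "j = Suc j'" using z ij by (cases j) auto
  then show "z : ?r" using z ij by (cases i) (auto simp: image_iff)
 qed auto
 have "prod (?g (a # I)) (?S (a # I)) = prod (?g (a # I)) ((%j. (0, Suc j)) ` ?T) * prod (?g (a # I)) (map_prod Suc Suc ` ?S I)"
  unfolding S using fin by (intro prod.union_disjoint) auto
 also have "prod (?g (a # I)) ((%j. (0, Suc j)) ` ?T) = (PROD j:?T. psign (fst (w ! a) * fst (w ! (I ! j))))"
  by (subst prod.reindex) (auto simp: inj_on_def)
 also have "... = (PROD b:(%j. I ! j) ` ?T. psign (fst (w ! a) * fst (w ! b)))"
  using Cons.prems by (subst prod.reindex) (auto simp: inj_on_def nth_eq_iff_index_eq)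
 also have "(%j. I ! j) ` ?T = {b : set I. b < a}" by (auto simp: in_set_conv_nth)
 also have "prod (?g (a # I)) (map_prod Suc Suc ` ?S I) = prod (?g I) (?S I)"
  by (subst prod.reindex[OF inj_on_subset[OF map_prod_inj_on[OF inj_Suc inj_Suc]]]) (auto simp: case_prod_unfold intro!: prod.cong)
 finally show ?case using Cons by simp
qed simp

text \<open>Insertion sort writes the permutation as a sequence of adjacent transpositions, and the
  pairs exchanged are its inversions.\<close>

lemma swap_sym_koszul: assumes "swap_sym V al" "w : words V" "si permutes {..<length w}"
 shows "al w = koszul si w *r al (permute_list si w)"
proof -
 let ?n = "length w" and ?I = "map si [0..<length w]"
 have d: "distinct ?I" using permutes_inj[OF assms(3)] by (auto simp: distinct_map inj_on_subset[OF _ subset_UNIV])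
 have s: "set ?I = {..<?n}" using permutes_image[OF assms(3)] by (simp add: lessThan_atLeast0)
 have "sort ?I = [0..<?n]"
  by (rule sorted_distinct_set_unique) (use d s in "auto simp: lessThan_atLeast0")
 then have "al w = al (map (nth w) (sort ?I))" by (simp add: map_nth)
 also have "... = kos w ?I *r al (map (nth w) ?I)" using s d by (intro kos_sort[OF assms(1,2)]) auto
 also have "kos w ?I = koszul si w" unfolding kos_pairs[OF d] koszul_def by (rule prod.cong) auto
 also have "map (nth w) ?I = permute_list si w" by (simp add: permute_list_def)
 finally show ?thesis .
qed

lemma cop_swap: "cop w (%u v. cop v (%s t. F u s t)) = cop w (%s v. cop v (%u t. psign (deg s * deg u) *r F u s t))"
 unfolding cop_assoc[symmetric] by (subst cop_comm) (simp add: mult.commute)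

section \<open>Products of cochains\<close>

text \<open>The cochains with values in \<open>Hom(\<and>N, W)\<close> are functions \<open>Ph acc w\<close> of a word \<open>acc\<close> of \<open>N\<close> and a
  word \<open>w\<close> of \<open>V\<close>. The operator \<open>wedge q r al\<close> multiplies with the cochain \<open>al\<close> of degree \<open>q\<close>; here
  \<open>r\<close> is the degree of the other factor.\<close>

definition wedge :: "int => int => ('v word => 'n) => ('n word => 'v word => 'w::real_vector) => 'n word => 'v word => 'w" where
 "wedge q r al Ph acc w = cop w (%u v. psign (r * deg u) *r Ph (acc @ [(deg u + q, al u)]) v)"

lemma multilinear_linear: "multilin V al ==> multilin V be ==> multilin V (%w. b *r al w + c *r be w)"
 by (simp add: multilinear_on_def scaleR_add_right mult.commute add_ac)

lemma swap_sym_linear: assumes "swap_sym V al" "swap_sym V be"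
 shows "swap_sym V (%w. b *r al w + c *r be w)" unfolding swap_sym_def
proof (intro ballI allI impI)
 fix w1 w2 x y
 assume "w1 : words V" "w2 : words V" "snd x : V (fst x)" "snd y : V (fst y)"
 then have *: "w1 @ x # y # w2 : words V" by simp
 show "b *r al (w1 @ x # y # w2) + c *r be (w1 @ x # y # w2) =
   psign (fst x * fst y) *r (b *r al (w1 @ y # x # w2) + c *r be (w1 @ y # x # w2))"
  unfolding swap_symD[OF assms(1) *] swap_symD[OF assms(2) *] by (simp add: scaleR_add_right mult.commute)
qed

lemma comp_wedge_pow_Suc: "comp_wedge_pow f K (Suc k) = wedge 1 (int k) K (comp_wedge_pow f K k)"
 by (simp add: fun_eq_iff wedge_def coprod_cop)

definition dcomp :: "('v word => 'v) => ('v word => 'w::real_vector) => 'v word => 'w" where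
 "dcomp lam al w = cop w (%u v. al ((deg u + 1, lam u) # v))"

definition act_part :: "('v word => int \<times> 'n => 'n::real_vector) => int => ('v word => 'n) => 'v word => 'n" where
 "act_part act q al w = cop w (%u v. psign (q * deg u) *r act u (deg v + q, al v))"

text \<open>For \<open>act\<close> built from a splitting, as in \<open>hact\<close>, this is the
  covariant derivative of a cochain of degree \<open>q\<close> with values in the kernel; the sign
  pattern is that of \<open>rep_diff\<close>.\<close>

definition ext_diff :: "('v word => 'v) => ('v word => int \<times> 'n => 'n::real_vector) => int => ('v word => 'n) => 'v word => 'n" where
 "ext_diff lam act q al w = act_part act q al w - psign q *r dcomp lam al w"

locale multilinear_map =
 fixes V :: "'v::real_vector grading" and N :: "'n::real_vector grading" and W :: "'w::real_vector grading"
  and f :: "'n word => 'w" and p :: int assumes N: "subspace (N i)" and W: "subspace (W i)"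
  and f_multi: "multilin N f" and f_deg: "a : words N ==> f a : W (p + deg a)"
begin

definition cochain :: "int => ('v word => 'n) => bool" where
 "cochain q al <-> multilin V al & swap_sym V al & (ALL u:words V. al u : N (deg u + q))"

text \<open>Here \<open>r\<close> includes the degree \<open>p\<close> of \<open>f\<close>, in
  contrast to the degree arguments of \<open>wedge\<close> and \<open>total_diff\<close>, which
  count the curvature factors alone.\<close>

definition adm :: "int => ('n word => 'v word => 'w) => bool" where
 "adm r Ph <-> (ALL a:words N. multilin V (Ph a) & swap_sym V (Ph a) & (ALL w:words V. Ph a w : W (r + deg a + deg w))) &
   (ALL w:words V. multilin N (%a. Ph a w))"

lemma adm_deg: "adm r Ph ==> a : words N ==> w : words V ==> Ph a w : W (r + deg a + deg w)"
 by (simp add: adm_def)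

lemma adm_last: "adm r Ph ==> w : words V ==> a : words N ==> x : N i ==> y : N i ==>
  Ph (a @ [(i, b *r x + c *r y)]) w = b *r Ph (a @ [(i, x)]) w + c *r Ph (a @ [(i, y)]) w"
 using multilinearD[of N "%a. Ph a w" a "[]"] by (simp add: adm_def)

lemma adm_last_0: "adm r Ph ==> w : words V ==> a : words N ==> Ph (a @ [(i, 0)]) w = 0"
 using adm_last[of r Ph w a 0 i 0 0 0] subspace_0[OF N] by simp

lemma adm_last_cop: assumes "adm r Ph" "t : words V" "a : words N" "s : words V'"
  and "!!u v. u : words V' ==> v : words V' ==> deg u + deg v = deg s ==> b u v : N i"
 shows "Ph (a @ [(i, cop s b)]) t = cop s (%u v. Ph (a @ [(i, b u v)]) t)"
proof -
 have "cop s b : N i & Ph (a @ [(i, cop s b)]) t = cop s (%u v. Ph (a @ [(i, b u v)]) t)"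
  by (rule cop_map[where L="%x. Ph (a @ [(i, x)]) t", OF N assms(4)]) (rule assms(5) adm_last[OF assms(1-3)]; assumption)+
 then show ?thesis ..
qed

lemma adm_base: "adm p (comp_wedge_pow f K 0)"
 using f_multi f_deg subspace_0[OF W] by (auto simp: adm_def multilinear_on_def swap_sym_def)

lemma adm_linear: assumes "adm r Ph" "adm r Ps" shows "adm r (%a w. b *r Ph a w + c *r Ps a w)"
 using assms unfolding adm_def
 by (auto intro!: multilinear_linear swap_sym_linear subspace_add[OF W] subspace_scale[OF W])

lemma multilinear_scaleR:
 "multilin V' al ==> (!!w1 i x y w2. c (w1 @ (i, x) # w2) = c (w1 @ (i, y) # w2)) ==> multilin V' (%w. c w *r al w)"
 unfolding multilinear_on_def by (simp add: scaleR_add_right) (metis mult.commute)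

lemma adm_wedge: assumes Ph: "adm s Ph" and al: "cochain q al" shows "adm (s + q) (wedge q r al Ph)"
proof -
 let ?y = "%u. (deg u + q, al u)" and ?c = "%u. psign (r * deg u)"
 have m: "multilin V al" "swap_sym V al" and alN: "!!u. u : words V ==> al u : N (deg u + q)"
  using al by (auto simp: cochain_def)
 have Ph': "!!a. a : words N ==> multilin V (Ph a)" "!!a. a : words N ==> swap_sym V (Ph a)"
  "!!a w. a : words N ==> w : words V ==> Ph a w : W (s + deg a + deg w)" "!!w. w : words V ==> multilin N (%a. Ph a w)"
  using Ph by (auto simp: adm_def)
 have 1: "multilin V (%u. ?c u *r Ph (a @ [?y u]) v)" if a: "a : words N" and v: "v : words V" for a v
 proof (rule multilinear_scaleR)
  show "multilin V (%u. Ph (a @ [?y u]) v)" unfolding multilinear_on_def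
  proof (intro ballI allI)
   fix w1 w2 i y z and b c :: real
   assume w: "w1 : words V" "w2 : words V" "y : V i" "z : V i"
   have "al (w1 @ (i, y) # w2) : N (deg w1 + (i + deg w2) + q)" "al (w1 @ (i, z) # w2) : N (deg w1 + (i + deg w2) + q)"
    using alN[of "w1 @ (i, y) # w2"] alN[of "w1 @ (i, z) # w2"] w by simp_all
   from adm_last[OF Ph v a this] show "Ph (a @ [?y (w1 @ (i, b *r y + c *r z) # w2)]) v =
     b *r Ph (a @ [?y (w1 @ (i, y) # w2)]) v + c *r Ph (a @ [?y (w1 @ (i, z) # w2)]) v"
    by (simp add: multilinearD[OF m(1) w])
  qed
 qed simp
 have 2: "swap_sym V (%u. ?c u *r Ph (a @ [?y u]) v)" if a: "a : words N" and v: "v : words V" for a v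
 proof (rule swap_sym_scaleR)
  show "swap_sym V (%u. Ph (a @ [?y u]) v)" unfolding swap_sym_def
  proof (intro ballI allI impI)
   fix w1 w2 y z assume w: "w1 : words V" "w2 : words V" "snd y : V (fst y)" "snd z : V (fst z)"
   have d: "deg (w1 @ y # z # w2) = deg (w1 @ z # y # w2)" by simp
   have "al (w1 @ z # y # w2) : N (deg (w1 @ z # y # w2) + q)" by (rule alN) (use w in simp)
   from adm_last[OF Ph v a this this, of "psign (fst y * fst z)" 0]
   show "Ph (a @ [?y (w1 @ y # z # w2)]) v = psign (fst y * fst z) *r Ph (a @ [?y (w1 @ z # y # w2)]) v"
    using swap_symD[OF m(2), of w1 y z w2] w unfolding d by simp
  qed
 qed (simp add: add.left_commute)
 have a: "a @ [?y u] : words N" if "a : words N" "u : words V" for a u using that alN by simp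
 have 3: "multilin V (%v. ?c u *r Ph (a @ [?y u]) v)" "swap_sym V (%v. ?c u *r Ph (a @ [?y u]) v)"
  if "a : words N" "u : words V" for a u
  by (rule multilinear_scaleR[OF Ph'(1)[OF a[OF that]] refl] swap_sym_scaleR[OF Ph'(2)[OF a[OF that]] refl])+
 have 4: "multilin N (%a. wedge q r al Ph a w)" if w: "w : words V" for w
  unfolding multilinear_on_def wedge_def cop_linear[symmetric]
 proof (intro ballI allI cop_words_cong[OF w])
  fix a1 a2 i x y u v and b c :: real
  assume "a1 : words N" "a2 : words N" "x : N i" "y : N i" "u : words V" "v : words V"
  then show "?c u *r Ph ((a1 @ (i, b *r x + c *r y) # a2) @ [?y u]) v =
    b *r ?c u *r Ph ((a1 @ (i, x) # a2) @ [?y u]) v + c *r ?c u *r Ph ((a1 @ (i, y) # a2) @ [?y u]) v"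
   using multilinearD[OF Ph'(4), of v a1 "a2 @ [?y u]" x i y b c] alN by (simp add: scaleR_add_right mult.commute)
 qed
 have 5: "wedge q r al Ph a w : W (s + q + deg a + deg w)" if aw: "a : words N" "w : words V" for a w
  unfolding wedge_def
 proof (intro cop_sub[OF W aw(2)] subspace_scale[OF W])
  fix u v assume u: "u : words V" "v : words V" "deg u + deg v = deg w"
  have e: "s + deg (a @ [?y u]) + deg v = s + q + deg a + deg w" using u by simp
  show "Ph (a @ [?y u]) v : W (s + q + deg a + deg w)" using Ph'(3)[OF a[OF aw(1) u(1)] u(2)] unfolding e .
 qed
 show ?thesis unfolding adm_def
 proof (intro conjI ballI)
  fix a' assume a': "a' : words N"
  show "multilin V (wedge q r al Ph a')" unfolding wedge_def by (rule cop_multilinear[OF 1[OF a'] 3(1)[OF a']])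
  show "swap_sym V (wedge q r al Ph a')" unfolding wedge_def by (rule cop_swap_sym[OF 2[OF a'] 3(2)[OF a']])
 qed (rule 4 5; assumption)+
qed

lemma wedge_cong:
 assumes "a : words N" "w : words V" "!!u. u : words V ==> al u = be u" "!!u. u : words V ==> be u : N (deg u + q)"
  and "!!a w. a : words N ==> w : words V ==> Ph a w = Ps a w"
 shows "wedge q r al Ph a w = wedge q r be Ps a w"
 unfolding wedge_def using assms by (intro cop_words_cong[OF assms(2)]) simp

lemma wedge_0: assumes "adm s Ph" "a : words N" "w : words V" "!!u. u : words V ==> al u = 0"
 shows "wedge q r al Ph a w = 0"
proof -
 have "cop w (%u v. psign (r * deg u) *r Ph (a @ [(deg u + q, al u)]) v) = cop w (%u v. 0)"
  by (rule cop_words_cong[OF assms(3)]) (simp add: adm_last_0[OF assms(1) _ assms(2)] assms(4))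
 then show ?thesis by (simp add: wedge_def)
qed

end

text \<open>Invariance of \<open>f\<close> means that \<open>f\<close> itself does not contribute to the differential.\<close>

locale invariant_map = multilinear_map V N W f p
 for V :: "'v::real_vector grading" and N :: "'n::real_vector grading" and W :: "'w::real_vector grading"
  and f :: "'n word => 'w" and p :: int +
 fixes lam :: "'v word => 'v" and act :: "'v word => int \<times> 'n => 'n" and rho :: "'v word => 'w => 'w"
 assumes lam_deg: "u : words V ==> lam u : V (deg u + 1)"
  and act_deg: "u : words V ==> y : N i ==> act u (i, y) : N (deg u + i + 1)"
  and rho_linear: "u : words V ==> z : W j ==> z' : W j ==> rho u (b *r z + c *r z') = b *r rho u z + c *r rho u z'"
  and invariant: "u : words V ==> a : words N ==>
   (SUM i<length a. psign ((deg u + 1) * deg (take i a)) *r f (a[i := (deg u + fst (a ! i) + 1, act u (a ! i))])) =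
   psign p *r psign (p * deg u) *r rho u (f a)"
begin

abbreviation dl :: "'v word => int \<times> 'v" where "dl u == (deg u + 1, lam u)"

definition inv_term :: "'v word => nat => ('n word => 'v word => 'w) => 'n word => 'v word => 'w" where
 "inv_term u i Ph a v = psign ((deg u + 1) * deg (take i a)) *r Ph (a[i := (deg u + fst (a ! i) + 1, act u (a ! i))]) v"

text \<open>The action on maps from the exterior power to \<open>W\<close>: through
  \<open>rho\<close> on values and through \<open>act\<close> on each argument, the latter signed by
  the earlier letters. Invariance of \<open>f\<close> is the statement that this kills
  \<open>f\<close>, which is how it enters \<open>total_diff_base\<close>.\<close>

definition hom_act :: "'v word => ('n word => 'v word => 'w) => 'n word => 'v word => 'w" where
 "hom_act u Ph a v = psign p *r psign (p * deg u) *r rho u (Ph a v) - (SUM i<length a. inv_term u i Ph a v)"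

definition act_diff :: "int => ('n word => 'v word => 'w) => 'n word => 'v word => 'w" where
 "act_diff r Ph a w = cop w (%u v. psign ((r + deg a) * deg u) *r hom_act u Ph a v)"

definition lam_diff :: "('n word => 'v word => 'w) => 'n word => 'v word => 'w" where
 "lam_diff Ph a w = cop w (%u v. Ph a (dl u # v))"

text \<open>The differential of a cochain with values in such maps. At the empty accumulator it is
  \<open>rep_diff\<close> up to the sign of \<open>p\<close>; at longer accumulators it has the
  extra terms that let the Leibniz rule be applied factor by factor.\<close>

definition total_diff :: "int => ('n word => 'v word => 'w) => 'n word => 'v word => 'w" where
 "total_diff r Ph a w = psign (deg a) *r act_diff r Ph a w - psign r *r lam_diff Ph a w"

lemma rho_0: "u : words V ==> rho u 0 = 0" using rho_linear[of u 0 0 0 0 0] subspace_0[OF W] by simp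

lemma dcomp_deg: assumes "!!u. u : words V ==> al u : N (deg u + q)" "w : words V"
 shows "dcomp lam al w : N (deg w + (q + 1))" unfolding dcomp_def
proof (rule cop_sub[OF N assms(2)])
 fix u v assume uv: "u : words V" "v : words V" "deg u + deg v = deg w"
 have "al (dl u # v) : N (deg (dl u # v) + q)" by (rule assms(1)) (use uv lam_deg in simp)
 moreover have "deg (dl u # v) + q = deg w + (q + 1)" using uv by simp
 ultimately show "al (dl u # v) : N (deg w + (q + 1))" by (simp only:)
qed

lemma act_mem:
 assumes "!!u. u : words V ==> al u : N (deg u + q)" "u : words V" "v : words V" "deg u + deg v = d"
 shows "act u (deg v + q, al v) : N (d + (q + 1))"
proof -
 have e: "deg u + (deg v + q) + 1 = d + (q + 1)" using assms(4) by simp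
 show ?thesis using act_deg[OF assms(2) assms(1)[OF assms(3)]] unfolding e .
qed

lemma act_part_deg: assumes "!!u. u : words V ==> al u : N (deg u + q)" "w : words V"
 shows "act_part act q al w : N (deg w + (q + 1))"
 unfolding act_part_def by (intro cop_sub[OF N assms(2)] subspace_scale[OF N] act_mem[OF assms(1)])

text \<open>The accumulator of the inner \<open>Ph\<close> is longer by one letter, a value of
  \<open>al\<close>. Acting on that letter is the part of the inner \<open>hom_act\<close> that the
  outer one does not contain, and it assembles into \<open>act_part\<close> of
  \<open>al\<close>.\<close>

lemma act_diff_wedge:
 assumes Ph: "adm s Ph" and al: "cochain q al" and a: "a : words N" and w: "w : words V"
 shows "act_diff (r + q) (wedge q r al Ph) a w =
  cop w (%s v. psign (r * deg s) *r act_diff r Ph (a @ [(deg s + q, al s)]) v) +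
  psign (deg a) *r wedge (q + 1) r (act_part act q al) Ph a w"
proof -
 let ?y = "%s. (deg s + q, al s)" and ?D = "deg a"
 let ?Z = "%u s t. Ph (a @ [(deg u + deg s + (q + 1), act u (?y s))]) t"
 have alN: "al u : N (deg u + q)" if "u : words V" for u using al that by (simp add: cochain_def)
 have ay: "a @ [?y s] : words N" if "s : words V" for s using a alN[OF that] by simp
 have hom: "hom_act u (wedge q r al Ph) a v = cop v (%s t. psign (r * deg s) *r (hom_act u Ph (a @ [?y s]) t +
   psign ((deg u + 1) * ?D) *r ?Z u s t))" if u: "u : words V" and v: "v : words V" for u v
 proof -
  have "rho u (wedge q r al Ph a v) = cop v (%t1 t. rho u (psign (r * deg t1) *r Ph (a @ [?y t1]) t))"
   unfolding wedge_def
  proof (rule cop_map[where L="rho u", OF W v, THEN conjunct2])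
   fix x t assume x: "x : words V" "t : words V" "deg x + deg t = deg v"
   have e: "s + deg (a @ [?y x]) + deg t = s + ?D + q + deg v" using x by simp
   show "psign (r * deg x) *r Ph (a @ [?y x]) t : W (s + ?D + q + deg v)"
    using adm_deg[OF Ph ay[OF x(1)] x(2)] unfolding e by (rule subspace_scale[OF W])
  qed (rule rho_linear[OF u])
  also have "... = cop v (%x t. psign (r * deg x) *r rho u (Ph (a @ [?y x]) t))"
  proof (rule cop_words_cong[OF v])
   fix x t assume x: "x : words V" "t : words V"
   note m = adm_deg[OF Ph ay[OF x(1)] x(2)]
   from rho_linear[OF u m m, of "psign (r * deg x)" 0]
   show "rho u (psign (r * deg x) *r Ph (a @ [?y x]) t) = psign (r * deg x) *r rho u (Ph (a @ [?y x]) t)" by simp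
  qed
  finally have 1: "psign p *r psign (p * deg u) *r rho u (wedge q r al Ph a v) =
    cop v (%x t. psign (r * deg x) *r psign p *r psign (p * deg u) *r rho u (Ph (a @ [?y x]) t))"
   by (simp add: mult_ac flip: cop_scaleR)
  have 2: "(SUM i<length a. inv_term u i (wedge q r al Ph) a v) =
    cop v (%x t. psign (r * deg x) *r (SUM i<length a. inv_term u i Ph (a @ [?y x]) t))"
   unfolding scaleR_sum_right cop_sum
   by (rule sum.cong) (auto simp: inv_term_def wedge_def nth_append list_update_append mult_ac simp flip: cop_scaleR)
  have 3: "inv_term u (length a) Ph (a @ [?y x]) t = psign ((deg u + 1) * ?D) *r ?Z u x t" for x t
   by (simp add: inv_term_def list_update_append algebra_simps)
  show ?thesis unfolding hom_act_def 1 2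
   by (simp add: 3 scaleR_diff_right scaleR_add_right cop_linear[of v 1 _ "-1", simplified] cop_add)
 qed
 let ?F = "%u x t. psign ((r + q + ?D) * deg u) *r psign (r * deg x) *r hom_act u Ph (a @ [?y x]) t"
  and ?H = "%u x t. psign ((r + q + ?D) * deg u) *r psign (r * deg x) *r psign ((deg u + 1) * ?D) *r ?Z u x t"
 have "act_diff (r + q) (wedge q r al Ph) a w = cop w (%u v. cop v (%x t. ?F u x t + ?H u x t))"
  unfolding act_diff_def
  by (rule cop_words_cong[OF w]) (simp only: hom cop_scaleR[symmetric] scaleR_add_right)
 also have "... = cop w (%u v. cop v (?F u)) + cop w (%u v. cop v (?H u))" by (simp add: cop_add)
 also have "cop w (%u v. cop v (?F u)) = cop w (%x v. psign (r * deg x) *r act_diff r Ph (a @ [?y x]) v)"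
  unfolding cop_swap[of w ?F] act_diff_def cop_scaleR[symmetric] by (intro cop_cong) (auto simp: psign_if)
 also have "cop w (%u v. cop v (?H u)) = cop w (%x t. cop x (%u y. ?H u y t))" by (rule cop_assoc[symmetric])
 also have "... = psign ?D *r wedge (q + 1) r (act_part act q al) Ph a w"
  unfolding wedge_def cop_scaleR[symmetric]
 proof (rule cop_words_cong[OF w])
  fix x t assume x: "x : words V" "t : words V"
  let ?d = "deg x + (q + 1)"
  have mem: "act u (?y y) : N ?d" if "u : words V" "y : words V" "deg u + deg y = deg x" for u y
   using act_mem[OF alN that(1,2)] that(3) by blast
  have "Ph (a @ [(?d, act_part act q al x)]) t = cop x (%u y. Ph (a @ [(?d, psign (q * deg u) *r act u (?y y))]) t)"
   unfolding act_part_def by (rule adm_last_cop[OF Ph x(2) a x(1)]) (rule subspace_scale[OF N mem])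
  then show "cop x (%u y. ?H u y t) = psign ?D *r psign (r * deg x) *r Ph (a @ [(?d, act_part act q al x)]) t"
   unfolding cop_scaleR[symmetric]
  proof (simp only: cop_scaleR[symmetric], intro cop_words_cong[OF x(1)])
   fix u y assume u: "u : words V" "y : words V" "deg u + deg y = deg x"
   have "Ph (a @ [(?d, psign (q * deg u) *r act u (?y y))]) t = psign (q * deg u) *r ?Z u y t"
    using adm_last[OF Ph x(2) a mem[OF u] mem[OF u], of "psign (q * deg u)" 0] by (simp flip: u(3))
   then show "?H u y t = psign ?D *r psign (r * deg x) *r Ph (a @ [(?d, psign (q * deg u) *r act u (?y y))]) t"
    unfolding u(3)[symmetric] by (auto simp: psign_if)
  qed
 qed
 finally show ?thesis .
qed

text \<open>By the coderivation property the bracket falls either into the word seen by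
  \<open>al\<close> or into the word seen by \<open>Ph\<close>.\<close>

lemma lam_diff_wedge:
 assumes Ph: "adm s Ph" and al: "cochain q al" and a: "a : words N" and w: "w : words V"
 shows "lam_diff (wedge q r al Ph) a w = psign r *r wedge (q + 1) r (dcomp lam al) Ph a w +
  cop w (%s v. psign ((r + 1) * deg s) *r lam_diff Ph (a @ [(deg s + q, al s)]) v)"
proof -
 let ?y = "%s. (deg s + q, al s)" and ?b = "%x t. psign (r * deg x) *r Ph (a @ [(deg x + q, al x)]) t"
 have alN: "al u : N (deg u + q)" if "u : words V" for u using al that by (simp add: cochain_def)
 have "lam_diff (wedge q r al Ph) a w = cop w (%x v. cop x (%u y. ?b (dl u # y) v)) +
   cop w (%x v. psign (deg x) *r cop v (%u t. ?b x (dl u # t)))"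
  unfolding lam_diff_def wedge_def by (rule cop_coder) simp
 also have "cop w (%x v. psign (deg x) *r cop v (%u t. ?b x (dl u # t))) =
   cop w (%x v. psign ((r + 1) * deg x) *r lam_diff Ph (a @ [?y x]) v)"
  unfolding lam_diff_def cop_scaleR[symmetric] by (intro cop_cong) (auto simp: psign_if)
 also have "cop w (%x v. cop x (%u y. ?b (dl u # y) v)) = psign r *r wedge (q + 1) r (dcomp lam al) Ph a w"
  unfolding wedge_def cop_scaleR[symmetric]
 proof (rule cop_words_cong[OF w])
  fix x v assume x: "x : words V" "v : words V"
  have e: "deg (dl u # y) = deg x + 1" "deg (dl u # y) + q = deg x + (q + 1)" if "deg u + deg y = deg x" for u y
   using that by auto
  have "Ph (a @ [(deg x + (q + 1), dcomp lam al x)]) v = cop x (%u y. Ph (a @ [(deg x + (q + 1), al (dl u # y))]) v)"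
   unfolding dcomp_def
  proof (rule adm_last_cop[OF Ph x(2) a x(1)])
   fix u y assume u: "u : words V" "y : words V" "deg u + deg y = deg x"
   have "al (dl u # y) : N (deg (dl u # y) + q)" by (rule alN) (use u lam_deg in simp)
   then show "al (dl u # y) : N (deg x + (q + 1))" unfolding e(2)[OF u(3)] .
  qed
  then show "cop x (%u y. ?b (dl u # y) v) = psign r *r psign (r * deg x) *r Ph (a @ [(deg x + (q + 1), dcomp lam al x)]) v"
  proof (simp only: cop_scaleR[symmetric], intro cop_words_cong[OF x(1)])
   fix u y :: "'v word" assume u: "deg u + deg y = deg x"
   show "?b (dl u # y) v = psign r *r psign (r * deg x) *r Ph (a @ [(deg x + (q + 1), al (dl u # y))]) v"
    unfolding e(2)[OF u] unfolding e(1)[OF u] by (auto simp: psign_if)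
  qed
 qed
 finally show ?thesis .
qed

text \<open>The graded Leibniz rule. The terms in which action or bracket hit \<open>al\<close>
  combine to its covariant derivative, the others to the differential of the remaining
  factor.\<close>

theorem total_diff_wedge:
 assumes Ph: "adm s Ph" and al: "cochain q al" and a: "a : words N" and w: "w : words V"
 shows "total_diff (r + q) (wedge q r al Ph) a w =
  wedge (q + 1) r (ext_diff lam act q al) Ph a w + psign q *r wedge q (r + 1) al (total_diff r Ph) a w"
proof -
 let ?y = "%s. (deg s + q, al s)"
 have alN: "al u : N (deg u + q)" if "u : words V" for u using al that by (simp add: cochain_def)
 have 1: "wedge (q + 1) r (ext_diff lam act q al) Ph a w =
   wedge (q + 1) r (act_part act q al) Ph a w - psign q *r wedge (q + 1) r (dcomp lam al) Ph a w"
 proof -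
  have "wedge (q + 1) r (ext_diff lam act q al) Ph a w = cop w (%u v.
    1 *r (psign (r * deg u) *r Ph (a @ [(deg u + (q + 1), act_part act q al u)]) v) +
    (- psign q) *r (psign (r * deg u) *r Ph (a @ [(deg u + (q + 1), dcomp lam al u)]) v))"
   unfolding wedge_def
  proof (rule cop_words_cong[OF w])
   fix u v assume u: "u : words V" "v : words V"
   from adm_last[OF Ph u(2) a act_part_deg[OF alN u(1)] dcomp_deg[OF alN u(1)], of 1 "- psign q"]
   show "psign (r * deg u) *r Ph (a @ [(deg u + (q + 1), ext_diff lam act q al u)]) v =
     1 *r (psign (r * deg u) *r Ph (a @ [(deg u + (q + 1), act_part act q al u)]) v) +
     (- psign q) *r (psign (r * deg u) *r Ph (a @ [(deg u + (q + 1), dcomp lam al u)]) v)"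
    by (simp add: ext_diff_def scaleR_diff_right mult.commute)
  qed
  then show ?thesis unfolding cop_linear wedge_def by simp
 qed
 have "psign q *r wedge q (r + 1) al (total_diff r Ph) a w = cop w (%x v.
   psign (deg a) *r psign (r * deg x) *r act_diff r Ph (a @ [?y x]) v +
   (- psign (r + q)) *r psign ((r + 1) * deg x) *r lam_diff Ph (a @ [?y x]) v)"
  unfolding wedge_def cop_scaleR[symmetric] total_diff_def by (rule cop_cong) (auto simp: psign_if)
 then show ?thesis unfolding total_diff_def act_diff_wedge[OF assms] lam_diff_wedge[OF assms] 1 cop_linear
  by (auto simp: psign_if scaleR_diff_right scaleR_add_right)
qed

lemma total_diff_base: assumes "a : words N" "w : words V"
 shows "total_diff 0 (comp_wedge_pow f K 0) a w = 0"
proof -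
 have h: "hom_act u (comp_wedge_pow f K 0) a v = 0" if "u : words V" for u v
  using invariant[OF that assms(1)] rho_0[OF that] by (cases "v = []") (auto simp: hom_act_def inv_term_def)
 have "act_diff 0 (comp_wedge_pow f K 0) a w = cop w (%u v. 0)"
  unfolding act_diff_def by (rule cop_words_cong[OF assms(2)]) (simp only: h scaleR_zero_right)
 then show ?thesis by (simp add: total_diff_def lam_diff_def)
qed

lemma total_diff_linear: assumes Ph: "adm s Ph" "adm s Ps" and a: "a : words N" and w: "w : words V"
 shows "total_diff r (%a w. b *r Ph a w + c *r Ps a w) a w = b *r total_diff r Ph a w + c *r total_diff r Ps a w"
proof -
 have "act_diff r (%a w. b *r Ph a w + c *r Ps a w) a w = cop w (%u v.
   b *r (psign ((r + deg a) * deg u) *r hom_act u Ph a v) + c *r (psign ((r + deg a) * deg u) *r hom_act u Ps a v))"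
  unfolding act_diff_def
 proof (rule cop_words_cong[OF w])
  fix u v assume u: "u : words V" "v : words V"
  have "rho u (b *r Ph a v + c *r Ps a v) = b *r rho u (Ph a v) + c *r rho u (Ps a v)"
   using Ph a u by (intro rho_linear[of _ _ "s + deg a + deg v"]) (auto simp: adm_def)
  then have "hom_act u (%a w. b *r Ph a w + c *r Ps a w) a v = b *r hom_act u Ph a v + c *r hom_act u Ps a v"
   by (simp add: hom_act_def inv_term_def scaleR_add_right scaleR_diff_right sum.distrib scaleR_sum_right mult_ac)
  then show "psign ((r + deg a) * deg u) *r hom_act u (%a w. b *r Ph a w + c *r Ps a w) a v =
    b *r (psign ((r + deg a) * deg u) *r hom_act u Ph a v) + c *r (psign ((r + deg a) * deg u) *r hom_act u Ps a v)"
   by (simp add: scaleR_add_right mult.commute)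
 qed
 then have 1: "act_diff r (%a w. b *r Ph a w + c *r Ps a w) a w = b *r act_diff r Ph a w + c *r act_diff r Ps a w"
  unfolding cop_linear act_diff_def .
 have 2: "lam_diff (%a w. b *r Ph a w + c *r Ps a w) a w = b *r lam_diff Ph a w + c *r lam_diff Ps a w"
  unfolding lam_diff_def cop_linear ..
 show ?thesis unfolding total_diff_def 1 2 by (simp add: scaleR_diff_right scaleR_add_right mult.commute)
qed

text \<open>The factor \<open>psign p\<close> is the sign of moving the differential past
  \<open>f\<close>; it matches the one in the invariance condition.\<close>

lemma rep_diff_total_diff: "rep_diff V lam rho (p + r) (%w. if w : words V then Ph [] w else 0) w =
  (if w : words V then psign p *r total_diff r Ph [] w else 0)"
proof (cases "w : words V")
 case True
 have "cop w (%u v. psign ((p + r) * deg u) *r rho u (if v : words V then Ph [] v else 0)) =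
   psign p *r act_diff r Ph [] w"
  unfolding act_diff_def cop_scaleR[symmetric] by (rule cop_words_cong[OF True]) (auto simp: hom_act_def psign_if)
 moreover have "cop w (%u v. if dl u # v : words V then Ph [] (dl u # v) else 0) = lam_diff Ph [] w"
  unfolding lam_diff_def by (rule cop_words_cong[OF True]) (simp add: lam_deg)
 ultimately show ?thesis using True
  by (simp add: rep_diff_def comp_dlam_def coprod_cop total_diff_def psign_add scaleR_diff_right)
qed (simp add: rep_diff_def)

end

section \<open>Polynomials in a parameter\<close>

text \<open>A polynomial function of degree at most \<open>n\<close> with coefficients in
  \<open>S\<close>, paired with its formal derivative. In the term \<open>j = 0\<close> the factor
  \<open>real j\<close> vanishes, whatever \<open>j - 1\<close> is.\<close>

definition polyd :: "'w::real_vector set => nat => (real => 'w) => (real => 'w) => bool" where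
 "polyd S n P P' <-> (EX c. (ALL j. c j : S) & (ALL t. P t = (SUM j<=n. t ^ j *r c j)) &
   (ALL t. P' t = (SUM j<=n. (real j * t ^ (j - 1)) *r c j)))"

lemma polyd_const: "x : S ==> 0 : S ==> polyd S n (%t. x) (%t. 0)"
proof -
 assume "x : S" "0 : S"
 have "(SUM j<=n. t ^ j *r (if j = 0 then x else 0)) = x" "(SUM j<=n. (real j * t ^ (j - 1)) *r (if j = 0 then x else 0)) = 0" for t :: real
  by (simp_all add: if_distrib sum.delta cong: if_cong)
 then show ?thesis using `x : S` `0 : S` unfolding polyd_def by (intro exI[of _ "%j. if j = 0 then x else 0"]) auto
qed

lemma polyd_linear: assumes S: "subspace S" and P: "polyd S n P P'" and Q: "polyd S n Q Q'"
 shows "polyd S n (%t. a *r P t + b *r Q t) (%t. a *r P' t + b *r Q' t)"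
proof -
 obtain c d where "ALL j. c j : S" "ALL t. P t = (SUM j<=n. t ^ j *r c j)" "ALL t. P' t = (SUM j<=n. (real j * t ^ (j - 1)) *r c j)"
  "ALL j. d j : S" "ALL t. Q t = (SUM j<=n. t ^ j *r d j)" "ALL t. Q' t = (SUM j<=n. (real j * t ^ (j - 1)) *r d j)"
  using P Q unfolding polyd_def by blast
 then show ?thesis unfolding polyd_def by (intro exI[of _ "%j. a *r c j + b *r d j"])
   (simp add: subspace_add[OF S] subspace_scale[OF S] scaleR_add_right sum.distrib scaleR_sum_right mult_ac)
qed

lemma polyd_add: "polyd UNIV n P P' ==> polyd UNIV n Q Q' ==> polyd UNIV n (%t. P t + Q t) (%t. P' t + Q' t)"
 using polyd_linear[OF subspace_UNIV, of n P P' Q Q' 1 1] by simp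

lemma polyd_scaleR: "polyd UNIV n P P' ==> polyd UNIV n (%t. a *r P t) (%t. a *r P' t)"
 using polyd_linear[OF subspace_UNIV, of n P P' P P' a 0] by simp

lemma polyd_sum:
 "finite I ==> (!!i. i : I ==> polyd UNIV n (P i) (P' i)) ==> polyd UNIV n (%t. SUM i:I. P i t) (%t. SUM i:I. P' i t)"
 by (induction I rule: finite_induct) (auto intro: polyd_add polyd_const)

lemma polyd_mult: assumes "polyd UNIV n P P'" "n + m <= k"
 shows "polyd UNIV k (%t. t ^ m *r P t) (%t. (real m * t ^ (m - 1)) *r P t + t ^ m *r P' t)"
proof -
 obtain c where c: "ALL t. P t = (SUM j<=n. t ^ j *r c j)" "ALL t. P' t = (SUM j<=n. (real j * t ^ (j - 1)) *r c j)"
  using assms(1) unfolding polyd_def by blast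
 let ?d = "%j. if m <= j & j <= n + m then c (j - m) else 0"
 have s: "(SUM j<=k. g j *r ?d j) = (SUM j<=n. g (j + m) *r c j)" for g
 proof -
  have "(SUM j<=k. g j *r ?d j) = (SUM j:{m..n + m}. g j *r ?d j)"
   using assms(2) by (intro sum.mono_neutral_right) auto
  also have "... = (SUM j:{m..n + m}. g j *r c (j - m))" by (rule sum.cong) auto
  also have "{m..n + m} = (%j. j + m) ` {..n}"
   using image_add_atLeastAtMost'[of m 0 n] by (simp add: atMost_atLeast0)
  finally show ?thesis by (simp add: sum.reindex)
 qed
 have d: "real (j + m) * t ^ (j + m - 1) = real m * t ^ (m - 1) * t ^ j + t ^ m * (real j * t ^ (j - 1))" for t :: real and j
  by (cases j; cases m) (auto simp: power_add algebra_simps)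
 show ?thesis unfolding polyd_def
 proof (intro exI[of _ ?d] conjI allI)
  show "t ^ m *r P t = (SUM j<=k. t ^ j *r ?d j)" for t
   unfolding s by (simp add: c(1) scaleR_sum_right power_add mult.commute)
  show "(real m * t ^ (m - 1)) *r P t + t ^ m *r P' t = (SUM j<=k. (real j * t ^ (j - 1)) *r ?d j)" for t
   unfolding s d by (simp add: c scaleR_sum_right scaleR_add_left sum.distrib)
 qed simp
qed

lemma polyd_cop:
 assumes "w : words V" "!!u v. u : words V ==> v : words V ==> polyd UNIV n (P u v) (P' u v)"
 shows "polyd UNIV n (%t. cop w (%u v. P u v t)) (%t. cop w (%u v. P' u v t))" using assms
proof (induction w arbitrary: P P')
 case (Cons x w)
 have w: "w : words V" "snd x : V (fst x)" using Cons.prems(1) by auto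
 have "polyd UNIV n (%t. cop w (%u v. P (x # u) v t)) (%t. cop w (%u v. P' (x # u) v t))"
  by (rule Cons.IH[OF w(1)]) (rule Cons.prems(2), use w in auto)
 moreover have "polyd UNIV n (%t. cop w (%u v. psign (fst x * deg u) *r P u (x # v) t))
   (%t. cop w (%u v. psign (fst x * deg u) *r P' u (x # v) t))"
  by (rule Cons.IH[OF w(1)]) (rule polyd_scaleR, rule Cons.prems(2), use w in auto)
 ultimately show ?case unfolding cop.simps by (rule polyd_add)
qed simp

text \<open>Forward differences give the weights of the quadrature formula.\<close>

lemma moments_top: "EX l :: (real \<times> real) list. ALL j<=n. (SUM (w, t)<-l. w * t ^ j) = (if j = n then 1 else 0)"
proof (induction n)
 case 0
 show ?case by (rule exI[of _ "[(1, 0)]"]) simp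
next
 case (Suc n)
 then obtain l :: "(real \<times> real) list" where l: "ALL j<=n. (SUM (w, t)<-l. w * t ^ j) = (if j = n then 1 else 0)" by blast
 let ?l = "map (%(w, t). (w / real (Suc n), t + 1)) l @ map (%(w, t). (- w / real (Suc n), t)) l"
 have b: "(t + 1) ^ j - t ^ j = (SUM i<j. real (j choose i) * t ^ i)" for t :: real and j
  unfolding binomial_ring[of t 1 j] by (simp flip: lessThan_Suc_atMost)
 have "(SUM (w, t)<-map (%(w, t). (w / c, t + 1)) l @ map (%(w, t). (- w / c, t)) l. w * t ^ j) =
   (SUM (w, t)<-l. w * ((t + 1) ^ j - t ^ j)) / c" for c :: real and j
  by (induction l) (auto simp: algebra_simps add_divide_distrib diff_divide_distrib)
 note this[of _ "real (Suc n)"]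
 also have "(SUM (w, t)<-l. w * ((t + 1) ^ j - t ^ j)) = (SUM i<j. real (j choose i) * (SUM (w, t)<-l. w * t ^ i))" for j
  unfolding b by (induction l) (auto simp: sum_distrib_left sum.distrib algebra_simps)
 finally have e: "(SUM (w, t)<-?l. w * t ^ j) = (SUM i<j. real (j choose i) * (SUM (w, t)<-l. w * t ^ i)) / real (Suc n)" for j .
 have "(SUM (w, t)<-?l. w * t ^ j) = (if j = Suc n then 1 else 0)" if "j <= Suc n" for j
 proof -
  have "(SUM i<j. real (j choose i) * (SUM (w, t)<-l. w * t ^ i)) = (SUM i<j. if i = n then real (j choose i) else 0)"
   using l that by (intro sum.cong) auto
  also have "... = (if j = Suc n then real (Suc n) else 0)" using that by (auto simp: sum.delta)
  finally show ?thesis unfolding e by simp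
 qed
 then show ?case by blast
qed

text \<open>The combination from \<open>moments_top\<close> kills the lower powers, so a multiple of
  it corrects the top moment without disturbing the others.\<close>

lemma moments: "EX l :: (real \<times> real) list. ALL j<=n. (SUM (w, t)<-l. w * t ^ j) = m j"
proof (induction n)
 case 0
 show ?case by (rule exI[of _ "[(m 0, 0)]"]) simp
next
 case (Suc n)
 then obtain l :: "(real \<times> real) list" where l: "ALL j<=n. (SUM (w, t)<-l. w * t ^ j) = m j" by blast
 obtain l' :: "(real \<times> real) list" where l': "ALL j<=Suc n. (SUM (w, t)<-l'. w * t ^ j) = (if j = Suc n then 1 else 0)"
  using moments_top[of "Suc n"] by blast
 let ?s = "m (Suc n) - (SUM (w, t)<-l. w * t ^ Suc n)"
 have "(SUM (w, t)<-l @ map (%(w, t). (?s * w, t)) l'. w * t ^ j) = (SUM (w, t)<-l. w * t ^ j) + ?s * (SUM (w, t)<-l'. w * t ^ j)" for j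
  by (simp add: comp_def case_prod_unfold mult.assoc sum_list_const_mult)
 then have "ALL j<=Suc n. (SUM (w, t)<-l @ map (%(w, t). (?s * w, t)) l'. w * t ^ j) = m j"
  using l l' by (auto simp: le_Suc_eq)
 then show ?case by blast
qed

text \<open>The prescribed moments \<open>1 / (j + 1)\<close> are the integrals of
  \<open>t ^ j\<close> over the unit interval. The list is chosen before the polynomials, so the
  same formula applies to all of them.\<close>

lemma quadrature:
 obtains l :: "(real \<times> real) list" where
  "!!P P' :: real => 'w::real_vector. polyd UNIV n P P' ==> P 1 - P 0 = (SUM (w, t)<-l. w *r P' t)"
proof -
 obtain l :: "(real \<times> real) list" where l: "ALL j<=n. (SUM (w, t)<-l. w * t ^ j) = 1 / real (Suc j)"
  using moments[of n "%j. 1 / real (Suc j)"] by blast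
 have "P 1 - P 0 = (SUM (w, t)<-l. w *r P' t)" if P: "polyd UNIV n P P'" for P P' :: "real => 'w"
 proof -
  obtain c where c: "ALL t. P t = (SUM j<=n. t ^ j *r c j)" "ALL t. P' t = (SUM j<=n. (real j * t ^ (j - 1)) *r c j)"
   using P unfolding polyd_def by blast
  have "(SUM (w, t)<-l. w *r P' t) = (SUM j<=n. (SUM (w, t)<-l. w * (real j * t ^ (j - 1))) *r c j)"
   by (induction l) (auto simp: c(2) scaleR_sum_right scaleR_add_left sum.distrib)
  also have "... = (SUM j<=n. (if j = 0 then 0 else 1) *r c j)"
  proof (intro sum.cong refl arg_cong[where f="%x. x *r _"])
   fix j assume j: "j : {..n}"
   have "(SUM (w, t)<-l. w * (real j * t ^ (j - 1))) = real j * (SUM (w, t)<-l. w * t ^ (j - 1))"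
    by (induction l) (auto simp: algebra_simps)
   then show "(SUM (w, t)<-l. w * (real j * t ^ (j - 1))) = (if j = 0 then 0 else 1)"
    using l j by (cases j) auto
  qed
  also have "... = P 1 - P 0" unfolding c(1)[rule_format] sum_subtractf[symmetric]
   by (intro sum.cong) (auto simp: power_0_left)
  finally show ?thesis by simp
 qed
 then show ?thesis by (rule that)
qed

text \<open>Up to degree 2 the central difference with step 1 is the derivative. It exhibits the
  derivative of the curvature as a difference of two curvatures, from which it inherits
  multilinearity, symmetry and values in the kernel.\<close>

lemma polyd_central_difference: assumes "polyd S 2 P P'"
 shows "P' t = P (t + 1 / 2) - P (t - 1 / 2)"
proof -
 obtain c where c: "ALL t. P t = (SUM j<=2. t ^ j *r c j)" "ALL t. P' t = (SUM j<=2. (real j * t ^ (j - 1)) *r c j)"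
  using assms unfolding polyd_def by blast
 have "(t + 1 / 2) ^ j - (t - 1 / 2) ^ j = real j * t ^ (j - 1)" if "j <= 2" for j
 proof -
  have "j = 0 | j = 1 | j = 2" using that by auto
  then show ?thesis by (auto simp: power2_eq_square algebra_simps)
 qed
 then show ?thesis unfolding c[rule_format] sum_subtractf[symmetric] scaleR_diff_left[symmetric] by simp
qed

context multilinear_map
begin

lemma adm_last_sum: assumes "adm s Ph" "w : words V" "a : words N" "ALL j. x j : N i" "finite J"
 shows "Ph (a @ [(i, SUM j:J. c j *r x j)]) w = (SUM j:J. c j *r Ph (a @ [(i, x j)]) w)"
 using assms(5)
proof (induction J rule: finite_induct)
 case (insert j J)
 have "(SUM j:J. c j *r x j) : N i" using assms(4) by (intro subspace_sum[OF N] subspace_scale[OF N]) auto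
 then show ?case using adm_last[OF assms(1-3), of "x j" i _ "c j" 1] assms(4) insert by simp
qed (simp add: adm_last_0[OF assms(1-3)])

text \<open>The coefficients of \<open>K t\<close> are pulled out of the last slot of the
  accumulator by \<open>adm_last_sum\<close>; what remains is the product rule for a power of
  \<open>t\<close>, at most the second, times a polynomial.\<close>

lemma polyd_wedge:
 assumes K: "!!u. u : words V ==> polyd (N (deg u + q)) 2 (%t. K t u) (%t. K' t u)"
  and Ph: "!!t. adm s (Ph t)" "!!t. adm s' (Ph' t)" and a: "a : words N" and w: "w : words V"
  and P: "!!a w. a : words N ==> w : words V ==> polyd UNIV n (%t. Ph t a w) (%t. Ph' t a w)"
 shows "polyd UNIV (n + 2) (%t. wedge q r (K t) (Ph t) a w) (%t. wedge q r (K' t) (Ph t) a w + wedge q r (K t) (Ph' t) a w)"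
 unfolding wedge_def cop_add[symmetric] scaleR_add_right[symmetric]
proof (intro polyd_cop[OF w] polyd_scaleR)
 fix u v assume u: "u : words V" and v: "v : words V"
 let ?i = "deg u + q"
 obtain c where c: "ALL j. c j : N ?i" "!!t. K t u = (SUM j<=2. t ^ j *r c j)" "!!t. K' t u = (SUM j<=2. (real j * t ^ (j - 1)) *r c j)"
  using K[OF u] unfolding polyd_def by blast
 have "polyd UNIV (n + 2) (%t. SUM j<=2. t ^ j *r Ph t (a @ [(?i, c j)]) v)
   (%t. SUM j<=2. (real j * t ^ (j - 1)) *r Ph t (a @ [(?i, c j)]) v + t ^ j *r Ph' t (a @ [(?i, c j)]) v)"
  by (rule polyd_sum[OF finite_atMost], rule polyd_mult, rule P) (use a c(1) v in auto)
 then show "polyd UNIV (n + 2) (%t. Ph t (a @ [(?i, K t u)]) v) (%t. Ph t (a @ [(?i, K' t u)]) v + Ph' t (a @ [(?i, K t u)]) v)"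
  by (simp only: c(2,3) adm_last_sum[OF Ph(1) v a c(1) finite_atMost] adm_last_sum[OF Ph(2) v a c(1) finite_atMost] sum.distrib)
qed

end

section \<open>Chern--Weil theory for extensions of L-infinity algebras\<close>

text \<open>\<open>lam_short\<close> confines the brackets to one and two arguments, as for crossed
  modules; this is what makes the curvature quadratic along a path of splittings.\<close>

locale linf =
 fixes V :: "'v::real_vector grading" and lam :: "'v word => 'v"
 assumes V: "subspace (V i)" and lam_multi: "multilin V lam"
  and lam_deg: "w : words V ==> lam w : V (deg w + 1)" and lam_swap: "swap_sym V lam"
  and lam_sq: "w : words V ==> dcomp lam lam w = 0"
  and lam_short: "length w ~= 1 ==> length w ~= 2 ==> lam w = 0"
begin

lemma lam_zero: "w1 : words V ==> w2 : words V ==> lam (w1 @ (i, 0) # w2) = 0"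
 using multilinearD[OF lam_multi, of w1 w2 0 i 0 0 0] subspace_0[OF V] by simp

lemma lam_last: "w : words V ==> x : V i ==> y : V i ==> lam (w @ [(i, b *r x + c *r y)]) = b *r lam (w @ [(i, x)]) + c *r lam (w @ [(i, y)])"
 using multilinearD[OF lam_multi, of w "[]"] by simp

text \<open>The coderivation puts an inner bracket in front of the word, whereas the adjoint action
  takes its argument last; this sign translates between the two.\<close>

lemma lam_rotate: assumes "snd x : V (fst x)" "w : words V"
 shows "lam (x # w) = psign (fst x * deg w) *r lam (w @ [x])"
proof -
 have "lam (w' @ x # w) = psign (fst x * deg w) *r lam (w' @ w @ [x])" if "w' : words V" for w'
  using assms(2) that
 proof (induction w arbitrary: w')
  case (Cons y w)
  have "lam (w' @ x # y # w) = psign (fst x * fst y) *r lam (w' @ y # x # w)"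
   by (rule swap_symD[OF lam_swap]) (use Cons.prems assms(1) in simp)
  also have "lam (w' @ y # x # w) = psign (fst x * deg w) *r lam (w' @ y # w @ [x])"
   using Cons.IH[of "w' @ [y]"] Cons.prems by simp
  finally show ?case by (auto simp: psign_if)
 qed simp
 from this[of "[]"] show ?thesis by simp
qed

end

lemma polyd_quadratic:
 assumes "c0 : S" "c1 : S" "c2 : S" "!!t. P t = c0 + t *r c1 + t\<^sup>2 *r c2" "!!t. P' t = c1 + (2 * t) *r c2"
 shows "polyd S 2 P P'" unfolding polyd_def
 by (rule exI[of _ "%j. if j = 0 then c0 else if j = 1 then c1 else c2"]) (simp add: assms numeral_2_eq_2)

abbreviation hmap :: "('v => 'u) => 'v word => 'u word" where "hmap h == map (map_prod id h)"

lemma deg_hmap [simp]: "deg (hmap h w) = deg w" by (induction w) auto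

definition rel_words :: "(int => 'u => 'v => bool) => 'u word => 'v word => bool" where
 "rel_words R = list_all2 (%x y. fst x = fst y & R (fst x) (snd x) (snd y))"

lemma rel_words_simps [simp]:
 "rel_words R [] []" "rel_words R (x # u) (y # v) <-> fst x = fst y & R (fst x) (snd x) (snd y) & rel_words R u v"
 by (auto simp: rel_words_def)

lemma rel_words_append: "rel_words R u v ==> rel_words R u' v' ==> rel_words R (u @ u') (v @ v')"
 by (auto simp: rel_words_def intro: list_all2_appendI)

text \<open>The relation \<open>R\<close> says that an element of the total algebra is mapped to an element of the
  base algebra; \<open>N\<close> is the kernel.\<close>

locale linf_ext = V: linf V lam + T: linf T lamh
 for V :: "'v::real_vector grading" and lam and T :: "'u::real_vector grading" and lamh +
 fixes R :: "int => 'u => 'v => bool" assumes R_sub: "R i a b ==> a : T i & b : V i"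
  and R_lin: "R i a b ==> R i a' b' ==> R i (c *r a + d *r a') (c *r b + d *r b')"
  and R_0: "R i 0 0" and R_lam: "rel_words R wh w ==> R (deg w + 1) (lamh wh) (lam w)"
begin

definition N :: "'u grading" where "N i = {a. R i a 0}"

lemma N_sub: "subspace (N i)" using R_0 R_lin[of i _ 0 _ 0] by (intro subspaceI2) (auto simp: N_def)

lemma N_T: "a : N i ==> a : T i" using R_sub by (auto simp: N_def)

lemma R_diff: "R i a b ==> R i a' b ==> a - a' : N i"
 using R_lin[of i a b a' b 1 "-1"] by (simp add: N_def)

lemma rel_words_words: "rel_words R u v ==> u : words T & v : words V & deg u = deg v"
 unfolding rel_words_def by (induction u v rule: list_all2_induct) (auto dest: R_sub)

text \<open>The kernel is an ideal: a letter of \<open>N\<close> projects to 0, and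
  \<open>lam\<close> vanishes on words with a letter 0.\<close>

lemma lamh_N: assumes "rel_words R u v" "rel_words R u' v'" "a : N i"
 shows "lamh (u @ (i, a) # u') : N (deg u + i + deg u' + 1)"
proof -
 have r: "rel_words R (u @ (i, a) # u') (v @ (i, 0) # v')"
  using assms by (intro rel_words_append) (auto simp: N_def)
 have "lam (v @ (i, 0) # v') = 0" using assms rel_words_words by (intro V.lam_zero) auto
 moreover have "deg (v @ (i, 0) # v') + 1 = deg u + i + deg u' + 1" using assms rel_words_words by simp
 ultimately show ?thesis using R_lam[OF r] unfolding N_def by (simp only: mem_Collect_eq)
qed

definition sect :: "('v => 'u) => bool" where "sect h <-> (ALL i. ALL v:V i. R i (h v) v) &
   (ALL i. ALL u:V i. ALL v:V i. ALL b c. h (b *r u + c *r v) = b *r h u + c *r h v)"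

definition curv :: "('v => 'u) => 'v word => 'u" where
 "curv h w = (if w : words V then lamh (hmap h w) - h (lam w) else 0)"

abbreviation dl :: "'v word => int \<times> 'v" where "dl u == (deg u + 1, lam u)"

context
 fixes h assumes h: "sect h"
begin

lemma sect_R: "v : V i ==> R i (h v) v"
 and sect_lin: "u : V i ==> v : V i ==> h (b *r u + c *r v) = b *r h u + c *r h v"
 using h by (auto simp: sect_def)

lemma sect_0: "h 0 = 0" using sect_lin[of 0 0 0 0 0] subspace_0[OF V.V] by simp

lemma hmap_rel: "w : words V ==> rel_words R (hmap h w) w" by (induction w) (auto intro: sect_R)

lemma hmap_words: "w : words V ==> hmap h w : words T" using hmap_rel rel_words_words by blast

lemma curv_N: "w : words V ==> curv h w : N (deg w + 1)"
 using R_diff[OF R_lam[OF hmap_rel] sect_R[OF V.lam_deg]] by (simp add: curv_def)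

lemma curv_multilinear: "multilin V (curv h)" unfolding multilinear_on_def
proof (intro ballI allI)
 fix w1 w2 i u v and b c :: real
 assume w: "w1 : words V" "w2 : words V" and uv: "u : V i" "v : V i"
 have "b *r u + c *r v : V i" using uv by (intro subspace_add[OF V.V] subspace_scale[OF V.V])
 moreover have hT: "h u : T i" "h v : T i" using sect_R R_sub uv by blast+
 moreover have "lam (w1 @ (i, u) # w2) : V (deg w1 + (i + deg w2) + 1)" "lam (w1 @ (i, v) # w2) : V (deg w1 + (i + deg w2) + 1)"
  using V.lam_deg[of "w1 @ (i, u) # w2"] V.lam_deg[of "w1 @ (i, v) # w2"] w uv by auto
 moreover have "lamh (hmap h w1 @ (i, b *r h u + c *r h v) # hmap h w2) =
   b *r lamh (hmap h w1 @ (i, h u) # hmap h w2) + c *r lamh (hmap h w1 @ (i, h v) # hmap h w2)"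
  by (rule multilinearD[OF T.lam_multi hmap_words[OF w(1)] hmap_words[OF w(2)] hT])
 ultimately show "curv h (w1 @ (i, b *r u + c *r v) # w2) = b *r curv h (w1 @ (i, u) # w2) + c *r curv h (w1 @ (i, v) # w2)"
  using w uv multilinearD[OF V.lam_multi w uv]
  by (simp add: curv_def sect_lin[OF uv] sect_lin[of _ "deg w1 + (i + deg w2) + 1"] scaleR_diff_right)
qed

lemma curv_swap: "swap_sym V (curv h)" unfolding swap_sym_def
proof (intro ballI allI impI)
 fix w1 w2 x y
 assume w: "w1 : words V" "w2 : words V" and xy: "snd x : V (fst x)" "snd y : V (fst y)"
 let ?w = "w1 @ x # y # w2" and ?w' = "w1 @ y # x # w2" and ?e = "psign (fst x * fst y)"
 have ww: "?w : words V" "?w' : words V" using w xy by auto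
 have "h (lam ?w) = ?e *r h (lam ?w')"
  using swap_symD[OF V.lam_swap ww(1)] sect_lin[OF V.lam_deg[OF ww(2)] V.lam_deg[OF ww(2)], of ?e 0] by simp
 moreover have "lamh (hmap h ?w) = ?e *r lamh (hmap h ?w')"
  using swap_symD[OF T.lam_swap, of "hmap h w1" "map_prod id h x" "map_prod id h y" "hmap h w2"] hmap_words[OF ww(1)] by simp
 ultimately show "curv h ?w = ?e *r curv h ?w'" using ww by (simp add: curv_def scaleR_diff_right)
qed

definition hact :: "'v word => int \<times> 'u => 'u" where "hact u y = lamh (hmap h u @ [y])"

lemma hact_N: "u : words V ==> y : N i ==> hact u (i, y) : N (deg u + i + 1)"
 using lamh_N[OF hmap_rel, of u "[]" "[]" y i] by (simp add: hact_def)

text \<open>Apply \<open>dcomp lamh lamh = 0\<close> to the lifted word and write the inner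
  \<open>lamh\<close> as \<open>curv h\<close> plus the lift of \<open>lam\<close>. The lifts of
  \<open>lam\<close> give \<open>dcomp lam (curv h)\<close>, because \<open>dcomp lam lam\<close>
  vanishes; the curvature terms give \<open>act_part\<close> after exchanging the two factors of the
  coproduct.\<close>

lemma bianchi: assumes w: "w : words V" shows "ext_diff lam hact 1 (curv h) w = 0"
proof -
 have hl: "h (dcomp lam lam w) = cop w (%u v. h (lam (dl u # v)))"
 proof -
  have "cop w (%u v. lam (dl u # v)) : V (deg w + 2) & h (cop w (%u v. lam (dl u # v))) = cop w (%u v. h (lam (dl u # v)))"
  proof (rule cop_map[where L=h, OF V.V w])
   fix u v assume uv: "u : words V" "v : words V" "deg u + deg v = deg w"
   have "lam (dl u # v) : V (deg (dl u # v) + 1)" using uv V.lam_deg by (intro V.lam_deg) simp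
   moreover have "deg (dl u # v) + 1 = deg w + 2" using uv by simp
   ultimately show "lam (dl u # v) : V (deg w + 2)" by (simp only:)
  qed (rule sect_lin)
  then show ?thesis by (simp add: dcomp_def)
 qed
 let ?A = "%u v. lamh ((deg u + 1, curv h u) # hmap h v)"
 have "dcomp lamh lamh (hmap h w) = cop w (%u v. lamh ((deg u + 1, lamh (hmap h u)) # hmap h v))"
  unfolding dcomp_def cop_hmap by simp
 then have sq: "cop w (%u v. lamh ((deg u + 1, lamh (hmap h u)) # hmap h v)) = 0"
  using T.lam_sq[OF hmap_words[OF w]] by simp
 have "dcomp lam (curv h) w = cop w (%u v. lamh ((deg u + 1, h (lam u)) # hmap h v) + (-1) *r h (lam (dl u # v)))"
  unfolding dcomp_def using V.lam_deg by (intro cop_words_cong[OF w]) (simp add: curv_def)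
 also have "... = cop w (%u v. lamh ((deg u + 1, h (lam u)) # hmap h v))"
  unfolding cop_add cop_scaleR using hl V.lam_sq[OF w] sect_0 by simp
 also have "... = cop w (%u v. lamh ((deg u + 1, lamh (hmap h u)) # hmap h v) + (-1) *r ?A u v)"
 proof (rule cop_words_cong[OF w])
  fix u v assume uv: "u : words V" "v : words V"
  have "lamh (hmap h u) : T (deg u + 1)" using T.lam_deg[OF hmap_words[OF uv(1)]] by simp
  moreover have "curv h u : T (deg u + 1)" by (rule N_T[OF curv_N[OF uv(1)]])
  ultimately have "lamh ((deg u + 1, 1 *r lamh (hmap h u) + (-1) *r curv h u) # hmap h v) =
    1 *r lamh ((deg u + 1, lamh (hmap h u)) # hmap h v) + (-1) *r ?A u v"
   using hmap_words[OF uv(2)] by (intro multilinear_hd[OF T.lam_multi]) auto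
  then show "lamh ((deg u + 1, h (lam u)) # hmap h v) = lamh ((deg u + 1, lamh (hmap h u)) # hmap h v) + (-1) *r ?A u v"
   using uv by (simp add: curv_def)
 qed
 also have "... = - cop w ?A" unfolding cop_add cop_scaleR sq by simp
 also have "cop w ?A = cop w (%u v. psign ((deg u + 1) * deg v) *r hact v (deg u + 1, curv h u))"
 proof (rule cop_words_cong[OF w])
  fix u v assume uv: "u : words V" "v : words V"
  show "?A u v = psign ((deg u + 1) * deg v) *r hact v (deg u + 1, curv h u)"
   using T.lam_rotate[of "(deg u + 1, curv h u)" "hmap h v"] N_T[OF curv_N[OF uv(1)]] hmap_words[OF uv(2)]
   by (simp add: hact_def)
 qed
 also have "... = act_part hact 1 (curv h) w"
  unfolding act_part_def by (subst cop_comm, rule cop_cong) (auto simp: psign_if)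
 finally show ?thesis by (simp add: ext_diff_def psign_if)
qed

end

definition path :: "('v => 'u) => ('v => 'u) => real => 'v => 'u" where
 "path h h' t v = h v + t *r (h' v - h v)"

text \<open>The difference of two splittings as a cochain of degree 0 with values in the kernel,
  supported on words of length one.\<close>

definition sdiff :: "('v => 'u) => ('v => 'u) => 'v word => 'u" where
 "sdiff h h' w = (case w of [x] => h' (snd x) - h (snd x) | _ => 0)"

context
 fixes h h' assumes h: "sect h" and h': "sect h'"
begin

lemma path_sect: "sect (path h h' t)" unfolding sect_def
proof (intro conjI allI ballI)
 show "R i (path h h' t v) v" if "v : V i" for i v
  using R_lin[OF sect_R[OF h that] sect_R[OF h' that], of "1 - t" t] by (simp add: path_def algebra_simps)
 show "path h h' t (b *r u + c *r v) = b *r path h h' t u + c *r path h h' t v" if "u : V i" "v : V i" for i u v b c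
  unfolding path_def sect_lin[OF h that] sect_lin[OF h' that] by (simp add: algebra_simps)
qed

lemma diff_N: "v : V i ==> h' v - h v : N i" using R_diff[OF sect_R[OF h'] sect_R[OF h]] by blast

lemma sdiff_N: "w : words V ==> sdiff h h' w : N (deg w)"
 using diff_N subspace_0[OF N_sub] by (auto simp: sdiff_def split: list.splits)

lemma sdiff_multilinear: "multilin V (sdiff h h')" unfolding multilinear_on_def
proof (intro ballI allI)
 fix w1 w2 i u v and b c :: real
 assume "u : V i" "v : V i"
 then show "sdiff h h' (w1 @ (i, b *r u + c *r v) # w2) = b *r sdiff h h' (w1 @ (i, u) # w2) + c *r sdiff h h' (w1 @ (i, v) # w2)"
  using sect_lin[OF h] sect_lin[OF h'] by (cases w1; cases w2) (auto simp: sdiff_def algebra_simps split: list.splits)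
qed

lemma sdiff_swap: "swap_sym V (sdiff h h')"
proof -
 have "sdiff h h' (w1 @ x # y # w2) = 0" for w1 w2 x y by (cases w1) (auto simp: sdiff_def split: list.splits)
 then show ?thesis by (simp add: swap_sym_def)
qed

text \<open>On words of length one or two the bracket of moved letters is expanded by
  multilinearity. The covariant derivative is taken at the moved splitting, so it depends on
  \<open>t\<close> as well and comes out as \<open>c1 + 2 t c2\<close>. On words of other lengths
  both sides vanish by \<open>lam_short\<close>, since \<open>sdiff\<close> is supported on single
  letters.\<close>

lemma polyd_curv: assumes w: "w : words V"
 shows "polyd (N (deg w + 1)) 2 (%t. curv (path h h' t) w) (%t. ext_diff lam (hact (path h h' t)) 0 (sdiff h h') w)"
proof -
 let ?k = "%t. path h h' t" and ?D = "%t. ext_diff lam (hact (path h h' t)) 0 (sdiff h h') w"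
 let ?d = "h' (lam w) - h (lam w)"
 have dN: "?d : N (deg w + 1)" by (rule diff_N[OF V.lam_deg[OF w]])
 have D: "?D t = cop w (%u v. lamh (hmap (?k t) u @ [(deg v, sdiff h h' v)])) - cop w (%u v. sdiff h h' (dl u # v))" for t
  by (simp add: ext_diff_def act_part_def dcomp_def hact_def[OF path_sect])
 have s0: "sdiff h h' [] = 0" "sdiff h h' (x # y # u) = 0" "sdiff h h' [x] = h' (snd x) - h (snd x)" for x y u
  by (simp_all add: sdiff_def)
 have z: "lamh (u @ [(i, 0)]) = 0" if "u : words T" for u i using T.lam_zero[OF that words_simps(1)] by simp
 have path_hmap: "hmap (?k t) u : words T" if "u : words V" for t u by (rule hmap_words[OF path_sect that])
 have pathT: "v : V i ==> ?k t v : T i" for v i t using sect_R[OF path_sect] R_sub by blast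
 have h0: "h 0 = 0" "h' 0 = 0" using sect_0 h h' by auto
 show ?thesis
 proof (cases "length w = 1 | length w = 2")
  case False
  have l: "lam w = 0" using V.lam_short False by blast
  have "curv (?k t) w = 0" for t
   using T.lam_short[of "hmap (?k t) w"] False l h0 by (simp add: curv_def path_def)
  moreover have "?D t = 0" for t
  proof -
   have "cop w (%u v. lamh (hmap (?k t) u @ [(deg v, sdiff h h' v)])) = cop w (%u v. 0)"
   proof (rule cop_cong)
    fix u v assume m: "mset u + mset v = mset w"
    note sp = split_word(1)[OF m] split_word(3)[OF m w]
    show "lamh (hmap (?k t) u @ [(deg v, sdiff h h' v)]) = 0"
    proof (cases "length v = 1")
     case True
     then show ?thesis using sp(1) False by (intro T.lam_short) auto
    next
     case False
     then have "sdiff h h' v = 0" by (auto simp: sdiff_def split: list.splits)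
     then show ?thesis using z[OF path_hmap[of u t]] sp(2) by simp
    qed
   qed
   moreover have "cop w (%u v. sdiff h h' (dl u # v)) = cop w (%u v. 0)"
   proof (rule cop_cong)
    fix u v assume m: "mset u + mset v = mset w"
    show "sdiff h h' (dl u # v) = 0"
    proof (cases v)
     case Nil
     then have "length u = length w" using split_word(1)[OF m] by simp
     then have "lam u = 0" using False by (intro V.lam_short) auto
     then show ?thesis using Nil h0 by (simp add: s0)
    qed (simp add: s0)
   qed
   ultimately show ?thesis by (simp add: D)
  qed
  ultimately show ?thesis using polyd_const[OF subspace_0[OF N_sub] subspace_0[OF N_sub]] by simp
 next
  case True
  then show ?thesis
  proof
   assume "length w = 1"
   then obtain x where x: "w = [x]" by (auto simp: length_Suc_conv)
   obtain i v where iv: "x = (i, v)" by (cases x)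
   have v: "v : V i" using w by (simp add: x iv)
   let ?c1 = "lamh [(i, h' v - h v)] - ?d"
   have hT: "h v : T i" "h' v - h v : T i" using sect_R[OF h v] R_sub N_T[OF diff_N[OF v]] by auto
   have "lamh [(i, ?k t v)] = lamh [(i, h v)] + t *r lamh [(i, h' v - h v)]" for t
    using T.lam_last[of "[]", OF _ hT, of 1 t] by (simp add: path_def)
   then have P: "curv (?k t) w = curv h w + t *r ?c1 + t\<^sup>2 *r 0" for t
    using w by (simp add: curv_def x iv path_def algebra_simps)
   have D1: "?D t = ?c1 + (2 * t) *r 0" for t
    unfolding D using T.lam_zero[of "[(i, ?k t v)]" "[]"] pathT[OF v] by (simp add: x iv s0 path_def)
   have "lamh [(i, h' v - h v)] : N (deg w + 1)"
    using lamh_N[of "[]" "[]" "[]" "[]", OF _ _ diff_N[OF v]] by (simp add: x iv)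
   then have "?c1 : N (deg w + 1)" by (rule subspace_diff[OF N_sub _ dN])
   from polyd_quadratic[OF curv_N[OF h w] this subspace_0[OF N_sub] P D1] show ?thesis .
  next
   assume "length w = 2"
   then obtain x y where xy: "w = [x, y]" by (auto simp: length_Suc_conv numeral_2_eq_2)
   obtain i a j b where ab: "x = (i, a)" "y = (j, b)" by (cases x, cases y)
   have a: "a : V i" and b: "b : V j" using w by (auto simp: xy ab)
   let ?a = "h' a - h a" and ?b = "h' b - h b" and ?l = "%x y. lamh [(i, x), (j, y)]"
   let ?c1 = "?l ?a (h b) + ?l (h a) ?b - ?d" and ?c2 = "?l ?a ?b"
   have hT: "h a : T i" "?a : T i" "h b : T j" "?b : T j"
    using sect_R[OF h a] sect_R[OF h b] R_sub N_T[OF diff_N[OF a]] N_T[OF diff_N[OF b]] by auto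
   have l1: "?l (h a + t *r ?a) y = ?l (h a) y + t *r ?l ?a y" if "y : T j" for y t
    using multilinear_hd[OF T.lam_multi, of "[(j, y)]" "h a" i ?a 1 t] hT that by simp
   have l2: "?l x (h b + t *r ?b) = ?l x (h b) + t *r ?l x ?b" if "x : T i" for x t
    using T.lam_last[of "[(i, x)]" "h b" j ?b 1 t] hT that by simp
   have k: "?k t a = h a + t *r ?a" "?k t b = h b + t *r ?b" "?k t (lam w) = h (lam w) + t *r ?d" for t
    by (simp_all add: path_def)
   have "?l (?k t a) (?k t b) = ?l (h a) (h b) + t *r (?l ?a (h b) + ?l (h a) ?b) + t\<^sup>2 *r ?c2" for t
    using pathT[OF b, of t] hT unfolding k by (simp add: l1 l2 scaleR_add_right power2_eq_square)
   then have P: "curv (?k t) w = curv h w + t *r ?c1 + t\<^sup>2 *r ?c2" for t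
    using w k(3)[of t] by (simp add: curv_def xy ab algebra_simps)
   \<comment> \<open>One of the two action terms on a word of length two has its letters in the
     opposite order.\<close>
   have sw: "psign (i * j) *r lamh [(j, ?k t b), (i, ?a)] = ?l ?a (?k t b)" for t
    using T.lam_rotate[of "(i, ?a)" "[(j, ?k t b)]"] hT pathT[OF b, of t] by simp
   have D1: "?D t = ?c1 + (2 * t) *r ?c2" for t
   proof -
    have e: "(2 * t) *r ?c2 = t *r ?c2 + t *r ?c2" by (simp flip: scaleR_add_left)
    have "?D t = ?l (?k t a) ?b + ?l ?a (?k t b) - ?d"
     unfolding D using T.lam_zero[of "[(i, ?k t a), (j, ?k t b)]" "[]"] T.lam_zero[of "[]" "[]"] pathT[OF a, of t] pathT[OF b, of t] sw[of t]
     by (simp add: xy ab s0)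
    also have "... = ?c1 + (2 * t) *r ?c2" unfolding k l1[OF hT(4)] l2[OF hT(2)] e by simp
    finally show ?thesis .
   qed
   have "?l ?a (h b) : N (deg w + 1)" "?l (h a) ?b : N (deg w + 1)" "?c2 : N (deg w + 1)"
    using lamh_N[of "[]" "[]" "[(j, h b)]" "[(j, b)]", OF _ _ diff_N[OF a]] sect_R[OF h b]
     lamh_N[of "[(i, h a)]" "[(i, a)]" "[]" "[]", OF _ _ diff_N[OF b]] sect_R[OF h a]
     lamh_N[of "[]" "[]" "[(j, ?b)]" "[(j, 0)]", OF _ _ diff_N[OF a]] diff_N[OF b]
    by (simp_all add: xy ab N_def)
   then have "?c1 : N (deg w + 1)" "?c2 : N (deg w + 1)" by (auto intro: subspace_diff[OF N_sub _ dN] subspace_add[OF N_sub])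
   from polyd_quadratic[OF curv_N[OF h w] this P D1] show ?thesis .
  qed
 qed
qed

end

end

section \<open>Spaces of cochains, coboundaries and cohomology classes\<close>

lemma words_permute: "w : words V ==> si permutes {..<length w} ==> permute_list si w : words V"
 by (simp add: words_def)

lemma sym_homI:
 assumes V: "!!i. subspace (V i)" and "multilin V al" "swap_sym V al" "!!w. w : words V ==> al w : W (p + deg w)"
 shows "(%w. if w : words V then al w else 0) : sym_hom V W p"
proof -
 have "b *r u + c *r v : V i" if "u : V i" "v : V i" for b c i u v
  using that by (intro subspace_add[OF V] subspace_scale[OF V])
 then have "multilin V (%w. if w : words V then al w else 0)"
  using assms(2) by (simp add: multilinear_on_def)
 then show ?thesis
  using assms(4) swap_sym_koszul[OF assms(3)] by (auto simp: sym_hom_def words_permute)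
qed

lemma sym_hom_subspace: assumes "!!i. subspace (W i)" shows "subspace (sym_hom V W p)"
proof (rule subspaceI2)
 show "0 : sym_hom V W p" using subspace_0[OF assms] by (simp add: sym_hom_def multilinear_on_def)
 fix al be and b c :: real assume *: "al : sym_hom V W p" "be : sym_hom V W p"
 have "koszul si w *r (b *r x + c *r y) = b *r koszul si w *r x + c *r koszul si w *r y" for si w and x y :: 'b
  by (simp add: scaleR_add_right mult.commute)
 then show "b *r al + c *r be : sym_hom V W p"
  using * subspace_add[OF assms] subspace_scale[OF assms]
  by (auto simp: sym_hom_def multilinear_on_def scaleR_app scaleR_add_right mult_ac)
qed

lemma rep_diff_cop: "rep_diff V lam rho p al w = (if w : words V
   then cop w (%u v. psign (p * deg u) *r rho u (al v)) - psign p *r cop w (%u v. al ((deg u + 1, lam u) # v)) else 0)"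
 by (simp add: rep_diff_def comp_dlam_def coprod_cop)

lemma rep_diff_linear:
 assumes rho: "!!u x y j b c. u : words V ==> x : W j ==> y : W j ==> rho u (b *r x + c *r y) = b *r rho u x + c *r rho u y"
  and al: "al : sym_hom V W p" "be : sym_hom V W p"
 shows "rep_diff V lam rho p (b *r al + c *r be) = b *r rep_diff V lam rho p al + c *r rep_diff V lam rho p be"
proof
 fix w
 show "rep_diff V lam rho p (b *r al + c *r be) w = (b *r rep_diff V lam rho p al + c *r rep_diff V lam rho p be) w"
 proof (cases "w : words V")
  case True
  have "cop w (%u v. psign (p * deg u) *r rho u ((b *r al + c *r be) v)) =
    cop w (%u v. b *r (psign (p * deg u) *r rho u (al v)) + c *r (psign (p * deg u) *r rho u (be v)))"
  proof (rule cop_words_cong[OF True])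
   fix u v assume u: "u : words V" "v : words V"
   have "rho u (b *r al v + c *r be v) = b *r rho u (al v) + c *r rho u (be v)"
    using al u by (intro rho[of _ _ "p + deg v"]) (auto simp: sym_hom_def)
   then show "psign (p * deg u) *r rho u ((b *r al + c *r be) v) =
     b *r (psign (p * deg u) *r rho u (al v)) + c *r (psign (p * deg u) *r rho u (be v))"
    by (simp add: scaleR_app scaleR_add_right mult.commute)
  qed
  moreover have "cop w (%u v. (b *r al + c *r be) ((deg u + 1, lam u) # v)) =
    b *r cop w (%u v. al ((deg u + 1, lam u) # v)) + c *r cop w (%u v. be ((deg u + 1, lam u) # v))"
   unfolding cop_linear[symmetric] by (simp add: scaleR_app)
  ultimately show ?thesis using True unfolding rep_diff_cop plus_fun_apply scaleR_app cop_linear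
   by (simp add: scaleR_diff_right scaleR_add_right mult.commute)
 qed (simp add: rep_diff_cop scaleR_app)
qed

lemma coboundaries_subspace: assumes W: "!!i. subspace (W i)"
  and rho: "!!u x y j b c. u : words V ==> x : W j ==> y : W j ==> rho u (b *r x + c *r y) = b *r rho u x + c *r rho u y"
 shows "subspace (rep_diff V lam rho p ` sym_hom V W p)"
proof (rule subspaceI2)
 note S = sym_hom_subspace[where W=W, OF W]
 have lin: "rep_diff V lam rho p (b *r al + c *r be) = b *r rep_diff V lam rho p al + c *r rep_diff V lam rho p be"
  if "al : sym_hom V W p" "be : sym_hom V W p" for al be b c
  by (rule rep_diff_linear[OF rho that]) assumption+
 have 0: "0 : sym_hom V W p" by (rule subspace_0[OF S])
 then show "0 : rep_diff V lam rho p ` sym_hom V W p" using lin[OF 0 0, of 0 0] by (intro image_eqI[of _ _ 0]) simp_all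
 fix x y and b c :: real assume "x : rep_diff V lam rho p ` sym_hom V W p" "y : rep_diff V lam rho p ` sym_hom V W p"
 then obtain al be where *: "al : sym_hom V W p" "be : sym_hom V W p" "x = rep_diff V lam rho p al" "y = rep_diff V lam rho p be"
  by blast
 have "b *r al + c *r be : sym_hom V W p" by (intro subspace_add[OF S] subspace_scale[OF S] *)
 then show "b *r x + c *r y : rep_diff V lam rho p ` sym_hom V W p" unfolding * lin[OF *(1,2), symmetric] by (rule imageI)
qed

lemma subspace_sum_list: "subspace S ==> (!!t. X t : S) ==> (SUM (c, t)<-l. c *r X t) : S"
 by (induction l) (auto intro: subspace_0 subspace_add subspace_scale)

text \<open>Classes are represented as sets of cocycles modulo a subspace of coboundaries, so
  cohomologous cochains give literally equal sets.\<close>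

lemma cohomology_class_eq: assumes S: "subspace (rep_diff V lam rho (p - 1) ` sym_hom V W (p - 1))"
  and d: "al' - al : rep_diff V lam rho (p - 1) ` sym_hom V W (p - 1)"
 shows "cohomology_class V lam rho W p al = cohomology_class V lam rho W p al'"
 using subspace_diff[OF S _ d, of "_ - al"] subspace_add[OF S _ d, of "_ - al'"] by (auto simp: cohomology_class_def)

text \<open>Invariance is demanded for every word \<open>xh\<close> of the total algebra that
  projects to \<open>w\<close>. The lift of \<open>w\<close> by any splitting is such a word, so one
  \<open>f\<close> yields an \<open>invariant_map\<close> for all splittings, in particular along a
  whole path of them.\<close>

locale chern_weil = linf_ext V lam T lamh R
 for V :: "'v::real_vector grading" and lam and T :: "'u::real_vector grading" and lamh and R +
 fixes W :: "'w::real_vector grading" and rho :: "'v word => 'w => 'w" and f :: "'u word => 'w" and p :: int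
 assumes W: "subspace (W i)" and f_multi: "multilin N f" and f_deg: "a : words N ==> f a : W (p + deg a)"
  and rho_linear: "u : words V ==> x : W j ==> y : W j ==> rho u (b *r x + c *r y) = b *r rho u x + c *r rho u y"
  and invariant: "rel_words R xh w ==> a : words N ==>
   (SUM i<length a. psign ((deg w + 1) * deg (take i a)) *r f (a[i := (deg w + fst (a ! i) + 1, lamh (xh @ [a ! i]))])) =
   psign p *r psign (p * deg w) *r rho w (f a)"
begin

sublocale multilinear_map V N W f p by unfold_locales (rule N_sub W f_multi f_deg; assumption?)+

lemma invariant_map: assumes h: "sect h" shows "invariant_map V N W f p lam (hact h) rho"
proof unfold_locales
 show "hact h u (i, y) : N (deg u + i + 1)" if "u : words V" "y : N i" for u y i by (rule hact_N[OF h that])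
 show "(SUM i<length a. psign ((deg u + 1) * deg (take i a)) *r f (a[i := (deg u + fst (a ! i) + 1, hact h u (a ! i))])) =
   psign p *r psign (p * deg u) *r rho u (f a)" if "u : words V" "a : words N" for u a
  using invariant[OF hmap_rel[OF h that(1)] that(2)] by (simp add: hact_def[OF h])
qed (rule V.lam_deg rho_linear; assumption)+

lemma wedge_zero: "wedge q r al (%a w. 0) a w = 0" by (simp add: wedge_def)

lemma adm_sym_hom: "adm r Ph ==> (%w. if w : words V then Ph [] w else 0) : sym_hom V W r"
 by (rule sym_homI[OF V.V]) (auto simp: adm_def dest!: bspec[of "words N" _ "[]"])

lemma cochain_curv: "sect h ==> cochain 1 (curv h)"
 by (simp add: cochain_def curv_multilinear curv_swap curv_N)

lemma adm_curv: "sect h ==> adm (p + int k) (comp_wedge_pow f (curv h) k)"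
proof (induction k)
 case 0
 then show ?case using adm_base[of "curv h"] by (simp del: comp_wedge_pow.simps)
next
 case (Suc k)
 show ?case using adm_wedge[OF Suc.IH[OF Suc.prems] cochain_curv[OF Suc.prems], of "int k"]
  unfolding comp_wedge_pow_Suc by (simp add: ac_simps)
qed

text \<open>Induction over the factors by the Leibniz rule: the new factor contributes its Bianchi
  identity, the remaining ones the induction hypothesis, and the base case is the invariance of
  \<open>f\<close>.\<close>

lemma total_diff_curv: assumes h: "sect h" and a: "a : words N" and w: "w : words V"
 shows "invariant_map.total_diff p lam (hact h) rho (int k) (comp_wedge_pow f (curv h) k) a w = 0"
proof -
 interpret I: invariant_map V N W f p lam "hact h" rho by (rule invariant_map[OF h])
 show ?thesis using a w
 proof (induction k arbitrary: a w)
  case 0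
  then show ?case using I.total_diff_base by (simp del: comp_wedge_pow.simps)
 next
  case (Suc k)
  have "wedge 1 (int k + 1) (curv h) (I.total_diff (int k) (comp_wedge_pow f (curv h) k)) a w =
    wedge 1 (int k + 1) (curv h) (%a w. 0) a w"
   using Suc by (intro wedge_cong) (auto simp: curv_N[OF h])
  moreover have "wedge (1 + 1) (int k) (ext_diff lam (hact h) 1 (curv h)) (comp_wedge_pow f (curv h) k) a w = 0"
   by (rule wedge_0[OF adm_curv[OF h] Suc.prems bianchi[OF h]])
  ultimately show ?case
   using I.total_diff_wedge[OF adm_curv[OF h] cochain_curv[OF h] Suc.prems, of "int k" k]
   unfolding comp_wedge_pow_Suc by (simp add: wedge_zero add.commute)
 qed
qed

abbreviation cw :: "nat => ('v => 'u) => 'v word => 'w" where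
 "cw k h == (%w. if w : words V then comp_wedge_pow f (curv h) k [] w else 0)"

theorem cw_cocycle: assumes h: "sect h" shows "cw k h : cocycles V lam rho W (p + int k)"
proof -
 have "rep_diff V lam rho (p + int k) (cw k h) w = 0" for w
  unfolding invariant_map.rep_diff_total_diff[OF invariant_map[OF h]] using total_diff_curv[OF h] by simp
 then show ?thesis using adm_sym_hom[OF adm_curv[OF h]] by (auto simp: cocycles_def)
qed

text \<open>The derivative of the \<open>k\<close>-th power of \<open>K\<close> in the direction of \<open>K'\<close>, and its primitive when
  \<open>K'\<close> is the differential of \<open>be\<close>.\<close>

primrec pow_deriv :: "('v word => 'u) => ('v word => 'u) => nat => 'u word => 'v word => 'w" where
 "pow_deriv K K' 0 = (%a w. 0)"
| "pow_deriv K K' (Suc k) =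
   (%a w. 1 *r wedge 1 (int k) K' (comp_wedge_pow f K k) a w + 1 *r wedge 1 (int k) K (pow_deriv K K' k) a w)"

primrec primitive :: "('v word => 'u) => ('v word => 'u) => nat => 'u word => 'v word => 'w" where
 "primitive K be 0 = (%a w. 0)"
| "primitive K be (Suc k) =
   (%a w. 1 *r wedge 0 (int k) be (comp_wedge_pow f K k) a w + (-1) *r wedge 1 (int k - 1) K (primitive K be k) a w)"

lemma adm_zero: "adm r (%a w. 0)"
 using subspace_0[OF W] by (simp add: adm_def multilinear_on_def swap_sym_def)

text \<open>The curvature factors are covariantly closed, so the differential of
  \<open>primitive\<close> acts on the single factor \<open>be\<close> and turns it into
  \<open>K'\<close>; this is \<open>pow_deriv\<close>. Quadrature then writes the difference of the
  two cochains as a finite combination of such coboundaries.\<close>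

theorem transgression: assumes h: "sect h" and h': "sect h'"
 shows "cw k h' - cw k h : rep_diff V lam rho (p + int k - 1) ` sym_hom V W (p + int k - 1)"
proof -
 let ?K = "%t. curv (path h h' t)" and ?be = "sdiff h h'"
 \<comment> \<open>Written as a central difference so that it is a cochain by construction;
   \<open>dbe\<close> identifies it with the covariant derivative of
   \<open>sdiff h h'\<close>.\<close>
 let ?K' = "%t w. 1 *r ?K (t + 1 / 2) w + (-1) *r ?K (t - 1 / 2) w"
 let ?W = "%t k. comp_wedge_pow f (?K t) k"
 note s = path_sect[OF h h']
 note pc = polyd_curv[OF h h']
 have be: "cochain 0 ?be"
  using sdiff_multilinear[OF h h'] sdiff_swap[OF h h'] sdiff_N[OF h h'] by (simp add: cochain_def)
 have K': "cochain 1 (?K' t)" for t using cochain_curv[OF s] unfolding cochain_def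
  by (intro conjI multilinear_linear swap_sym_linear ballI subspace_add[OF N] subspace_scale[OF N]) auto
 have dbe: "ext_diff lam (hact (path h h' t)) 0 ?be w = ?K' t w" if "w : words V" for t w
  using polyd_central_difference[OF pc[OF that]] by simp
 have pK: "polyd (N (deg u + 1)) 2 (%t. ?K t u) (%t. ?K' t u)" if "u : words V" for u
  using pc[OF that] polyd_central_difference[OF pc[OF that]] by simp
 have aP: "adm (p + int k) (pow_deriv (?K t) (?K' t) k)" for t k
 proof (induction k)
  case (Suc k)
  have e: "p + int (Suc k) = p + int k + 1" by simp
  show ?case unfolding e pow_deriv.simps
   by (rule adm_linear[OF adm_wedge[OF adm_curv[OF s] K'] adm_wedge[OF Suc cochain_curv[OF s]]])
 qed (simp add: adm_zero)
 have aT: "adm (p + int k - 1) (primitive (?K t) ?be k)" for t k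
 proof (induction k)
  case (Suc k)
  have "adm (p + int k + 0) (wedge 0 (int k) ?be (?W t k))" by (rule adm_wedge[OF adm_curv[OF s] be])
  moreover have "adm (p + int k - 1 + 1) (wedge 1 (int k - 1) (?K t) (primitive (?K t) ?be k))"
   by (rule adm_wedge[OF Suc cochain_curv[OF s]])
  ultimately show ?case using adm_linear[of "p + int k" _ _ 1 "-1"] by simp
 qed (simp add: adm_zero)
 have D: "invariant_map.total_diff p lam (hact (path h h' t)) rho (int k - 1) (primitive (?K t) ?be k) a w =
   pow_deriv (?K t) (?K' t) k a w" if "a : words N" "w : words V" for t k a w
 proof -
  interpret I: invariant_map V N W f p lam "hact (path h h' t)" rho by (rule invariant_map[OF s])
  show ?thesis using that
  proof (induction k arbitrary: a w)
   case 0
   then show ?case using I.total_diff_linear[OF adm_zero adm_zero 0, of _ 0 0] by simp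
  next
   case (Suc k)
   note aw = Suc.prems
   have 1: "I.total_diff (int k + 0) (wedge 0 (int k) ?be (?W t k)) a w = wedge 1 (int k) (?K' t) (?W t k) a w"
   proof -
    have "wedge 1 (int k) (ext_diff lam (hact (path h h' t)) 0 ?be) (?W t k) a w = wedge 1 (int k) (?K' t) (?W t k) a w"
     using aw dbe K' by (intro wedge_cong) (auto simp: cochain_def)
    moreover have "wedge 0 (int k + 1) ?be (I.total_diff (int k) (?W t k)) a w = wedge 0 (int k + 1) ?be (%a w. 0) a w"
     using aw total_diff_curv[OF s] sdiff_N[OF h h'] by (intro wedge_cong) auto
    ultimately show ?thesis unfolding I.total_diff_wedge[OF adm_curv[OF s] be aw] by (simp add: wedge_zero)
   qed
   \<comment> \<open>Moving the differential past \<open>K\<close>, which has degree 1, produces the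
     minus sign that the factor -1 in \<open>primitive\<close> compensates.\<close>
   have 2: "I.total_diff (int k - 1 + 1) (wedge 1 (int k - 1) (?K t) (primitive (?K t) ?be k)) a w =
     - wedge 1 (int k) (?K t) (pow_deriv (?K t) (?K' t) k) a w"
   proof -
    have "wedge (1 + 1) (int k - 1) (ext_diff lam (hact (path h h' t)) 1 (?K t)) (primitive (?K t) ?be k) a w = 0"
     by (rule wedge_0[OF aT aw bianchi[OF s]])
    moreover have "wedge 1 (int k - 1 + 1) (?K t) (I.total_diff (int k - 1) (primitive (?K t) ?be k)) a w =
      wedge 1 (int k - 1 + 1) (?K t) (pow_deriv (?K t) (?K' t) k) a w"
     using aw Suc.IH curv_N[OF s] by (intro wedge_cong) auto
    ultimately show ?thesis unfolding I.total_diff_wedge[OF aT cochain_curv[OF s] aw] by simp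
   qed
   have "adm (p + int k) (wedge 0 (int k) ?be (?W t k))" "adm (p + int k) (wedge 1 (int k - 1) (?K t) (primitive (?K t) ?be k))"
    using adm_wedge[OF adm_curv[OF s] be] adm_wedge[OF aT cochain_curv[OF s]] by force+
   from I.total_diff_linear[OF this aw, of "int k" 1 "-1"] 1 2 show ?case by simp
  qed
 qed
 \<comment> \<open>Each of the \<open>k\<close> factors is quadratic in \<open>t\<close>.\<close>
 have P: "polyd UNIV (2 * k) (%t. ?W t k a w) (%t. pow_deriv (?K t) (?K' t) k a w)" if "a : words N" "w : words V" for k a w
  using that
 proof (induction k arbitrary: a w)
  case (Suc k)
  from polyd_wedge[OF pK adm_curv[OF s] aP Suc.prems Suc.IH] show ?case unfolding comp_wedge_pow_Suc by simp
 qed (auto intro: polyd_const)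
 obtain l :: "(real \<times> real) list" where
  l: "!!P P' :: real => 'w. polyd UNIV (2 * k) P P' ==> P 1 - P 0 = (SUM (w, t)<-l. w *r P' t)"
  by (rule quadrature) blast
 let ?B = "rep_diff V lam rho (p + int k - 1) ` sym_hom V W (p + int k - 1)"
 let ?X = "%t w. if w : words V then pow_deriv (?K t) (?K' t) k [] w else 0"
 have B: "subspace ?B" by (rule coboundaries_subspace[OF W]) (rule rho_linear; assumption)
 have "?X t : ?B" for t
 proof -
  let ?Y = "%w. if w : words V then primitive (?K t) ?be k [] w else 0"
  have e: "rep_diff V lam rho (p + (int k - 1)) ?Y = psign p *r ?X t"
   unfolding fun_eq_iff invariant_map.rep_diff_total_diff[OF invariant_map[OF s[of t]]] by (simp add: D scaleR_app)
  have "rep_diff V lam rho (p + int k - 1) ?Y : ?B" by (rule imageI[OF adm_sym_hom[OF aT]])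
  from subspace_scale[OF B this[unfolded e[unfolded add_diff_eq]], of "psign p"] show ?thesis by simp
 qed
 then have "(SUM (c, t)<-l. c *r ?X t) : ?B" by (rule subspace_sum_list[OF B])
 moreover have "cw k h' - cw k h = (SUM (c, t)<-l. c *r ?X t)"
 proof
  fix w
  have "(SUM (c, t)<-l. c *r ?X t) w = (SUM (c, t)<-l. c *r ?X t w)" for l
   by (induction l) (auto simp: scaleR_app)
  moreover have "path h h' 0 = h" "path h h' 1 = h'" by (simp_all add: path_def fun_eq_iff)
  ultimately show "(cw k h' - cw k h) w = (SUM (c, t)<-l. c *r ?X t) w"
   using l[OF P[OF words_simps(1)], of w] by (auto simp: case_prod_unfold)
 qed
 ultimately show ?thesis by simp
qed

end

section \<open>Crossed modules as L-infinity algebras\<close>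

context crossed_mod
begin

abbreviation "V == shift (cm_grading C)"

lemma zero_mem [simp]: "0 : low C" "0 : up C" using low up by (auto intro: subspace_0)

lemma zeros [simp]: "bdry C 0 = 0" "x : up C ==> action C x 0 = 0" "u : low C ==> action C 0 u = 0"
 "x : up C ==> brk C x 0 = 0" "x : up C ==> brk C 0 x = 0"
proof -
 show "bdry C 0 = 0" using bdry_linear[of 0 0 0 0] by simp
 show "x : up C ==> action C x 0 = 0" using action_linear[of x 0 0 0 0] by simp
 show "u : low C ==> action C 0 u = 0" using action_linear_left[of 0 0 u 0 0] by simp
 show r: "x : up C ==> brk C x 0 = 0" using brk_linear[of x 0 0 0 0] by simp
 show "x : up C ==> brk C 0 x = 0" using r brk_skew[of 0 x] by simp
qed

lemma brk_linear_left: assumes "x : up C" "y : up C" "z : up C"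
 shows "brk C (b *r y + c *r z) x = b *r brk C y x + c *r brk C z x"
proof -
 have "b *r y + c *r z : up C" using assms by (intro subspace_add[OF up] subspace_scale[OF up])
 then show ?thesis using brk_skew[of _ x] assms brk_linear[OF assms] by simp
qed

text \<open>After the shift \<open>low\<close> sits in degree -2 and \<open>up\<close> in degree -1,
  and all other degrees are zero.\<close>

lemma V_iff:
 "v : V i <-> fst v : low C & snd v : up C & (i ~= -2 --> fst v = 0) & (i ~= -1 --> snd v = 0)"
 by (cases v) (auto simp: shift_def grading_def zero_prod_def)

lemma V_sub: "subspace (V i)"
 by (rule subspaceI2) (auto simp: V_iff intro!: subspace_add[OF low] subspace_add[OF up] subspace_scale[OF low] subspace_scale[OF up])

lemma cm_lam_short: "length w ~= 1 ==> length w ~= 2 ==> cm_lam C w = 0"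
 by (cases "(C, w)" rule: cm_lam.cases) auto

lemma cm_lam_1: "cm_lam C [x] = (0, - bdry C (fst (snd x)))" by (cases x rule: prod_cases3) simp

lemma cm_lam_2: "cm_lam C [x, y] = (action C (snd (snd x)) (fst (snd y)) + action C (snd (snd y)) (fst (snd x)),
  brk C (snd (snd x)) (snd (snd y)))" by (cases x rule: prod_cases3; cases y rule: prod_cases3) simp

lemma cm_lam_multilinear: "multilin V (cm_lam C)" unfolding multilinear_on_def
proof (intro ballI allI)
 fix w1 w2 i u v and b c :: real
 assume w: "w1 : words V" "w2 : words V" and uv: "u : V i" "v : V i"
 let ?w = "%u. w1 @ (i, u) # w2"
 consider "w1 = []" "w2 = []" | y where "w1 = []" "w2 = [y]" | y where "w1 = [y]" "w2 = []" | "length (w1 @ w2) > 1"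
  by (cases w1; cases w2; cases "tl w1"; cases "tl w2") auto
 then show "cm_lam C (?w (b *r u + c *r v)) = b *r cm_lam C (?w u) + c *r cm_lam C (?w v)"
 proof cases
  case 1
  then show ?thesis using uv bdry_linear by (auto simp: cm_lam_1 V_iff)
 next
  case 2
  then show ?thesis using w uv
   by (auto simp: cm_lam_2 V_iff action_linear action_linear_left brk_linear_left algebra_simps)
 next
  case 3
  then show ?thesis using w uv
   by (auto simp: cm_lam_2 V_iff action_linear action_linear_left brk_linear algebra_simps)
 next
  case 4
  then have "cm_lam C (?w z) = 0" for z by (intro cm_lam_short) auto
  then show ?thesis by simp
 qed
qed

lemma cm_lam_deg: assumes "w : words V" shows "cm_lam C w : V (deg w + 1)"
proof -
 consider x where "w = [x]" | x y where "w = [x, y]" | "length w ~= 1" "length w ~= 2"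
  by (cases w; cases "tl w"; cases "tl (tl w)") auto
 then show ?thesis
 proof cases
  case 1
  then show ?thesis using assms subspace_neg[OF up] bdry_up by (auto simp: cm_lam_1 V_iff)
 next
  case 2
  then show ?thesis using assms subspace_add[OF low] action_low brk_up by (auto simp: cm_lam_2 V_iff)
 next
  case 3
  then show ?thesis using cm_lam_short subspace_0[OF V_sub] by metis
 qed
qed

lemma cm_lam_swap: "swap_sym V (cm_lam C)" unfolding swap_sym_def
proof (intro ballI allI impI)
 fix w1 w2 x y
 assume xy: "snd x : V (fst x)" "snd y : V (fst y)"
 show "cm_lam C (w1 @ x # y # w2) = psign (fst x * fst y) *r cm_lam C (w1 @ y # x # w2)"
 proof (cases "w1 = [] & w2 = []")
  case True
  have e: "brk C (snd (snd x)) (snd (snd y)) = - brk C (snd (snd y)) (snd (snd x))"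
   using xy by (intro brk_skew) (simp_all add: V_iff)
  have w: "w1 = []" "w2 = []" using True by auto
  show ?thesis using xy unfolding w append_Nil cm_lam_2 e by (auto simp: V_iff psign_if)
 next
  case False
  then have "length (w1 @ w2) > 0" by auto
  then have "cm_lam C (w1 @ x # y # w2) = 0" "cm_lam C (w1 @ y # x # w2) = 0" by (auto intro!: cm_lam_short)
  then show ?thesis by simp
 qed
qed

text \<open>The square of the coderivation is checked by word length. Length two gives the
  equivariance of \<open>bdry\<close> and the Peiffer identity, length three the Jacobi identity and
  the compatibility of \<open>action\<close> with \<open>brk\<close>. The other lengths vanish by
  arity, or because a boundary has no \<open>low\<close> component.\<close>

lemma linf: "linf V (cm_lam C)"
proof
 show "subspace (V i)" for i by (rule V_sub)
 show "multilin V (cm_lam C)" by (rule cm_lam_multilinear)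
 show "cm_lam C w : V (deg w + 1)" if "w : words V" for w by (rule cm_lam_deg[OF that])
 show "swap_sym V (cm_lam C)" by (rule cm_lam_swap)
 show "cm_lam C w = 0" if "length w ~= 1" "length w ~= 2" for w by (rule cm_lam_short[OF that])
 have z: "cm_lam C ((i, 0) # w) = 0" if "w : words V" for i w
  using multilinear_hd[OF cm_lam_multilinear that, of 0 i 0 0 0] subspace_0[OF V_sub] by simp
 show "dcomp (cm_lam C) (cm_lam C) w = 0" if w: "w : words V" for w
 proof -
  let ?b = "%u v. cm_lam C ((deg u + 1, cm_lam C u) # v)"
  have b0: "?b u v = 0" if "v : words V" "length u ~= 1" "length u ~= 2" for u v
   using z[OF that(1)] cm_lam_short[OF that(2,3)] by simp
  consider "w = []" | x where "w = [x]" | x y where "w = [x, y]" | x y z where "w = [x, y, z]" | "length w > 3"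
   by (cases w; cases "tl w"; cases "tl (tl w)"; cases "tl (tl (tl w))") auto
  then show ?thesis
  proof cases
   case 1
   then show ?thesis using b0[of "[]" "[]"] by (simp add: dcomp_def)
  next
   case (2 x)
   have "?b [] [x] = 0" by (rule b0) (use w 2 in auto)
   then show ?thesis by (simp add: dcomp_def 2 cm_lam_1 zero_prod_def)
  next
   case (3 x y)
   obtain i a xi j b et where e: "x = (i, a, xi)" "y = (j, b, et)" by (cases x rule: prod_cases3; cases y rule: prod_cases3)
   have m: "a : low C" "xi : up C" "b : low C" "et : up C" "i ~= -2 --> a = 0" "i ~= -1 --> xi = 0" "j ~= -2 --> b = 0" "j ~= -1 --> et = 0"
    using w by (auto simp: 3 e V_iff)
   have p: "action C (bdry C a) b = - action C (bdry C b) a" using peiffer[OF m(1,3)] by (simp add: eq_neg_iff_add_eq_0)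
   have n: "u : low C ==> v : low C ==> action C (- bdry C u) v = - action C (bdry C u) v"
    "u : low C ==> x : up C ==> brk C (- bdry C u) x = brk C x (bdry C u)"
    "u : low C ==> x : up C ==> brk C x (- bdry C u) = - brk C x (bdry C u)"
    "u : low C ==> - bdry C u : up C" for u v x
    using action_linear_left[of "bdry C u" 0 v "-1" 0] brk_linear_left[of x "bdry C u" 0 "-1" 0] brk_skew[of x "bdry C u"]
     brk_linear[of x "bdry C u" 0 "-1" 0] bdry_up[of u] subspace_neg[OF up] by simp_all
   have "?b [] [x, y] = 0" by (rule b0) (use w 3 in auto)
   moreover have "?b [x, y] [] + ?b [x] [y] + psign (i * j) *r ?b [y] [x] = 0"
    unfolding e cm_lam_1 cm_lam_2 snd_conv fst_conv
    using m p by (cases "i = -2"; cases "i = -1"; cases "j = -2"; cases "j = -1") (auto simp: n bdry_action zero_prod_def psign_if bdry_up)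
   ultimately show ?thesis by (simp add: dcomp_def 3 e)
  next
   case (4 x y z)
   obtain i a xi j b et k c ze where e: "x = (i, a, xi)" "y = (j, b, et)" "z = (k, c, ze)"
    by (cases x rule: prod_cases3; cases y rule: prod_cases3; cases z rule: prod_cases3)
   have m: "a : low C" "xi : up C" "b : low C" "et : up C" "c : low C" "ze : up C"
    "i ~= -2 --> a = 0" "i ~= -1 --> xi = 0" "j ~= -2 --> b = 0" "j ~= -1 --> et = 0" "k ~= -2 --> c = 0" "k ~= -1 --> ze = 0"
    using w by (auto simp: 4 e V_iff)
   have add: "u : low C ==> v : low C ==> x : up C ==> action C x (u + v) = action C x u + action C x v" for x u v
    using action_linear[of x u v 1 1] by simp
   have jac: "brk C (brk C xi et) ze - brk C (brk C xi ze) et + brk C (brk C et ze) xi = 0"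
    using brk_jacobi[OF m(2,4,6)] brk_skew[OF brk_up[OF m(2,6)] m(4)] brk_skew[OF brk_up[OF m(4,6)] m(2)] by simp
   let ?s = "psign (j * k)" and ?t = "psign (i * (j + k))"
   \<comment> \<open>The signs matter only when all three letters have degree -1; otherwise one of
     the \<open>up\<close> components is 0 and every term vanishes.\<close>
   have up_part: "brk C (brk C xi et) ze + ?s *r brk C (brk C xi ze) et + ?t *r brk C (brk C et ze) xi = 0"
   proof (cases "i = -1 & j = -1 & k = -1")
    case True
    then show ?thesis using jac by (simp add: psign_if)
   next
    case False
    then have "xi = 0 | et = 0 | ze = 0" using m by auto
    then show ?thesis using m by (auto simp: brk_up)
   qed
   have a: "action C ze (action C et a) + ?s *r action C et (action C ze a) + ?t *r action C (brk C et ze) a = 0"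
   proof (cases "j = -1 & k = -1")
    case True
    then show ?thesis by (simp add: psign_if action_brk[OF m(4,6,1)])
   next
    case False
    then have "et = 0 | ze = 0" using m by auto
    then show ?thesis using m by (auto simp: action_low)
   qed
   have b: "action C ze (action C xi b) + ?s *r action C (brk C xi ze) b + ?t *r action C xi (action C ze b) = 0"
   proof (cases "i = -1 & k = -1 & j = -2")
    case True
    then show ?thesis by (simp add: psign_if action_brk[OF m(2,6,3)])
   next
    case False
    then have "xi = 0 | ze = 0 | b = 0" using m by auto
    then show ?thesis using m by (auto simp: action_low brk_up)
   qed
   have c: "action C (brk C xi et) c + ?s *r action C et (action C xi c) + ?t *r action C xi (action C et c) = 0"
   proof (cases "i = -1 & j = -1 & k = -2")
    case True
    then show ?thesis by (simp add: psign_if action_brk[OF m(2,4,5)])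
   next
    case False
    then have "xi = 0 | et = 0 | c = 0" using m by auto
    then show ?thesis using m by (auto simp: action_low brk_up)
   qed
   have l: "?b u v = 0" if "length u = 1" "length v = 2" for u v using that by (intro cm_lam_short) auto
   have "?b [x, y, z] [] = 0" "?b [] [x, y, z] = 0" by (rule b0; use w 4 in auto)+
   moreover have "?b [x] [y, z] = 0" "?b [y] [x, z] = 0" "?b [z] [x, y] = 0" by (rule l; simp)+
   moreover have "?b [x, y] [z] + psign (j * k) *r ?b [x, z] [y] + psign (i * (j + k)) *r ?b [y, z] [x] = 0"
    unfolding e cm_lam_2 snd_conv fst_conv
   proof -
    have "action C (brk C xi et) c + action C ze (action C xi b + action C et a) +
      ?s *r (action C (brk C xi ze) b + action C et (action C xi c + action C ze a)) +
      ?t *r (action C (brk C et ze) a + action C xi (action C et c + action C ze b)) =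
     (action C ze (action C et a) + ?s *r action C et (action C ze a) + ?t *r action C (brk C et ze) a) +
     (action C ze (action C xi b) + ?s *r action C (brk C xi ze) b + ?t *r action C xi (action C ze b)) +
     (action C (brk C xi et) c + ?s *r action C et (action C xi c) + ?t *r action C xi (action C et c))"
     using m by (simp add: add action_low scaleR_add_right)
    then show "(action C (brk C xi et) c + action C ze (action C xi b + action C et a), brk C (brk C xi et) ze) +
      ?s *r (action C (brk C xi ze) b + action C et (action C xi c + action C ze a), brk C (brk C xi ze) et) +
      ?t *r (action C (brk C et ze) a + action C xi (action C et c + action C ze b), brk C (brk C et ze) xi) = 0"
     using up_part unfolding a b c by (simp add: zero_prod_def)
   qed
   ultimately show ?thesis by (simp add: dcomp_def 4 e algebra_simps)
  next
   case 5
   have "cop w ?b = cop w (%u v. 0)"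
   proof (rule cop_cong)
    fix u v assume m: "mset u + mset v = mset w"
    show "?b u v = 0"
    proof (cases "length u = 1 | length u = 2")
     case True
     then show ?thesis using split_word(1)[OF m] 5 by (intro cm_lam_short) auto
    next
     case False
     then show ?thesis using split_word(3)[OF m w] by (intro b0) auto
    qed
   qed
   then show ?thesis by (simp add: dcomp_def)
  qed
 qed
qed

end

section \<open>Linearity of the coefficient action and of cohomology classes\<close>

lemma lie_der_linear: assumes "xi : VF M" "f : C_inf M" "g : C_inf M"
 shows "lie_der xi (b *r f + c *r g) = b *r lie_der xi f + c *r lie_der xi g"
 using assms by (simp add: lie_der_add lie_der_scaleR C_inf_scaleR)

lemma (in lgroupoid) FX_rep_linear:
 assumes w: "w : words (shift (cm_grading (LTX X)))" and xy: "x : FX X j" "y : FX X j"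
 shows "FX_rep X w (b *r x + c *r y) = b *r FX_rep X w x + c *r FX_rep X w y"
proof -
 obtain f F g H where e: "x = (f, F)" "y = (g, H)" by (cases x, cases y)
 have m: "f : C_inf Ob" "F : C_inf A" "g : C_inf Ob" "H : C_inf A"
  using xy C_inf_subspace[of Ob] C_inf_subspace[of A]
  by (auto simp: e FX_def grading_def mult_funs_iff subspace_0 zero_prod_def split: if_splits)
 show ?thesis
 proof (cases "(X, w, x)" rule: FX_rep.cases)
  case (1 X' f' F')
  then show ?thesis by (auto simp: e fun_eq_iff scaleR_app algebra_simps)
 next
  case (2 X' i a xi u f' F')
  have v: "(a, xi, u) : shift (cm_grading (LTX X)) i" using w 2 by (simp del: LTX_simps)
  have a: "a : AS X" and xi: "(xi, u) : MF X"
   using v crossed_mod.V_iff[OF crossed_mod_LTX, of "(a, xi, u)" i] by auto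
  note l = lie_der_linear[OF mult_fieldsD(2)[OF xi] m(1,3)] lie_der_linear[OF mult_fieldsD(1)[OF xi] m(2,4)]
   lie_der_linear[OF right_inv_vector_field[OF a] m(2,4)]
  have w: "w = [(i, a, xi, u)]" using 2 by simp
  show ?thesis by (simp add: e w l) (auto simp: l fun_eq_iff scaleR_app algebra_simps)
 next
  case 3
  then show ?thesis by (auto simp: e zero_prod_def)
 qed
qed

lemma comp_wedge_pow_linear:
 "comp_wedge_pow (b *r f + c *r g) K k a w = b *r comp_wedge_pow f K k a w + c *r comp_wedge_pow g K k a w"
proof (induction k arbitrary: a w)
 case (Suc k)
 show ?case unfolding comp_wedge_pow_Suc wedge_def cop_linear[symmetric] by (simp add: Suc scaleR_add_right mult.commute del: comp_wedge_pow.simps)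
qed (simp add: scaleR_app)

lemma cohomology_class_linear: assumes W: "!!i. subspace (W i)"
  and rho: "!!u x y j b c. u : words V ==> x : W j ==> y : W j ==> rho u (b *r x + c *r y) = b *r rho u x + c *r rho u y"
  and *: "al' : cohomology_class V lam rho W p al" "be' : cohomology_class V lam rho W p be"
 shows "b *r al' + c *r be' : cohomology_class V lam rho W p (b *r al + c *r be)"
proof -
 note S = sym_hom_subspace[where W=W, OF W]
 let ?B = "rep_diff V lam rho (p - 1) ` sym_hom V W (p - 1)"
 have B: "subspace ?B" by (rule coboundaries_subspace[OF W]) (rule rho; assumption)
 have co: "al' : sym_hom V W p" "be' : sym_hom V W p" "rep_diff V lam rho p al' = 0" "rep_diff V lam rho p be' = 0"
  and d: "al' - al : ?B" "be' - be : ?B" using * by (auto simp: cohomology_class_def cocycles_def)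
 have "rep_diff V lam rho p (b *r al' + c *r be') = b *r rep_diff V lam rho p al' + c *r rep_diff V lam rho p be'"
  by (rule rep_diff_linear[OF _ co(1,2)]) (rule rho; assumption)
 moreover have "b *r al' + c *r be' : sym_hom V W p" by (intro subspace_add[OF S] subspace_scale[OF S] co)
 moreover have "b *r (al' - al) + c *r (be' - be) : ?B" by (intro subspace_add[OF B] subspace_scale[OF B] d)
 then have "b *r al' + c *r be' - (b *r al + c *r be) : ?B" by (simp add: algebra_simps)
 ultimately show ?thesis using co by (simp add: cohomology_class_def cocycles_def)
qed

section \<open>The Atiyah extension of a principal 2-bundle\<close>

context two_bundle_loc
begin

declare X.LTX_simps [simp del]

abbreviation "VX == shift (cm_grading (LTX X))"
abbreviation "VP == shift (cm_grading (LAt B))"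
abbreviation "VAd == shift (cm_grading (LAd B))"

definition proj_rel :: "int => ('p0 => 'p1 tvec) \<times> ('p0, 'p1) mfield => ('x0 => 'x1 tvec) \<times> ('x0, 'x1) mfield => bool" where
 "proj_rel i v w <-> v : VP i & w : VX i & proj_low (fst v) (fst w) & proj_up (snd v) (snd w)"

lemma proj_uminus: "proj_up x y ==> proj_up (- x) (- y)"
 using proj_up_linear[of x y x y "-1" 0] by simp

lemma proj_cm_lam: assumes "rel_words proj_rel u v"
 shows "proj_low (fst (cm_lam (LAt B) u)) (fst (cm_lam (LTX X) v)) & proj_up (snd (cm_lam (LAt B) u)) (snd (cm_lam (LTX X) v))"
proof -
 note cA = crossed_mod_LAt and cX = X.crossed_mod_LTX
 have len: "length u = length v" using assms by (simp add: rel_words_def list_all2_lengthD)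
 have add: "proj_low a b ==> proj_low a' b' ==> proj_low (a + a') (b + b')" for a b a' b'
  using proj_low_linear[of a b a' b' 1 1] by simp
 consider x y where "u = [x]" "v = [y]" | x x' y y' where "u = [x, x']" "v = [y, y']" | "length u ~= 1" "length u ~= 2"
  using len by (cases u; cases v; cases "tl u"; cases "tl v"; cases "tl (tl u)") auto
 then show ?thesis
 proof cases
  case 1
  then show ?thesis using assms proj_low_0 proj_uminus[OF proj_bdry]
   by (auto simp: crossed_mod.cm_lam_1[OF cA] crossed_mod.cm_lam_1[OF cX] proj_rel_def)
 next
  case 2
  then show ?thesis using assms
   by (auto simp: crossed_mod.cm_lam_2[OF cA] crossed_mod.cm_lam_2[OF cX] proj_rel_def
     intro!: add proj_action proj_brk)
 next
  case 3
  then show ?thesis using crossed_mod.cm_lam_short[OF cA, of u] crossed_mod.cm_lam_short[OF cX, of v] len proj_low_0 proj_up_0 by simp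
 qed
qed

sublocale E: linf_ext VX "cm_lam (LTX X)" VP "cm_lam (LAt B)" proj_rel
proof (intro linf_ext.intro linf_ext_axioms.intro)
 note cA = crossed_mod_LAt and cX = X.crossed_mod_LTX
 note sA = crossed_mod.V_sub[OF cA] and sX = crossed_mod.V_sub[OF cX]
 show "linf VX (cm_lam (LTX X))" by (rule crossed_mod.linf[OF cX])
 show "linf VP (cm_lam (LAt B))" by (rule crossed_mod.linf[OF cA])
 show "proj_rel i a b ==> a : VP i & b : VX i" for i a b by (simp add: proj_rel_def)
 show "proj_rel i (c *r a + d *r a') (c *r b + d *r b')" if "proj_rel i a b" "proj_rel i a' b'" for i a b a' b' c d
  using that proj_low_linear proj_up_linear
  by (simp add: proj_rel_def subspace_add[OF sA] subspace_scale[OF sA] subspace_add[OF sX] subspace_scale[OF sX])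
 show "proj_rel i 0 0" for i
  using proj_low_0 proj_up_0 subspace_0[OF sA] subspace_0[OF sX] by (simp add: proj_rel_def)
 show "proj_rel (deg w + 1) (cm_lam (LAt B) wh) (cm_lam (LTX X) w)" if r: "rel_words proj_rel wh w" for wh w
 proof -
  have "wh : words VP & w : words VX & deg wh = deg w"
   using r unfolding rel_words_def by (induction wh w rule: list_all2_induct) (auto simp: proj_rel_def)
  then show ?thesis
   using crossed_mod.cm_lam_deg[OF cA, of wh] crossed_mod.cm_lam_deg[OF cX, of w] proj_cm_lam[OF r] by (auto simp: proj_rel_def)
 qed
qed

text \<open>\<open>N\<close> is the kernel of the projectability relation, whereas
  \<open>LAd\<close> is cut out by vanishing push-forwards. The inclusion allows a map on
  \<open>LAd\<close> to be restricted to \<open>N\<close>.\<close>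

lemma N_LAd: "E.N i <= VAd i"
proof
 fix v assume "v : E.N i"
 then have v: "v : VP i" "proj_low (fst v) 0" "proj_up (snd v) 0" by (auto simp: E.N_def proj_rel_def)
 then have "push_low B (fst v) = 0" "push_up B (snd v) = 0" by (auto intro: push_low_eq push_up_eq)
 then show "v : VAd i" using v(1) by (auto simp: shift_def grading_def LAd_def split: if_splits)
qed

lemma S_proj_rel: "rel_words proj_rel u v ==> S_proj B u = v" unfolding rel_words_def S_proj_def
 by (induction u v rule: list_all2_induct) (auto simp: proj_rel_def push_low_eq push_up_eq prod_eq_iff)

abbreviation "splitting th == map_prod (split_low B th) (split_up B th)"

text \<open>The lifts are projectable and linear. The degree conditions carry over from the base
  because both components of the splitting send 0 to 0.\<close>

lemma splitting_sect: assumes "two_connection B th" shows "E.sect (splitting th)"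
proof -
 note cA = crossed_mod_LAt and cX = X.crossed_mod_LTX
 have 0: "split_low B th 0 = 0" "split_up B th 0 = 0"
  using split_low_linear[OF assms, of 0 0 0 0] split_up_linear[OF assms, of 0 0 0 0]
   subspace_0[OF X.algebroid_sections_subspace] subspace_0[OF X.mult_fields_subspace] by simp_all
 have m: "v : VX i ==> fst v : AS X & snd v : MF X" for v i
  using crossed_mod.V_iff[OF cX, of v i] by (simp add: X.LTX_simps(1,2))
 show ?thesis unfolding E.sect_def
 proof (intro conjI allI ballI)
  fix i v assume v: "v : VX i"
  have p: "proj_low (split_low B th (fst v)) (fst v)" "proj_up (split_up B th (snd v)) (snd v)"
   using proj_split_low[OF assms] proj_split_up[OF assms] m[OF v] by auto
  then have "splitting th v : VP i"
   using v 0 unfolding crossed_mod.V_iff[OF cA] crossed_mod.V_iff[OF cX] by (auto simp: proj_low_def proj_up_def)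
  then show "proj_rel i (splitting th v) v" using p v by (simp add: proj_rel_def)
 next
  fix i u v and b c :: real assume "u : VX i" "v : VX i"
  then show "splitting th (b *r u + c *r v) = b *r splitting th u + c *r splitting th v"
   using m split_low_linear[OF assms] split_up_linear[OF assms] by (auto simp: prod_eq_iff)
 qed
qed

lemma curvature_curv: "curvature B th = E.curv (splitting th)"
 by (simp add: fun_eq_iff curvature_def E.curv_def S_split_def)

lemma curvature_sym_hom: assumes "two_connection B th" shows "curvature B th : sym_hom VX VAd 1"
proof -
 note s = splitting_sect[OF assms]
 have "(%w. if w : words VX then E.curv (splitting th) w else 0) : sym_hom VX VAd 1"
 proof (rule sym_homI[OF E.V.V E.curv_multilinear[OF s] E.curv_swap[OF s]])
  show "E.curv (splitting th) w : VAd (1 + deg w)" if "w : words VX" for w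
   using E.curv_N[OF s that] N_LAd by (auto simp: add.commute)
 qed
 moreover have "(%w. if w : words VX then E.curv (splitting th) w else 0) = curvature B th"
  unfolding curvature_curv by (auto simp: E.curv_def)
 ultimately show ?thesis by simp
qed

lemma multilinear_mono: assumes f: "multilin V f" and NV: "!!i. N i <= V i" shows "multilin N f"
 unfolding multilinear_on_def
proof (intro ballI allI)
 fix w1 w2 i u v and b c :: real
 assume "w1 : words N" "w2 : words N" "u : N i" "v : N i"
 then have "w1 : words V" "w2 : words V" "u : V i" "v : V i" using NV by (auto simp: words_iff)
 then show "f (w1 @ (i, b *r u + c *r v) # w2) = b *r f (w1 @ (i, u) # w2) + c *r f (w1 @ (i, v) # w2)"
  by (rule multilinearD[OF f])
qed

text \<open>The condition in \<open>invariant_hom\<close> concerns words of length \<open>k\<close>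
  and is stated with push-forwards, which \<open>S_proj_rel\<close> identifies with the projected
  word. On words of other lengths \<open>f\<close> is 0 and both sides vanish.\<close>

lemma invariant_chern_weil: assumes f: "f : invariant_hom B k p"
 shows "chern_weil VX (cm_lam (LTX X)) VP (cm_lam (LAt B)) proj_rel (FX X) (FX_rep X) f p"
proof (intro chern_weil.intro chern_weil_axioms.intro)
 have ext: "f : ext_hom k VAd (FX X) p" using f by (simp add: invariant_hom_def)
 have NA: "a : words E.N ==> a : words VAd" for a using N_LAd by (auto simp: words_iff)
 show "linf_ext VX (cm_lam (LTX X)) VP (cm_lam (LAt B)) proj_rel" by (rule E.linf_ext_axioms)
 show "subspace (FX X i)" for i by (rule X.subspace_FX)
 show "multilin E.N f" by (rule multilinear_mono[OF _ N_LAd]) (use ext in "simp add: ext_hom_def")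
 show "f a : FX X (p + deg a)" if "a : words E.N" for a using ext NA[OF that] by (simp add: ext_hom_def)
 show "FX_rep X u (b *r x + c *r y) = b *r FX_rep X u x + c *r FX_rep X u y"
  if "u : words VX" "x : FX X j" "y : FX X j" for u x y j b c by (rule X.FX_rep_linear[OF that])
 show "(SUM i<length a. psign ((deg w + 1) * deg (take i a)) *r f (a[i := (deg w + fst (a ! i) + 1, cm_lam (LAt B) (xh @ [a ! i]))])) =
   psign p *r psign (p * deg w) *r FX_rep X w (f a)"
  if r: "rel_words proj_rel xh w" and a: "a : words E.N" for xh w a
 proof (cases "length a = k")
  case True
  have d: "xh : words VP" "deg xh = deg w" using E.rel_words_words[OF r] by auto
  note inv = f[unfolded invariant_hom_def mem_Collect_eq, THEN conjunct2, rule_format, OF d(1) NA[OF a] True]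
  show ?thesis using inv True unfolding d(2) S_proj_rel[OF r] by (simp add: upd_conv_take_nth_drop)
 next
  case False
  then have z: "f a = 0" "f (a[i := x]) = 0" for i x using ext by (simp_all add: ext_hom_def)
  have "FX_rep X w 0 = 0"
   using X.FX_rep_linear[of w 0 0 0 0 0] E.rel_words_words[OF r] subspace_0[OF X.subspace_FX] by simp
  then show ?thesis by (simp add: z)
 qed
qed

lemma cw_cochain_eq:
 "cw_cochain B th k f = (%w. if w : words VX then comp_wedge_pow f (E.curv (splitting th)) k [] w else 0)"
 by (simp add: fun_eq_iff cw_cochain_def curvature_curv)

lemma cw_cochain_cocycle: assumes "two_connection B th" and f: "f : invariant_hom B k p"
 shows "cw_cochain B th k f : base_cocycles B (p + int k)" unfolding cw_cochain_eq base_cocycles_def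
 by (rule chern_weil.cw_cocycle[OF invariant_chern_weil[OF f] splitting_sect[OF assms(1)]])

lemma cw_cochain_class:
 assumes "two_connection B th" "two_connection B th'" and f: "f : invariant_hom B k p"
 shows "base_class B (p + int k) (cw_cochain B th k f) = base_class B (p + int k) (cw_cochain B th' k f)"
 unfolding cw_cochain_eq base_class_def
proof (rule cohomology_class_eq)
 show "subspace (rep_diff VX (cm_lam (LTX X)) (FX_rep X) (p + int k - 1) ` sym_hom VX (FX X) (p + int k - 1))"
  by (rule coboundaries_subspace[OF X.subspace_FX X.FX_rep_linear])
qed (rule chern_weil.transgression[OF invariant_chern_weil[OF f] splitting_sect[OF assms(1)] splitting_sect[OF assms(2)]])

lemma cw_cochain_linear: "cw_cochain B th k (b *r f + c *r g) = b *r cw_cochain B th k f + c *r cw_cochain B th k g"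
 by (simp add: fun_eq_iff cw_cochain_eq comp_wedge_pow_linear scaleR_app)

end

section \<open>The Chern-Weil map of a principal 2-bundle and its independence of the
  2-connection\<close>

theorem theorem5p45:
  fixes B :: "('p0, 'p1, 'e::euclidean_space, 'g0, 'g1, 'f::euclidean_space,
      'x0, 'x1, 'd::euclidean_space) two_bundle"
    and \<theta> :: "('p0, 'p1, 'g0, 'g1) forms"
    and k :: nat
  assumes "principal_2_bundle B" and "two_connection B \<theta>"
  shows "\<exists>cw.
     (\<forall>p. \<forall>f\<in>invariant_hom B k p. \<forall>g\<in>invariant_hom B k p. \<forall>c d.
        \<forall>\<alpha>\<in>cw p f. \<forall>\<beta>\<in>cw p g. c *\<^sub>R \<alpha> + d *\<^sub>R \<beta> \<in> cw p (c *\<^sub>R f + d *\<^sub>R g)) \<and>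
     (\<forall>\<theta>'. two_connection B \<theta>' \<longrightarrow>
        curvature B \<theta>' \<in> sym_hom (shift (cm_grading (LTX (Base B))))
          (shift (cm_grading (LAd B))) 1 \<and>
        (\<forall>p. \<forall>f\<in>invariant_hom B k p.
           cw_cochain B \<theta>' k f \<in> base_cocycles B (p + int k) \<and>
           cw p f = base_class B (p + int k) (cw_cochain B \<theta>' k f)))"
proof -
 interpret two_bundle_loc B by unfold_locales (rule assms(1))
 have lin: "c *r \<alpha> + d *r \<beta> : base_class B (p + int k) (cw_cochain B \<theta> k (c *r f + d *r g))"
  if "\<alpha> : base_class B (p + int k) (cw_cochain B \<theta> k f)" "\<beta> : base_class B (p + int k) (cw_cochain B \<theta> k g)" for p f g c d \<alpha> \<beta>
  using that unfolding cw_cochain_linear base_class_def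
  by (intro cohomology_class_linear[OF X.subspace_FX X.FX_rep_linear])
 \<comment> \<open>The witness is formed with \<theta>; by \<open>cw_cochain_class\<close> it gives
   the class belonging to every other 2-connection too.\<close>
 show ?thesis by (rule exI[of _ "%p f. base_class B (p + int k) (cw_cochain B \<theta> k f)"])
   (use lin curvature_sym_hom cw_cochain_cocycle cw_cochain_class[OF assms(2)] in auto)
qed

end
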